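(* Let $N\ge1$, $0<p<1$, $0<r_0<R$, $\Omega=\mathcal{A}(r_0,R)=\{x\in\mathbb{R}^N:r_0<|x|<R\}$, $\mu<C_H(\mathcal{A}(r_0,R))$, $\mu\neq0$. Consider nonnegative radial solutions $u=u(r)$, $r=|x|$, of $$\Delta u+\frac{\mu}{\delta(x)^2}u=u^p\quad\text{in }\mathcal{A}(r_0,R).$$ (i) For any given $r_0<R_0<R$ there exists a unique solution positive in $(R_0,R)$, with a dead core in $[r_0,R_0]$. At the outer boundary it behaves like $k(R-r)^{\beta_-}$ for some $k>0$. Vice versa, for any given $r_0<R_0<R$ there exists a unique solution positive in $(r_0,R_0)$, with a dead core in $[R_0,R]$. At the inner boundary it behaves like $k(r-r_0)^{\beta_-}$ for some $k>0$. (ii) The sum of two solutions as in (i), having a disjoint support, is a solution with a dead core interval (possibly reduced to a point) and positive near the inner and outer boundary. (iii) If $\mu<0$, for any given $r_0<R_0<R$ and $u(R_0)=u_0>0$ there exists a unique positive solution. At the outer and inner boundaries it behaves like $k_1(R-r)^{\beta_-}$, respectively $k_2(r-r_0)^{\beta_-}$, for some $k_1,k_2>0$. If moreover $\mu>-\frac{2(p+1)}{(1-p)^2}$, we have: (iv) For any given $c>0$ there exists a unique positive solution such that $u(r)/(r-r_0)^{\beta_+}\to c$ as $r\to r_0$. At the outer boundary it behaves like $k(R-r)^{\beta_-}$ for some $k>0$. Vice versa, for any given $c>0$ there exists a unique positive solution such that $u(r)/(R-r)^{\beta_+}\to c$ as $r\to R$. At the inner boundary it behaves like $k(r-r_0)^{\beta_-}$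 for some $k>0$. (v) There exists a unique solution such that $u(r)/(r-r_0)^{\frac{2}{1-p}}\to c'$ as $r\to r_0$, where $c'=\Big(\frac{2(1+p)}{(p-1)^2}+\mu\Big)^{1/(p-1)}$. At the outer boundary it behaves like $k(R-r)^{\beta_-}$ for some $k>0$. The same holds if the roles of the inner and outer boundary are interchanged.
   Context: $\delta(x)=\min\{R-|x|,|x|-r_0\}$ is the distance of $x$ to the boundary of the annulus. $\beta_\pm=\frac12\pm\sqrt{\frac14-\mu}$. The Hardy constant of a bounded domain $\Omega$ is $C_H(\Omega)=\inf_{\phi\in W^{1,2}_0(\Omega),\,\phi\ne0}\frac{\int_\Omega|\nabla\phi|^2dx}{\int_\Omega\delta^{-2}\phi^2dx}$, where $\delta$ is the distance to $\partial\Omega$; it is known that $0<C_H\le\frac14$. "Behaves like $k(R-r)^{\beta_-}$ at the outer boundary" means $u(r)/(R-r)^{\beta_-}\to k$ as $r\to R$, and similarly at the inner boundary. "Dead core in an interval" means that $u$ vanishes identically there.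
   Formalization: In (iii) the datum u(R0)=u0 is taken together with u'(R0)=0; with the value alone uniqueness fails, since e.g. a solution from (iv) passes through the same point as the zero-slope solution. *)

theory Defs
  imports "HOL-Analysis.Analysis"
begin

section \<open>Smooth functions and the Laplacian\<close>

definition partial :: "'a::euclidean_space \<Rightarrow> ('a \<Rightarrow> real) \<Rightarrow> 'a \<Rightarrow> real" where
  "partial b f x = frechet_derivative f (at x) b"

text \<open>Meant for open \<open>S\<close>, where differentiability within \<open>S\<close> and at a point agree.\<close>

primrec Ck_on :: "nat \<Rightarrow> 'a::euclidean_space set \<Rightarrow> ('a \<Rightarrow> real) \<Rightarrow> bool" where
  "Ck_on 0 S f \<longleftrightarrow> continuous_on S f"
| "Ck_on (Suc k) S f \<longleftrightarrow> f differentiable_on S \<and> (\<forall>b\<in>Basis. Ck_on k S (partial b f))"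

definition gradient :: "('a::euclidean_space \<Rightarrow> real) \<Rightarrow> 'a \<Rightarrow> 'a" where
  "gradient f x = (\<Sum>b\<in>Basis. partial b f x *\<^sub>R b)"

definition laplacian :: "('a::euclidean_space \<Rightarrow> real) \<Rightarrow> 'a \<Rightarrow> real" where
  "laplacian f x = (\<Sum>b\<in>Basis. partial b (partial b f) x)"


section \<open>Sobolev functions and the Hardy constant\<close>

definition test_function :: "'a::euclidean_space set \<Rightarrow> ('a \<Rightarrow> real) \<Rightarrow> bool" where
  "test_function \<Omega> \<phi> \<longleftrightarrow>
     (\<forall>k. Ck_on k UNIV \<phi>) \<and>
     compact (closure {x. \<phi> x \<noteq> 0}) \<and> closure {x. \<phi> x \<noteq> 0} \<subseteq> \<Omega>"

definition L2_on :: "'a::euclidean_space set \<Rightarrow> ('a \<Rightarrow> 'b::euclidean_space) \<Rightarrow> bool" where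
  "L2_on \<Omega> f \<longleftrightarrow>
     f \<in> borel_measurable (lebesgue_on \<Omega>) \<and>
     integrable (lebesgue_on \<Omega>) (\<lambda>x. (norm (f x))\<^sup>2)"

definition weak_gradient ::
  "'a::euclidean_space set \<Rightarrow> ('a \<Rightarrow> real) \<Rightarrow> ('a \<Rightarrow> 'a) \<Rightarrow> bool" where
  "weak_gradient \<Omega> u g \<longleftrightarrow>
     (\<forall>\<phi>. test_function \<Omega> \<phi> \<longrightarrow> (\<forall>b\<in>Basis.
        (\<integral>x. u x * partial b \<phi> x \<partial>lebesgue_on \<Omega>) =
        - (\<integral>x. (g x \<bullet> b) * \<phi> x \<partial>lebesgue_on \<Omega>)))"

text \<open>
  \<open>W12 \<Omega> u g\<close> says that \<open>u\<close> belongs to the Sobolev space of square integrable functions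
  with square integrable weak gradient, and that \<open>g\<close> represents this gradient;
  \<open>W12_0 \<Omega> u g\<close> says that moreover \<open>u\<close> lies in the closure of the test functions
  for the Sobolev norm.
\<close>

definition W12 ::
  "'a::euclidean_space set \<Rightarrow> ('a \<Rightarrow> real) \<Rightarrow> ('a \<Rightarrow> 'a) \<Rightarrow> bool" where
  "W12 \<Omega> u g \<longleftrightarrow> L2_on \<Omega> u \<and> L2_on \<Omega> g \<and> weak_gradient \<Omega> u g"

definition W12_0 ::
  "'a::euclidean_space set \<Rightarrow> ('a \<Rightarrow> real) \<Rightarrow> ('a \<Rightarrow> 'a) \<Rightarrow> bool" where
  "W12_0 \<Omega> u g \<longleftrightarrow>
     W12 \<Omega> u g \<and>
     (\<exists>\<phi>. (\<forall>n::nat. test_function \<Omega> (\<phi> n)) \<and>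
        (\<lambda>n. (\<integral>x. (\<phi> n x - u x)\<^sup>2 \<partial>lebesgue_on \<Omega>) +
             (\<integral>x. (norm (gradient (\<phi> n) x - g x))\<^sup>2 \<partial>lebesgue_on \<Omega>)) \<longlonglongrightarrow> 0)"

text \<open>
  The quotient is formed in \<^typ>\<open>ennreal\<close>, so that a divergent denominator yields the
  quotient \<open>0\<close>; the denominator never vanishes because \<open>u\<close> is not almost everywhere zero.
\<close>

definition hardy_constant :: "'a::euclidean_space set \<Rightarrow> ereal" where
  "hardy_constant \<Omega> = enn2ereal
     (Inf {(\<integral>\<^sup>+x. ennreal ((norm (g x))\<^sup>2) \<partial>lebesgue_on \<Omega>) /
           (\<integral>\<^sup>+x. ennreal ((u x)\<^sup>2 / (infdist x (frontier \<Omega>))\<^sup>2) \<partial>lebesgue_on \<Omega>) | u g.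
           W12_0 \<Omega> u g \<and> \<not> (AE x in lebesgue_on \<Omega>. u x = 0)})"


section \<open>Radial solutions in an annulus\<close>

definition annulus :: "real \<Rightarrow> real \<Rightarrow> 'a::euclidean_space set" where
  "annulus r0 R = {x. r0 < norm x \<and> norm x < R}"

definition annulus_dist :: "real \<Rightarrow> real \<Rightarrow> 'a::euclidean_space \<Rightarrow> real" where
  "annulus_dist r0 R x = min (R - norm x) (norm x - r0)"

definition nonneg_solution ::
  "real \<Rightarrow> real \<Rightarrow> real \<Rightarrow> real \<Rightarrow> ('a::euclidean_space \<Rightarrow> real) \<Rightarrow> bool" where
  "nonneg_solution p \<mu> r0 R U \<longleftrightarrow>
     Ck_on 2 (annulus r0 R) U \<and>
     (\<forall>x\<in>annulus r0 R.
        0 \<le> U x \<and>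
        laplacian U x + \<mu> / (annulus_dist r0 R x)\<^sup>2 * U x = U x powr p)"

text \<open>
  A radial solution is given by its profile \<open>u\<close>, of which only the values on
  \<open>{r0<..<R}\<close> matter; the \<^term>\<open>TYPE('a)\<close> argument fixes the ambient space.
\<close>

definition radial_solution ::
  "'a::euclidean_space itself \<Rightarrow> real \<Rightarrow> real \<Rightarrow> real \<Rightarrow> real \<Rightarrow> (real \<Rightarrow> real) \<Rightarrow> bool" where
  "radial_solution _ p \<mu> r0 R u \<longleftrightarrow> nonneg_solution p \<mu> r0 R (\<lambda>x::'a. u (norm x))"

definition positive_on :: "real set \<Rightarrow> (real \<Rightarrow> real) \<Rightarrow> bool" where
  "positive_on I u \<longleftrightarrow> (\<forall>r\<in>I. 0 < u r)"

definition dead_core :: "real set \<Rightarrow> (real \<Rightarrow> real) \<Rightarrow> bool" where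
  "dead_core I u \<longleftrightarrow> (\<forall>r\<in>I. u r = 0)"

definition unique_on :: "real set \<Rightarrow> ((real \<Rightarrow> real) \<Rightarrow> bool) \<Rightarrow> bool" where
  "unique_on I P \<longleftrightarrow> (\<exists>u. P u \<and> (\<forall>v. P v \<longrightarrow> (\<forall>r\<in>I. v r = u r)))"

definition beta_minus :: "real \<Rightarrow> real" where
  "beta_minus \<mu> = 1/2 - sqrt (1/4 - \<mu>)"

definition beta_plus :: "real \<Rightarrow> real" where
  "beta_plus \<mu> = 1/2 + sqrt (1/4 - \<mu>)"

definition behaves_outer :: "real \<Rightarrow> real \<Rightarrow> real \<Rightarrow> (real \<Rightarrow> real) \<Rightarrow> bool" where
  "behaves_outer R a k u \<longleftrightarrow> ((\<lambda>r. u r / (R - r) powr a) \<longlongrightarrow> k) (at_left R)"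

definition behaves_inner :: "real \<Rightarrow> real \<Rightarrow> real \<Rightarrow> (real \<Rightarrow> real) \<Rightarrow> bool" where
  "behaves_inner r0 a k u \<longleftrightarrow> ((\<lambda>r. u r / (r - r0) powr a) \<longlongrightarrow> k) (at_right r0)"

definition outer_dead_core_solution ::
  "'a::euclidean_space itself \<Rightarrow> real \<Rightarrow> real \<Rightarrow> real \<Rightarrow> real \<Rightarrow> real \<Rightarrow> (real \<Rightarrow> real) \<Rightarrow> bool" where
  "outer_dead_core_solution T p \<mu> r0 R R0 u \<longleftrightarrow>
     radial_solution T p \<mu> r0 R u \<and> positive_on {r0<..<R0} u \<and> dead_core {R0..R} u"

definition inner_dead_core_solution ::
  "'a::euclidean_space itself \<Rightarrow> real \<Rightarrow> real \<Rightarrow> real \<Rightarrow> real \<Rightarrow> real \<Rightarrow> (real \<Rightarrow> real) \<Rightarrow> bool" where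
  "inner_dead_core_solution T p \<mu> r0 R R0 u \<longleftrightarrow>
     radial_solution T p \<mu> r0 R u \<and> positive_on {R0<..<R} u \<and> dead_core {r0..R0} u"

definition positive_solution ::
  "'a::euclidean_space itself \<Rightarrow> real \<Rightarrow> real \<Rightarrow> real \<Rightarrow> real \<Rightarrow> (real \<Rightarrow> real) \<Rightarrow> bool" where
  "positive_solution T p \<mu> r0 R u \<longleftrightarrow>
     radial_solution T p \<mu> r0 R u \<and> positive_on {r0<..<R} u"

text \<open>
  Prescribing the value \<open>u0\<close> at \<open>R0\<close> alone leaves a one-parameter family of positive
  solutions. As for radial solutions in a ball, where \<open>R0 = 0\<close> and the slope vanishes by
  symmetry, and as for the dead core solutions, which start from \<open>R0\<close> with zero value and zero
  slope, the datum \<open>u(R0) = u0\<close> is an initial datum with zero slope.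
\<close>

definition positive_solution_from ::
  "'a::euclidean_space itself \<Rightarrow> real \<Rightarrow> real \<Rightarrow> real \<Rightarrow> real \<Rightarrow> real \<Rightarrow> real \<Rightarrow> (real \<Rightarrow> real) \<Rightarrow> bool" where
  "positive_solution_from T p \<mu> r0 R R0 u0 u \<longleftrightarrow>
     positive_solution T p \<mu> r0 R u \<and> u R0 = u0 \<and> (u has_real_derivative 0) (at R0)"

end

theory Submission
  imports Defs
begin

text \<open>
  In terms of the profile, the equation reads \<open>(w u')' = w (u powr p - \<mu> u / \<delta>\<^sup>2)\<close> with
  \<open>w r = r ^ (N - 1)\<close>. All one-dimensional arguments allow an arbitrary positive \<open>C\<^sup>1\<close> weight
  \<open>w\<close>, so that the reflection \<open>r \<mapsto> r0 + R - r\<close> exchanges the two boundaries.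

  The hypothesis \<open>\<mu> < C\<^sub>H\<close> enters only through two consequences: \<open>\<mu> < 1/4\<close>, and no positive
  solution of the linear equation on a subinterval vanishes at both ends while being bounded by
  \<open>\<delta> powr \<beta>\<^sub>+\<close>. Hence the linear solution \<open>\<psi>\<close> behaving like \<open>(r - r0) powr \<beta>\<^sub>+\<close> at \<open>r0\<close> is
  positive and behaves like \<open>(R - r) powr \<beta>\<^sub>-\<close> at \<open>R\<close>. Writing \<open>u = \<phi> v\<close> with a
  positive linear solution \<open>\<phi>\<close> removes the singular potential:
  \<open>(w \<phi>\<^sup>2 v')' = w \<phi> powr (1 + p) * v powr p\<close>, a Volterra equation for \<open>v\<close>. Solutions are
  obtained by monotone iteration from a subsolution; \<open>v\<close> is nondecreasing and bounded because
  \<open>p < 1\<close>, which gives the outer behaviour. Uniqueness follows by comparing two solutions up to a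
  constant factor \<open>L\<close> and improving \<open>L\<close> to \<open>L powr p\<close> repeatedly.
\<close>

section \<open>A sublinear Volterra equation with a singular left end\<close>

text \<open>As \<open>u powr p\<close> is not Lipschitz at 0, zero data admit the solution 0 beside
  the wanted one, so contraction and Gronwall arguments fail. Hence the iteration climbs from a
  nonzero subsolution, and uniqueness concerns positive solutions with an a priori bound
  \<open>v1 \<le> C * v2\<close> near the start: from matching growth bounds at the edge of a dead
  core, from a common growth limit at the boundary, from a common positive value at an interior
  point. At a singular end with distance \<open>s\<close>, dividing by the linear solution gives
  \<open>kernel_E\<close> of order \<open>s powr (- 2 * bp)\<close> and \<open>kernel_F\<close> of
  order \<open>s powr (bp * (1 + p))\<close>. The double integral converges because
  \<open>bp * (1 - p) < 2\<close>, that is \<open>bp < \<alpha>\<close> for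
  \<open>\<alpha> = 2 / (1 - p)\<close>; this is what the additional lower bound on \<mu> in (iv)
  and (v) says. Hardy's inequality is given for Sobolev functions on the annulus but is applied to
  truncated powers of a radial profile, which are merely C1; smooth radial approximation and polar
  coordinates close this gap.\<close>

lemma DERIV_nonneg_le:
  fixes f f' :: "real \<Rightarrow> real"
  assumes "y \<le> x" "\<And>z. y \<le> z \<Longrightarrow> z \<le> x \<Longrightarrow> (f has_real_derivative f' z) (at z)"
    "\<And>z. y \<le> z \<Longrightarrow> z \<le> x \<Longrightarrow> 0 \<le> f' z"
  shows "f y \<le> f x"
  by (rule DERIV_nonneg_imp_nondecreasing[OF assms(1)]) (use assms(2,3) in blast)

lemma right_limit_le:
  fixes f f' :: "real \<Rightarrow> real"
  assumes lim: "(f \<longlongrightarrow> l) (at_right a)"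
    and der: "\<And>x. a < x \<Longrightarrow> x < b \<Longrightarrow> (f has_real_derivative f' x) (at x)"
    and nn: "\<And>x. a < x \<Longrightarrow> x < b \<Longrightarrow> 0 \<le> f' x"
    and x: "a < x" "x < b"
  shows "l \<le> f x"
proof (rule tendsto_upperbound[OF lim])
  have "f y \<le> f x" if "a < y" "y < x" for y
    by (rule DERIV_nonneg_le[of y x f f']) (use that der nn x in auto)
  then show "eventually (\<lambda>y. f y \<le> f x) (at_right a)"
    using x(1) unfolding eventually_at_right_field by blast
qed simp

text \<open>The kernels may be singular at \<open>a\<close>; on the half-open interval they are
  continuous, hence measurable, and the missing endpoint is a null set.\<close>

lemma integrable_on_left_open:
  fixes f :: "real \<Rightarrow> real"
  shows "f integrable_on {a<..r} \<longleftrightarrow> f integrable_on {a..r}"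
proof (rule integrable_spike_set_eq)
  have "{a<..r} - {a..r} \<union> ({a..r} - {a<..r}) \<subseteq> {a}" by auto
  then show "negligible ({a<..r} - {a..r} \<union> ({a..r} - {a<..r}))"
    using negligible_sing negligible_subset by blast
qed

text \<open>For p < 1 the left-hand side grows more slowly than \<open>M\<close>:
  \<open>2 * c \<le> M\<close> and \<open>2 * k \<le> M powr (1 - p)\<close> bound each summand by
  half of \<open>M\<close>. Such an \<open>M\<close> is a level that the iteration cannot
  cross.\<close>

lemma sublinear_bound:
  fixes p c k M0 :: real
  assumes "0 < p" "p < 1" "0 \<le> k"
  obtains M where "M0 \<le> M" "0 < M" "c + k * M powr p \<le> M"
proof -
  define M where "M = Max {1, M0, 2 * c, (2 * k) powr (1 / (1 - p))}"
  have M: "1 \<le> M" "M0 \<le> M" "2 * c \<le> M" "(2 * k) powr (1 / (1 - p)) \<le> M"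
    unfolding M_def by (auto intro!: Max_ge)
  have "2 * k = ((2 * k) powr (1 / (1 - p))) powr (1 - p)"
    using assms by (cases "k = 0") (auto simp: powr_powr)
  also have "\<dots> \<le> M powr (1 - p)"
    using assms M by (intro powr_mono2) auto
  finally have "2 * k * M powr p \<le> M powr (1 - p) * M powr p"
    by (rule mult_right_mono) simp
  also have "\<dots> = M" using M by (simp flip: powr_add)
  finally have "c + k * M powr p \<le> M" using M(3) by linarith
  then show ?thesis using that M by auto
qed

text \<open>With the increasing function \<open>K\<close> in the role of \<open>k\<close>, this
  gives continuity of the limit of the monotone iteration from a modulus of continuity common to all
  iterates.\<close>

lemma continuous_on_dominated:
  fixes v k :: "real \<Rightarrow> real"
  assumes k: "continuous_on S k"
    and le: "\<And>x y. x \<in> S \<Longrightarrow> y \<in> S \<Longrightarrow> x \<le> y \<Longrightarrow> \<bar>v y - v x\<bar> \<le> C * \<bar>k y - k x\<bar>"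
  shows "continuous_on S v"
  unfolding continuous_on_def
proof
  fix x assume x: "x \<in> S"
  have "((\<lambda>y. C * \<bar>k y - k x\<bar>) \<longlongrightarrow> C * \<bar>k x - k x\<bar>) (at x within S)"
    using k x by (intro tendsto_intros) (auto simp: continuous_on_def)
  then have lim: "((\<lambda>y. C * \<bar>k y - k x\<bar>) \<longlongrightarrow> 0) (at x within S)" by simp
  have "((\<lambda>y. v y - v x) \<longlongrightarrow> 0) (at x within S)"
  proof (rule Lim_null_comparison[OF _ lim])
    show "\<forall>\<^sub>F y in at x within S. norm (v y - v x) \<le> C * \<bar>k y - k x\<bar>"
      unfolding eventually_at_filter
    proof (intro always_eventually allI impI)
      fix y assume "y \<in> S"
      then show "norm (v y - v x) \<le> C * \<bar>k y - k x\<bar>"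
        using le[OF x, of y] le[of y x] x by (cases "x \<le> y") (auto simp: abs_minus_commute)
    qed
  qed
  then show "(v \<longlongrightarrow> v x) (at x within S)" by (simp add: LIM_zero_iff)
qed

text \<open>Models \<open>v' = E * J\<close>, \<open>J' = F * h\<close> with \<open>J\<close>
  vanishing at \<open>a\<close>. The factor \<open>E\<close> may blow up at \<open>a\<close>; only
  its product with the primitive of \<open>\<bar>F\<bar>\<close> has to be integrable. The absolute
  value is there because in the linear equation \<open>F\<close> has no sign.\<close>

locale volterra =
  fixes a b :: real and E F :: "real \<Rightarrow> real"
  assumes ab: "a < b"
    and contE: "continuous_on {a<..<b} E" and posE: "\<And>r. a < r \<Longrightarrow> r < b \<Longrightarrow> 0 < E r"
    and contF: "continuous_on {a..<b} F"
    and intEF: "\<And>r. a < r \<Longrightarrow> r < b \<Longrightarrow>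
       (\<lambda>s. E s * integral {a..s} (\<lambda>t. \<bar>F t\<bar>)) integrable_on {a..r}"
begin

definition J :: "(real \<Rightarrow> real) \<Rightarrow> real \<Rightarrow> real" where
  "J h s = integral {a..s} (\<lambda>t. F t * h t)"

definition T :: "(real \<Rightarrow> real) \<Rightarrow> real \<Rightarrow> real" where
  "T h r = integral {a..r} (\<lambda>s. E s * J h s)"

definition Fabs :: "real \<Rightarrow> real" where
  "Fabs s = integral {a..s} (\<lambda>t. \<bar>F t\<bar>)"

text \<open>\<open>T\<close> applied to 1 with \<open>F\<close> replaced by its absolute value. It
  majorizes all \<open>T h\<close> with \<open>h\<close> bounded by 1: powers of \<open>K\<close>
  bound the Neumann series, and \<open>K\<close> is a modulus of continuity for the range of
  \<open>T\<close>.\<close>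

definition K :: "real \<Rightarrow> real" where
  "K r = integral {a..r} (\<lambda>s. E s * Fabs s)"

lemma cont_sub:
  assumes "continuous_on {a..<b} h" "r < b"
  shows "continuous_on {a..r} h"
  by (rule continuous_on_subset[OF assms(1)]) (use assms(2) in auto)

lemma F_mult_cont: "continuous_on {a..<b} h \<Longrightarrow> continuous_on {a..<b} (\<lambda>t. F t * h t)"
  by (intro continuous_intros contF)

lemma F_mult_integrable: "continuous_on {a..<b} h \<Longrightarrow> s < b \<Longrightarrow> (\<lambda>t. F t * h t) integrable_on {a..s}"
  by (intro integrable_continuous_interval cont_sub[OF F_mult_cont])

lemma abs_F_integrable: "s < b \<Longrightarrow> (\<lambda>t. \<bar>F t\<bar>) integrable_on {a..s}"
  by (intro integrable_continuous_interval cont_sub[of "\<lambda>t. \<bar>F t\<bar>"] continuous_intros contF)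

lemma J_at_a [simp]: "J h a = 0" by (simp add: J_def)
lemma T_at_a [simp]: "T h a = 0" by (simp add: T_def)
lemma K_at_a [simp]: "K a = 0" by (simp add: K_def)

lemma indef_deriv:
  assumes "continuous_on {a..<b} f" "a < r" "r < b"
  shows "((\<lambda>x. integral {a..x} f) has_real_derivative f r) (at r)"
proof -
  have "((\<lambda>x. integral {a..x} f) has_real_derivative f r) (at r within {a..(r+b)/2})"
    by (rule integral_has_real_derivative) (use assms in \<open>auto intro!: cont_sub[OF assms(1)]\<close>)
  moreover have "at r within {a..(r+b)/2} = at r"
    by (rule at_within_interior) (use assms in auto)
  ultimately show ?thesis by simp
qed

lemma J_deriv:
  assumes "continuous_on {a..<b} h" "a < r" "r < b"
  shows "(J h has_real_derivative F r * h r) (at r)"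
  using indef_deriv[OF F_mult_cont[OF assms(1)] assms(2,3)] by (simp add: J_def[abs_def])

lemma indef_cont:
  assumes "\<And>r. a < r \<Longrightarrow> r < b \<Longrightarrow> (f::real\<Rightarrow>real) integrable_on {a..r}"
  shows "continuous_on {a..<b} (\<lambda>x. integral {a..x} f)"
proof -
  have "continuous (at x within {a..<b}) (\<lambda>x. integral {a..x} f)" if x: "a \<le> x" "x < b" for x
  proof -
    have "continuous_on {a..(x+b)/2} (\<lambda>x. integral {a..x} f)"
      by (rule indefinite_integral_continuous_1) (use x assms in auto)
    then have "continuous (at x within {a..(x+b)/2}) (\<lambda>x. integral {a..x} f)"
      using x by (auto simp: continuous_on_eq_continuous_within)
    moreover have "at x within {a..(x+b)/2} = at x within {a..<b}"
      by (rule at_within_nhd[of _ "{..<(x+b)/2}"]) (use x in auto)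
    ultimately show ?thesis by simp
  qed
  then show ?thesis by (auto simp: continuous_on_eq_continuous_within)
qed

lemma J_cont: "continuous_on {a..<b} h \<Longrightarrow> continuous_on {a..<b} (J h)"
  unfolding J_def[abs_def] by (rule indef_cont) (rule F_mult_integrable)

lemma Fabs_cont: "continuous_on {a..<b} Fabs"
  unfolding Fabs_def[abs_def] by (rule indef_cont) (rule abs_F_integrable)

lemma Fabs_nonneg: "s < b \<Longrightarrow> 0 \<le> Fabs s"
  unfolding Fabs_def by (intro integral_nonneg abs_F_integrable) auto

lemma J_bound:
  assumes h: "continuous_on {a..<b} h" "s < b" "\<And>t. a \<le> t \<Longrightarrow> t \<le> s \<Longrightarrow> \<bar>h t\<bar> \<le> M"
  shows "\<bar>J h s\<bar> \<le> M * Fabs s"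
proof -
  have "norm (integral {a..s} (\<lambda>t. F t * h t)) \<le> integral {a..s} (\<lambda>t. M * \<bar>F t\<bar>)"
  proof (rule integral_norm_bound_integral[OF F_mult_integrable[OF h(1,2)]])
    show "(\<lambda>t. M * \<bar>F t\<bar>) integrable_on {a..s}"
      by (intro integrable_on_mult_right abs_F_integrable h)
    show "norm (F t * h t) \<le> M * \<bar>F t\<bar>" if "t \<in> {a..s}" for t
      using h(3)[of t] that by (auto simp: abs_mult mult.commute[of M] intro!: mult_left_mono)
  qed
  then show ?thesis by (simp add: J_def Fabs_def)
qed

text \<open>Near \<open>a\<close> nothing is known about \<open>E\<close> alone, so integrability
  comes from domination by \<open>E * Fabs\<close>, which the locale assumes integrable.\<close>

lemma T_integrable_aux:
  assumes g: "continuous_on {a..<b} g" "g a = 0" "a < r" "r < b"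
    "\<And>s. a < s \<Longrightarrow> s \<le> r \<Longrightarrow> \<bar>g s\<bar> \<le> M * Fabs s"
  shows "(\<lambda>s. E s * g s) integrable_on {a..r}"
proof -
  have "(\<lambda>s. E s * g s) integrable_on {a<..r}"
  proof (rule measurable_bounded_by_integrable_imp_integrable_real)
    show "(\<lambda>s. E s * g s) \<in> borel_measurable (lebesgue_on {a<..r})"
    proof (rule continuous_imp_measurable_on_sets_lebesgue)
      show "continuous_on {a<..r} (\<lambda>s. E s * g s)"
        by (intro continuous_intros continuous_on_subset[OF contE] continuous_on_subset[OF g(1)])
          (use g in auto)
    qed simp
    have "(\<lambda>s. M * (E s * Fabs s)) integrable_on {a..r}"
      using intEF[OF g(3,4)] by (intro integrable_on_mult_right) (simp add: Fabs_def)
    then show "(\<lambda>s. M * (E s * Fabs s)) integrable_on {a<..r}"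
      using integrable_on_left_open by blast
    show "\<bar>E s * g s\<bar> \<le> M * (E s * Fabs s)" if "s \<in> {a<..r}" for s
      using g(5)[of s] posE[of s] that g(4)
      by (auto simp: abs_mult mult.left_commute[of M] intro!: mult_left_mono)
  qed simp
  then show ?thesis
    using integrable_on_left_open by blast
qed

lemma T_integrable:
  assumes h: "continuous_on {a..<b} h" "r < b"
  shows "(\<lambda>s. E s * J h s) integrable_on {a..r}"
proof (cases "a < r")
  case True
  have "compact (h ` {a..r})" by (intro compact_continuous_image cont_sub h) simp
  then obtain M where M: "\<And>t. t \<in> {a..r} \<Longrightarrow> \<bar>h t\<bar> \<le> M"
    by (metis bounded_real compact_imp_bounded imageI)
  show ?thesis
    by (rule T_integrable_aux[OF J_cont[OF h(1)] _ True h(2), of M])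
      (use h M in \<open>auto intro!: J_bound\<close>)
next
  case False
  then show ?thesis
    by (metis integrable_on_refl box_real(2) integrable_on_empty atLeastatMost_empty linorder_neqE_linordered_idom)
qed

lemma K_integrable: "r < b \<Longrightarrow> (\<lambda>s. E s * Fabs s) integrable_on {a..r}"
  using intEF[of r] unfolding Fabs_def
  by (metis integrable_on_refl box_real(2) integrable_on_empty atLeastatMost_empty linorder_neqE_linordered_idom)

text \<open>The integrand need not be continuous at the lower limit; integrability together with
  continuity at the upper limit is what differentiation requires.\<close>

lemma improper_deriv:
  assumes g: "continuous_on {a..<b} g" "a < r" "r < b"
    "\<And>r. a < r \<Longrightarrow> r < b \<Longrightarrow> (\<lambda>s. E s * g s) integrable_on {a..r}"
  shows "((\<lambda>x. integral {a..x} (\<lambda>s. E s * g s)) has_real_derivative E r * g r) (at r)"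
proof -
  have c: "continuous_on {a<..<b} (\<lambda>s. E s * g s)"
    by (intro continuous_intros contE continuous_on_subset[OF g(1)]) auto
  then have "isCont (\<lambda>s. E s * g s) r"
    using g(2,3) by (auto simp: continuous_on_eq_continuous_at)
  then have "((\<lambda>x. integral {a..x} (\<lambda>s. E s * g s)) has_vector_derivative E r * g r)
      (at r within {a..(r+b)/2})"
    using integral_has_vector_derivative_continuous_at[of "\<lambda>s. E s * g s" a "(r+b)/2" r "{}"]
      g(2,3) g(4)[of "(r+b)/2"] by (auto intro: continuous_at_imp_continuous_at_within)
  moreover have "at r within {a..(r+b)/2} = at r"
    by (rule at_within_interior) (use g in auto)
  ultimately show ?thesis by (simp add: has_real_derivative_iff_has_vector_derivative)
qed

lemma T_deriv:
  assumes "continuous_on {a..<b} h" "a < r" "r < b"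
  shows "(T h has_real_derivative E r * J h r) (at r)"
  unfolding T_def[abs_def]
  by (rule improper_deriv) (use assms in \<open>auto intro: J_cont T_integrable\<close>)

lemma K_deriv: "a < r \<Longrightarrow> r < b \<Longrightarrow> (K has_real_derivative E r * Fabs r) (at r)"
  unfolding K_def[abs_def] by (rule improper_deriv) (auto intro: Fabs_cont K_integrable)

lemma T_cont: "continuous_on {a..<b} h \<Longrightarrow> continuous_on {a..<b} (T h)"
  unfolding T_def[abs_def] by (rule indef_cont) (rule T_integrable)

lemma K_cont: "continuous_on {a..<b} K"
  unfolding K_def[abs_def] by (rule indef_cont) (rule K_integrable)

lemma right_tendsto:
  assumes "continuous_on {a..<b} h" shows "(h \<longlongrightarrow> h a) (at_right a)"
proof -
  have "(h \<longlongrightarrow> h a) (at a within {a..<b})" using assms ab by (auto simp: continuous_on_def)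
  then have "(h \<longlongrightarrow> h a) (at a within {a<..<b})" by (rule tendsto_within_subset) auto
  moreover have "at a within {a<..<b} = at_right a"
    by (rule at_within_nhd[of _ "{..<b}"]) (use ab in auto)
  ultimately show ?thesis by simp
qed

lemma mono_from:
  fixes f g f' g' :: "real \<Rightarrow> real"
  assumes c: "continuous_on {a..<b} f" "continuous_on {a..<b} g" "f a \<le> g a"
    and d: "\<And>x. a < x \<Longrightarrow> x < r \<Longrightarrow> (f has_real_derivative f' x) (at x)"
       "\<And>x. a < x \<Longrightarrow> x < r \<Longrightarrow> (g has_real_derivative g' x) (at x)"
       "\<And>x. a < x \<Longrightarrow> x < r \<Longrightarrow> f' x \<le> g' x"
    and r: "a \<le> r" "r < b"
  shows "f r \<le> g r"
proof -
  have barrier_coeff: "continuous_on {a..r} (\<lambda>x. g x - f x)"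
    by (intro continuous_intros cont_sub c r)
  have "(\<lambda>x. g x - f x) a \<le> (\<lambda>x. g x - f x) r"
  proof (rule DERIV_nonneg_imp_increasing_open[OF r(1) _ barrier_coeff])
    fix x assume x: "a < x" "x < r"
    then have "((\<lambda>x. g x - f x) has_real_derivative g' x - f' x) (at x)"
      by (intro derivative_intros d)
    moreover have "0 \<le> g' x - f' x" using d(3)[OF x] by simp
    ultimately show "\<exists>y. ((\<lambda>x. g x - f x) has_real_derivative y) (at x) \<and> 0 \<le> y" by blast
  qed
  then show ?thesis using c(3) by simp
qed

lemma T_bound:
  assumes h: "continuous_on {a..<b} h" "a \<le> r" "r < b" "\<And>t. a \<le> t \<Longrightarrow> t \<le> r \<Longrightarrow> \<bar>h t\<bar> \<le> M"
  shows "\<bar>T h r\<bar> \<le> M * K r"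
proof -
  have "norm (integral {a..r} (\<lambda>s. E s * J h s)) \<le> integral {a..r} (\<lambda>s. M * (E s * Fabs s))"
  proof (rule integral_norm_bound_integral)
    show "norm (E s * J h s) \<le> M * (E s * Fabs s)" if s: "s \<in> {a..r}" for s
    proof (cases "s = a")
      case False
      then have "\<bar>J h s\<bar> \<le> M * Fabs s" using s h by (intro J_bound) auto
      then show ?thesis using posE[of s] False s h(3)
        by (auto simp: abs_mult mult.left_commute[of M] intro!: mult_left_mono)
    qed (simp add: Fabs_def)
  qed (use h in \<open>auto intro!: T_integrable integrable_on_mult_right K_integrable\<close>)
  then show ?thesis by (simp add: T_def K_def)
qed

text \<open>Dominated convergence twice: for the inner integral with majorant
  \<open>M * \<bar>F t\<bar>\<close>, then for the outer one with
  \<open>M * (E s * Fabs s)\<close>.\<close>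

lemma T_tendsto:
  assumes h: "\<And>n. continuous_on {a..<b} (h n)" "continuous_on {a..<b} g" "a \<le> r" "r < b"
    "\<And>n t. a \<le> t \<Longrightarrow> t \<le> r \<Longrightarrow> \<bar>h n t\<bar> \<le> M"
    "\<And>t. a \<le> t \<Longrightarrow> t \<le> r \<Longrightarrow> (\<lambda>n. h n t) \<longlonglongrightarrow> g t"
  shows "(\<lambda>n. T (h n) r) \<longlonglongrightarrow> T g r"
proof -
  have Jl: "(\<lambda>n. J (h n) s) \<longlonglongrightarrow> J g s" if s: "a \<le> s" "s \<le> r" for s
    unfolding J_def
  proof (rule dominated_convergence(2)[where h="\<lambda>t. M * \<bar>F t\<bar>"])
    show "norm (F t * h n t) \<le> M * \<bar>F t\<bar>" if "t \<in> {a..s}" for n t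
      using h(5)[of t n] that s by (auto simp: abs_mult mult.commute[of M] intro!: mult_left_mono)
  qed (use s h in \<open>auto intro!: F_mult_integrable integrable_on_mult_right abs_F_integrable tendsto_intros\<close>)
  show ?thesis unfolding T_def
  proof (rule dominated_convergence(2)[where h="\<lambda>s. M * (E s * Fabs s)"])
    show "norm (E s * J (h n) s) \<le> M * (E s * Fabs s)" if s: "s \<in> {a..r}" for s n
    proof (cases "s = a")
      case False
      then have "\<bar>J (h n) s\<bar> \<le> M * Fabs s" using s h by (intro J_bound) auto
      then show ?thesis using posE[of s] False s h(4)
        by (auto simp: abs_mult mult.left_commute[of M] intro!: mult_left_mono)
    qed (simp add: Fabs_def)
  qed (use h Jl in \<open>auto intro!: T_integrable integrable_on_mult_right K_integrable tendsto_intros\<close>)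
qed

lemma K_mono:
  assumes "a \<le> s" "s \<le> r" "r < b"
  shows "K s \<le> K r"
proof (cases "a < s")
  case True
  show ?thesis
    by (rule DERIV_nonneg_le[OF assms(2) K_deriv])
      (use True assms in \<open>auto intro!: mult_nonneg_nonneg Fabs_nonneg less_imp_le[OF posE]\<close>)
next
  case False
  then have "s = a" using assms by simp
  moreover have "0 \<le> K r" unfolding K_def
  proof (rule integral_nonneg)
    show "0 \<le> E x * Fabs x" if "x \<in> {a..r}" for x
      using that assms posE[of x] Fabs_nonneg[of x] by (cases "x = a") (auto simp: Fabs_def)
  qed (use assms in \<open>auto intro: K_integrable\<close>)
  ultimately show ?thesis by simp
qed

lemma K_nonneg: "a \<le> r \<Longrightarrow> r < b \<Longrightarrow> 0 \<le> K r"
  using K_mono[of a r] by simp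

lemma T_add_lin:
  assumes "continuous_on {a..<b} h1" "continuous_on {a..<b} h2" "r < b"
  shows "T (\<lambda>t. h1 t + h2 t) r = T h1 r + T h2 r"
proof -
  have "J (\<lambda>t. h1 t + h2 t) s = J h1 s + J h2 s" if "s \<le> r" for s
    using that assms unfolding J_def
    by (subst integral_add[symmetric]) (auto intro!: F_mult_integrable integral_cong simp: algebra_simps)
  then have "T (\<lambda>t. h1 t + h2 t) r = integral {a..r} (\<lambda>s. E s * J h1 s + E s * J h2 s)"
    unfolding T_def by (intro integral_cong) (auto simp: algebra_simps)
  also have "\<dots> = T h1 r + T h2 r"
    unfolding T_def by (intro integral_add T_integrable assms)
  finally show ?thesis .
qed

lemma T_zero: "T (\<lambda>t. 0) r = 0" by (simp add: T_def J_def)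

text \<open>The Neumann series of \<open>T\<close> applied to 1. The triangular structure of a
  Volterra operator gives the bound \<open>K r ^ n / fact n\<close> for its terms, so the series
  converges however large \<open>K\<close> is.\<close>

theorem linear_exists:
  "\<exists>g. continuous_on {a..<b} g \<and> g a = 1 \<and> (\<forall>r\<in>{a..<b}. g r = 1 + T g r)"
proof -
  define G where "G n = (T ^^ n) (\<lambda>_. 1)" for n
  have G0: "G 0 = (\<lambda>_. 1)" and GS: "G (Suc n) = T (G n)" for n by (auto simp: G_def)
  have Gc: "continuous_on {a..<b} (G n)" for n
    by (induction n) (auto simp: G0 GS intro: T_cont)
  have Gb: "\<bar>G n r\<bar> \<le> K r ^ n / fact n" if "a \<le> r" "r < b" for n r
    using that
  proof (induction n arbitrary: r)
    case (Suc n)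
    \<comment> \<open>The derivative of \<open>B\<close> is \<open>K x ^ n / fact n\<close> times
      that of \<open>K\<close>, which is exactly the bound that the induction hypothesis gives for
      the derivative of \<open>T (G n)\<close>; so the functions are compared through their
      derivatives.\<close>
    define B where "B r = K r ^ Suc n / fact (Suc n)" for r
    have Bc: "continuous_on {a..<b} B" unfolding B_def by (intro continuous_intros K_cont) auto
    have Bd: "(B has_real_derivative K x ^ n / fact n * (E x * Fabs x)) (at x)" if "a < x" "x < b" for x
    proof -
      have "(B has_real_derivative (of_nat (Suc n) * K x ^ n * (E x * Fabs x)) / fact (Suc n)) (at x)"
        unfolding B_def
        using DERIV_cdivide[OF DERIV_power[OF K_deriv[OF that], of "Suc n"], of "fact (Suc n)"]
        by (simp only: diff_Suc_Suc diff_zero mult.assoc mult.commute mult.left_commute)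
      moreover have "(of_nat (Suc n) * K x ^ n * (E x * Fabs x)) / fact (Suc n) = K x ^ n / fact n * (E x * Fabs x)"
        by (simp add: field_simps del: of_nat_Suc)
      ultimately show ?thesis by simp
    qed
    have J: "\<bar>E x * J (G n) x\<bar> \<le> K x ^ n / fact n * (E x * Fabs x)" if x: "a < x" "x < b" for x
    proof -
      have "\<bar>J (G n) x\<bar> \<le> K x ^ n / fact n * Fabs x"
      proof (rule J_bound[OF Gc])
        show "\<bar>G n t\<bar> \<le> K x ^ n / fact n" if t: "a \<le> t" "t \<le> x" for t
        proof -
          have "\<bar>G n t\<bar> \<le> K t ^ n / fact n" using Suc.IH[of t] t x by auto
          also have "\<dots> \<le> K x ^ n / fact n"
            using t x by (intro divide_right_mono power_mono K_mono K_nonneg) auto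
          finally show ?thesis .
        qed
      qed fact
      from mult_left_mono[OF this, of "E x"] show ?thesis
        using posE[OF x] by (simp add: abs_mult mult.left_commute)
    qed
    have "T (G n) r \<le> B r"
      by (rule mono_from[OF T_cont[OF Gc] Bc _ T_deriv[OF Gc] Bd])
        (use Suc.prems J in \<open>auto simp: B_def abs_le_iff\<close>)
    moreover have "- T (G n) r \<le> B r"
      by (rule mono_from[where f="\<lambda>r. - T (G n) r", OF continuous_on_minus[OF T_cont[OF Gc]] Bc _ DERIV_minus[OF T_deriv[OF Gc]] Bd])
        (use Suc.prems J in \<open>auto simp: B_def abs_le_iff\<close>)
    ultimately show ?case by (simp add: GS B_def abs_le_iff)
  qed (simp add: G0)
  define g where "g r = (\<Sum>n. G n r)" for r
  define S where "S N r = (\<Sum>n<N. G n r)" for N r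
  have Sc: "continuous_on {a..<b} (S N)" for N
    unfolding S_def by (intro continuous_intros Gc)
  have UL: "uniform_limit {a..r} S g sequentially" if r: "a \<le> r" "r < b" for r
    unfolding S_def g_def
  proof (rule Weierstrass_m_test)
    show "norm (G n x) \<le> K r ^ n / fact n" if "x \<in> {a..r}" for n x
    proof -
      have "\<bar>G n x\<bar> \<le> K x ^ n / fact n" using Gb[of x n] that r by auto
      also have "\<dots> \<le> K r ^ n / fact n"
        using that r by (intro divide_right_mono power_mono K_mono K_nonneg) auto
      finally show ?thesis by simp
    qed
    show "summable (\<lambda>n. K r ^ n / fact n)"
      using summable_exp[of "K r"] by (simp add: divide_inverse mult.commute)
  qed
  have lim: "(\<lambda>N. S N r) \<longlonglongrightarrow> g r" if "a \<le> r" "r < b" for r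
    using tendsto_uniform_limitI[OF UL[OF that]] that by auto
  have gcr: "continuous_on {a..r} g" if "a \<le> r" "r < b" for r
    by (rule uniform_limit_theorem[OF _ UL[OF that]]) (auto intro!: always_eventually cont_sub Sc that)
  have gc: "continuous_on {a..<b} g"
    unfolding continuous_on_eq_continuous_within
  proof
    fix x assume x: "x \<in> {a..<b}"
    then have "continuous (at x within {a..(x+b)/2}) g"
      using gcr[of "(x+b)/2"] by (auto simp: continuous_on_eq_continuous_within)
    moreover have "at x within {a..(x+b)/2} = at x within {a..<b}"
      by (rule at_within_nhd[of _ "{..<(x+b)/2}"]) (use x in auto)
    ultimately show "continuous (at x within {a..<b}) g" by simp
  qed
  have fp: "g r = 1 + T g r" if r: "a \<le> r" "r < b" for r
  proof -
    have Sb: "\<bar>S N t\<bar> \<le> exp (K r)" if t: "a \<le> t" "t \<le> r" for N t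
    proof -
      have "\<bar>S N t\<bar> \<le> (\<Sum>n<N. \<bar>G n t\<bar>)" unfolding S_def by (rule sum_abs)
      also have "\<dots> \<le> (\<Sum>n<N. K r ^ n / fact n)"
      proof (rule sum_mono)
        fix n
        have "\<bar>G n t\<bar> \<le> K t ^ n / fact n" using Gb[of t n] t r by auto
        also have "\<dots> \<le> K r ^ n / fact n"
          using t r by (intro divide_right_mono power_mono K_mono K_nonneg) auto
        finally show "\<bar>G n t\<bar> \<le> K r ^ n / fact n" .
      qed
      also have "\<dots> \<le> (\<Sum>n. K r ^ n / fact n)"
        using summable_exp[of "K r"] K_nonneg[OF r]
        by (intro sum_le_suminf) (auto simp: divide_inverse mult.commute)
      also have "\<dots> = exp (K r)" by (simp add: exp_def divide_inverse mult.commute)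
      finally show ?thesis .
    qed
    have "(\<lambda>N. T (S N) r) \<longlonglongrightarrow> T g r"
      by (rule T_tendsto[OF Sc gc r Sb]) (use r lim in auto)
    moreover have TS: "T (S N) r = S (Suc N) r - 1" for N
    proof (induction N)
      case 0 then show ?case by (simp add: S_def G0 T_zero)
    next
      case (Suc N)
      have "T (S (Suc N)) r = T (\<lambda>t. S N t + G N t) r" by (simp add: S_def[abs_def])
      also have "\<dots> = T (S N) r + T (G N) r" by (rule T_add_lin[OF Sc Gc r(2)])
      finally have "T (S (Suc N)) r = T (S N) r + T (G N) r" .
      moreover have "S (Suc (Suc N)) r = S (Suc N) r + T (G N) r"
        unfolding S_def by (simp add: GS)
      ultimately show ?case using Suc by linarith
    qed
    moreover have "(\<lambda>N. S (Suc N) r - 1) \<longlonglongrightarrow> g r - 1"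
      using LIMSEQ_Suc[OF lim[OF r]] by (intro tendsto_intros)
    ultimately have "T g r = g r - 1" using LIMSEQ_unique by auto
    then show ?thesis by simp
  qed
  show ?thesis using gc fp ab fp[of a] by (intro exI[of _ g]) auto
qed


text \<open>An estimate of increments that is uniform in \<open>h\<close>: it makes the iterates
  equicontinuous, with modulus \<open>K\<close>.\<close>

lemma T_lip:
  assumes h: "continuous_on {a..<b} h" "a \<le> s" "s \<le> r" "r < b"
    "\<And>t. a \<le> t \<Longrightarrow> t \<le> r \<Longrightarrow> \<bar>h t\<bar> \<le> M"
  shows "\<bar>T h r - T h s\<bar> \<le> M * \<bar>K r - K s\<bar>"
proof -
  have 1: "T h s + integral {s..r} (\<lambda>s. E s * J h s) = T h r"
    unfolding T_def by (intro Henstock_Kurzweil_Integration.integral_combine T_integrable h)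
  have 2: "K s + integral {s..r} (\<lambda>s. E s * Fabs s) = K r"
    unfolding K_def by (intro Henstock_Kurzweil_Integration.integral_combine K_integrable h)
  have "norm (integral {s..r} (\<lambda>s. E s * J h s)) \<le> integral {s..r} (\<lambda>s. M * (E s * Fabs s))"
  proof (rule integral_norm_bound_integral)
    show "(\<lambda>s. E s * J h s) integrable_on {s..r}"
      by (rule integrable_subinterval_real[OF T_integrable[OF h(1,4)]]) (use h in auto)
    show "(\<lambda>s. M * (E s * Fabs s)) integrable_on {s..r}"
      by (intro integrable_on_mult_right integrable_subinterval_real[OF K_integrable[OF h(4)]]) (use h in auto)
    show "norm (E x * J h x) \<le> M * (E x * Fabs x)" if x: "x \<in> {s..r}" for x
    proof (cases "x = a")
      case False
      then have "\<bar>J h x\<bar> \<le> M * Fabs x" using x h by (intro J_bound) auto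
      then show ?thesis using posE[of x] False x h
        by (auto simp: abs_mult mult.left_commute[of M] intro!: mult_left_mono)
    qed (simp add: Fabs_def)
  qed
  moreover have "T h r - T h s = integral {s..r} (\<lambda>s. E s * J h s)" using 1 by simp
  moreover have "K r - K s = integral {s..r} (\<lambda>s. E s * Fabs s)" using 2 by simp
  ultimately have "\<bar>T h r - T h s\<bar> \<le> M * (K r - K s)" by simp
  moreover have "K s \<le> K r" using K_mono h by auto
  ultimately show ?thesis by simp
qed

lemma T_mono:
  assumes h: "continuous_on {a..<b} h1" "continuous_on {a..<b} h2" "r < b"
    "\<And>t. a \<le> t \<Longrightarrow> t \<le> r \<Longrightarrow> h1 t \<le> h2 t" "\<And>t. a \<le> t \<Longrightarrow> t \<le> r \<Longrightarrow> 0 \<le> F t"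
  shows "T h1 r \<le> T h2 r"
proof -
  have "J h1 s \<le> J h2 s" if "s \<le> r" for s
    unfolding J_def using that h by (intro integral_le F_mult_integrable mult_left_mono) auto
  moreover have "0 \<le> E s" if "s \<in> {a..r} - {a}" for s using posE[of s] that h by auto
  ultimately have "E s * J h1 s \<le> E s * J h2 s" if "s \<in> {a..r}" for s
    using that by (cases "s = a") (auto intro!: mult_left_mono)
  then show ?thesis unfolding T_def by (intro integral_le T_integrable h)
qed

lemma T_nonneg_mono:
  assumes h: "continuous_on {a..<b} h" "a \<le> s" "s \<le> r" "r < b"
    "\<And>t. a \<le> t \<Longrightarrow> t \<le> r \<Longrightarrow> 0 \<le> h t" "\<And>t. a \<le> t \<Longrightarrow> t \<le> r \<Longrightarrow> 0 \<le> F t"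
  shows "T h s \<le> T h r"
proof -
  have 1: "T h s + integral {s..r} (\<lambda>s. E s * J h s) = T h r"
    unfolding T_def by (intro Henstock_Kurzweil_Integration.integral_combine T_integrable h)
  have "0 \<le> J h x" if "x \<le> r" for x
    unfolding J_def using that h by (intro integral_nonneg F_mult_integrable mult_nonneg_nonneg) auto
  then have "0 \<le> E x * J h x" if "x \<in> {s..r}" for x
    using that posE[of x] h by (cases "x = a") auto
  then have "0 \<le> integral {s..r} (\<lambda>s. E s * J h s)"
    by (intro integral_nonneg integrable_subinterval_real[OF T_integrable[OF h(1,4)]]) (use h in auto)
  then show ?thesis using 1 by simp
qed

lemma powr_cont:
  assumes "continuous_on {a..<b} h" "\<And>t. a \<le> t \<Longrightarrow> t < b \<Longrightarrow> 0 \<le> h t" "0 < (p::real)"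
  shows "continuous_on {a..<b} (\<lambda>t. h t powr p)"
  using assms by (intro continuous_on_powr') auto

text \<open>Monotone iteration. It has to start from a given subsolution, because for
  \<open>c = 0\<close> the iteration from 0 stays at 0. The last conclusion says that the limit
  stays below every supersolution above \<open>v0\<close>, even if it is one only up to
  \<open>r1\<close>; this later fixes the growth of the limit at \<open>a\<close>.\<close>

theorem sublinear_exists:
  fixes p c :: real
  assumes F: "\<And>t. a \<le> t \<Longrightarrow> t < b \<Longrightarrow> 0 \<le> F t" and p: "0 < p" "p < 1"
    and v0: "continuous_on {a..<b} v0" "\<And>r. a \<le> r \<Longrightarrow> r < b \<Longrightarrow> 0 \<le> v0 r"
      "\<And>r. a \<le> r \<Longrightarrow> r < b \<Longrightarrow> v0 r \<le> c + T (\<lambda>t. v0 t powr p) r"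
  obtains v where "continuous_on {a..<b} v" "\<And>r. a \<le> r \<Longrightarrow> r < b \<Longrightarrow> v0 r \<le> v r"
    "\<And>r. a \<le> r \<Longrightarrow> r < b \<Longrightarrow> v r = c + T (\<lambda>t. v t powr p) r"
    "\<And>r1 V r. r1 < b \<Longrightarrow> continuous_on {a..<b} V \<Longrightarrow> (\<And>r. a \<le> r \<Longrightarrow> r < b \<Longrightarrow> 0 \<le> V r) \<Longrightarrow>
       (\<And>r. a \<le> r \<Longrightarrow> r \<le> r1 \<Longrightarrow> v0 r \<le> V r) \<Longrightarrow>
       (\<And>r. a \<le> r \<Longrightarrow> r \<le> r1 \<Longrightarrow> c + T (\<lambda>t. V t powr p) r \<le> V r) \<Longrightarrow> a \<le> r \<Longrightarrow> r \<le> r1 \<Longrightarrow> v r \<le> V r"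
proof -
  define V where "V n = ((\<lambda>h r. c + T (\<lambda>t. h t powr p) r) ^^ n) v0" for n
  have V0: "V 0 = v0" and VS: "V (Suc n) = (\<lambda>r. c + T (\<lambda>t. V n t powr p) r)" for n
    by (auto simp: V_def)
  have VB: "continuous_on {a..<b} (V n) \<and> (\<forall>r\<in>{a..<b}. v0 r \<le> V n r \<and> V n r \<le> V (Suc n) r)" for n
  proof (induction n)
    case 0 then show ?case using v0 by (auto simp: V0 VS)
  next
    case (Suc n)
    have le: "v0 r \<le> V n r" "V n r \<le> V (Suc n) r" if "a \<le> r" "r < b" for r
      using Suc that by auto
    have nn: "0 \<le> V n r" if "a \<le> r" "r < b" for r using le[OF that] v0(2)[OF that] by linarith
    have nn': "0 \<le> V (Suc n) r" if "a \<le> r" "r < b" for r using le[OF that] nn[OF that] by linarith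
    have c1: "continuous_on {a..<b} (\<lambda>t. V n t powr p)" using Suc nn p by (intro powr_cont) auto
    then have cS: "continuous_on {a..<b} (V (Suc n))" unfolding VS by (intro continuous_on_add continuous_on_const T_cont)
    have c2: "continuous_on {a..<b} (\<lambda>t. V (Suc n) t powr p)" using cS nn' p by (intro powr_cont) auto
    have "V (Suc n) r \<le> V (Suc (Suc n)) r" if "a \<le> r" "r < b" for r
      unfolding VS[of "Suc n"]
      by (subst VS) (use that Suc nn nn' p F in \<open>auto intro!: T_mono c1 c2 powr_mono2\<close>)
    moreover have "v0 r \<le> V (Suc n) r" if "a \<le> r" "r < b" for r using le[OF that] by linarith
    ultimately show ?case using cS by auto
  qed
  have Vc: "continuous_on {a..<b} (V n)" for n using VB by blast
  have Vmon: "V n r \<le> V (Suc n) r" and Vge: "v0 r \<le> V n r" if "a \<le> r" "r < b" for n r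
    using VB that by auto
  have Vnn: "0 \<le> V n r" if "a \<le> r" "r < b" for n r using Vge[OF that, of n] v0(2)[OF that] by linarith
  have Vpc: "continuous_on {a..<b} (\<lambda>t. V n t powr p)" for n
    using Vc Vnn p by (intro powr_cont) auto
  have bounded: "\<exists>M>0. \<forall>n. \<forall>t\<in>{a..r}. V n t \<le> M" if r: "a \<le> r" "r < b" for r
  proof -
    have "compact (v0 ` {a..r})" by (intro compact_continuous_image cont_sub v0 r) simp
    then obtain M0 where M0: "\<And>t. t \<in> {a..r} \<Longrightarrow> \<bar>v0 t\<bar> \<le> M0"
      by (metis bounded_real compact_imp_bounded imageI)
    \<comment> \<open>Invariant level: if an iterate is at most \<open>M\<close> up to
      \<open>r\<close>, so is the next one, since \<open>K\<close> increases.\<close>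
    obtain M where M: "M0 \<le> M" "0 < M" "c + K r * M powr p \<le> M"
      using sublinear_bound[OF p K_nonneg[OF r]] by blast
    have "V n t \<le> M" if "t \<in> {a..r}" for n t
      using that
    proof (induction n arbitrary: t)
      case 0 then show ?case using M0[of t] M by (auto simp: V0)
    next
      case (Suc n)
      have "\<bar>T (\<lambda>t. V n t powr p) t\<bar> \<le> M powr p * K t"
        using Suc Vnn p r by (intro T_bound Vpc) (auto intro!: powr_mono2)
      also have "\<dots> \<le> K r * M powr p" using K_mono[of t r] Suc.prems r by (simp add: mult.commute mult_left_mono)
      finally show ?case using M by (simp add: VS)
    qed
    then show ?thesis using M(2) by blast
  qed
  define v where "v r = lim (\<lambda>n. V n r)" for r
  have lim: "(\<lambda>n. V n r) \<longlonglongrightarrow> v r" and Vlev: "V n r \<le> v r" if r: "a \<le> r" "r < b" for r n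
  proof -
    obtain M where M: "\<And>n. V n r \<le> M" using bounded[OF r] r by (metis atLeastAtMost_iff order_refl)
    have "incseq (\<lambda>n. V n r)" using Vmon[OF r] by (intro incseq_SucI)
    from incseq_convergent[OF this, of M] M obtain L where L: "(\<lambda>n. V n r) \<longlonglongrightarrow> L" "\<And>i. V i r \<le> L" by auto
    then have "v r = L" unfolding v_def by (intro limI)
    then show "(\<lambda>n. V n r) \<longlonglongrightarrow> v r" "V n r \<le> v r" using L by auto
  qed
  have vge: "v0 r \<le> v r" if "a \<le> r" "r < b" for r using Vlev[OF that, of 0] by (simp add: V0)
  have vnn: "0 \<le> v r" if "a \<le> r" "r < b" for r using vge[OF that] v0(2)[OF that] by linarith
  have vcr: "continuous_on {a..r} v" if r: "a \<le> r" "r < b" for r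
  proof -
    obtain M where M: "0 < M" "\<And>n t. a \<le> t \<Longrightarrow> t \<le> r \<Longrightarrow> V n t \<le> M" using bounded[OF r] by (metis atLeastAtMost_iff)
    show ?thesis
    proof (rule continuous_on_dominated[OF cont_sub[OF K_cont r(2)]])
      fix x y assume xy: "x \<in> {a..r}" "y \<in> {a..r}" "x \<le> y"
      show "\<bar>v y - v x\<bar> \<le> M powr p * \<bar>K y - K x\<bar>"
      proof (rule LIMSEQ_le_const2)
        show "(\<lambda>n. \<bar>V (Suc n) y - V (Suc n) x\<bar>) \<longlonglongrightarrow> \<bar>v y - v x\<bar>"
          using xy r by (intro tendsto_intros LIMSEQ_Suc[OF lim]) auto
        show "\<exists>N. \<forall>n\<ge>N. \<bar>V (Suc n) y - V (Suc n) x\<bar> \<le> M powr p * \<bar>K y - K x\<bar>"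
        proof (intro exI allI impI)
          fix n
          have "\<bar>T (\<lambda>t. V n t powr p) y - T (\<lambda>t. V n t powr p) x\<bar> \<le> M powr p * \<bar>K y - K x\<bar>"
            using xy r M p Vnn by (intro T_lip Vpc) (auto intro!: powr_mono2)
          then show "\<bar>V (Suc n) y - V (Suc n) x\<bar> \<le> M powr p * \<bar>K y - K x\<bar>" by (simp add: VS)
        qed
      qed
    qed
  qed
  have vc: "continuous_on {a..<b} v"
    unfolding continuous_on_eq_continuous_within
  proof
    fix x assume x: "x \<in> {a..<b}"
    then have "continuous (at x within {a..(x+b)/2}) v"
      using vcr[of "(x+b)/2"] by (auto simp: continuous_on_eq_continuous_within)
    moreover have "at x within {a..(x+b)/2} = at x within {a..<b}"
      by (rule at_within_nhd[of _ "{..<(x+b)/2}"]) (use x in auto)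
    ultimately show "continuous (at x within {a..<b}) v" by simp
  qed
  have fp: "v r = c + T (\<lambda>t. v t powr p) r" if r: "a \<le> r" "r < b" for r
  proof -
    obtain M where M: "0 < M" "\<And>n t. a \<le> t \<Longrightarrow> t \<le> r \<Longrightarrow> V n t \<le> M" using bounded[OF r] by (metis atLeastAtMost_iff)
    have "(\<lambda>n. T (\<lambda>t. V n t powr p) r) \<longlonglongrightarrow> T (\<lambda>t. v t powr p) r"
    proof (rule T_tendsto[OF Vpc _ r, where M = "M powr p"])
      show "continuous_on {a..<b} (\<lambda>t. v t powr p)" using vc vnn p by (intro powr_cont) auto
      show "\<bar>V n t powr p\<bar> \<le> M powr p" if "a \<le> t" "t \<le> r" for n t
        using that r M Vnn p by (auto intro!: powr_mono2)
      show "(\<lambda>n. V n t powr p) \<longlonglongrightarrow> v t powr p" if "a \<le> t" "t \<le> r" for t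
        using that r lim[of t] p Vnn[of t] vnn[of t] by (intro tendsto_powr') auto
    qed
    then have "(\<lambda>n. V (Suc n) r) \<longlonglongrightarrow> c + T (\<lambda>t. v t powr p) r"
      unfolding VS by (intro tendsto_intros)
    moreover have "(\<lambda>n. V (Suc n) r) \<longlonglongrightarrow> v r" by (rule LIMSEQ_Suc[OF lim[OF r]])
    ultimately show ?thesis by (rule LIMSEQ_unique[symmetric])
  qed
  have up: "v r \<le> W r" if W: "r1 < b" "continuous_on {a..<b} W" "\<And>r. a \<le> r \<Longrightarrow> r < b \<Longrightarrow> 0 \<le> W r"
    "\<And>r. a \<le> r \<Longrightarrow> r \<le> r1 \<Longrightarrow> v0 r \<le> W r"
    "\<And>r. a \<le> r \<Longrightarrow> r \<le> r1 \<Longrightarrow> c + T (\<lambda>t. W t powr p) r \<le> W r" and r: "a \<le> r" "r \<le> r1" for r r1 W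
  proof -
    have "V n t \<le> W t" if "a \<le> t" "t \<le> r1" for n t
      using that
    proof (induction n arbitrary: t)
      case 0 then show ?case using W(4) by (auto simp: V0)
    next
      case (Suc n)
      have "T (\<lambda>t. V n t powr p) t \<le> T (\<lambda>t. W t powr p) t"
      proof (rule T_mono[OF Vpc])
        show "continuous_on {a..<b} (\<lambda>t. W t powr p)" by (rule powr_cont[OF W(2,3) p(1)])
        show "V n s powr p \<le> W s powr p" if "a \<le> s" "s \<le> t" for s
          using Suc.IH[of s] Suc.prems that Vnn[of s n] W(1) p by (intro powr_mono2) auto
      qed (use Suc.prems W(1) F in auto)
      then show ?case using W(5)[OF Suc.prems] unfolding VS by linarith
    qed
    then show ?thesis using lim[of r] W(1) r by (intro LIMSEQ_le_const2) auto
  qed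
  show ?thesis
  proof (rule that[of v])
    fix r1 V r
    assume "r1 < b" "continuous_on {a..<b} V" "\<And>r. a \<le> r \<Longrightarrow> r < b \<Longrightarrow> 0 \<le> V r"
      "\<And>r. a \<le> r \<Longrightarrow> r \<le> r1 \<Longrightarrow> v0 r \<le> V r"
      "\<And>r. a \<le> r \<Longrightarrow> r \<le> r1 \<Longrightarrow> c + T (\<lambda>t. V t powr p) r \<le> V r" "a \<le> r" "r \<le> r1"
    then show "v r \<le> V r" by (rule up)
  qed (use vc vge fp in auto)
qed

end

section \<open>Kernels of power type, and comparison of positive solutions up to a factor\<close>

lemma cont_image_bounded:
  fixes f :: "real \<Rightarrow> real"
  assumes "continuous_on {x..y} f"
  obtains M where "0 < M" "\<And>t. x \<le> t \<Longrightarrow> t \<le> y \<Longrightarrow> \<bar>f t\<bar> \<le> M"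
proof -
  have "compact (f ` {x..y})" by (intro compact_continuous_image assms) simp
  then obtain M where "\<And>t. t \<in> {x..y} \<Longrightarrow> \<bar>f t\<bar> \<le> M"
    by (metis bounded_real compact_imp_bounded imageI)
  then show ?thesis using that[of "\<bar>M\<bar> + 1"] by fastforce
qed

lemma cont_pos_lower:
  fixes f :: "real \<Rightarrow> real"
  assumes "continuous_on {x..y} f" "\<And>t. x \<le> t \<Longrightarrow> t \<le> y \<Longrightarrow> 0 < f t"
  obtains m where "0 < m" "\<And>t. x \<le> t \<Longrightarrow> t \<le> y \<Longrightarrow> m \<le> f t"
proof (cases "x \<le> y")
  case True
  then obtain z where "z \<in> {x..y}" "\<forall>t\<in>{x..y}. f z \<le> f t"
    using continuous_attains_inf[of "{x..y}" f] assms(1) by auto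
  then show ?thesis using that[of "f z"] assms(2) by auto
next
  case False then show ?thesis using that[of 1] by auto
qed

lemma powr_shift_integrable:
  fixes a r \<tau> :: real
  assumes "- 1 < \<tau>"
  shows "(\<lambda>s. (s - a) powr \<tau>) integrable_on {a..r}"
proof (cases "a \<le> r")
  case True
  have "((\<lambda>s. (s - a) powr \<tau>) has_integral (r - a) powr (\<tau> + 1) / (\<tau> + 1) - (a - a) powr (\<tau> + 1) / (\<tau> + 1)) {a..r}"
  proof (rule fundamental_theorem_of_calculus_interior[OF True])
    show "continuous_on {a..r} (\<lambda>s. (s - a) powr (\<tau> + 1) / (\<tau> + 1))"
      using assms by (intro continuous_intros continuous_on_powr') auto
    show "((\<lambda>s. (s - a) powr (\<tau> + 1) / (\<tau> + 1)) has_vector_derivative (x - a) powr \<tau>) (at x)"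
      if "x \<in> {a<..<r}" for x
      unfolding has_real_derivative_iff_has_vector_derivative[symmetric] using that assms
      by (auto intro!: derivative_eq_intros)
  qed
  then show ?thesis by blast
qed auto

lemma integrable_powr_bounded:
  fixes g :: "real \<Rightarrow> real"
  assumes g: "continuous_on {a<..r} g" and t: "- 1 < \<tau>"
    and bd: "eventually (\<lambda>s. \<bar>g s\<bar> \<le> C * (s - a) powr \<tau>) (at_right a)"
  shows "g integrable_on {a..r}"
proof (cases "a < r")
  case True
  obtain b where b: "a < b" "\<And>s. a < s \<Longrightarrow> s < b \<Longrightarrow> \<bar>g s\<bar> \<le> C * (s - a) powr \<tau>"
    using bd unfolding eventually_at_right_field by auto
  define c where "c = min r ((a + b) / 2)"
  have c: "a < c" "c \<le> r" "c < b" using True b(1) unfolding c_def by (auto simp: min_def)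
  have "g integrable_on {a<..c}"
  proof (rule measurable_bounded_by_integrable_imp_integrable_real)
    show "g \<in> borel_measurable (lebesgue_on {a<..c})"
      by (rule continuous_imp_measurable_on_sets_lebesgue) (use c in \<open>auto intro: continuous_on_subset[OF g]\<close>)
    show "(\<lambda>s. C * (s - a) powr \<tau>) integrable_on {a<..c}"
      unfolding integrable_on_left_open by (intro integrable_on_mult_right powr_shift_integrable t)
    show "\<bar>g s\<bar> \<le> C * (s - a) powr \<tau>" if "s \<in> {a<..c}" for s
      using b(2)[of s] that c by auto
  qed simp
  then have "g integrable_on {a..c}" using integrable_on_left_open by blast
  moreover have "g integrable_on {c..r}"
    by (intro integrable_continuous_interval continuous_on_subset[OF g]) (use c in auto)
  ultimately show ?thesis using c by (intro Henstock_Kurzweil_Integration.integrable_combine[of a c r]) auto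
next
  case False
  then show ?thesis
    by (metis integrable_on_refl box_real(2) integrable_on_empty atLeastatMost_empty linorder_neqE_linordered_idom)
qed

text \<open>The primitive of \<open>\<bar>F\<bar>\<close> is of order
  \<open>(s - a) powr (\<sigma> + 1)\<close>; multiplied by \<open>E\<close> it has the exponent
  \<open>\<sigma> + 1 - \<kappa>\<close>, which exceeds -1.\<close>

lemma volterraI_powr:
  fixes E F :: "real \<Rightarrow> real"
  assumes ab: "a < b"
    and contE: "continuous_on {a<..<b} E" and posE: "\<And>r. a < r \<Longrightarrow> r < b \<Longrightarrow> 0 < E r"
    and contF: "continuous_on {a..<b} F"
    and F: "eventually (\<lambda>s. \<bar>F s\<bar> \<le> C1 * (s - a) powr \<sigma>) (at_right a)"
    and E: "eventually (\<lambda>s. E s \<le> C2 * (s - a) powr (- \<kappa>)) (at_right a)"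
    and ex: "0 \<le> \<sigma>" "\<kappa> < \<sigma> + 2" "0 \<le> C1" "0 \<le> C2"
  shows "volterra a b E F"
proof
  fix r assume r: "a < r" "r < b"
  let ?I = "\<lambda>s. integral {a..s} (\<lambda>t. \<bar>F t\<bar>)"
  have cI: "continuous_on {a..r} ?I"
    by (intro indefinite_integral_continuous_1 integrable_continuous_interval continuous_intros
        continuous_on_subset[OF contF]) (use r in auto)
  have cF: "(\<lambda>t. \<bar>F t\<bar>) integrable_on {a..s}" if "s \<le> r" for s
    by (intro integrable_continuous_interval continuous_intros continuous_on_subset[OF contF]) (use r that in auto)
  obtain x where x: "a < x" "\<And>s. a < s \<Longrightarrow> s < x \<Longrightarrow> \<bar>F s\<bar> \<le> C1 * (s - a) powr \<sigma>"
      "\<And>s. a < s \<Longrightarrow> s < x \<Longrightarrow> E s \<le> C2 * (s - a) powr (- \<kappa>)"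
    using eventually_conj[OF F E] unfolding eventually_at_right_field by auto
  show "(\<lambda>s. E s * ?I s) integrable_on {a..r}"
  proof (rule integrable_powr_bounded)
    show "continuous_on {a<..r} (\<lambda>s. E s * ?I s)"
      by (intro continuous_intros continuous_on_subset[OF contE] continuous_on_subset[OF cI]) (use r in auto)
    show "- 1 < \<sigma> + 1 - \<kappa>" using ex by simp
    show "\<forall>\<^sub>F s in at_right a. \<bar>E s * ?I s\<bar> \<le> (C1 * C2) * (s - a) powr (\<sigma> + 1 - \<kappa>)"
      unfolding eventually_at_right_field
    proof (intro exI[of _ "min x r"] conjI allI impI)
      fix s assume s: "a < s" "s < min x r"
      have "\<bar>?I s\<bar> \<le> C1 * (s - a) powr \<sigma> * (s - a)"
      proof -
        \<comment> \<open>The pointwise bound on \<open>F\<close> is available only for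
          \<open>t > a\<close>, hence the passage to the open interval.\<close>
        have "?I s = integral {a<..<s} (\<lambda>t. \<bar>F t\<bar>)" by (rule integral_open_interval_real)
        also have "\<dots> \<le> integral {a<..<s} (\<lambda>t. C1 * (s - a) powr \<sigma>)"
        proof (rule integral_le)
          show "(\<lambda>t. \<bar>F t\<bar>) integrable_on {a<..<s}"
            using cF[of s] s integrable_on_open_interval_real by auto
          show "(\<lambda>t. C1 * (s - a) powr \<sigma>) integrable_on {a<..<s}"
            using integrable_on_open_interval_real integrable_const_ivl by blast
          show "\<bar>F t\<bar> \<le> C1 * (s - a) powr \<sigma>" if "t \<in> {a<..<s}" for t
          proof -
            have "\<bar>F t\<bar> \<le> C1 * (t - a) powr \<sigma>" using x(2)[of t] that s by auto
            also have "\<dots> \<le> C1 * (s - a) powr \<sigma>" using that ex by (intro mult_left_mono powr_mono2) auto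
            finally show ?thesis .
          qed
        qed
        also have "\<dots> = integral {a..s} (\<lambda>t. C1 * (s - a) powr \<sigma>)" by (rule integral_open_interval_real[symmetric])
        also have "\<dots> = C1 * (s - a) powr \<sigma> * (s - a)" using s by simp
        finally have "?I s \<le> C1 * (s - a) powr \<sigma> * (s - a)" .
        moreover have "0 \<le> ?I s" using s by (intro integral_nonneg cF) auto
        ultimately show ?thesis by simp
      qed
      moreover have "\<bar>E s\<bar> \<le> C2 * (s - a) powr (- \<kappa>)" using x(3)[of s] posE[of s] s r by auto
      ultimately have "\<bar>E s\<bar> * \<bar>?I s\<bar> \<le> (C2 * (s - a) powr (- \<kappa>)) * (C1 * (s - a) powr \<sigma> * (s - a))"
        by (intro mult_mono) auto
      also have "\<dots> = (C1 * C2) * (s - a) powr (\<sigma> + 1 - \<kappa>)"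
        using s by (simp add: powr_add powr_minus powr_diff field_simps)
      finally show "\<bar>E s * ?I s\<bar> \<le> (C1 * C2) * (s - a) powr (\<sigma> + 1 - \<kappa>)" by (simp add: abs_mult)
    qed (use x r in auto)
  qed
qed (use assms in auto)

text \<open>A bound near \<open>a\<close> extends up to \<open>r\<close> by compactness. The
  constant is taken at least 1 so that the powers \<open>L powr (p ^ n)\<close> decrease to
  1.\<close>

lemma ratio_bounded:
  fixes v1 v2 :: "real \<Rightarrow> real"
  assumes c: "continuous_on {a<..<b} v1" "continuous_on {a<..<b} v2"
    and pos: "\<And>r. a < r \<Longrightarrow> r < b \<Longrightarrow> 0 < v1 r" "\<And>r. a < r \<Longrightarrow> r < b \<Longrightarrow> 0 < v2 r"
    and ev: "eventually (\<lambda>r. v1 r \<le> C * v2 r) (at_right a)" and r: "a < r" "r < b"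
  obtains L where "1 \<le> L" "\<And>s. a < s \<Longrightarrow> s \<le> r \<Longrightarrow> v1 s \<le> L * v2 s"
proof -
  obtain x where x: "a < x" "\<And>s. a < s \<Longrightarrow> s < x \<Longrightarrow> v1 s \<le> C * v2 s"
    using ev unfolding eventually_at_right_field by auto
  obtain M where M: "0 < M" "\<And>s. min x r \<le> s \<Longrightarrow> s \<le> r \<Longrightarrow> \<bar>v1 s / v2 s\<bar> \<le> M"
  proof (rule cont_image_bounded[of "min x r" r "\<lambda>s. v1 s / v2 s"])
    have "v2 s \<noteq> 0" if "s \<in> {min x r..r}" for s using pos(2)[of s] that x r by (auto simp: min_def split: if_splits)
    then show "continuous_on {min x r..r} (\<lambda>s. v1 s / v2 s)"
      by (intro continuous_intros continuous_on_subset[OF c(1)] continuous_on_subset[OF c(2)]) (use x r in auto)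
  qed blast
  define L where "L = max 1 (max C M)"
  have "v1 s \<le> L * v2 s" if s: "a < s" "s \<le> r" for s
  proof (cases "s < x")
    case True
    have "v1 s \<le> C * v2 s" using x(2) s True by auto
    also have "\<dots> \<le> L * v2 s" using pos(2)[of s] s r by (intro mult_right_mono) (auto simp: L_def)
    finally show ?thesis .
  next
    case False
    then have "\<bar>v1 s / v2 s\<bar> \<le> M" using M(2)[of s] s by simp
    then have "v1 s / v2 s \<le> M" by linarith
    then have "v1 s \<le> M * v2 s" using pos(2)[of s] s r by (simp add: divide_simps)
    also have "\<dots> \<le> L * v2 s" using pos(2)[of s] s r by (intro mult_right_mono) (auto simp: L_def)
    finally show ?thesis .
  qed
  then show ?thesis using that[of L] by (auto simp: L_def)
qed

text \<open>If \<open>v1 \<le> L * v2\<close> with \<open>L \<ge> 1\<close>, then integrating twice improves the constant to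
  \<open>L powr p\<close>; iterating drives it to \<open>1\<close>.\<close>

lemma sublinear_compare:
  fixes E F v1 v2 J1 J2 :: "real \<Rightarrow> real"
  assumes p: "0 < p" "p < 1" and c: "0 \<le> c"
    and EF: "\<And>r. a < r \<Longrightarrow> r < b \<Longrightarrow> 0 \<le> E r" "\<And>r. a < r \<Longrightarrow> r < b \<Longrightarrow> 0 \<le> F r"
    and pos: "\<And>r. a < r \<Longrightarrow> r < b \<Longrightarrow> 0 < v1 r" "\<And>r. a < r \<Longrightarrow> r < b \<Longrightarrow> 0 < v2 r"
    and d1: "\<And>r. a < r \<Longrightarrow> r < b \<Longrightarrow> (v1 has_real_derivative E r * J1 r) (at r)"
      "\<And>r. a < r \<Longrightarrow> r < b \<Longrightarrow> (J1 has_real_derivative F r * v1 r powr p) (at r)"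
    and d2: "\<And>r. a < r \<Longrightarrow> r < b \<Longrightarrow> (v2 has_real_derivative E r * J2 r) (at r)"
      "\<And>r. a < r \<Longrightarrow> r < b \<Longrightarrow> (J2 has_real_derivative F r * v2 r powr p) (at r)"
    and lim: "(v1 \<longlongrightarrow> c) (at_right a)" "(v2 \<longlongrightarrow> c) (at_right a)"
      "(J1 \<longlongrightarrow> 0) (at_right a)" "(J2 \<longlongrightarrow> 0) (at_right a)"
    and ev: "eventually (\<lambda>r. v1 r \<le> C * v2 r) (at_right a)" and r: "a < r" "r < b"
  shows "v1 r \<le> v2 r"
proof -
  have cv: "continuous_on {a<..<b} v1" "continuous_on {a<..<b} v2"
    using d1(1) d2(1) by (auto intro!: continuous_at_imp_continuous_on DERIV_isCont)
  obtain L where L: "1 \<le> L" "\<And>s. a < s \<Longrightarrow> s \<le> r \<Longrightarrow> v1 s \<le> L * v2 s"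
    using ratio_bounded[OF cv pos ev r] by blast
  have improve: "v1 s \<le> (l powr p) * v2 s"
    if l: "1 \<le> l" "\<And>s. a < s \<Longrightarrow> s \<le> r \<Longrightarrow> v1 s \<le> l * v2 s" and s: "a < s" "s < r" for l s
  proof -
    have lp: "1 \<le> l powr p" using l p by (intro ge_one_powr_ge_zero) auto
    have Jle: "J1 t \<le> l powr p * J2 t" if t: "a < t" "t < r" for t
    proof -
      have "0 - 0 \<le> l powr p * J2 t - J1 t"
      proof (rule right_limit_le[where f="\<lambda>t. l powr p * J2 t - J1 t" and a = a and b = r])
        show "((\<lambda>t. l powr p * J2 t - J1 t) \<longlongrightarrow> 0 - 0) (at_right a)"
          using tendsto_diff[OF tendsto_mult[OF tendsto_const[of "l powr p"] lim(4)] lim(3)] by simp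
        fix x assume x: "a < x" "x < r"
        show "((\<lambda>t. l powr p * J2 t - J1 t) has_real_derivative
            l powr p * (F x * v2 x powr p) - F x * v1 x powr p) (at x)"
          using x r by (auto intro!: derivative_eq_intros d1 d2)
        have "v1 x powr p \<le> (l * v2 x) powr p"
          using l(2)[of x] pos[of x] x r p by (intro powr_mono2) auto
        then have "v1 x powr p \<le> l powr p * v2 x powr p"
          using l(1) pos[of x] x r by (simp add: powr_mult)
        from mult_left_mono[OF this EF(2)[of x]]
        show "0 \<le> l powr p * (F x * v2 x powr p) - F x * v1 x powr p"
          using x r by (simp add: algebra_simps)
      qed (use t in auto)
      then show ?thesis by simp
    qed
    have "l powr p * c - c \<le> l powr p * v2 s - v1 s"
    proof (rule right_limit_le[where f="\<lambda>t. l powr p * v2 t - v1 t" and a = a and b = r])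
      show "((\<lambda>t. l powr p * v2 t - v1 t) \<longlongrightarrow> l powr p * c - c) (at_right a)"
        by (intro tendsto_intros lim)
      fix x assume x: "a < x" "x < r"
      show "((\<lambda>t. l powr p * v2 t - v1 t) has_real_derivative
          l powr p * (E x * J2 x) - E x * J1 x) (at x)"
        using x r by (auto intro!: derivative_eq_intros d1 d2)
      show "0 \<le> l powr p * (E x * J2 x) - E x * J1 x"
        using mult_left_mono[OF Jle[OF x] EF(1)[of x]] x r by (simp add: algebra_simps)
    qed (use s in auto)
    \<comment> \<open>The common nonnegative limit at \<open>a\<close> makes the difference start
      with the right sign.\<close>
    moreover have "0 \<le> l powr p * c - c" using lp c by (simp add: mult_left_le_one_le mult_le_cancel_right1)
    ultimately show ?thesis by simp
  qed
  \<comment> \<open>\<open>improve\<close> gives the better constant only left of \<open>r\<close>;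
    continuity restores it at \<open>r\<close>, so that the conclusion has the form of the
    hypothesis and can be iterated.\<close>
  have improve': "v1 s \<le> (l powr p) * v2 s"
    if l: "1 \<le> l" "\<And>s. a < s \<Longrightarrow> s \<le> r \<Longrightarrow> v1 s \<le> l * v2 s" and s: "a < s" "s \<le> r" for l s
  proof (cases "s = r")
    case True
    have "isCont v1 r" "isCont v2 r" using d1(1)[OF r] d2(1)[OF r] by (auto intro: DERIV_isCont)
    then have l1: "(v1 \<longlongrightarrow> v1 r) (at_left r)" "((\<lambda>s. l powr p * v2 s) \<longlongrightarrow> l powr p * v2 r) (at_left r)"
      by (auto simp: isCont_def intro!: tendsto_intros intro: tendsto_within_subset)
    have "eventually (\<lambda>s. v1 s \<le> l powr p * v2 s) (at_left r)"
      unfolding eventually_at_left_field using improve[OF l] r by (intro exI[of _ a]) auto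
    from tendsto_le[OF _ l1(2,1) this] show ?thesis using True by simp
  qed (use improve[OF l] s in auto)
  have it: "\<forall>s. a < s \<and> s \<le> r \<longrightarrow> v1 s \<le> L powr (p ^ n) * v2 s" for n
  proof (induction n)
    case 0 then show ?case using L by auto
  next
    case (Suc n)
    have "1 \<le> L powr (p ^ n)" using L p by (intro ge_one_powr_ge_zero) auto
    from improve'[OF this] Suc show ?case by (auto simp: powr_powr mult.commute)
  qed
  have "(\<lambda>n. L powr (p ^ n) * v2 r) \<longlonglongrightarrow> L powr 0 * v2 r"
    using p L by (intro tendsto_intros LIMSEQ_realpow_zero) auto
  then have "v1 r \<le> L powr 0 * v2 r"
    by (rule LIMSEQ_le_const) (use it r in auto)
  then show ?thesis using L by simp
qed

section \<open>The linear equation\<close>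

definition bdist :: "real \<Rightarrow> real \<Rightarrow> real \<Rightarrow> real" where
  "bdist r0 R r = min (R - r) (r - r0)"

text \<open>Divergence form with the derivative \<open>d\<close> as a separate function: Wronskians,
  quotients and the reflection then involve only the derivatives of \<phi> and of
  \<open>w * d\<close>.\<close>

definition lin_sol :: "real \<Rightarrow> real \<Rightarrow> real \<Rightarrow> (real \<Rightarrow> real) \<Rightarrow> real \<Rightarrow> real \<Rightarrow>
    (real \<Rightarrow> real) \<Rightarrow> (real \<Rightarrow> real) \<Rightarrow> bool" where
  "lin_sol r0 R \<mu> w a b \<phi> d \<longleftrightarrow> (\<forall>r. a < r \<and> r < b \<longrightarrow> (\<phi> has_real_derivative d r) (at r) \<and>
     ((\<lambda>r. w r * d r) has_real_derivative - (w r * \<mu> / (bdist r0 R r)\<^sup>2 * \<phi> r)) (at r))"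

lemma bdist_mirror: "bdist r0 R (r0 + R - r) = bdist r0 R r"
  by (auto simp: bdist_def min_def)

lemma bdist_pos: "r0 < r \<Longrightarrow> r < R \<Longrightarrow> 0 < bdist r0 R r"
  by (simp add: bdist_def)

lemma mirror_right: "filterlim (\<lambda>r::real. c - r) (at_right (c - b)) (at_left b)"
  unfolding filterlim_at
  by (auto intro!: tendsto_eq_intros simp: eventually_at_left_field intro: exI[of _ "b - 1"])

lemma mirror_left: "filterlim (\<lambda>r::real. c - r) (at_left (c - a)) (at_right a)"
  unfolding filterlim_at
  by (auto intro!: tendsto_eq_intros simp: eventually_at_right_field intro: exI[of _ "a + 1"])

lemma DERIV_reflect:
  assumes "(f has_real_derivative D) (at (c - r))"
  shows "((\<lambda>r::real. f (c - r)) has_real_derivative - D) (at r)"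
proof -
  have "((\<lambda>r. c - r) has_real_derivative - 1) (at r)" by (auto intro!: derivative_eq_intros)
  from DERIV_chain2[where f=f, OF assms this] show ?thesis by simp
qed

lemma lin_sol_mirror:
  assumes "lin_sol r0 R \<mu> w a b \<phi> d"
  shows "lin_sol r0 R \<mu> (\<lambda>r. w (r0 + R - r)) (r0 + R - b) (r0 + R - a)
    (\<lambda>r. \<phi> (r0 + R - r)) (\<lambda>r. - d (r0 + R - r))"
  unfolding lin_sol_def
proof (intro allI impI)
  fix r assume r: "r0 + R - b < r \<and> r < r0 + R - a"
  then have r': "a < r0 + R - r" "r0 + R - r < b" by auto
  have 1: "(\<phi> has_real_derivative d (r0 + R - r)) (at (r0 + R - r))"
    "((\<lambda>r. w r * d r) has_real_derivative - (w (r0 + R - r) * \<mu> / (bdist r0 R (r0 + R - r))\<^sup>2 * \<phi> (r0 + R - r))) (at (r0 + R - r))"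
    using assms r' unfolding lin_sol_def by blast+
  have "((\<lambda>r. - (w (r0 + R - r) * d (r0 + R - r))) has_real_derivative
      - (w (r0 + R - r) * \<mu> / (bdist r0 R r)\<^sup>2 * \<phi> (r0 + R - r))) (at r)"
    using DERIV_minus[OF DERIV_reflect[OF 1(2)]] by (simp add: bdist_mirror)
  then show "((\<lambda>r. \<phi> (r0 + R - r)) has_real_derivative - d (r0 + R - r)) (at r) \<and>
    ((\<lambda>r. w (r0 + R - r) * - d (r0 + R - r)) has_real_derivative
      - (w (r0 + R - r) * \<mu> / (bdist r0 R r)\<^sup>2 * \<phi> (r0 + R - r))) (at r)"
    using DERIV_reflect[OF 1(1)] by simp
qed

lemma eventually_bdist_inner: "r0 < R \<Longrightarrow> eventually (\<lambda>r. r0 < r \<and> r < R \<and> bdist r0 R r = r - r0) (at_right r0)"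
  unfolding eventually_at_right_field bdist_def by (intro exI[of _ "(r0 + R) / 2"]) auto

lemma eventually_bdist_outer: "r0 < R \<Longrightarrow> eventually (\<lambda>r. r0 < r \<and> r < R \<and> bdist r0 R r = R - r) (at_left R)"
  unfolding eventually_at_left_field bdist_def by (intro exI[of _ "(r0 + R) / 2"]) auto

lemma bound_from_ends:
  fixes f g :: "real \<Rightarrow> real"
  assumes c: "continuous_on {a<..<b} f" "continuous_on {a<..<b} g" "a < b"
    and g: "\<And>r. a < r \<Longrightarrow> r < b \<Longrightarrow> 0 < g r"
    and e: "eventually (\<lambda>r. f r \<le> C1 * g r) (at_right a)" "eventually (\<lambda>r. f r \<le> C2 * g r) (at_left b)"
  obtains C where "0 < C" "\<And>r. a < r \<Longrightarrow> r < b \<Longrightarrow> f r \<le> C * g r"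
proof -
  obtain x where x: "a < x" "\<And>s. a < s \<Longrightarrow> s < x \<Longrightarrow> f s \<le> C1 * g s"
    using e(1) unfolding eventually_at_right_field by auto
  obtain y where y: "y < b" "\<And>s. y < s \<Longrightarrow> s < b \<Longrightarrow> f s \<le> C2 * g s"
    using e(2) unfolding eventually_at_left_field by auto
  obtain M where M: "0 < M" "\<And>s. x \<le> s \<Longrightarrow> s \<le> y \<Longrightarrow> \<bar>f s / g s\<bar> \<le> M"
  proof (rule cont_image_bounded[of x y "\<lambda>s. f s / g s"])
    have "g s \<noteq> 0" if "s \<in> {x..y}" for s using g[of s] that x y by auto
    then show "continuous_on {x..y} (\<lambda>s. f s / g s)"
      by (intro continuous_intros continuous_on_subset[OF c(1)] continuous_on_subset[OF c(2)]) (use x y in auto)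
  qed blast
  define C where "C = max M (max C1 C2)"
  have "f r \<le> C * g r" if r: "a < r" "r < b" for r
  proof -
    have "f r \<le> C1 * g r \<or> f r \<le> C2 * g r \<or> f r \<le> M * g r"
    proof (cases "r < x \<or> y < r")
      case False
      then have "\<bar>f r / g r\<bar> \<le> M" using M(2)[of r] by auto
      then have "f r / g r \<le> M" by linarith
      then show ?thesis using g[OF r] by (simp add: divide_simps)
    qed (use x y r in auto)
    moreover have "C1 * g r \<le> C * g r" "C2 * g r \<le> C * g r" "M * g r \<le> C * g r"
      using g[OF r] by (auto simp: C_def intro!: mult_right_mono)
    ultimately show ?thesis by linarith
  qed
  then show ?thesis using that[of C] M by (auto simp: C_def)
qed

text \<open>Variation of constants: \<open>J\<close> stands for \<open>w e\<^sup>2 g'\<close>.\<close>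

lemma product_deriv:
  fixes w e e' g J :: "real \<Rightarrow> real"
  assumes S: "a < x" "x < b"
    and ne: "\<And>r. a < r \<Longrightarrow> r < b \<Longrightarrow> w r \<noteq> 0" "\<And>r. a < r \<Longrightarrow> r < b \<Longrightarrow> e r \<noteq> 0"
    and d: "(e has_real_derivative e' x) (at x)" "((\<lambda>r. w r * e' r) has_real_derivative A) (at x)"
      "(g has_real_derivative 1 / (w x * (e x)\<^sup>2) * J x) (at x)" "(J has_real_derivative H) (at x)"
  shows "((\<lambda>r. e r * g r) has_real_derivative e' x * g x + J x / (w x * e x)) (at x)"
    and "((\<lambda>r. w r * (e' r * g r + J r / (w r * e r))) has_real_derivative A * g x + H / e x) (at x)"
proof -
  have [simp]: "w x \<noteq> 0" "e x \<noteq> 0" using ne S by auto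
  show "((\<lambda>r. e r * g r) has_real_derivative e' x * g x + J x / (w x * e x)) (at x)"
    by (rule DERIV_cong[OF DERIV_mult[OF d(1,3)]]) (simp add: field_simps power2_eq_square)
  have "((\<lambda>r. w r * e' r * g r + J r / e r) has_real_derivative A * g x + H / e x) (at x)"
    by (rule DERIV_cong[OF DERIV_add[OF DERIV_mult[OF d(2,3)] DERIV_divide[OF d(4,1)]]])
      (simp_all add: field_simps power2_eq_square)
  then show "((\<lambda>r. w r * (e' r * g r + J r / (w r * e r))) has_real_derivative A * g x + H / e x) (at x)"
    by (rule has_field_derivative_transform_within_open[where S="{a<..<b}"])
      (use S ne in \<open>auto simp: field_simps\<close>)
qed

text \<open>In \<open>no_ground_state\<close> the bound with exponent \<open>beta_plus \<mu>\<close>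
  carries the finite energy condition: for \<open>0 < \<mu>\<close> the exponent
  \<open>beta_minus \<mu>\<close> is positive too, so vanishing at the boundary alone would not tell
  the two kinds of behaviour apart.\<close>

locale annular_ode =
  fixes r0 R \<mu> :: real and w w' :: "real \<Rightarrow> real"
  assumes r0R: "r0 < R" and mu: "\<mu> < 1/4"
    and w_deriv: "\<And>r. r0 \<le> r \<Longrightarrow> r \<le> R \<Longrightarrow> (w has_real_derivative w' r) (at r)"
    and w'_cont: "continuous_on {r0..R} w'"
    and w_pos: "\<And>r. r0 \<le> r \<Longrightarrow> r \<le> R \<Longrightarrow> 0 < w r"
    and no_ground_state: "\<And>\<phi> d a b C. r0 \<le> a \<Longrightarrow> a < b \<Longrightarrow> b \<le> R \<Longrightarrow>
        lin_sol r0 R \<mu> w a b \<phi> d \<Longrightarrow>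
        (\<And>r. a < r \<Longrightarrow> r < b \<Longrightarrow> 0 < \<phi> r \<and> \<phi> r \<le> C * bdist r0 R r powr beta_plus \<mu>) \<Longrightarrow>
        (\<phi> \<longlongrightarrow> 0) (at_right a) \<Longrightarrow> (\<phi> \<longlongrightarrow> 0) (at_left b) \<Longrightarrow> False"
begin

abbreviation "bp \<equiv> beta_plus \<mu>"
abbreviation "bm \<equiv> beta_minus \<mu>"
abbreviation "\<delta> \<equiv> bdist r0 R"

text \<open>The equation \<open>x * (x - 1) = - \<mu>\<close> is the indicial equation of
  \<open>u'' + \<mu> / s\<^sup>2 * u = 0\<close>; its roots are \<open>bp\<close> and
  \<open>bm\<close>.\<close>

lemma bp_gt: "1/2 < bp" and bpm: "bp + bm = 1" and bp_eq: "bp * (bp - 1) = - \<mu>"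
proof -
  have "0 < sqrt (1/4 - \<mu>)" using mu by simp
  moreover have "(sqrt (1/4 - \<mu>))\<^sup>2 = 1/4 - \<mu>" using mu by simp
  ultimately show "1/2 < bp" "bp + bm = 1" "bp * (bp - 1) = - \<mu>"
    by (auto simp: beta_plus_def beta_minus_def power2_eq_square algebra_simps)
qed

lemma w_cont: "continuous_on {r0..R} w"
  using w_deriv by (intro continuous_at_imp_continuous_on ballI DERIV_isCont[of w]) auto

lemma w_bounds:
  obtains m M where "0 < m" "0 < M" "\<And>r. r0 \<le> r \<Longrightarrow> r \<le> R \<Longrightarrow> m \<le> w r \<and> w r \<le> M \<and> \<bar>w' r\<bar> \<le> M"
proof -
  obtain m where m: "0 < m" "\<And>r. r0 \<le> r \<Longrightarrow> r \<le> R \<Longrightarrow> m \<le> w r"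
    using cont_pos_lower[OF w_cont] w_pos by blast
  obtain M1 where M1: "0 < M1" "\<And>r. r0 \<le> r \<Longrightarrow> r \<le> R \<Longrightarrow> \<bar>w r\<bar> \<le> M1"
    using cont_image_bounded[OF w_cont] by blast
  obtain M2 where M2: "0 < M2" "\<And>r. r0 \<le> r \<Longrightarrow> r \<le> R \<Longrightarrow> \<bar>w' r\<bar> \<le> M2"
    using cont_image_bounded[OF w'_cont] by blast
  show ?thesis
    by (rule that[of m "max M1 M2"]) (use m M1 M2 in \<open>fastforce simp: abs_le_iff\<close>)+
qed

lemma delta_cont: "continuous_on A \<delta>"
  unfolding bdist_def[abs_def] by (intro continuous_intros)

lemma deltap_cont: "continuous_on {r0<..<R} (\<lambda>r. \<delta> r powr a)"
  by (intro continuous_on_powr delta_cont continuous_on_const) (use bdist_pos in force)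

lemma annular_mirror: "annular_ode r0 R \<mu> (\<lambda>r. w (r0 + R - r)) (\<lambda>r. - w' (r0 + R - r))"
proof
  show "((\<lambda>r. w (r0 + R - r)) has_real_derivative - w' (r0 + R - r)) (at r)" if "r0 \<le> r" "r \<le> R" for r
    by (rule DERIV_reflect) (use w_deriv that in auto)
  show "continuous_on {r0..R} (\<lambda>r. - w' (r0 + R - r))"
    by (intro continuous_intros continuous_on_compose2[OF w'_cont]) auto
  fix \<phi> d :: "real \<Rightarrow> real" and a b C
  assume ab: "r0 \<le> a" "a < b" "b \<le> R" and l: "lin_sol r0 R \<mu> (\<lambda>r. w (r0 + R - r)) a b \<phi> d"
    and bd: "\<And>r. a < r \<Longrightarrow> r < b \<Longrightarrow> 0 < \<phi> r \<and> \<phi> r \<le> C * \<delta> r powr bp"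
    and lim: "(\<phi> \<longlongrightarrow> 0) (at_right a)" "(\<phi> \<longlongrightarrow> 0) (at_left b)"
  show False
  proof (rule no_ground_state[of "r0 + R - b" "r0 + R - a"])
    show "lin_sol r0 R \<mu> w (r0 + R - b) (r0 + R - a) (\<lambda>r. \<phi> (r0 + R - r)) (\<lambda>r. - d (r0 + R - r))"
      using lin_sol_mirror[OF l] by simp
    show "((\<lambda>r. \<phi> (r0 + R - r)) \<longlongrightarrow> 0) (at_right (r0 + R - b))"
      using filterlim_compose[OF lim(2)] mirror_left[of "r0 + R" "r0 + R - b"] by simp
    show "((\<lambda>r. \<phi> (r0 + R - r)) \<longlongrightarrow> 0) (at_left (r0 + R - a))"
      using filterlim_compose[OF lim(1)] mirror_right[of "r0 + R" "r0 + R - a"] by simp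
    show "0 < \<phi> (r0 + R - r) \<and> \<phi> (r0 + R - r) \<le> C * \<delta> r powr bp"
      if "r0 + R - b < r" "r < r0 + R - a" for r
      using bd[of "r0 + R - r"] that by (auto simp: bdist_mirror)
  qed (use ab in auto)
qed (use r0R mu w_pos in auto)

text \<open>The power \<open>e\<close> solves the Euler equation without weight. In
  \<open>\<psi> = e * g\<close> the factor \<open>g\<close> absorbs the weight and the change of
  \<delta> beyond the midpoint; these are perturbations of lower order, so \<open>g\<close> solves a
  Volterra equation with \<open>g r0 = 1\<close>. The limit for \<open>d\<close> is what makes
  Wronskians with functions of higher order vanish at \<open>r0\<close>.\<close>

lemma principal_inner:
  obtains \<psi> d where "lin_sol r0 R \<mu> w r0 R \<psi> d" "continuous_on {r0..<R} \<psi>" "\<psi> r0 = 0"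
    "((\<lambda>r. \<psi> r / (r - r0) powr bp) \<longlongrightarrow> 1) (at_right r0)"
    "((\<lambda>r. (r - r0) powr bp * d r) \<longlongrightarrow> 0) (at_right r0)"
proof -
  define m where "m = (r0 + R) / 2"
  define e where "e r = (r - r0) powr bp" for r
  define e' where "e' r = bp * (r - r0) powr (bp - 1)" for r
  \<comment> \<open>The correction \<open>1 / \<delta>\<^sup>2 - 1 / (r - r0)\<^sup>2\<close>,
    written with \<open>max\<close> so that it is visibly continuous; it vanishes up to the
    midpoint.\<close>
  define q where "q r = 1 / (R - max r m)\<^sup>2 - 1 / (max r m - r0)\<^sup>2" for r
  define E where "E r = 1 / (w r * (e r)\<^sup>2)" for r
  \<comment> \<open>This is \<open>- e * ((w * e')' + w * \<mu> / \<delta>\<^sup>2 * e)\<close>: the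
    defect of \<open>e\<close> in the linear equation, multiplied by \<open>- e\<close>. Within the
    defect the terms of order \<open>bp - 2\<close> have cancelled by the indicial equation.\<close>
  define F where "F r = - (w' r * (bp * (r - r0) powr (2 * bp - 1)) + w r * \<mu> * (r - r0) powr (2 * bp) * q r)" for r
  have m: "r0 < m" "m < R" and mm: "R - m = m - r0" using r0R by (auto simp: m_def field_simps)
  have q: "1 / (\<delta> r)\<^sup>2 = 1 / (r - r0)\<^sup>2 + q r" if "r0 < r" "r < R" for r
  proof (cases "r \<le> m")
    case True
    then have "\<delta> r = r - r0" "max r m = m" by (auto simp: bdist_def m_def)
    then show ?thesis by (simp add: q_def mm)
  next
    case False
    then have "\<delta> r = R - r" "max r m = r" by (auto simp: bdist_def m_def)
    then show ?thesis by (simp add: q_def)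
  qed
  have q0: "q r = 0" if "r \<le> m" for r
  proof -
    have "max r m = m" using that by auto
    then show ?thesis by (simp add: q_def mm)
  qed
  have epos: "0 < e r" if "r0 < r" for r using that by (simp add: e_def)
  obtain mw M where wb: "0 < mw" "0 < M" "\<And>r. r0 \<le> r \<Longrightarrow> r \<le> R \<Longrightarrow> mw \<le> w r \<and> w r \<le> M \<and> \<bar>w' r\<bar> \<le> M"
    by (rule w_bounds) blast
  interpret volterra r0 R E F
  proof (rule volterraI_powr[OF r0R, where \<sigma> = "2 * bp - 1" and \<kappa> = "2 * bp" and ?C1.0 = "M * bp" and ?C2.0 = "1 / mw"])
    show "continuous_on {r0<..<R} E"
      unfolding E_def e_def
      by (intro continuous_intros continuous_on_subset[OF w_cont] continuous_on_powr)
        (use w_pos in \<open>auto simp: less_le\<close>)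
    show "0 < E r" if "r0 < r" "r < R" for r using w_pos[of r] epos[of r] that by (simp add: E_def)
    have "continuous_on {r0..<R} q"
      unfolding q_def by (intro continuous_intros) (use m in auto)
    then show "continuous_on {r0..<R} F"
      unfolding F_def
      by (intro continuous_intros continuous_on_subset[OF w_cont] continuous_on_subset[OF w'_cont] continuous_on_powr')
        (use bp_gt in auto)
    have near: "eventually (\<lambda>s. r0 < s \<and> s < m) (at_right r0)"
      unfolding eventually_at_right_field using m by (intro exI[of _ m]) auto
    show "\<forall>\<^sub>F s in at_right r0. \<bar>F s\<bar> \<le> M * bp * (s - r0) powr (2 * bp - 1)"
      using near
    proof eventually_elim
      case (elim s)
      then have "\<bar>F s\<bar> = \<bar>w' s\<bar> * (bp * (s - r0) powr (2 * bp - 1))"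
        using q0[of s] bp_gt by (simp add: F_def abs_mult)
      also have "\<dots> \<le> M * (bp * (s - r0) powr (2 * bp - 1))"
        using wb(3)[of s] elim m bp_gt by (intro mult_right_mono) auto
      finally show ?case by simp
    qed
    show "\<forall>\<^sub>F s in at_right r0. E s \<le> 1 / mw * (s - r0) powr - (2 * bp)"
      using near
    proof eventually_elim
      case (elim s)
      have "(e s)\<^sup>2 = (s - r0) powr (2 * bp)"
        using elim by (simp add: e_def power2_eq_square flip: powr_add)
      moreover have "mw \<le> w s" using wb(3)[of s] elim m by auto
      ultimately show ?case using elim wb(1)
        by (simp add: E_def powr_minus field_simps mult_right_mono)
    qed
  qed (use bp_gt wb in auto)
  obtain g where g: "continuous_on {r0..<R} g" "g r0 = 1" "\<And>r. r0 \<le> r \<Longrightarrow> r < R \<Longrightarrow> g r = 1 + T g r"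
    using linear_exists by auto
  define \<psi> where "\<psi> r = e r * g r" for r
  define d where "d r = e' r * g r + J g r / (w r * e r)" for r
  have lin: "lin_sol r0 R \<mu> w r0 R \<psi> d"
    unfolding lin_sol_def
  proof (intro allI impI)
    fix x assume x: "r0 < x \<and> x < R"
    have w0: "w x \<noteq> 0" using w_pos[of x] x by auto
    have de: "(e has_real_derivative e' x) (at x)"
      unfolding e_def e'_def using x by (auto intro!: derivative_eq_intros)
    have de': "(e' has_real_derivative - \<mu> * (x - r0) powr (bp - 2)) (at x)"
    proof -
      have "(e' has_real_derivative bp * ((bp - 1) * (x - r0) powr (bp - 2))) (at x)"
        unfolding e'_def using x by (auto intro!: derivative_eq_intros)
      then show ?thesis using bp_eq by (simp flip: mult.assoc)
    qed
    have dwe: "((\<lambda>r. w r * e' r) has_real_derivative w' x * e' x + - \<mu> * (x - r0) powr (bp - 2) * w x) (at x)"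
      using DERIV_mult[OF w_deriv de'] x by auto
    have dg: "(g has_real_derivative 1 / (w x * (e x)\<^sup>2) * J g x) (at x)"
    proof -
      have "((\<lambda>r. 1 + T g r) has_real_derivative 0 + E x * J g x) (at x)"
        using x by (intro DERIV_add DERIV_const T_deriv g) auto
      then have "((\<lambda>r. 1 + T g r) has_real_derivative 1 / (w x * (e x)\<^sup>2) * J g x) (at x)"
        by (simp add: E_def)
      then show ?thesis
        by (rule has_field_derivative_transform_within_open[where S="{r0<..<R}"]) (use x g(3) in auto)
    qed
    have dJ: "(J g has_real_derivative F x * g x) (at x)" using x by (intro J_deriv g) auto
    have ne: "w r \<noteq> 0" "e r \<noteq> 0" if "r0 < r" "r < R" for r
      using w_pos[of r] epos[of r] that by auto
    note pd = product_deriv[of r0 x R w e e' _ g "J g", OF _ _ ne de dwe dg dJ]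
    have "(w' x * e' x + - \<mu> * (x - r0) powr (bp - 2) * w x) * g x + F x * g x / e x
       = - (w x * \<mu> / (\<delta> x)\<^sup>2 * \<psi> x)"
    proof -
      define s where "s = x - r0"
      have s: "0 < s" using x by (simp add: s_def)
      have p: "s powr (2 * bp - 1) = e x * s powr (bp - 1)" "s powr (2 * bp) = e x * e x"
        "s powr (bp - 2) = e x * (1 / s\<^sup>2)"
        using s by (auto simp: e_def s_def powr_diff powr_add power2_eq_square simp flip: powr_add)
      have "F x / e x = - (w' x * e' x + w x * \<mu> * e x * q x)"
        using epos[of x] x unfolding F_def s_def[symmetric] p e'_def by (simp add: field_simps)
      then have "F x * g x / e x = - (w' x * e' x + w x * \<mu> * e x * q x) * g x"
        by (metis times_divide_eq_left)
      moreover have "w x * \<mu> / (\<delta> x)\<^sup>2 * \<psi> x = w x * \<mu> * e x * g x * (1 / (\<delta> x)\<^sup>2)"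
        by (simp add: \<psi>_def)
      ultimately show ?thesis
        unfolding q[of x, OF conjunct1[OF x] conjunct2[OF x]] s_def[symmetric] p by (simp add: algebra_simps)
    qed
    with pd x show "(\<psi> has_real_derivative d x) (at x) \<and>
        ((\<lambda>r. w r * d r) has_real_derivative - (w x * \<mu> / (\<delta> x)\<^sup>2 * \<psi> x)) (at x)"
      unfolding \<psi>_def[abs_def] d_def[abs_def] by simp
  qed
  have cont: "continuous_on {r0..<R} \<psi>"
    unfolding \<psi>_def e_def using bp_gt by (intro continuous_intros continuous_on_powr' g) auto
  have near: "eventually (\<lambda>s. r0 < s \<and> s < R) (at_right r0)"
    unfolding eventually_at_right_field using r0R by (intro exI[of _ R]) auto
  have gl: "(g \<longlongrightarrow> 1) (at_right r0)" using right_tendsto[OF g(1)] g(2) by simp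
  have l1: "((\<lambda>r. \<psi> r / (r - r0) powr bp) \<longlongrightarrow> 1) (at_right r0)"
    by (rule Lim_transform_eventually[OF gl eventually_mono[OF near]])
      (use epos in \<open>auto simp: \<psi>_def e_def\<close>)
  have Jl: "(J g \<longlongrightarrow> 0) (at_right r0)" using right_tendsto[OF J_cont[OF g(1)]] by simp
  have id0: "((\<lambda>r. r - r0) \<longlongrightarrow> 0) (at_right r0)" by (auto intro!: tendsto_eq_intros)
  have wl: "(w \<longlongrightarrow> w r0) (at_right r0)"
    using DERIV_isCont[OF w_deriv[of r0]] r0R by (auto simp: isCont_def intro: tendsto_within_subset)
  have "((\<lambda>r. bp * (r - r0) powr (2 * bp - 1) * g r + J g r / w r) \<longlongrightarrow> bp * 0 powr (2 * bp - 1) * 1 + 0 / w r0) (at_right r0)"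
    using bp_gt w_pos[of r0] r0R near
    by (intro tendsto_intros tendsto_powr' id0 gl Jl wl) (auto elim: eventually_mono)
  then have lim2: "((\<lambda>r. bp * (r - r0) powr (2 * bp - 1) * g r + J g r / w r) \<longlongrightarrow> 0) (at_right r0)"
    using bp_gt by simp
  have l2: "((\<lambda>r. (r - r0) powr bp * d r) \<longlongrightarrow> 0) (at_right r0)"
  proof (rule Lim_transform_eventually[OF lim2 eventually_mono[OF near]])
    fix s assume s: "r0 < s \<and> s < R"
    then have "(s - r0) powr (2 * bp - 1) = e s * (s - r0) powr (bp - 1)"
      by (simp add: e_def flip: powr_add)
    then show "bp * (s - r0) powr (2 * bp - 1) * g s + J g s / w s = (s - r0) powr bp * d s"
      using s epos[of s] w_pos[of s] by (simp add: d_def e'_def e_def[symmetric] field_simps)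
  qed
  show ?thesis by (rule that[OF lin cont _ l1 l2]) (simp add: \<psi>_def e_def)
qed

end

lemma one_less_two: "(1::real) < 2" by simp

lemma isCont_tendsto_within: "isCont f x \<Longrightarrow> (f \<longlongrightarrow> f x) (at x within S)"
  by (metis continuous_at_imp_continuous_at_within continuous_within)

lemma cont_on_tendsto:
  fixes f :: "real \<Rightarrow> real"
  assumes "continuous_on {a<..<b} f" "a < x" "x < b"
  shows "(f \<longlongrightarrow> f x) (at x within S)"
  using assms by (intro isCont_tendsto_within) (simp add: continuous_on_eq_continuous_at)

lemma tendsto_zero_of_quotient:
  fixes f e :: "real \<Rightarrow> real"
  assumes "((\<lambda>r. f r / e r) \<longlongrightarrow> l) F" "(e \<longlongrightarrow> 0) F" "eventually (\<lambda>r. e r \<noteq> 0) F"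
  shows "(f \<longlongrightarrow> 0) F"
proof -
  have "((\<lambda>r. f r / e r * e r) \<longlongrightarrow> l * 0) F" by (intro tendsto_mult assms)
  then have "((\<lambda>r. f r / e r * e r) \<longlongrightarrow> 0) F" by simp
  then show ?thesis
    by (rule Lim_transform_eventually[OF _ eventually_mono[OF assms(3)]]) simp
qed

section \<open>Positivity of the principal solutions and their behaviour at the opposite
  boundary\<close>

context annular_ode
begin

lemma lin_sol_cont: "lin_sol r0 R \<mu> w a b \<phi> d \<Longrightarrow> continuous_on {a<..<b} \<phi>"
  unfolding lin_sol_def by (auto intro!: continuous_at_imp_continuous_on intro: DERIV_isCont)

lemma powr_tendsto_0_right: "0 < a \<Longrightarrow> ((\<lambda>s. (s - r0) powr a) \<longlongrightarrow> 0) (at_right r0)"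
proof -
  assume a: "0 < a"
  have "((\<lambda>s. s - r0) \<longlongrightarrow> 0) (at_right r0)" by (auto intro!: tendsto_eq_intros)
  moreover have "\<forall>\<^sub>F s in at_right r0. 0 \<le> s - r0"
    using eventually_at_right_less[of r0] by eventually_elim simp
  ultimately show ?thesis using tendsto_powr'[of "\<lambda>s. s - r0" 0 "at_right r0" "\<lambda>_. a" a] a by simp
qed

lemma powr_tendsto_0_left: "0 < a \<Longrightarrow> ((\<lambda>s. (R - s) powr a) \<longlongrightarrow> 0) (at_left R)"
  using filterlim_compose[OF powr_tendsto_0_right[of a] mirror_right[of "r0 + R" R, simplified]] by simp

lemma near_right: "\<forall>\<^sub>F r in at_right r0. r0 < r \<and> r < R" "\<forall>\<^sub>F r in at_right r0. (r - r0) powr a \<noteq> 0"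
  using eventually_bdist_inner[OF r0R] by (auto elim: eventually_mono)

lemma near_left: "\<forall>\<^sub>F r in at_left R. r0 < r \<and> r < R" "\<forall>\<^sub>F r in at_left R. (R - r) powr a \<noteq> 0"
  using eventually_bdist_outer[OF r0R] by (auto elim: eventually_mono)

lemma bp_pos: "0 < bp" using bp_gt by simp

text \<open>At a first zero \<open>b\<close> the function \<psi> would be a positive solution
  between \<open>r0\<close> and \<open>b\<close> that vanishes at both ends and is of order
  \<open>bp\<close> at \<open>r0\<close>, against \<open>no_ground_state\<close>.\<close>

lemma principal_positive:
  assumes lin: "lin_sol r0 R \<mu> w r0 R \<psi> d"
    and l1: "((\<lambda>r. \<psi> r / (r - r0) powr bp) \<longlongrightarrow> 1) (at_right r0)"
    and r: "r0 < r" "r < R"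
  shows "0 < \<psi> r"
proof (rule ccontr)
  assume np: "\<not> 0 < \<psi> r"
  have cont: "continuous_on {r0<..<R} \<psi>" by (rule lin_sol_cont[OF lin])
  have ev: "eventually (\<lambda>s. 0 < \<psi> s \<and> \<psi> s \<le> 2 * \<delta> s powr bp) (at_right r0)"
    using order_tendstoD(1)[OF l1 zero_less_one] order_tendstoD(2)[OF l1 one_less_two] eventually_bdist_inner[OF r0R]
    by eventually_elim (auto simp: zero_less_divide_iff divide_simps split: if_splits)
  then obtain \<eta> where \<eta>: "r0 < \<eta>" "\<And>s. r0 < s \<Longrightarrow> s < \<eta> \<Longrightarrow> 0 < \<psi> s"
    unfolding eventually_at_right_field by auto
  define x0 where "x0 = min r ((r0 + \<eta>) / 2)"
  have x0: "r0 < x0" "x0 < \<eta>" "x0 \<le> r" using \<eta> r unfolding x0_def by (auto simp: min_def)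
  have c2: "continuous_on {x0..r} \<psi>" by (rule continuous_on_subset[OF cont]) (use x0 r in auto)
  \<comment> \<open>Left of \<open>x0\<close> the function \<psi> is positive by its normalisation,
    so its first zero is the infimum of a closed bounded set.\<close>
  define Z where "Z = {s \<in> {x0..r}. \<psi> s \<le> 0}"
  have "closed Z" unfolding Z_def
    by (rule continuous_on_closed_Collect_le[OF c2 continuous_on_const closed_atLeastAtMost])
  moreover have "bdd_below Z" "Z \<noteq> {}" using np x0 r by (auto simp: Z_def intro!: bdd_belowI[of _ x0])
  ultimately have bZ: "Inf Z \<in> Z" using closed_contains_Inf by blast
  define b where "b = Inf Z"
  have b: "x0 \<le> b" "b \<le> r" "\<psi> b \<le> 0" using bZ by (auto simp: b_def Z_def)
  have posb: "0 < \<psi> s" if s: "r0 < s" "s < b" for s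
  proof (rule ccontr)
    assume n: "\<not> 0 < \<psi> s"
    then have "x0 \<le> s" using \<eta>(2)[of s] s x0 by force
    then have "s \<in> Z" using n s b by (auto simp: Z_def)
    then have "b \<le> s" unfolding b_def using \<open>bdd_below Z\<close> by (rule cInf_lower)
    then show False using s by simp
  qed
  have bl: "(\<psi> \<longlongrightarrow> \<psi> b) (at_left b)"
    by (rule cont_on_tendsto[OF cont]) (use b x0 r in auto)
  have b0: "r0 < b" "b < R" using b x0 r by auto
  have "0 \<le> \<psi> b"
    by (rule tendsto_lowerbound[OF bl])
      (use posb b0 in \<open>auto simp: eventually_at_left_field less_imp_le intro!: exI[of _ r0]\<close>)
  then have bl: "(\<psi> \<longlongrightarrow> 0) (at_left b)" using bl b by auto
  have dl: "((\<lambda>s. \<delta> s powr bp) \<longlongrightarrow> \<delta> b powr bp) (at_left b)"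
    by (rule cont_on_tendsto[OF deltap_cont b0])
  \<comment> \<open>As \<open>b\<close> is an interior point, the comparison power stays away from 0
    there while \<psi> tends to 0.\<close>
  have evb: "eventually (\<lambda>s. \<psi> s \<le> 1 * \<delta> s powr bp) (at_left b)"
  proof -
    have "0 < \<delta> b powr bp" using bdist_pos[OF b0] by simp
    then have "eventually (\<lambda>s. \<delta> b powr bp / 2 < \<delta> s powr bp) (at_left b)"
      "eventually (\<lambda>s. \<psi> s < \<delta> b powr bp / 2) (at_left b)"
      by (intro order_tendstoD[OF dl] order_tendstoD[OF bl]; simp)+
    then show ?thesis by eventually_elim auto
  qed
  obtain C where C: "0 < C" "\<And>s. r0 < s \<Longrightarrow> s < b \<Longrightarrow> \<psi> s \<le> C * \<delta> s powr bp"
  proof (rule bound_from_ends[of r0 b \<psi> "\<lambda>s. \<delta> s powr bp" 2 1])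
    show "continuous_on {r0<..<b} \<psi>" "continuous_on {r0<..<b} (\<lambda>s. \<delta> s powr bp)"
      using b0 by (auto intro: continuous_on_subset[OF cont] continuous_on_subset[OF deltap_cont])
    show "0 < \<delta> s powr bp" if "r0 < s" "s < b" for s using bdist_pos[of r0 s R] that b0 by simp
    show "\<forall>\<^sub>F s in at_right r0. \<psi> s \<le> 2 * \<delta> s powr bp" using ev by eventually_elim auto
  qed (use b0 evb in auto)
  have "(\<psi> \<longlongrightarrow> 0) (at_right r0)"
    by (rule tendsto_zero_of_quotient[OF l1 powr_tendsto_0_right[OF bp_pos] near_right(2)])
  then show False
    using no_ground_state[of r0 b \<psi> d C] b0 posb C bl lin by (auto simp: lin_sol_def)
qed

lemma wronskian_const:
  assumes l: "lin_sol r0 R \<mu> w a b f df" "lin_sol r0 R \<mu> w a b g dg"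
  obtains c where "\<And>r. a < r \<Longrightarrow> r < b \<Longrightarrow> w r * df r * g r - f r * (w r * dg r) = c"
proof -
  define W where "W r = w r * df r * g r - f r * (w r * dg r)" for r
  have d: "(W has_real_derivative 0) (at x)" if "x \<in> {a<..<b}" for x
  proof -
    have x: "(f has_real_derivative df x) (at x)" "(g has_real_derivative dg x) (at x)"
      "((\<lambda>r. w r * df r) has_real_derivative - (w x * \<mu> / (\<delta> x)\<^sup>2 * f x)) (at x)"
      "((\<lambda>r. w r * dg r) has_real_derivative - (w x * \<mu> / (\<delta> x)\<^sup>2 * g x)) (at x)"
      using l that unfolding lin_sol_def by auto
    show ?thesis unfolding W_def
      by (rule DERIV_cong[OF DERIV_diff[OF DERIV_mult[OF x(3,2)] DERIV_mult[OF x(1,4)]]])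
        (simp add: algebra_simps)
  qed
  have const: "W x = W y" if "a < x" "x < b" "a < y" "y < b" for x y
    by (rule has_field_derivative_zero_constant[of "{a<..<b}" W, THEN exE])
      (use d that in \<open>auto simp: has_field_derivative_at_within\<close>)
  have "w r * df r * g r - f r * (w r * dg r) = W ((a + b) / 2)" if "a < r" "r < b" for r
    using const[of r "(a + b) / 2"] that by (simp add: W_def)
  then show ?thesis by (rule that)
qed

text \<open>Reduction of order: the derivative of \<open>\<psi> / \<xi>\<close> is
  \<open>c / (w * \<xi>\<^sup>2)\<close> with the constant Wronskian \<open>c\<close>. L'Hospital's
  rule gives the order \<open>- n\<close> of the quotient at \<open>R\<close>, and multiplying by
  \<xi> gives the exponent \<open>bp - n = bm\<close>.\<close>

lemma principal_outer_behaviour: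
  assumes psi: "lin_sol r0 R \<mu> w r0 R \<psi> d" "((\<lambda>r. \<psi> r / (r - r0) powr bp) \<longlongrightarrow> 1) (at_right r0)"
    and chi: "lin_sol r0 R \<mu> w r0 R \<xi> dc" "((\<lambda>r. \<xi> r / (R - r) powr bp) \<longlongrightarrow> 1) (at_left R)"
      "\<And>r. r0 < r \<Longrightarrow> r < R \<Longrightarrow> 0 < \<xi> r"
  shows "\<exists>k>0. ((\<lambda>r. \<psi> r / (R - r) powr bm) \<longlongrightarrow> k) (at_left R)"
proof -
  define n where "n = 2 * bp - 1"
  have n: "0 < n" using bp_gt by (simp add: n_def)
  have pos: "0 < \<psi> r" if "r0 < r" "r < R" for r by (rule principal_positive[OF psi that])
  obtain c where c: "\<And>r. r0 < r \<Longrightarrow> r < R \<Longrightarrow> w r * d r * \<xi> r - \<psi> r * (w r * dc r) = c"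
    using wronskian_const[OF psi(1) chi(1)] by blast
  define h where "h r = \<psi> r / \<xi> r" for r
  have dh: "(h has_real_derivative c / (w r * (\<xi> r)\<^sup>2)) (at r)" if r: "r0 < r" "r < R" for r
  proof -
    have "(\<psi> has_real_derivative d r) (at r)" "(\<xi> has_real_derivative dc r) (at r)"
      using psi(1) chi(1) r unfolding lin_sol_def by auto
    then have "(h has_real_derivative (d r * \<xi> r - \<psi> r * dc r) / (\<xi> r * \<xi> r)) (at r)"
      unfolding h_def using chi(3)[OF r] by (intro DERIV_divide) auto
    moreover have "(d r * \<xi> r - \<psi> r * dc r) / (\<xi> r * \<xi> r) = c / (w r * (\<xi> r)\<^sup>2)"
      using chi(3)[OF r] w_pos[of r] r c[OF r] by (simp add: field_simps power2_eq_square)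
    ultimately show ?thesis by simp
  qed
  have near: "eventually (\<lambda>r. r0 < r \<and> r < R) (at_left R)"
    using eventually_bdist_outer[OF r0R] by eventually_elim auto
  have wl: "(w \<longlongrightarrow> w R) (at_left R)"
    using r0R by (intro isCont_tendsto_within DERIV_isCont[OF w_deriv]) auto
  have wR: "0 < w R" using w_pos r0R by auto
  \<comment> \<open>If \<open>c = 0\<close>, then \<psi> is a multiple of \<xi> and therefore of
    order \<open>bp\<close> at both ends: a ground state on the whole interval.\<close>
  have "c \<noteq> 0"
  proof
    assume c0: "c = 0"
    have "h x = h y" if "r0 < x" "x < R" "r0 < y" "y < R" for x y
      by (rule has_field_derivative_zero_constant[of "{r0<..<R}" h, THEN exE])
        (use dh c0 that in \<open>auto simp: has_field_derivative_at_within\<close>)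
    then obtain k where k: "\<And>r. r0 < r \<Longrightarrow> r < R \<Longrightarrow> h r = k" by metis
    have kp: "\<psi> r = k * \<xi> r" if "r0 < r" "r < R" for r
      using k[OF that] chi(3)[OF that] by (simp add: h_def field_simps)
    have cont: "continuous_on {r0<..<R} \<psi>" by (rule lin_sol_cont[OF psi(1)])
    have k0: "0 < k" using k[of "(r0 + R) / 2"] pos[of "(r0 + R) / 2"] chi(3)[of "(r0 + R) / 2"] r0R
      by (auto simp: h_def zero_less_divide_iff)
    have ev1: "\<forall>\<^sub>F r in at_right r0. \<psi> r \<le> 2 * \<delta> r powr bp"
      using order_tendstoD(2)[OF psi(2) one_less_two] eventually_bdist_inner[OF r0R]
      by eventually_elim (auto simp: divide_simps split: if_splits)
    have ev2: "\<forall>\<^sub>F r in at_left R. \<psi> r \<le> (2 * k) * \<delta> r powr bp"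
      using order_tendstoD(2)[OF chi(2) one_less_two] eventually_bdist_outer[OF r0R] near
    proof eventually_elim
      case (elim r)
      then have "\<xi> r \<le> 2 * \<delta> r powr bp" by (auto simp: divide_simps split: if_splits)
      then show ?case using kp[of r] elim k0 by simp
    qed
    obtain C where C: "0 < C" "\<And>r. r0 < r \<Longrightarrow> r < R \<Longrightarrow> \<psi> r \<le> C * \<delta> r powr bp"
      using bound_from_ends[OF cont deltap_cont r0R _ ev1 ev2] bdist_pos by (metis powr_gt_zero less_irrefl)
    have z1: "(\<psi> \<longlongrightarrow> 0) (at_right r0)"
      by (rule tendsto_zero_of_quotient[OF psi(2) powr_tendsto_0_right[OF bp_pos] near_right(2)])
    have "(\<xi> \<longlongrightarrow> 0) (at_left R)"
      by (rule tendsto_zero_of_quotient[OF chi(2) powr_tendsto_0_left[OF bp_pos] near_left(2)])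
    then have "((\<lambda>r. k * \<xi> r) \<longlongrightarrow> k * 0) (at_left R)" by (intro tendsto_intros)
    then have "((\<lambda>r. k * \<xi> r) \<longlongrightarrow> 0) (at_left R)" by simp
    then have z2: "(\<psi> \<longlongrightarrow> 0) (at_left R)"
      by (rule Lim_transform_eventually[OF _ eventually_mono[OF near]]) (auto simp: kp)
    show False using no_ground_state[of r0 R \<psi> d C] r0R psi(1) pos C z1 z2 by auto
  qed
  define L where "L = c / (n * w R)"
  have "((\<lambda>r. h r / (R - r) powr (- n)) \<longlongrightarrow> L) (at_left R)"
  proof (rule lhopital_left_at_top[where f'="\<lambda>r. c / (w r * (\<xi> r)\<^sup>2)" and g'="\<lambda>r. n * (R - r) powr (- n - 1)"])
    show "LIM r at_left R. (R - r) powr - n :> at_top"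
    proof -
      have "LIM r at_left R. (R - r) powr n :> at_right 0"
        unfolding filterlim_at using powr_tendsto_0_left[OF n] near
        by (auto elim: eventually_mono)
      then have "LIM r at_left R. inverse ((R - r) powr n) :> at_top"
        by (rule filterlim_compose[OF filterlim_inverse_at_top_right])
      then show ?thesis by (simp add: powr_minus)
    qed
    show "\<forall>\<^sub>F r in at_left R. n * (R - r) powr (- n - 1) \<noteq> 0" using near n by (auto elim: eventually_mono)
    show "\<forall>\<^sub>F r in at_left R. (h has_real_derivative c / (w r * (\<xi> r)\<^sup>2)) (at r)"
      using near by eventually_elim (use dh in auto)
    show "\<forall>\<^sub>F r in at_left R. ((\<lambda>r. (R - r) powr - n) has_real_derivative n * (R - r) powr (- n - 1)) (at r)"
      using near by eventually_elim (auto intro!: derivative_eq_intros)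
    have "((\<lambda>r. c / (n * w r * (\<xi> r / (R - r) powr bp)\<^sup>2)) \<longlongrightarrow> c / (n * w R * 1\<^sup>2)) (at_left R)"
      using wR n by (intro tendsto_intros wl chi) auto
    then have l: "((\<lambda>r. c / (n * w r * (\<xi> r / (R - r) powr bp)\<^sup>2)) \<longlongrightarrow> L) (at_left R)" by (simp add: L_def)
    show "((\<lambda>r. c / (w r * (\<xi> r)\<^sup>2) / (n * (R - r) powr (- n - 1))) \<longlongrightarrow> L) (at_left R)"
    proof (rule Lim_transform_eventually[OF l eventually_mono[OF near]])
      fix r assume r: "r0 < r \<and> r < R"
      have "((R - r) powr bp)\<^sup>2 = (R - r) powr (2 * bp)" using r by (simp add: power2_eq_square flip: powr_add)
      moreover have "(R - r) powr (- n - 1) = 1 / (R - r) powr (2 * bp)"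
        using r by (simp add: n_def powr_minus powr_diff powr_add field_simps)
      ultimately show "c / (n * w r * (\<xi> r / (R - r) powr bp)\<^sup>2) = c / (w r * (\<xi> r)\<^sup>2) / (n * (R - r) powr (- n - 1))"
        using r by (simp add: power_divide ac_simps)
    qed
  qed
  from tendsto_mult[OF this chi(2)]
  have "((\<lambda>r. h r / (R - r) powr (- n) * (\<xi> r / (R - r) powr bp)) \<longlongrightarrow> L) (at_left R)" by simp
  then have lim: "((\<lambda>r. \<psi> r / (R - r) powr bm) \<longlongrightarrow> L) (at_left R)"
  proof (rule Lim_transform_eventually[OF _ eventually_mono[OF near]])
    fix r assume r: "r0 < r \<and> r < R"
    have "bm = - n + bp" using bpm by (simp add: n_def)
    then have "(R - r) powr (- n) * (R - r) powr bp = (R - r) powr bm" by (simp flip: powr_add)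
    then show "h r / (R - r) powr (- n) * (\<xi> r / (R - r) powr bp) = \<psi> r / (R - r) powr bm"
      using chi(3)[of r] r by (simp add: h_def)
  qed
  \<comment> \<open>The sign of \<open>L\<close> comes from the positivity of \<psi>, not from a
    computation of the sign of \<open>c\<close>.\<close>
  have "0 \<le> L"
    by (rule tendsto_lowerbound[OF lim]) (use near pos in \<open>auto elim!: eventually_mono simp: less_imp_le\<close>)
  moreover have "L \<noteq> 0" using \<open>c \<noteq> 0\<close> n wR by (simp add: L_def)
  ultimately show ?thesis using lim by (intro exI[of _ L]) auto
qed

text \<open>The solution \<xi> is the reflection of the inner principal solution for the reflected
  weight. Each of the two serves as the comparison function in the asymptotics of the other.\<close>

lemma principal_pair:
  obtains \<psi> d \<xi> dc k k' where
    "lin_sol r0 R \<mu> w r0 R \<psi> d" "continuous_on {r0..<R} \<psi>" "\<psi> r0 = 0"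
    "((\<lambda>r. \<psi> r / (r - r0) powr bp) \<longlongrightarrow> 1) (at_right r0)"
    "((\<lambda>r. (r - r0) powr bp * d r) \<longlongrightarrow> 0) (at_right r0)"
    "\<And>r. r0 < r \<Longrightarrow> r < R \<Longrightarrow> 0 < \<psi> r"
    "0 < k" "((\<lambda>r. \<psi> r / (R - r) powr bm) \<longlongrightarrow> k) (at_left R)"
    "lin_sol r0 R \<mu> w r0 R \<xi> dc" "((\<lambda>r. \<xi> r / (R - r) powr bp) \<longlongrightarrow> 1) (at_left R)"
    "\<And>r. r0 < r \<Longrightarrow> r < R \<Longrightarrow> 0 < \<xi> r"
    "0 < k'" "((\<lambda>r. \<xi> r / (r - r0) powr bm) \<longlongrightarrow> k') (at_right r0)"
proof -
  interpret m: annular_ode r0 R \<mu> "\<lambda>r. w (r0 + R - r)" "\<lambda>r. - w' (r0 + R - r)"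
    by (rule annular_mirror)
  obtain \<psi> d where p: "lin_sol r0 R \<mu> w r0 R \<psi> d" "continuous_on {r0..<R} \<psi>" "\<psi> r0 = 0"
    "((\<lambda>r. \<psi> r / (r - r0) powr bp) \<longlongrightarrow> 1) (at_right r0)"
    "((\<lambda>r. (r - r0) powr bp * d r) \<longlongrightarrow> 0) (at_right r0)"
    by (rule principal_inner)
  obtain c dc where c: "lin_sol r0 R \<mu> (\<lambda>r. w (r0 + R - r)) r0 R c dc"
    "((\<lambda>r. c r / (r - r0) powr bp) \<longlongrightarrow> 1) (at_right r0)"
    by (rule m.principal_inner)
  have pm: "lin_sol r0 R \<mu> (\<lambda>r. w (r0 + R - r)) r0 R (\<lambda>r. \<psi> (r0 + R - r)) (\<lambda>r. - d (r0 + R - r))"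
    using lin_sol_mirror[OF p(1)] by simp
  have cm: "lin_sol r0 R \<mu> w r0 R (\<lambda>r. c (r0 + R - r)) (\<lambda>r. - dc (r0 + R - r))"
    using lin_sol_mirror[OF c(1)] by simp
  have L: "filterlim (\<lambda>r. r0 + R - r) (at_right r0) (at_left R)" "filterlim (\<lambda>r. r0 + R - r) (at_left R) (at_right r0)"
    using mirror_right[of "r0 + R" R] mirror_left[of "r0 + R" r0] by auto
  have cm2: "((\<lambda>r. c (r0 + R - r) / (R - r) powr bp) \<longlongrightarrow> 1) (at_left R)"
    using filterlim_compose[OF c(2) L(1)] by simp
  have pm2: "((\<lambda>r. \<psi> (r0 + R - r) / (R - r) powr bp) \<longlongrightarrow> 1) (at_left R)"
    using filterlim_compose[OF p(4) L(1)] by simp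
  have ppos: "0 < \<psi> r" if "r0 < r" "r < R" for r by (rule principal_positive[OF p(1,4) that])
  have cpos: "0 < c r" if "r0 < r" "r < R" for r by (rule m.principal_positive[OF c that])
  obtain k where k: "0 < k" "((\<lambda>r. \<psi> r / (R - r) powr bm) \<longlongrightarrow> k) (at_left R)"
    using principal_outer_behaviour[OF p(1,4) cm cm2] cpos by auto
  obtain k' where k': "0 < k'" "((\<lambda>r. c r / (R - r) powr bm) \<longlongrightarrow> k') (at_left R)"
    using m.principal_outer_behaviour[OF c pm pm2] ppos by auto
  have "((\<lambda>r. c (r0 + R - r) / (r - r0) powr bm) \<longlongrightarrow> k') (at_right r0)"
    using filterlim_compose[OF k'(2) L(2)] by simp
  from that[OF p ppos k cm cm2 _ k'(1) this] cpos show ?thesis by auto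
qed

end

section \<open>The sublinear equation\<close>

definition ode_sol :: "real \<Rightarrow> real \<Rightarrow> real \<Rightarrow> real \<Rightarrow> (real \<Rightarrow> real) \<Rightarrow> real \<Rightarrow> real \<Rightarrow>
    (real \<Rightarrow> real) \<Rightarrow> (real \<Rightarrow> real) \<Rightarrow> bool" where
  "ode_sol r0 R \<mu> p w a b u d \<longleftrightarrow> (\<forall>r. a < r \<and> r < b \<longrightarrow> 0 \<le> u r \<and> (u has_real_derivative d r) (at r) \<and>
     ((\<lambda>r. w r * d r) has_real_derivative w r * (u r powr p - \<mu> / (bdist r0 R r)\<^sup>2 * u r)) (at r))"

lemma ode_sol_mirror:
  assumes "ode_sol r0 R \<mu> p w a b u d"
  shows "ode_sol r0 R \<mu> p (\<lambda>r. w (r0 + R - r)) (r0 + R - b) (r0 + R - a)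
    (\<lambda>r. u (r0 + R - r)) (\<lambda>r. - d (r0 + R - r))"
  unfolding ode_sol_def
proof (intro allI impI)
  fix r assume r: "r0 + R - b < r \<and> r < r0 + R - a"
  let ?s = "r0 + R - r"
  have r': "a < ?s" "?s < b" using r by auto
  have 1: "0 \<le> u ?s" "(u has_real_derivative d ?s) (at ?s)"
    "((\<lambda>r. w r * d r) has_real_derivative w ?s * (u ?s powr p - \<mu> / (bdist r0 R ?s)\<^sup>2 * u ?s)) (at ?s)"
    using assms r' unfolding ode_sol_def by blast+
  have "((\<lambda>r. - (w (r0 + R - r) * d (r0 + R - r))) has_real_derivative
      w ?s * (u ?s powr p - \<mu> / (bdist r0 R r)\<^sup>2 * u ?s)) (at r)"
    using DERIV_minus[OF DERIV_reflect[OF 1(3)]] by (simp add: bdist_mirror)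
  then show "0 \<le> u ?s \<and> ((\<lambda>r. u (r0 + R - r)) has_real_derivative - d ?s) (at r) \<and>
    ((\<lambda>r. w (r0 + R - r) * - d (r0 + R - r)) has_real_derivative
      w ?s * (u ?s powr p - \<mu> / (bdist r0 R r)\<^sup>2 * u ?s)) (at r)"
    using DERIV_reflect[OF 1(2)] 1(1) by simp
qed

lemma limit_le_of_deriv:
  fixes f f' :: "real \<Rightarrow> real"
  assumes lim: "(f \<longlongrightarrow> l) (at_right a)"
    and der: "\<And>z. a < z \<Longrightarrow> z \<le> x \<Longrightarrow> (f has_real_derivative f' z) (at z)"
    and nn: "\<And>z. a < z \<Longrightarrow> z \<le> x \<Longrightarrow> 0 \<le> f' z"
    and x: "a < x"
  shows "l \<le> f x"
proof (rule tendsto_upperbound[OF lim])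
  have "f y \<le> f x" if "a < y" "y < x" for y
    by (rule DERIV_nonneg_le[of y x f f']) (use that der nn x in auto)
  then show "eventually (\<lambda>y. f y \<le> f x) (at_right a)"
    using x(1) unfolding eventually_at_right_field by blast
qed simp

text \<open>L'Hospital's rule for the difference quotient: a derivative that extends continuously to
  \<open>c\<close> is the derivative at \<open>c\<close>. It glues solutions at an interior point
  and treats the flat point of the bump function.\<close>

lemma glue_deriv:
  fixes f g :: "real \<Rightarrow> real"
  assumes c: "a < c" "c < b" and d: "\<And>x. a < x \<Longrightarrow> x < b \<Longrightarrow> x \<noteq> c \<Longrightarrow> (f has_real_derivative g x) (at x)"
    and cont: "isCont f c" "isCont g c"
  shows "(f has_real_derivative g c) (at c)"
proof -
  have near: "eventually (\<lambda>x. a < x \<and> x < b \<and> x \<noteq> c) (at c)"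
  proof -
    have "eventually (\<lambda>x. x \<in> {a<..<b}) (at c)" by (rule eventually_at_in_open') (use c in auto)
    then show ?thesis unfolding eventually_at_filter by eventually_elim auto
  qed
  have "((\<lambda>x. (f x - f c) / (x - c)) \<longlongrightarrow> g c) (at c)"
  proof (rule lhopital[where f'=g and g'="\<lambda>_. 1"])
    show "((\<lambda>x. f x - f c) \<longlongrightarrow> 0) (at c)" using cont(1) by (simp add: isCont_def LIM_zero)
    show "((\<lambda>x. x - c) \<longlongrightarrow> 0) (at c)" by (simp add: LIM_zero)
    show "\<forall>\<^sub>F x in at c. ((\<lambda>x. f x - f c) has_real_derivative g x) (at x)"
      using near by eventually_elim (auto intro!: derivative_eq_intros d)
    show "\<forall>\<^sub>F x in at c. ((\<lambda>x. x - c) has_real_derivative 1) (at x)"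
      by (intro always_eventually allI) (auto intro!: derivative_eq_intros)
    show "((\<lambda>x. g x / 1) \<longlongrightarrow> g c) (at c)" using cont(2) by (simp add: isCont_def)
  qed (use near in \<open>auto elim: eventually_mono\<close>)
  then show ?thesis by (simp add: has_field_derivative_iff)
qed

lemma isCont_sides:
  fixes f :: "real \<Rightarrow> real"
  assumes "(f \<longlongrightarrow> f c) (at_left c)" "(f \<longlongrightarrow> f c) (at_right c)"
  shows "isCont f c"
  using assms by (simp add: isCont_def filterlim_at_split)

text \<open>Sub- and supersolutions are explicit only up to some \<open>x1\<close>; the iteration
  needs functions on the whole interval, so they are frozen from there on.\<close>

lemma continuous_extension_const:
  fixes z :: "real \<Rightarrow> real"
  assumes z: "continuous_on {a<..x1} z" "(z \<longlongrightarrow> l) (at_right a)" and x1: "a < x1"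
  shows "continuous_on {a..<b} (\<lambda>r. if r \<le> a then l else z (min r x1))"
proof -
  let ?h = "\<lambda>r. if r \<le> a then l else z (min r x1)"
  have "(?h \<longlongrightarrow> ?h r) (at r within {a..<b})" if r: "a \<le> r" "r < b" for r
  proof (cases "r = a")
    case True
    have "(?h \<longlongrightarrow> l) (at_right a)"
    proof (rule Lim_transform_eventually[OF z(2)])
      show "\<forall>\<^sub>F r in at_right a. z r = ?h r"
        unfolding eventually_at_right_field using x1 by (intro exI[of _ x1]) auto
    qed
    moreover have "at a within {a..<b} = at_right a"
      by (rule at_within_nhd[of _ "{..<b}"]) (use r True in auto)
    ultimately show ?thesis using True by simp
  next
    case False
    have "continuous_on {a<..} (\<lambda>r. z (min r x1))"
      by (rule continuous_on_compose2[OF z(1)]) (use x1 in \<open>auto intro!: continuous_intros\<close>)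
    then have "isCont (\<lambda>r. z (min r x1)) r" using False r by (simp add: continuous_on_eq_continuous_at)
    then have "((\<lambda>r. z (min r x1)) \<longlongrightarrow> z (min r x1)) (at r)" by (simp add: isCont_def)
    then have "(?h \<longlongrightarrow> z (min r x1)) (at r)"
      by (rule Lim_transform_within_open[where s="{a<..}"]) (use False r in auto)
    then have "(?h \<longlongrightarrow> z (min r x1)) (at r within {a..<b})" by (rule tendsto_within_subset) simp
    then show ?thesis using False r by simp
  qed
  then show ?thesis unfolding continuous_on_def atLeastLessThan_iff Ball_def by blast
qed

context volterra
begin

text \<open>Differential inequalities become an integral inequality by integrating twice from
  \<open>a\<close>, where value and flux vanish. The factor \<sigma> acts as a sign: 1 gives
  \<open>z \<le> T h\<close>, -1 the reverse.\<close>

lemma T_sub: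
  assumes h: "continuous_on {a..<b} h" and x1: "a < x1" "x1 < b"
    and z: "\<And>x. a < x \<Longrightarrow> x \<le> x1 \<Longrightarrow> (z has_real_derivative Z x) (at x)"
      "\<And>x. a < x \<Longrightarrow> x \<le> x1 \<Longrightarrow> (Jz has_real_derivative H x) (at x)"
      "\<And>x. a < x \<Longrightarrow> x \<le> x1 \<Longrightarrow> \<sigma> * H x \<le> \<sigma> * (F x * h x)"
      "\<And>x. a < x \<Longrightarrow> x \<le> x1 \<Longrightarrow> \<sigma> * Z x \<le> \<sigma> * (E x * Jz x)"
    and lim: "(z \<longlongrightarrow> 0) (at_right a)" "(Jz \<longlongrightarrow> 0) (at_right a)"
    and r: "a < r" "r \<le> x1"
  shows "\<sigma> * z r \<le> \<sigma> * T h r"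
proof -
  have J: "0 \<le> \<sigma> * J h x - \<sigma> * Jz x" if x: "a < x" "x \<le> x1" for x
  proof (rule limit_le_of_deriv[OF _ _ _ x(1), where f="\<lambda>x. \<sigma> * J h x - \<sigma> * Jz x"])
    have "((\<lambda>x. \<sigma> * J h x - \<sigma> * Jz x) \<longlongrightarrow> \<sigma> * 0 - \<sigma> * 0) (at_right a)"
      using right_tendsto[OF J_cont[OF h]] lim by (intro tendsto_intros) auto
    then show "((\<lambda>x. \<sigma> * J h x - \<sigma> * Jz x) \<longlongrightarrow> 0) (at_right a)" by simp
    fix y assume y: "a < y" "y \<le> x"
    then show "((\<lambda>x. \<sigma> * J h x - \<sigma> * Jz x) has_real_derivative \<sigma> * (F y * h y) - \<sigma> * H y) (at y)"
      using x x1 by (intro DERIV_diff DERIV_cmult J_deriv h z) auto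
    show "0 \<le> \<sigma> * (F y * h y) - \<sigma> * H y" using z(3)[of y] x y by auto
  qed
  have "0 \<le> \<sigma> * T h r - \<sigma> * z r"
  proof (rule limit_le_of_deriv[OF _ _ _ r(1), where f="\<lambda>x. \<sigma> * T h x - \<sigma> * z x"])
    have "((\<lambda>x. \<sigma> * T h x - \<sigma> * z x) \<longlongrightarrow> \<sigma> * 0 - \<sigma> * 0) (at_right a)"
      using right_tendsto[OF T_cont[OF h]] lim by (intro tendsto_intros) auto
    then show "((\<lambda>x. \<sigma> * T h x - \<sigma> * z x) \<longlongrightarrow> 0) (at_right a)" by simp
    fix y assume y: "a < y" "y \<le> r"
    then show "((\<lambda>x. \<sigma> * T h x - \<sigma> * z x) has_real_derivative \<sigma> * (E y * J h y) - \<sigma> * Z y) (at y)"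
      using r x1 by (intro DERIV_diff DERIV_cmult T_deriv h z) auto
    have "0 \<le> E y * (\<sigma> * J h y - \<sigma> * Jz y)"
      using posE[of y] J[of y] y r x1 by (intro mult_nonneg_nonneg) auto
    moreover have "\<sigma> * Z y \<le> \<sigma> * (E y * Jz y)" using z(4)[of y] y r by auto
    ultimately show "0 \<le> \<sigma> * (E y * J h y) - \<sigma> * Z y" by (simp add: algebra_simps)
  qed
  then show ?thesis by simp
qed

end

locale annular_pow = annular_ode +
  fixes p :: real
  assumes p: "0 < p" "p < 1"
begin

text \<open>The exponent at which \<open>s powr (\<alpha> - 2)\<close> and
  \<open>(s powr \<alpha>) powr p\<close> agree, so that \<open>u'' = u powr p\<close> is solved by
  a multiple of \<open>s powr \<alpha>\<close>.\<close>

definition \<alpha> :: real where "\<alpha> = 2 / (1 - p)"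
abbreviation "lin \<equiv> lin_sol r0 R \<mu> w"
abbreviation "sol \<equiv> ode_sol r0 R \<mu> p w"

definition kernel_E :: "(real \<Rightarrow> real) \<Rightarrow> real \<Rightarrow> real" where "kernel_E \<phi> r = 1 / (w r * (\<phi> r)\<^sup>2)"
definition kernel_F :: "(real \<Rightarrow> real) \<Rightarrow> real \<Rightarrow> real" where "kernel_F \<phi> r = w r * \<phi> r powr (1 + p)"

lemma alpha: "2 < \<alpha>" "\<alpha> * p = \<alpha> - 2" "\<alpha> * (1 - p) = 2"
  using p by (auto simp: \<alpha>_def field_simps)

lemma pow_mirror: "annular_pow r0 R \<mu> (\<lambda>r. w (r0 + R - r)) (\<lambda>r. - w' (r0 + R - r)) p"
  using annular_mirror p by (simp add: annular_pow_def annular_pow_axioms_def)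

text \<open>The flux \<open>w * \<phi>\<^sup>2 * v'\<close> of the quotient is the weighted
  Wronskian of \<open>u\<close> and \<phi>; in its derivative the two potential terms
  cancel.\<close>

lemma sol_quotient_derivs:
  assumes u: "sol a b u d" and l: "lin a b \<phi> d\<phi>" and pos: "0 < \<phi> r" and wr: "0 < w r" and r: "a < r" "r < b"
  shows "((\<lambda>r. u r / \<phi> r) has_real_derivative kernel_E \<phi> r * (w r * d r * \<phi> r - u r * (w r * d\<phi> r))) (at r)"
    and "((\<lambda>r. w r * d r * \<phi> r - u r * (w r * d\<phi> r)) has_real_derivative kernel_F \<phi> r * (u r / \<phi> r) powr p) (at r)"
proof -
  have x: "0 \<le> u r" "(u has_real_derivative d r) (at r)" "(\<phi> has_real_derivative d\<phi> r) (at r)"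
    "((\<lambda>r. w r * d r) has_real_derivative w r * (u r powr p - \<mu> / (\<delta> r)\<^sup>2 * u r)) (at r)"
    "((\<lambda>r. w r * d\<phi> r) has_real_derivative - (w r * \<mu> / (\<delta> r)\<^sup>2 * \<phi> r)) (at r)"
    using u l r unfolding ode_sol_def lin_sol_def by auto
  show "((\<lambda>r. u r / \<phi> r) has_real_derivative kernel_E \<phi> r * (w r * d r * \<phi> r - u r * (w r * d\<phi> r))) (at r)"
    by (rule DERIV_cong[OF DERIV_divide[OF x(2,3)]])
      (use pos wr in \<open>auto simp: kernel_E_def field_simps power2_eq_square\<close>)
  have F: "kernel_F \<phi> r * (u r / \<phi> r) powr p = w r * \<phi> r * u r powr p"
    using pos x(1) by (simp add: kernel_F_def powr_divide powr_add)
  show "((\<lambda>r. w r * d r * \<phi> r - u r * (w r * d\<phi> r)) has_real_derivative kernel_F \<phi> r * (u r / \<phi> r) powr p) (at r)"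
    unfolding F
    by (rule DERIV_cong[OF DERIV_diff[OF DERIV_mult[OF x(4,3)] DERIV_mult[OF x(2,5)]]])
      (simp add: algebra_simps)
qed

lemma sol_of_quotient:
  assumes l: "lin a b \<phi> d\<phi>" and pos: "\<And>r. a < r \<Longrightarrow> r < b \<Longrightarrow> 0 < \<phi> r" and ab: "r0 \<le> a" "b \<le> R"
    and v: "\<And>r. a < r \<Longrightarrow> r < b \<Longrightarrow> (v has_real_derivative kernel_E \<phi> r * J r) (at r)"
      "\<And>r. a < r \<Longrightarrow> r < b \<Longrightarrow> (J has_real_derivative kernel_F \<phi> r * v r powr p) (at r)"
      "\<And>r. a < r \<Longrightarrow> r < b \<Longrightarrow> 0 \<le> v r"
  shows "sol a b (\<lambda>r. \<phi> r * v r) (\<lambda>r. d\<phi> r * v r + J r / (w r * \<phi> r))"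
  unfolding ode_sol_def
proof (intro allI impI)
  fix x assume x: "a < x \<and> x < b"
  have wp: "w r \<noteq> 0" if "a < r" "r < b" for r using w_pos[of r] that ab by auto
  have fp: "\<phi> r \<noteq> 0" if "a < r" "r < b" for r using pos[of r] that ab by auto
  have ld: "(\<phi> has_real_derivative d\<phi> x) (at x)"
    "((\<lambda>r. w r * d\<phi> r) has_real_derivative - (w x * \<mu> / (\<delta> x)\<^sup>2 * \<phi> x)) (at x)"
    using l x unfolding lin_sol_def by auto
  have vd: "(v has_real_derivative 1 / (w x * (\<phi> x)\<^sup>2) * J x) (at x)" using v(1)[of x] x by (simp add: kernel_E_def)
  have Jd: "(J has_real_derivative kernel_F \<phi> x * v x powr p) (at x)" using v(2) x by auto
  note pd = product_deriv[of a x b w \<phi> d\<phi> _ v J, OF _ _ wp fp ld vd Jd]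
  have "kernel_F \<phi> x * v x powr p / \<phi> x = w x * (\<phi> x * v x) powr p"
    using pos[of x] v(3)[of x] x by (simp add: kernel_F_def powr_mult powr_add)
  then have "- (w x * \<mu> / (\<delta> x)\<^sup>2 * \<phi> x) * v x + kernel_F \<phi> x * v x powr p / \<phi> x
     = w x * ((\<phi> x * v x) powr p - \<mu> / (\<delta> x)\<^sup>2 * (\<phi> x * v x))"
    by (simp add: algebra_simps)
  then show "0 \<le> \<phi> x * v x \<and> ((\<lambda>r. \<phi> r * v r) has_real_derivative d\<phi> x * v x + J x / (w x * \<phi> x)) (at x) \<and>
      ((\<lambda>r. w r * (d\<phi> r * v r + J r / (w r * \<phi> r))) has_real_derivative
       w x * ((\<phi> x * v x) powr p - \<mu> / (\<delta> x)\<^sup>2 * (\<phi> x * v x))) (at x)"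
    using pd x pos[of x] v(3)[of x] by auto
qed

text \<open>Both \<open>u\<close> and \<open>w * d\<close> satisfy the hypotheses of
  \<open>glue_deriv\<close>, because the right-hand side of the equation is continuous at the
  interior point \<open>c\<close>.\<close>

lemma glue_sol:
  assumes c: "r0 < c" "c < R" and l: "sol r0 c u d" and r: "sol c R u d" and u: "0 \<le> u c"
    and cont: "isCont u c" "isCont d c"
  shows "sol r0 R u d"
proof -
  let ?g = "\<lambda>r. w r * (u r powr p - \<mu> / (\<delta> r)\<^sup>2 * u r)"
  have ne: "0 \<le> u x \<and> (u has_real_derivative d x) (at x) \<and> ((\<lambda>r. w r * d r) has_real_derivative ?g x) (at x)"
    if "r0 < x" "x < R" "x \<noteq> c" for x
    using l r that unfolding ode_sol_def by (cases "x < c") auto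
  have nn: "0 \<le> u x" if "r0 < x" "x < R" for x using ne[OF that] u by (cases "x = c") auto
  have wc: "isCont w c" using w_deriv[of c] c by (auto intro: DERIV_isCont)
  have near: "eventually (\<lambda>x. r0 < x \<and> x < R) (at c)"
    using eventually_at_in_open'[of "{r0<..<R}" c] c by (auto elim: eventually_mono)
  have pc: "isCont (\<lambda>r. u r powr p) c"
    unfolding isCont_def
    by (rule tendsto_powr') (use cont(1) p near nn in \<open>auto simp: isCont_def elim: eventually_mono\<close>)
  have "\<delta> c \<noteq> 0" using bdist_pos[OF c] by simp
  moreover have "isCont \<delta> c" using delta_cont[of UNIV] by (simp add: continuous_on_eq_continuous_at)
  ultimately have gc: "isCont ?g c" by (intro continuous_intros wc pc cont) auto
  have "(u has_real_derivative d c) (at c)"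
    by (rule glue_deriv[OF c _ cont]) (use ne in blast)
  moreover have "((\<lambda>r. w r * d r) has_real_derivative ?g c) (at c)"
    by (rule glue_deriv[OF c _ _ gc]) (use ne cont wc in \<open>auto intro: continuous_intros\<close>)
  ultimately show ?thesis unfolding ode_sol_def using ne u by metis
qed

end

section \<open>Kernel conditions for the quotients and behaviour at the outer boundary\<close>

lemma mono_left_limit:
  fixes v :: "real \<Rightarrow> real"
  assumes ab: "a < b" and mono: "\<And>x y. a \<le> x \<Longrightarrow> x \<le> y \<Longrightarrow> y < b \<Longrightarrow> v x \<le> v y"
    and bd: "\<And>x. a \<le> x \<Longrightarrow> x < b \<Longrightarrow> v x \<le> M"
  obtains L where "(v \<longlongrightarrow> L) (at_left b)" "v a \<le> L"
proof -
  define S where "S = v ` {a..<b}"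
  have S: "S \<noteq> {}" "bdd_above S" using ab bd by (auto simp: S_def intro!: bdd_aboveI[of _ M])
  have le: "v x \<le> Sup S" if "a \<le> x" "x < b" for x
    using that S by (intro cSup_upper) (auto simp: S_def)
  have "(v \<longlongrightarrow> Sup S) (at_left b)"
  proof (rule order_tendstoI)
    fix y assume "y < Sup S"
    then obtain x where x: "a \<le> x" "x < b" "y < v x" using less_cSup_iff[OF S] by (auto simp: S_def)
    then have "\<forall>z>x. z < b \<longrightarrow> y < v z" using mono[of x] by (meson less_imp_le less_le_trans)
    then show "\<forall>\<^sub>F x in at_left b. y < v x" unfolding eventually_at_left_field using x by blast
  next
    fix y assume "Sup S < y"
    then have "\<forall>z>a. z < b \<longrightarrow> v z < y" using le by (meson less_imp_le le_less_trans)
    then show "\<forall>\<^sub>F x in at_left b. v x < y" unfolding eventually_at_left_field using ab by blast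
  qed
  then show ?thesis using that le[of a] ab by auto
qed

text \<open>For \<open>t > 1\<close> also \<open>A \<le> A * t powr p\<close>; dividing by
  \<open>t powr p\<close> leaves a bound for \<open>t powr (1 - p)\<close>.\<close>

lemma sublinear_imp_bounded:
  fixes t A B p :: real
  assumes "0 < p" "p < 1" "0 \<le> A" "0 \<le> B" "0 \<le> t" "t \<le> A + B * t powr p"
  shows "t \<le> max 1 ((A + B) powr (1 / (1 - p)))"
proof (cases "t \<le> 1")
  case False
  then have tp: "1 \<le> t powr p" using assms by (intro ge_one_powr_ge_zero) auto
  have "t \<le> A * t powr p + B * t powr p"     using assms mult_left_mono[OF tp assms(3)] by simp
  then have "t powr (1 - p) * t powr p \<le> (A + B) * t powr p"
    using False by (simp add: algebra_simps flip: powr_add)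
  then have "t powr (1 - p) \<le> A + B"
    by (rule mult_right_le_imp_le) (use tp False in auto)
  then have "(t powr (1 - p)) powr (1 / (1 - p)) \<le> (A + B) powr (1 / (1 - p))"
    using assms by (intro powr_mono2) auto
  then show ?thesis using False assms by (simp add: powr_powr)
qed simp

context annular_pow
begin

lemma kernel_E_cont:
  assumes "continuous_on S \<phi>" "S \<subseteq> {r0..R}" "\<And>r. r \<in> S \<Longrightarrow> 0 < \<phi> r"
  shows "continuous_on S (kernel_E \<phi>)"
proof -
  have "w r * (\<phi> r)\<^sup>2 \<noteq> 0" if "r \<in> S" for r
    using assms(2) assms(3)[OF that] w_pos[of r] that by fastforce
  then show ?thesis unfolding kernel_E_def[abs_def]
    by (intro continuous_intros continuous_on_subset[OF w_cont assms(2)] assms(1)) auto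
qed

lemma kernel_F_cont:
  assumes "continuous_on S \<phi>" "S \<subseteq> {r0..R}" "\<And>r. r \<in> S \<Longrightarrow> 0 \<le> \<phi> r"
  shows "continuous_on S (kernel_F \<phi>)"
  unfolding kernel_F_def[abs_def] using p assms
  by (intro continuous_intros continuous_on_subset[OF w_cont assms(2)] continuous_on_powr') auto

lemma kernel_E_pos: "r0 < r \<Longrightarrow> r < R \<Longrightarrow> 0 < \<phi> r \<Longrightarrow> 0 < kernel_E \<phi> r"
  using w_pos[of r] by (simp add: kernel_E_def)

lemma kernel_F_nonneg: "r0 \<le> r \<Longrightarrow> r < R \<Longrightarrow> 0 \<le> kernel_F \<phi> r"
  using w_pos[of r] by (simp add: kernel_F_def)

text \<open>At an interior starting point both kernels are bounded, so the power conditions hold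
  with exponents 0.\<close>

lemma volterra_regular:
  assumes l: "lin r0 R \<phi> d\<phi>" and pos: "\<And>r. r0 < r \<Longrightarrow> r < R \<Longrightarrow> 0 < \<phi> r" and a: "r0 < a" "a < R"
  shows "volterra a R (kernel_E \<phi>) (kernel_F \<phi>)"
proof -
  have c: "continuous_on {a..<R} \<phi>" by (rule continuous_on_subset[OF lin_sol_cont[OF l]]) (use a in auto)
  have cE: "continuous_on {a..<R} (kernel_E \<phi>)" by (rule kernel_E_cont[OF c]) (use a pos in auto)
  have cF: "continuous_on {a..<R} (kernel_F \<phi>)"
    by (rule kernel_F_cont[OF c]) (use a pos in \<open>auto simp: less_imp_le\<close>)
  define b where "b = (a + R) / 2"
  have b: "a < b" "b < R" using a by (auto simp: b_def)
  obtain M1 where M1: "0 < M1" "\<And>t. a \<le> t \<Longrightarrow> t \<le> b \<Longrightarrow> \<bar>kernel_E \<phi> t\<bar> \<le> M1"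
    by (rule cont_image_bounded[OF continuous_on_subset[OF cE, of "{a..b}"]]) (use b in auto)
  obtain M2 where M2: "0 < M2" "\<And>t. a \<le> t \<Longrightarrow> t \<le> b \<Longrightarrow> \<bar>kernel_F \<phi> t\<bar> \<le> M2"
    by (rule cont_image_bounded[OF continuous_on_subset[OF cF, of "{a..b}"]]) (use b in auto)
  show ?thesis
  proof (rule volterraI_powr[OF a(2), where \<sigma> = 0 and \<kappa> = 0 and ?C1.0 = M2 and ?C2.0 = M1])
    show "continuous_on {a<..<R} (kernel_E \<phi>)" by (rule continuous_on_subset[OF cE]) auto
    show "0 < kernel_E \<phi> r" if "a < r" "r < R" for r using kernel_E_pos pos that a by auto
    show "\<forall>\<^sub>F s in at_right a. \<bar>kernel_F \<phi> s\<bar> \<le> M2 * (s - a) powr 0"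
      unfolding eventually_at_right_field using M2 b by (intro exI[of _ b]) auto
    show "\<forall>\<^sub>F s in at_right a. kernel_E \<phi> s \<le> M1 * (s - a) powr - 0"
      unfolding eventually_at_right_field using M1 b by (intro exI[of _ b]) (auto simp: abs_le_iff)
  qed (use cF M1 M2 in auto)
qed

lemma principal_near:
  assumes psi: "((\<lambda>r. \<psi> r / (r - r0) powr bp) \<longlongrightarrow> 1) (at_right r0)"
  shows "\<forall>\<^sub>F r in at_right r0. (r - r0) powr bp / 2 \<le> \<psi> r \<and> \<psi> r \<le> 2 * (r - r0) powr bp"
proof -
  have "(1/2::real) < 1" by simp
  from order_tendstoD(1)[OF psi this] order_tendstoD(2)[OF psi one_less_two] near_right(1)
  show ?thesis by eventually_elim (auto simp: field_simps)
qed

lemma powr_double: "0 < s \<Longrightarrow> (s powr x)\<^sup>2 = s powr (2 * x)" for s x :: real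
  by (simp add: power2_eq_square flip: powr_add)

lemma volterra_singular:
  assumes psi: "lin r0 R \<psi> d" "continuous_on {r0..<R} \<psi>" "\<psi> r0 = 0"
    "((\<lambda>r. \<psi> r / (r - r0) powr bp) \<longlongrightarrow> 1) (at_right r0)"
    "\<And>r. r0 < r \<Longrightarrow> r < R \<Longrightarrow> 0 < \<psi> r" and b: "bp < \<alpha>"
  shows "volterra r0 R (kernel_E \<psi>) (kernel_F \<psi>)"
proof -
  obtain mw M where wb: "0 < mw" "0 < M" "\<And>r. r0 \<le> r \<Longrightarrow> r \<le> R \<Longrightarrow> mw \<le> w r \<and> w r \<le> M \<and> \<bar>w' r\<bar> \<le> M"
    by (rule w_bounds) blast
  note near = eventually_conj[OF principal_near[OF psi(4)] near_right(1)]
  show ?thesis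
  proof (rule volterraI_powr[OF r0R, where \<sigma> = "bp * (1 + p)" and \<kappa> = "2 * bp" and ?C1.0 = "M * 2 powr (1 + p)" and ?C2.0 = "4 / mw"])
    show "continuous_on {r0<..<R} (kernel_E \<psi>)"
      by (rule kernel_E_cont[OF continuous_on_subset[OF psi(2)]]) (use psi(5) in auto)
    show "0 < kernel_E \<psi> r" if "r0 < r" "r < R" for r using kernel_E_pos psi(5) that by auto
    have "0 \<le> \<psi> r" if "r0 \<le> r" "r < R" for r
      using psi(3) psi(5)[of r] that by (cases "r = r0") auto
    then show "continuous_on {r0..<R} (kernel_F \<psi>)" by (intro kernel_F_cont psi) auto
    show "\<forall>\<^sub>F s in at_right r0. \<bar>kernel_F \<psi> s\<bar> \<le> M * 2 powr (1 + p) * (s - r0) powr (bp * (1 + p))"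
      using near
    proof eventually_elim
      case (elim s)
      have "\<psi> s powr (1 + p) \<le> (2 * (s - r0) powr bp) powr (1 + p)"
        using elim psi(5)[of s] p by (intro powr_mono2) auto
      also have "\<dots> = 2 powr (1 + p) * (s - r0) powr (bp * (1 + p))"
        by (simp add: powr_mult powr_powr)
      finally have "w s * \<psi> s powr (1 + p) \<le> M * (2 powr (1 + p) * (s - r0) powr (bp * (1 + p)))"
        using wb(2) wb(3)[of s] w_pos[of s] elim by (intro mult_mono) auto
      then show ?case using w_pos[of s] elim by (simp add: kernel_F_def abs_mult)
    qed
    show "\<forall>\<^sub>F s in at_right r0. kernel_E \<psi> s \<le> 4 / mw * (s - r0) powr - (2 * bp)"
      using near
    proof eventually_elim
      case (elim s)
      have "mw * ((s - r0) powr bp / 2)\<^sup>2 \<le> w s * (\<psi> s)\<^sup>2"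
        using wb(3)[of s] wb(1) elim by (intro mult_mono power_mono) auto
      then have "1 / (w s * (\<psi> s)\<^sup>2) \<le> 1 / (mw * ((s - r0) powr bp / 2)\<^sup>2)"
        using wb(1) elim by (intro divide_left_mono) (auto intro!: mult_pos_pos simp: w_pos psi(5))
      also have "\<dots> = 4 / mw * (s - r0) powr - (2 * bp)"
        using elim by (simp add: power_divide powr_double powr_minus field_simps)
      finally show ?case by (simp add: kernel_E_def)
    qed
    have "bp * (1 - p) < \<alpha> * (1 - p)" using b p by (intro mult_strict_right_mono) auto
    then show "2 * bp < bp * (1 + p) + 2" using alpha by (simp add: algebra_simps)
    show "0 \<le> bp * (1 + p)" using bp_gt p by simp
  qed (use wb in auto)
qed

text \<open>The quotient \<open>v\<close> is nondecreasing, so only an upper bound is missing. With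
  \<open>v powr p\<close> frozen at its value in \<open>r\<close>, two integrations of the power
  bounds for the kernels give \<open>v r \<le> A0 + B0 * v r powr p\<close> with constants
  independent of \<open>r\<close>, and p < 1 bounds \<open>v\<close>.\<close>

lemma outer_limit:
  assumes a: "r0 \<le> a" "a < R" and k: "0 < k" "((\<lambda>r. \<phi> r / (R - r) powr bm) \<longlongrightarrow> k) (at_left R)"
    and v: "\<And>r. a < r \<Longrightarrow> r < R \<Longrightarrow> (v has_real_derivative kernel_E \<phi> r * J r) (at r)"
      "\<And>r. a < r \<Longrightarrow> r < R \<Longrightarrow> (J has_real_derivative kernel_F \<phi> r * v r powr p) (at r)"
      "\<And>r. a < r \<Longrightarrow> r < R \<Longrightarrow> 0 < v r" "\<And>r. a < r \<Longrightarrow> r < R \<Longrightarrow> 0 \<le> J r"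
    and pos: "\<And>r. a < r \<Longrightarrow> r < R \<Longrightarrow> 0 < \<phi> r"
  shows "\<exists>L>0. ((\<lambda>r. \<phi> r * v r / (R - r) powr bm) \<longlongrightarrow> L) (at_left R)"
proof -
  obtain mw M where wb: "0 < mw" "0 < M" "\<And>r. r0 \<le> r \<Longrightarrow> r \<le> R \<Longrightarrow> mw \<le> w r \<and> w r \<le> M \<and> \<bar>w' r\<bar> \<le> M"
    by (rule w_bounds) blast
  define n where "n = 1 - 2 * bm"
  have n: "0 < n" and bmh: "bm < 1/2" using bp_gt bpm by (auto simp: n_def)
  \<comment> \<open>A loss exponent: at least \<open>- 1 - bm * (1 + p)\<close>, so that the flux is
    at most of order \<open>(R - s) powr (- m)\<close>; positive, so that constants are bounded by
    this power as well; and below \<open>n = 1 - 2 * bm\<close>, so that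
    \<open>(R - s) powr (- 2 * bm - m)\<close> is still integrable.\<close>
  define m where "m = (max 0 (- 1 - bm * (1 + p)) + n) / 2"
  have "- 1 - bm * (1 + p) < n"
  proof -
    have "bm * (1 - p) < 2"
    proof (cases "bm \<le> 0")
      case True
      then have "bm * (1 - p) \<le> 0" using p by (intro mult_nonpos_nonneg) auto
      then show ?thesis by simp
    next
      case False
      then have "bm * (1 - p) \<le> 1/2 * 1" using p bmh by (intro mult_mono) auto
      then show ?thesis by simp
    qed
    then show ?thesis by (simp add: n_def algebra_simps)
  qed
  then have m: "0 < m" "m < n" "- 1 - bm * (1 + p) \<le> m" using n by (auto simp: m_def max_def split: if_splits)
  have EEp: "0 < kernel_E \<phi> r" if "a < r" "r < R" for r using kernel_E_pos[of r \<phi>] pos[OF that] that a by auto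
  have mono: "v x \<le> v y" if "a < x" "x \<le> y" "y < R" for x y
    by (rule DERIV_nonneg_le[OF that(2) v(1)]) (use that v(4) EEp in \<open>auto intro!: mult_nonneg_nonneg simp: less_imp_le\<close>)
  have "k/2 < k" "k < 2 * k" using k by auto
  from order_tendstoD(1)[OF k(2) this(1)] order_tendstoD(2)[OF k(2) this(2)]
  have "\<forall>\<^sub>F r in at_left R. k/2 < \<phi> r / (R - r) powr bm \<and> \<phi> r / (R - r) powr bm < 2 * k"
    by (rule eventually_conj)
  then obtain y where y: "y < R" "\<And>r. y < r \<Longrightarrow> r < R \<Longrightarrow> k/2 < \<phi> r / (R - r) powr bm \<and> \<phi> r / (R - r) powr bm < 2 * k"
    unfolding eventually_at_left_field by blast
  \<comment> \<open>The entry \<open>R - 1\<close> makes all bases \<open>R - s\<close> at most 1,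
    so that lowering an exponent enlarges the power.\<close>
  define r1 where "r1 = max ((a + R) / 2) (max ((y + R) / 2) (R - 1))"
  have "(a + R) / 2 < R" "(y + R) / 2 < R" "R - 1 < R" using a y(1) by auto
  then have r1: "(a + R) / 2 \<le> r1" "(y + R) / 2 \<le> r1" "R - 1 \<le> r1" "r1 < R"
    unfolding r1_def max_less_iff_conj by (linarith | blast)+
  then have r1': "a < r1" "y < r1" using a y(1) by (auto simp: field_simps)
  have phi: "k/2 * (R - s) powr bm \<le> \<phi> s" "\<phi> s \<le> 2 * k * (R - s) powr bm" if "r1 \<le> s" "s < R" for s
    using y(2)[of s] that r1' by (auto simp: field_simps)
  define CF where "CF = M * (2 * k) powr (1 + p)"
  define CE where "CE = 4 / (mw * k\<^sup>2)"
  have C: "0 < CF" "0 < CE" using wb k by (auto simp: CF_def CE_def)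
  have Fb: "kernel_F \<phi> s \<le> CF * (R - s) powr (- m - 1)" if s: "r1 \<le> s" "s < R" for s
  proof -
    have "\<phi> s powr (1 + p) \<le> (2 * k * (R - s) powr bm) powr (1 + p)"
      using phi[OF s] pos[of s] r1' s p by (intro powr_mono2) auto
    also have "\<dots> = (2 * k) powr (1 + p) * (R - s) powr (bm * (1 + p))" using k by (simp add: powr_mult powr_powr)
    also have "(R - s) powr (bm * (1 + p)) \<le> (R - s) powr (- m - 1)"
      using s r1 m by (intro powr_mono') auto
    finally have "\<phi> s powr (1 + p) \<le> (2 * k) powr (1 + p) * (R - s) powr (- m - 1)" by (simp add: mult_left_mono)
    then have "w s * \<phi> s powr (1 + p) \<le> M * ((2 * k) powr (1 + p) * (R - s) powr (- m - 1))"
      using wb(2) wb(3)[of s] s r1' a by (intro mult_mono) auto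
    then show ?thesis by (simp add: kernel_F_def CF_def)
  qed
  have Eb: "kernel_E \<phi> s \<le> CE * (R - s) powr (- 2 * bm)" if s: "r1 \<le> s" "s < R" for s
  proof -
    have "mw * (k/2 * (R - s) powr bm)\<^sup>2 \<le> w s * (\<phi> s)\<^sup>2"
      using wb(1) wb(3)[of s] s r1' a phi[OF s] k by (intro mult_mono power_mono) auto
    then have "1 / (w s * (\<phi> s)\<^sup>2) \<le> 1 / (mw * (k/2 * (R - s) powr bm)\<^sup>2)"
      using wb(1) k s by (intro frac_le) auto
    also have "\<dots> = CE * (R - s) powr (- 2 * bm)"
      using s by (simp add: power_mult_distrib power_divide powr_double powr_minus field_simps CE_def)
    finally show ?thesis by (simp add: kernel_E_def)
  qed
  define \<sigma> where "\<sigma> = n - m"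
  have sig: "0 < \<sigma>" using m by (simp add: \<sigma>_def)
  define A0 where "A0 = v r1 + CE * J r1 / \<sigma>"
  define B0 where "B0 = CE * CF / (m * \<sigma>)"
  have J1: "0 \<le> J r1" "0 < v r1" using v r1 r1' by auto
  have AB: "0 \<le> A0" "0 \<le> B0" using J1 C sig m by (auto simp: A0_def B0_def)
  have bound: "v r \<le> A0 + B0 * v r powr p" if r: "r1 \<le> r" "r < R" for r
  proof -
    define V where "V = v r powr p"
    define A where "A = CE * (J r1 + V * CF / m)"
    have Jb: "J s \<le> (J r1 + V * CF / m) * (R - s) powr (- m)" if s: "r1 \<le> s" "s \<le> r" for s
    proof -
      have "V * CF / m * (R - r1) powr (- m) - J r1 \<le> V * CF / m * (R - s) powr (- m) - J s"
      proof (rule DERIV_nonneg_le[where f="\<lambda>s. V * CF / m * (R - s) powr (- m) - J s", OF s(1)])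
        fix z assume z: "r1 \<le> z" "z \<le> s"
        then show "((\<lambda>s. V * CF / m * (R - s) powr (- m) - J s) has_real_derivative
            V * CF * (R - z) powr (- m - 1) - kernel_F \<phi> z * v z powr p) (at z)"
          using s r r1' m by (auto intro!: derivative_eq_intros v(2))
        have "v z powr p \<le> V" unfolding V_def using mono[of z r] v(3)[of z] z s r r1' p by (intro powr_mono2) auto
        then have "kernel_F \<phi> z * v z powr p \<le> (CF * (R - z) powr (- m - 1)) * V"
          using Fb[of z] z s r C kernel_F_nonneg[of z \<phi>] r1' a by (intro mult_mono) auto
        then show "0 \<le> V * CF * (R - z) powr (- m - 1) - kernel_F \<phi> z * v z powr p" by (simp add: ac_simps)
      qed
      moreover have "0 \<le> V * CF / m * (R - r1) powr (- m)" using C m by (simp add: V_def)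
      ultimately have "J s \<le> J r1 + V * CF / m * (R - s) powr (- m)" by linarith
      also have "J r1 \<le> J r1 * (R - s) powr (- m)"
      proof -
        have "(R - s) powr 0 \<le> (R - s) powr (- m)" using s r r1 m by (intro powr_mono') auto
        then show ?thesis using s r J1 by (simp add: mult_le_cancel_left1)
      qed
      finally show ?thesis by (simp add: algebra_simps)
    qed
    have "- (A * (R - r1) powr \<sigma> / \<sigma>) - v r1 \<le> - (A * (R - r) powr \<sigma> / \<sigma>) - v r"
    proof (rule DERIV_nonneg_le[where f="\<lambda>s. - (A * (R - s) powr \<sigma> / \<sigma>) - v s", OF r(1)])
      fix z assume z: "r1 \<le> z" "z \<le> r"
      then show "((\<lambda>s. - (A * (R - s) powr \<sigma> / \<sigma>) - v s) has_real_derivative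
          A * (R - z) powr (\<sigma> - 1) - kernel_E \<phi> z * J z) (at z)"
        using r r1' sig by (auto intro!: derivative_eq_intros v(1))
      have "kernel_E \<phi> z * J z \<le> (CE * (R - z) powr (- 2 * bm)) * ((J r1 + V * CF / m) * (R - z) powr (- m))"
        using Eb[of z] Jb[OF z] z r r1' EEp[of z] v(4)[of z] C by (intro mult_mono) auto
      also have "\<dots> = A * ((R - z) powr (- 2 * bm) * (R - z) powr (- m))" by (simp add: A_def ac_simps)
      also have "(R - z) powr (- 2 * bm) * (R - z) powr (- m) = (R - z) powr (\<sigma> - 1)"
        by (simp add: \<sigma>_def n_def algebra_simps flip: powr_add)
      finally show "0 \<le> A * (R - z) powr (\<sigma> - 1) - kernel_E \<phi> z * J z" by simp
    qed
    moreover have "0 \<le> A" using C J1 m by (simp add: A_def V_def)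
    then have "0 \<le> A * (R - r) powr \<sigma> / \<sigma>" using sig by simp
    moreover have "A * (R - r1) powr \<sigma> / \<sigma> \<le> A * 1 / \<sigma>"
    proof -
      have "(R - r1) powr \<sigma> \<le> 1 powr \<sigma>" using r1 sig by (intro powr_mono2) auto
      then show ?thesis using sig \<open>0 \<le> A\<close> by (intro divide_right_mono mult_left_mono) auto
    qed
    ultimately have "v r \<le> v r1 + A / \<sigma>" by simp
    also have "\<dots> = A0 + B0 * V" using m by (simp add: A0_def B0_def A_def add_divide_distrib ring_distribs)
    finally show ?thesis by (simp add: V_def)
  qed
  define Mv where "Mv = max 1 ((A0 + B0) powr (1 / (1 - p)))"
  have vb: "v r \<le> Mv" if "r1 \<le> r" "r < R" for r
    unfolding Mv_def
    by (rule sublinear_imp_bounded[OF p AB _ bound[OF that]]) (use v(3)[of r] that r1' in auto)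
  obtain L where L: "(v \<longlongrightarrow> L) (at_left R)" "v r1 \<le> L"
    by (rule mono_left_limit[OF r1(4), of v Mv]) (use mono vb r1' in auto)
  have "0 < L" using L J1 by simp
  moreover have "((\<lambda>r. \<phi> r * v r / (R - r) powr bm) \<longlongrightarrow> k * L) (at_left R)"
    using tendsto_mult[OF k(2) L(1)] by simp
  ultimately show ?thesis using k by (intro exI[of _ "k * L"]) auto
qed

end

section \<open>Growth at a start with zero value and zero flux\<close>

lemma powr_half_square: "(x powr (y / 2))\<^sup>2 = x powr y" for x y :: real
  by (simp only: power2_eq_square powr_add[symmetric] field_sum_of_halves)

text \<open>By monotonicity \<open>v powr p\<close> is at most its value at \<open>r\<close>;
  integrating twice with it frozen gives
  \<open>v r \<le> M\<^sup>2 * (r - a)\<^sup>2 * v r powr p\<close>. In terms of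
  \<open>v powr (1 - p)\<close> this can be set directly against \<open>start_lower\<close>.\<close>

lemma start_upper:
  fixes E F v J :: "real \<Rightarrow> real"
  assumes p: "0 < p" "p < 1" and M: "0 < M"
    and EF: "\<And>r. a < r \<Longrightarrow> r < b \<Longrightarrow> 0 \<le> E r \<and> E r \<le> M" "\<And>r. a < r \<Longrightarrow> r < b \<Longrightarrow> 0 \<le> F r \<and> F r \<le> M"
    and v: "\<And>r. a < r \<Longrightarrow> r < b \<Longrightarrow> (v has_real_derivative E r * J r) (at r)"
      "\<And>r. a < r \<Longrightarrow> r < b \<Longrightarrow> (J has_real_derivative F r * v r powr p) (at r)"
      "\<And>r. a < r \<Longrightarrow> r < b \<Longrightarrow> 0 < v r"
    and lim: "(v \<longlongrightarrow> 0) (at_right a)" "(J \<longlongrightarrow> 0) (at_right a)"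
    and r: "a < r" "r < b"
  shows "v r powr (1 - p) \<le> M\<^sup>2 * (r - a)\<^sup>2"
proof -
  have J0: "0 \<le> J s" if "a < s" "s < b" for s
    by (rule limit_le_of_deriv[OF lim(2) v(2) _ that(1)]) (use that EF in auto)
  have mono: "v x \<le> v y" if "a < x" "x \<le> y" "y < b" for x y
    by (rule DERIV_nonneg_le[OF that(2) v(1)]) (use that J0 EF in \<open>auto intro!: mult_nonneg_nonneg\<close>)
  define V where "V = v r powr p"
  have V: "0 < V" using v(3)[OF r] by (simp add: V_def)
  have id0: "((\<lambda>s. c * (s - a)) \<longlongrightarrow> 0) (at_right a)" for c by (auto intro!: tendsto_eq_intros)
  have Jb: "J s \<le> M * V * (r - a)" if s: "a < s" "s \<le> r" for s
  proof -
    have "0 \<le> M * V * (s - a) - J s"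
    proof (rule limit_le_of_deriv[OF _ _ _ s(1), where f="\<lambda>s. M * V * (s - a) - J s"])
      show "((\<lambda>s. M * V * (s - a) - J s) \<longlongrightarrow> 0) (at_right a)"
        using tendsto_diff[OF id0 lim(2)] by simp
      fix z assume z: "a < z" "z \<le> s"
      then show "((\<lambda>s. M * V * (s - a) - J s) has_real_derivative M * V - F z * v z powr p) (at z)"
        using s r by (auto intro!: derivative_eq_intros v(2))
      have "v z powr p \<le> V" unfolding V_def using mono[of z r] v(3)[of z] z s r p by (intro powr_mono2) auto
      then have "F z * v z powr p \<le> M * V" using EF(2)[of z] z s r M by (intro mult_mono) auto
      then show "0 \<le> M * V - F z * v z powr p" by simp
    qed
    then have "J s \<le> M * V * (s - a)" by simp
    also have "\<dots> \<le> M * V * (r - a)" using s V M by (intro mult_left_mono) auto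
    finally show ?thesis .
  qed
  have "0 \<le> M * (M * V * (r - a)) * (r - a) - v r"
  proof (rule limit_le_of_deriv[OF _ _ _ r(1), where f="\<lambda>s. M * (M * V * (r - a)) * (s - a) - v s"])
    show "((\<lambda>s. M * (M * V * (r - a)) * (s - a) - v s) \<longlongrightarrow> 0) (at_right a)"
      using tendsto_diff[OF id0 lim(1)] by simp
    fix z assume z: "a < z" "z \<le> r"
    then show "((\<lambda>s. M * (M * V * (r - a)) * (s - a) - v s) has_real_derivative M * (M * V * (r - a)) - E z * J z) (at z)"
      using r by (auto intro!: derivative_eq_intros v(1))
    have "E z * J z \<le> M * (M * V * (r - a))" using EF(1)[of z] Jb[OF z] J0[of z] z r M by (intro mult_mono) auto
    then show "0 \<le> M * (M * V * (r - a)) - E z * J z" by simp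
  qed
  then have "v r powr (1 - p) * V \<le> (M\<^sup>2 * (r - a)\<^sup>2) * V"
    using v(3)[OF r] by (simp add: V_def power2_eq_square ac_simps flip: powr_add)
  then show ?thesis using V by (rule mult_right_le_imp_le)
qed

text \<open>Energy method: multiplying the flux equation by \<open>J\<close> shows that
  \<open>J\<^sup>2\<close> dominates a multiple of \<open>v powr (p + 1)\<close>. So
  \<open>v'\<close> dominates a multiple of \<open>v powr ((p + 1) / 2)\<close>, and the derivative
  of \<open>v powr ((1 - p) / 2)\<close> is bounded below.\<close>

lemma start_lower:
  fixes E F v J :: "real \<Rightarrow> real"
  assumes p: "0 < p" "p < 1" and m: "0 < m" "0 < M"
    and EF: "\<And>r. a < r \<Longrightarrow> r < b \<Longrightarrow> m \<le> E r \<and> E r \<le> M" "\<And>r. a < r \<Longrightarrow> r < b \<Longrightarrow> m \<le> F r"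
    and v: "\<And>r. a < r \<Longrightarrow> r < b \<Longrightarrow> (v has_real_derivative E r * J r) (at r)"
      "\<And>r. a < r \<Longrightarrow> r < b \<Longrightarrow> (J has_real_derivative F r * v r powr p) (at r)"
      "\<And>r. a < r \<Longrightarrow> r < b \<Longrightarrow> 0 < v r"
    and lim: "(v \<longlongrightarrow> 0) (at_right a)" "(J \<longlongrightarrow> 0) (at_right a)"
  shows "\<exists>q>0. \<forall>r. a < r \<and> r < b \<longrightarrow> q * (r - a)\<^sup>2 \<le> v r powr (1 - p)"
proof -
  have J0: "0 \<le> J s" if "a < s" "s < b" for s
  proof (rule limit_le_of_deriv[OF lim(2) v(2) _ that(1)])
    show "0 \<le> F z * v z powr p" if "a < z" "z \<le> s" for z
      using EF(2)[of z] m that \<open>s < b\<close> by auto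
  qed (use that in auto)
  \<comment> \<open>Chosen with \<open>\<kappa> * (p + 1) * M = 2 * m\<close>, so that the
    derivative of \<open>\<kappa> * v powr (p + 1)\<close> is at most that of
    \<open>J\<^sup>2\<close>.\<close>
  define \<kappa> where "\<kappa> = 2 * m / ((p + 1) * M)"
  have k: "0 < \<kappa>" using m p by (simp add: \<kappa>_def)
  \<comment> \<open>The resulting lower bound for the derivative of
    \<open>v powr ((1 - p) / 2)\<close>; the exponents \<open>(1 - p) / 2 - 1\<close> and
    \<open>(p + 1) / 2\<close> cancel.\<close>
  define q where "q = (1 - p) / 2 * (m * sqrt \<kappa>)"
  have q: "0 < q" using k p m by (simp add: q_def)
  have pl: "((\<lambda>s. v s powr x) \<longlongrightarrow> 0) (at_right a)" if ab: "a < b" and x: "0 < x" for x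
  proof -
    have "\<forall>\<^sub>F s in at_right a. 0 \<le> v s"
      unfolding eventually_at_right_field using ab v(3) by (intro exI[of _ b]) (auto simp: less_imp_le)
    then show ?thesis using tendsto_powr'[OF lim(1), of "\<lambda>_. x" x] x by simp
  qed
  have Jb: "sqrt \<kappa> * v r powr ((p + 1) / 2) \<le> J r" if r: "a < r" "r < b" for r
  proof -
    have "0 \<le> (J r)\<^sup>2 - \<kappa> * v r powr (p + 1)"
    proof (rule limit_le_of_deriv[OF _ _ _ r(1), where f="\<lambda>s. (J s)\<^sup>2 - \<kappa> * v s powr (p + 1)"])
      have "((\<lambda>s. (J s)\<^sup>2 - \<kappa> * v s powr (p + 1)) \<longlongrightarrow> 0\<^sup>2 - \<kappa> * 0) (at_right a)"
        using r p by (intro tendsto_intros lim pl) auto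
      then show "((\<lambda>s. (J s)\<^sup>2 - \<kappa> * v s powr (p + 1)) \<longlongrightarrow> 0) (at_right a)" by simp
      fix z assume z: "a < z" "z \<le> r"
      have vz: "0 < v z" using v(3) z r by auto
      show "((\<lambda>s. (J s)\<^sup>2 - \<kappa> * v s powr (p + 1)) has_real_derivative
          2 * J z * (F z * v z powr p) - \<kappa> * ((p + 1) * v z powr p * (E z * J z))) (at z)"
        using z r vz by (auto intro!: derivative_eq_intros v simp: algebra_simps)
      have "\<kappa> * (p + 1) * E z \<le> \<kappa> * (p + 1) * M" using k p EF(1)[of z] z r by (intro mult_left_mono) auto
      also have "\<dots> = 2 * m" using m p by (simp add: \<kappa>_def)
      also have "\<dots> \<le> 2 * F z" using EF(2)[of z] z r by auto
      finally have "0 \<le> (2 * F z - \<kappa> * (p + 1) * E z) * (J z * v z powr p)"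
        using J0[of z] z r by (intro mult_nonneg_nonneg) auto
      then show "0 \<le> 2 * J z * (F z * v z powr p) - \<kappa> * ((p + 1) * v z powr p * (E z * J z))"
        by (simp add: algebra_simps)
    qed
    moreover have "(sqrt \<kappa> * v r powr ((p + 1) / 2))\<^sup>2 = \<kappa> * v r powr (p + 1)"
      using k by (simp add: power_mult_distrib powr_half_square)
    ultimately have "(sqrt \<kappa> * v r powr ((p + 1) / 2))\<^sup>2 \<le> (J r)\<^sup>2" by simp
    then show ?thesis by (rule power2_le_imp_le) (rule J0[OF r])
  qed
  have "q * (r - a) \<le> v r powr ((1 - p) / 2)" if r: "a < r" "r < b" for r
  proof -
    have "0 \<le> v r powr ((1 - p) / 2) - q * (r - a)"
    proof (rule limit_le_of_deriv[OF _ _ _ r(1), where f="\<lambda>s. v s powr ((1 - p) / 2) - q * (s - a)"])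
      have "((\<lambda>s. v s powr ((1 - p) / 2) - q * (s - a)) \<longlongrightarrow> 0 - q * (a - a)) (at_right a)"
        using r p by (intro tendsto_intros lim pl) auto
      then show "((\<lambda>s. v s powr ((1 - p) / 2) - q * (s - a)) \<longlongrightarrow> 0) (at_right a)" by simp
      fix z assume z: "a < z" "z \<le> r"
      have vz: "0 < v z" using v(3) z r by auto
      show "((\<lambda>s. v s powr ((1 - p) / 2) - q * (s - a)) has_real_derivative
          (1 - p) / 2 * v z powr ((1 - p) / 2 - 1) * (E z * J z) - q) (at z)"
        using z r vz by (auto intro!: derivative_eq_intros v simp: algebra_simps)
      have "m * (sqrt \<kappa> * v z powr ((p + 1) / 2)) \<le> E z * J z"
        using EF(1)[of z] Jb[of z] z r m k by (intro mult_mono) auto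
      then have "v z powr ((1 - p) / 2 - 1) * (m * (sqrt \<kappa> * v z powr ((p + 1) / 2))) \<le> v z powr ((1 - p) / 2 - 1) * (E z * J z)"
        by (intro mult_left_mono) auto
      also have "v z powr ((1 - p) / 2 - 1) * (m * (sqrt \<kappa> * v z powr ((p + 1) / 2))) = m * sqrt \<kappa> * (v z powr ((1 - p) / 2 - 1) * v z powr ((p + 1) / 2))"
        by (simp add: ac_simps)
      also have "v z powr ((1 - p) / 2 - 1) * v z powr ((p + 1) / 2) = 1"
      proof -
        have "(1 - p) / 2 - 1 + (p + 1) / 2 = 0" by (simp add: field_simps)
        then show ?thesis using vz by (simp flip: powr_add)
      qed
      finally have "m * sqrt \<kappa> \<le> v z powr ((1 - p) / 2 - 1) * (E z * J z)" by simp
      then have "(1 - p) / 2 * (m * sqrt \<kappa>) \<le> (1 - p) / 2 * (v z powr ((1 - p) / 2 - 1) * (E z * J z))"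
        using p by (intro mult_left_mono) auto
      then show "0 \<le> (1 - p) / 2 * v z powr ((1 - p) / 2 - 1) * (E z * J z) - q"
        by (simp add: q_def mult.assoc)
    qed
    then show ?thesis by simp
  qed
  then have "q\<^sup>2 * (r - a)\<^sup>2 \<le> v r powr (1 - p)" if r: "a < r" "r < b" for r
  proof -
    have "(q * (r - a))\<^sup>2 \<le> (v r powr ((1 - p) / 2))\<^sup>2"
      using \<open>\<And>r. a < r \<Longrightarrow> r < b \<Longrightarrow> q * (r - a) \<le> v r powr ((1 - p) / 2)\<close>[OF r] q r by (intro power_mono) auto
    then show ?thesis by (simp add: power_mult_distrib powr_half_square)
  qed
  then show ?thesis using q by (intro exI[of _ "q\<^sup>2"]) auto
qed

context annular_pow
begin

lemma sol_cong:
  assumes "sol a b u d" "\<And>r. a < r \<Longrightarrow> r < b \<Longrightarrow> u r = u' r \<and> d r = d' r"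
  shows "sol a b u' d'"
  unfolding ode_sol_def
proof (intro allI impI)
  fix r assume r: "a < r \<and> r < b"
  then have x: "0 \<le> u r" "(u has_real_derivative d r) (at r)"
    "((\<lambda>r. w r * d r) has_real_derivative w r * (u r powr p - \<mu> / (\<delta> r)\<^sup>2 * u r)) (at r)"
    using assms(1) unfolding ode_sol_def by auto
  have "(u' has_real_derivative d r) (at r)"
    by (rule has_field_derivative_transform_within_open[OF x(2), where S="{a<..<b}"]) (use assms(2) r in auto)
  moreover have "((\<lambda>r. w r * d' r) has_real_derivative w r * (u r powr p - \<mu> / (\<delta> r)\<^sup>2 * u r)) (at r)"
    by (rule has_field_derivative_transform_within_open[OF x(3), where S="{a<..<b}"]) (use assms(2) r in auto)
  ultimately show "0 \<le> u' r \<and> (u' has_real_derivative d' r) (at r) \<and>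
      ((\<lambda>r. w r * d' r) has_real_derivative w r * (u' r powr p - \<mu> / (\<delta> r)\<^sup>2 * u' r)) (at r)"
    using x(1) assms(2)[of r] r by auto
qed

lemma lin_d_isCont:
  assumes "lin r0 R \<phi> d" "r0 < x" "x < R"
  shows "isCont d x"
proof -
  have "isCont (\<lambda>r. w r * d r) x" using assms unfolding lin_sol_def by (auto intro: DERIV_isCont)
  moreover have "isCont w x" using w_deriv[of x] assms by (auto intro: DERIV_isCont)
  ultimately have "isCont (\<lambda>r. w r * d r / w r) x"
    using w_pos[of x] assms by (intro continuous_divide) auto
  moreover have "\<forall>\<^sub>F r in nhds x. w r * d r / w r = d r"
  proof -
    have "\<forall>\<^sub>F r in nhds x. r \<in> {r0<..<R}" by (rule eventually_nhds_in_open) (use assms in auto)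
    then show ?thesis
    proof eventually_elim
      case (elim r)
      then have "w r \<noteq> 0" using w_pos[of r] by auto
      then show ?case by simp
    qed
  qed
  ultimately show ?thesis using isCont_cong[of "\<lambda>r. w r * d r / w r" d x] by simp
qed

text \<open>Common end of the existence proofs: the double integral is differentiated back, its flux
  is nonnegative, and \<open>outer_limit\<close> gives the behaviour at \<open>R\<close>.\<close>

lemma fixed_point_sol:
  assumes V: "volterra a R (kernel_E \<phi>) (kernel_F \<phi>)" and a: "r0 \<le> a" "a < R"
    and l: "lin a R \<phi> d\<phi>" and pos: "\<And>r. a < r \<Longrightarrow> r < R \<Longrightarrow> 0 < \<phi> r"
    and k: "0 < k" "((\<lambda>r. \<phi> r / (R - r) powr bm) \<longlongrightarrow> k) (at_left R)"
    and v: "continuous_on {a..<R} v"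
      "\<And>r. a \<le> r \<Longrightarrow> r < R \<Longrightarrow> v r = c + volterra.T a (kernel_E \<phi>) (kernel_F \<phi>) (\<lambda>t. v t powr p) r"
      "\<And>r. a \<le> r \<Longrightarrow> r < R \<Longrightarrow> 0 \<le> v r" "\<And>r. a < r \<Longrightarrow> r < R \<Longrightarrow> 0 < v r"
  obtains J where "sol a R (\<lambda>r. \<phi> r * v r) (\<lambda>r. d\<phi> r * v r + J r / (w r * \<phi> r))"
    "(v \<longlongrightarrow> c) (at_right a)" "(J \<longlongrightarrow> 0) (at_right a)"
    "\<exists>L>0. ((\<lambda>r. \<phi> r * v r / (R - r) powr bm) \<longlongrightarrow> L) (at_left R)"
proof -
  interpret V: volterra a R "kernel_E \<phi>" "kernel_F \<phi>" by (rule V)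
  define h where "h = (\<lambda>t. v t powr p)"
  have hc: "continuous_on {a..<R} h" unfolding h_def using v p by (intro V.powr_cont) auto
  have dJ: "(V.J h has_real_derivative kernel_F \<phi> r * v r powr p) (at r)" if "a < r" "r < R" for r
    using V.J_deriv[OF hc that] by (simp add: h_def)
  have dv: "(v has_real_derivative kernel_E \<phi> r * V.J h r) (at r)" if r: "a < r" "r < R" for r
  proof -
    have "((\<lambda>r. c + V.T h r) has_real_derivative 0 + kernel_E \<phi> r * V.J h r) (at r)"
      by (intro DERIV_add DERIV_const V.T_deriv hc r)
    then have "((\<lambda>r. c + V.T h r) has_real_derivative kernel_E \<phi> r * V.J h r) (at r)" by simp
    then show ?thesis
      by (rule has_field_derivative_transform_within_open[where S="{a<..<R}"]) (use r v(2) h_def in auto)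
  qed
  have Jl: "(V.J h \<longlongrightarrow> 0) (at_right a)" using V.right_tendsto[OF V.J_cont[OF hc]] by simp
  have vl: "(v \<longlongrightarrow> c) (at_right a)" using V.right_tendsto[OF v(1)] v(2)[of a] a by simp
  have J0: "0 \<le> V.J h r" if "a < r" "r < R" for r
    by (rule limit_le_of_deriv[OF Jl dJ _ that(1)]) (use that a kernel_F_nonneg in auto)
  have "sol a R (\<lambda>r. \<phi> r * v r) (\<lambda>r. d\<phi> r * v r + V.J h r / (w r * \<phi> r))"
    by (rule sol_of_quotient[OF l pos a(1) _ dv dJ]) (use v(3) in auto)
  moreover have "\<exists>L>0. ((\<lambda>r. \<phi> r * v r / (R - r) powr bm) \<longlongrightarrow> L) (at_left R)"
    by (rule outer_limit[OF a k dv dJ v(4) J0 pos])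
  ultimately show ?thesis using that vl Jl by blast
qed

lemma regular_limits:
  assumes l: "lin r0 R \<phi> d\<phi>" and pos: "0 < \<phi> a" and a: "r0 < a" "a < R"
    and lim: "(v \<longlongrightarrow> c) (at_right a)" "(J \<longlongrightarrow> 0) (at_right a)"
  shows "((\<lambda>r. \<phi> r * v r) \<longlongrightarrow> \<phi> a * c) (at_right a)"
    "((\<lambda>r. d\<phi> r * v r + J r / (w r * \<phi> r)) \<longlongrightarrow> d\<phi> a * c) (at_right a)"
proof -
  have 1: "(\<phi> \<longlongrightarrow> \<phi> a) (at_right a)" by (rule cont_on_tendsto[OF lin_sol_cont[OF l] a])
  have 2: "(d\<phi> \<longlongrightarrow> d\<phi> a) (at_right a)" by (rule isCont_tendsto_within[OF lin_d_isCont[OF l a]])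
  have 3: "(w \<longlongrightarrow> w a) (at_right a)"
    using a by (intro isCont_tendsto_within DERIV_isCont[OF w_deriv]) auto
  show "((\<lambda>r. \<phi> r * v r) \<longlongrightarrow> \<phi> a * c) (at_right a)" by (intro tendsto_intros 1 lim)
  have "((\<lambda>r. d\<phi> r * v r + J r / (w r * \<phi> r)) \<longlongrightarrow> d\<phi> a * c + 0 / (w a * \<phi> a)) (at_right a)"
    using pos w_pos[of a] a by (intro tendsto_intros 1 2 3 lim) auto
  then show "((\<lambda>r. d\<phi> r * v r + J r / (w r * \<phi> r)) \<longlongrightarrow> d\<phi> a * c) (at_right a)" by simp
qed

text \<open>Continuation by 0 requires zero value and zero slope at \<open>c\<close>, and with these
  data 0 is a fixed point. To escape from it the iteration starts from a multiple of
  \<open>(r - c) powr \<alpha>\<close>, the natural growth at the edge of a dead core.\<close>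

lemma dead_core_exists:
  assumes c: "r0 < c" "c < R"
  obtains u d where "sol r0 R u d" "\<And>r. r \<le> c \<Longrightarrow> u r = 0" "\<And>r. c < r \<Longrightarrow> r < R \<Longrightarrow> 0 < u r"
    "\<exists>L>0. ((\<lambda>r. u r / (R - r) powr bm) \<longlongrightarrow> L) (at_left R)"
proof -
  obtain \<psi> d k where psi: "lin r0 R \<psi> d" "\<And>r. r0 < r \<Longrightarrow> r < R \<Longrightarrow> 0 < \<psi> r"
    "0 < k" "((\<lambda>r. \<psi> r / (R - r) powr bm) \<longlongrightarrow> k) (at_left R)"
    by (rule principal_pair) blast
  have V: "volterra c R (kernel_E \<psi>) (kernel_F \<psi>)" by (rule volterra_regular[OF psi(1,2) c])
  interpret V: volterra c R "kernel_E \<psi>" "kernel_F \<psi>" by (rule V)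
  define x1 where "x1 = (c + R) / 2"
  have x1: "c < x1" "x1 < R" using c by (auto simp: x1_def)
  have pc: "continuous_on {c..x1} \<psi>" by (rule continuous_on_subset[OF lin_sol_cont[OF psi(1)]]) (use c x1 in auto)
  have "continuous_on {c..x1} (kernel_E \<psi>)" by (rule kernel_E_cont[OF pc]) (use c x1 psi in auto)
  then obtain m1 where m1: "0 < m1" "\<And>t. c \<le> t \<Longrightarrow> t \<le> x1 \<Longrightarrow> m1 \<le> kernel_E \<psi> t"
    by (rule cont_pos_lower) (use c x1 psi kernel_E_pos in auto)
  have "continuous_on {c..x1} (kernel_F \<psi>)" by (rule kernel_F_cont[OF pc]) (use c x1 psi in \<open>auto simp: less_imp_le\<close>)
  moreover have "0 < kernel_F \<psi> t" if "c \<le> t" "t \<le> x1" for t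
    using psi(2)[of t] w_pos[of t] that c x1 by (simp add: kernel_F_def)
  ultimately obtain m2 where m2: "0 < m2" "\<And>t. c \<le> t \<Longrightarrow> t \<le> x1 \<Longrightarrow> m2 \<le> kernel_F \<psi> t"
    by (rule cont_pos_lower) auto
  \<comment> \<open>Solves \<open>\<epsilon> * \<alpha> * (\<alpha> - 1) = m1 * m2 * \<epsilon> powr
    p\<close>; then \<open>z\<close> is an exact solution for the constant kernels \<open>m1\<close>
    and \<open>m2\<close>, hence a subsolution for the larger true ones.\<close>
  define \<epsilon> where "\<epsilon> = (m1 * m2 / (\<alpha> * (\<alpha> - 1))) powr (1 / (1 - p))"
  have a1: "0 < \<alpha> * (\<alpha> - 1)" using alpha by auto
  have eps: "0 < \<epsilon>" using m1 m2 alpha(1) by (simp add: \<epsilon>_def)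
  have eps2: "\<epsilon> * \<alpha> = m1 * m2 * \<epsilon> powr p / (\<alpha> - 1)"
  proof -
    have "\<epsilon> powr (1 - p) = m1 * m2 / (\<alpha> * (\<alpha> - 1))" using p m1 m2 a1 by (simp add: \<epsilon>_def powr_powr)
    moreover have "\<epsilon> = \<epsilon> powr (1 - p) * \<epsilon> powr p" using eps by (simp flip: powr_add)
    ultimately have "\<epsilon> = m1 * m2 / (\<alpha> * (\<alpha> - 1)) * \<epsilon> powr p" by simp
    then have "\<epsilon> * \<alpha> = m1 * m2 / (\<alpha> * (\<alpha> - 1)) * \<epsilon> powr p * \<alpha>" by simp
    also have "\<dots> = m1 * m2 * \<epsilon> powr p / (\<alpha> - 1)" using alpha(1) by simp
    finally show ?thesis .
  qed
  define z where "z r = \<epsilon> * (r - c) powr \<alpha>" for r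
  define Jz where "Jz r = m2 * \<epsilon> powr p / (\<alpha> - 1) * (r - c) powr (\<alpha> - 1)" for r
  define v0 where "v0 r = (if r \<le> c then 0 else z (min r x1))" for r
  have powl: "((\<lambda>r. (r - c) powr x) \<longlongrightarrow> 0) (at_right c)" if "0 < x" for x
  proof -
    have "((\<lambda>s. s - c) \<longlongrightarrow> 0) (at_right c)" by (auto intro!: tendsto_eq_intros)
    moreover have "\<forall>\<^sub>F s in at_right c. 0 \<le> s - c"
      using eventually_at_right_less[of c] by eventually_elim simp
    ultimately show ?thesis using tendsto_powr'[of "\<lambda>s. s - c" 0 "at_right c" "\<lambda>_. x" x] that by simp
  qed
  have zl: "(z \<longlongrightarrow> 0) (at_right c)"
    unfolding z_def by (intro tendsto_mult_right_zero powl) (use alpha in auto)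
  have Jzl: "(Jz \<longlongrightarrow> 0) (at_right c)"
    unfolding Jz_def by (intro tendsto_mult_right_zero powl) (use alpha in auto)
  have v0c: "continuous_on {c..<R} v0"
    unfolding v0_def
    by (rule continuous_extension_const[OF _ zl x1(1)]) (auto simp: z_def intro!: continuous_intros)
  have v0nn: "0 \<le> v0 r" for r using eps by (simp add: v0_def z_def)
  define h where "h = (\<lambda>t. v0 t powr p)"
  have hc: "continuous_on {c..<R} h" unfolding h_def using v0c v0nn p by (intro V.powr_cont) auto
  have sub1: "v0 r \<le> V.T h r" if r: "c < r" "r \<le> x1" for r
  proof -
    have "1 * z r \<le> 1 * V.T h r"
    proof (rule V.T_sub[OF hc x1 _ _ _ _ zl Jzl r])
      fix x assume x: "c < x" "x \<le> x1"
      show "(z has_real_derivative \<epsilon> * \<alpha> * (x - c) powr (\<alpha> - 1)) (at x)"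
        unfolding z_def using x by (auto intro!: derivative_eq_intros)
      show "(Jz has_real_derivative m2 * \<epsilon> powr p * (x - c) powr (\<alpha> - 2)) (at x)"
      proof -
        have "((\<lambda>r. (r - c) powr (\<alpha> - 1)) has_real_derivative (\<alpha> - 1) * (x - c) powr (\<alpha> - 2)) (at x)"
          using x by (auto intro!: derivative_eq_intros)
        from DERIV_cmult[OF this, of "m2 * \<epsilon> powr p / (\<alpha> - 1)"] show ?thesis
          unfolding Jz_def using alpha(1) by (simp add: mult.assoc)
      qed
      have "h x = \<epsilon> powr p * (x - c) powr (\<alpha> - 2)"
        using x eps alpha by (simp add: h_def v0_def z_def powr_mult powr_powr min_def)
      moreover have "m2 * (\<epsilon> powr p * (x - c) powr (\<alpha> - 2)) \<le> kernel_F \<psi> x * (\<epsilon> powr p * (x - c) powr (\<alpha> - 2))"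
        using m2(2)[of x] x by (intro mult_right_mono) auto
      ultimately show "1 * (m2 * \<epsilon> powr p * (x - c) powr (\<alpha> - 2)) \<le> 1 * (kernel_F \<psi> x * h x)" by (simp add: mult.assoc)
      have "m1 * Jz x \<le> kernel_E \<psi> x * Jz x"
        using m1(2)[of x] m2(1) alpha x by (intro mult_right_mono) (auto simp: Jz_def)
      then show "1 * (\<epsilon> * \<alpha> * (x - c) powr (\<alpha> - 1)) \<le> 1 * (kernel_E \<psi> x * Jz x)"
        unfolding eps2 by (simp add: Jz_def ac_simps)
    qed
    then show ?thesis using r by (simp add: v0_def min_def)
  qed
  have sub: "v0 r \<le> 0 + V.T (\<lambda>t. v0 t powr p) r" if r: "c \<le> r" "r < R" for r
  proof (cases "r \<le> x1")
    case True
    then show ?thesis using sub1[of r] r by (cases "r = c") (auto simp: v0_def h_def)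
  next
    case False
    then have "v0 r = v0 x1" using x1 by (simp add: v0_def)
    also have "\<dots> \<le> V.T h x1" by (rule sub1) (use x1 in auto)
    also have "\<dots> \<le> V.T h r"
      by (rule V.T_nonneg_mono[OF hc]) (use r x1 False kernel_F_nonneg c in \<open>auto simp: h_def\<close>)
    finally show ?thesis by (simp add: h_def)
  qed
  obtain v where v: "continuous_on {c..<R} v"
    "\<And>r. c \<le> r \<Longrightarrow> r < R \<Longrightarrow> v0 r \<le> v r" "\<And>r. c \<le> r \<Longrightarrow> r < R \<Longrightarrow> v r = 0 + V.T (\<lambda>t. v t powr p) r"
    by (rule V.sublinear_exists[OF _ p v0c v0nn sub]) (use kernel_F_nonneg c in auto)
  have vpos: "0 < v r" if "c < r" "r < R" for r
  proof -
    have "0 < v0 r" using that x1 eps by (simp add: v0_def z_def)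
    then show ?thesis using v(2)[of r] that by auto
  qed
  have vnn: "0 \<le> v r" if "c \<le> r" "r < R" for r using v(2)[OF that] v0nn[of r] by linarith
  have linc: "lin c R \<psi> d" using psi(1) c unfolding lin_sol_def by auto
  obtain J where J: "sol c R (\<lambda>r. \<psi> r * v r) (\<lambda>r. d r * v r + J r / (w r * \<psi> r))"
    "(v \<longlongrightarrow> 0) (at_right c)" "(J \<longlongrightarrow> 0) (at_right c)"
    "\<exists>L>0. ((\<lambda>r. \<psi> r * v r / (R - r) powr bm) \<longlongrightarrow> L) (at_left R)"
  proof (rule fixed_point_sol[OF V _ c(2) linc _ psi(3,4) v(1,3) vnn vpos])
    show "0 < \<psi> r" if "c < r" "r < R" for r using psi(2) that c by simp
  qed (use c in auto)
  define u where "u r = (if r \<le> c then 0 else \<psi> r * v r)" for r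
  define du where "du r = (if r \<le> c then 0 else d r * v r + J r / (w r * \<psi> r))" for r
  have s1: "sol r0 c u du"
  proof (rule sol_cong[of r0 c "\<lambda>_. 0" "\<lambda>_. 0"])
    show "sol r0 c (\<lambda>_. 0) (\<lambda>_. 0)" unfolding ode_sol_def using p by auto
  qed (auto simp: u_def du_def)
  have s2: "sol c R u du" by (rule sol_cong[OF J(1)]) (auto simp: u_def du_def)
  have ev: "\<forall>\<^sub>F r in at_right c. c < r" by (rule eventually_at_right_less)
  have evl: "\<forall>\<^sub>F r in at_left c. r < c" unfolding eventually_at_left_field using c by blast
  have lims: "((\<lambda>r. \<psi> r * v r) \<longlongrightarrow> 0) (at_right c)" "((\<lambda>r. d r * v r + J r / (w r * \<psi> r)) \<longlongrightarrow> 0) (at_right c)"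
    using regular_limits[OF psi(1) psi(2)[OF c] c J(2,3)] by simp_all
  have "isCont u c" "isCont du c"
  proof -
    have "(u \<longlongrightarrow> 0) (at_right c)"
      by (rule Lim_transform_eventually[OF lims(1) eventually_mono[OF ev]]) (auto simp: u_def)
    moreover have "(u \<longlongrightarrow> 0) (at_left c)"
      by (rule Lim_transform_eventually[OF tendsto_const eventually_mono[OF evl]]) (auto simp: u_def)
    ultimately show "isCont u c" by (intro isCont_sides) (auto simp: u_def)
    have "(du \<longlongrightarrow> 0) (at_right c)"
      by (rule Lim_transform_eventually[OF lims(2) eventually_mono[OF ev]]) (auto simp: du_def)
    moreover have "(du \<longlongrightarrow> 0) (at_left c)"
      by (rule Lim_transform_eventually[OF tendsto_const eventually_mono[OF evl]]) (auto simp: du_def)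
    ultimately show "isCont du c" by (intro isCont_sides) (auto simp: du_def)
  qed
  then have "sol r0 R u du" by (intro glue_sol[OF c s1 s2]) (auto simp: u_def)
  moreover have "\<exists>L>0. ((\<lambda>r. u r / (R - r) powr bm) \<longlongrightarrow> L) (at_left R)"
  proof -
    obtain L where L: "0 < L" "((\<lambda>r. \<psi> r * v r / (R - r) powr bm) \<longlongrightarrow> L) (at_left R)" using J(4) by auto
    have "\<forall>\<^sub>F r in at_left R. c < r" unfolding eventually_at_left_field using c by blast
    then have "((\<lambda>r. u r / (R - r) powr bm) \<longlongrightarrow> L) (at_left R)"
      by (intro Lim_transform_eventually[OF L(2)]) (auto simp: u_def elim!: eventually_mono)
    then show ?thesis using L by blast
  qed
  moreover have "0 < u r" if "c < r" "r < R" for r using that vpos psi(2) c by (simp add: u_def)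
  ultimately show ?thesis by (intro that[of u du]) (auto simp: u_def)
qed

end

section \<open>Uniqueness from a dead core and from prescribed growth at the boundary\<close>

context annular_pow
begin

lemma compare_via:
  assumes s: "sol a R u1 d1" "sol a R u2 d2" and a: "r0 \<le> a" "a < R"
    and l: "lin a R \<phi> d\<phi>" and pos: "\<And>r. a < r \<Longrightarrow> r < R \<Longrightarrow> 0 < \<phi> r"
      "\<And>r. a < r \<Longrightarrow> r < R \<Longrightarrow> 0 < u1 r" "\<And>r. a < r \<Longrightarrow> r < R \<Longrightarrow> 0 < u2 r"
    and c: "0 \<le> c" "((\<lambda>r. u1 r / \<phi> r) \<longlongrightarrow> c) (at_right a)" "((\<lambda>r. u2 r / \<phi> r) \<longlongrightarrow> c) (at_right a)"
    and J: "((\<lambda>r. w r * d1 r * \<phi> r - u1 r * (w r * d\<phi> r)) \<longlongrightarrow> 0) (at_right a)"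
      "((\<lambda>r. w r * d2 r * \<phi> r - u2 r * (w r * d\<phi> r)) \<longlongrightarrow> 0) (at_right a)"
    and ev: "\<forall>\<^sub>F r in at_right a. u1 r \<le> C * u2 r" and r: "a < r" "r < R"
  shows "u1 r \<le> u2 r"
proof -
  have wp: "0 < w r" if "a < r" "r < R" for r using w_pos[of r] that a by auto
  have near: "\<forall>\<^sub>F r in at_right a. a < r \<and> r < R"
    unfolding eventually_at_right_field using a by (intro exI[of _ R]) auto
  have "u1 r / \<phi> r \<le> u2 r / \<phi> r"
  proof (rule sublinear_compare[where E="kernel_E \<phi>" and F="kernel_F \<phi>" and a=a and b=R and C=C,
        OF p c(1) _ _ _ _ _ _ _ _ c(2,3) J _ r])
    show "\<forall>\<^sub>F r in at_right a. u1 r / \<phi> r \<le> C * (u2 r / \<phi> r)"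
      using ev near
    proof eventually_elim
      case (elim r)
      then show ?case using pos(1)[of r] by (simp add: divide_right_mono)
    qed
    show "0 \<le> kernel_E \<phi> r" "0 \<le> kernel_F \<phi> r" if "a < r" "r < R" for r
      using kernel_E_pos[of r \<phi>] kernel_F_nonneg[of r \<phi>] pos(1)[of r] that a by auto
    show "0 < u1 r / \<phi> r" "0 < u2 r / \<phi> r" if "a < r" "r < R" for r using pos that by auto
  qed (use sol_quotient_derivs[OF s(1) l] sol_quotient_derivs[OF s(2) l] pos(1) wp in auto)
  then show ?thesis using pos(1)[OF r] by (simp add: divide_le_cancel)
qed

text \<open>A zero of a nonnegative solution is a minimum. This yields the second initial condition
  at the edge of a dead core, which the definition does not prescribe.\<close>

lemma deriv_zero_at_min:
  assumes "sol r0 R u d" "r0 < c" "c < R" "u c = 0"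
  shows "d c = 0"
proof (rule DERIV_local_min)
  show "(u has_real_derivative d c) (at c)" using assms unfolding ode_sol_def by auto
  show "0 < min (c - r0) (R - c)" using assms by simp
  have "0 \<le> u y" if "r0 < y" "y < R" for y using assms(1) that unfolding ode_sol_def by blast
  then show "\<forall>y. \<bar>c - y\<bar> < min (c - r0) (R - c) \<longrightarrow> u c \<le> u y"
    using assms(4) by (simp add: abs_less_iff)
qed

text \<open>Both quotients have zero value and zero flux at \<open>c\<close>.
  \<open>start_upper\<close> for the first and \<open>start_lower\<close> for the second bound their
  ratio, which is the a priori bound that the comparison starts from.\<close>

lemma dead_core_unique_le:
  assumes c: "r0 < c" "c < R" and s: "sol r0 R u1 d1" "sol r0 R u2 d2"
    and z: "u1 c = 0" "u2 c = 0"
    and pos: "\<And>r. c < r \<Longrightarrow> r < R \<Longrightarrow> 0 < u1 r" "\<And>r. c < r \<Longrightarrow> r < R \<Longrightarrow> 0 < u2 r"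
    and r: "c < r" "r < R"
  shows "u1 r \<le> u2 r"
proof -
  obtain \<psi> d k where psi: "lin r0 R \<psi> d" "\<And>r. r0 < r \<Longrightarrow> r < R \<Longrightarrow> 0 < \<psi> r"
    by (rule principal_pair) blast
  have lc: "lin c R \<psi> d" using psi(1) c unfolding lin_sol_def by auto
  define v where "v u r = u r / \<psi> r" for u :: "real \<Rightarrow> real" and r
  define J where "J u du r = w r * du r * \<psi> r - u r * (w r * d r)" for u du :: "real \<Rightarrow> real" and r
  have lim: "(v u \<longlongrightarrow> 0) (at_right c)" "(J u du \<longlongrightarrow> 0) (at_right c)"
    if "sol r0 R u du" "u c = 0" for u du
  proof -
    have wc: "0 < w c" using w_pos[of c] c by auto
    note vj = sol_quotient_derivs[OF that(1) psi(1) psi(2)[OF c] wc c]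
    show "(v u \<longlongrightarrow> 0) (at_right c)"
      using isCont_tendsto_within[OF DERIV_isCont[OF vj(1)]] that(2) by (simp add: v_def[abs_def])
    show "(J u du \<longlongrightarrow> 0) (at_right c)"
      using isCont_tendsto_within[OF DERIV_isCont[OF vj(2)]] that(2) deriv_zero_at_min[OF that(1) c that(2)]
      by (simp add: J_def[abs_def])
  qed
  define x1 where "x1 = (c + R) / 2"
  have x1: "c < x1" "x1 < R" using c by (auto simp: x1_def)
  have pc: "continuous_on {c..x1} \<psi>" by (rule continuous_on_subset[OF lin_sol_cont[OF psi(1)]]) (use c x1 in auto)
  have Ec: "continuous_on {c..x1} (kernel_E \<psi>)" by (rule kernel_E_cont[OF pc]) (use c x1 psi in auto)
  then obtain m1 where m1: "0 < m1" "\<And>t. c \<le> t \<Longrightarrow> t \<le> x1 \<Longrightarrow> m1 \<le> kernel_E \<psi> t"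
    by (rule cont_pos_lower) (use c x1 psi kernel_E_pos in auto)
  have Fc: "continuous_on {c..x1} (kernel_F \<psi>)" by (rule kernel_F_cont[OF pc]) (use c x1 psi in \<open>auto simp: less_imp_le\<close>)
  moreover have "0 < kernel_F \<psi> t" if "c \<le> t" "t \<le> x1" for t
    using psi(2)[of t] w_pos[of t] that c x1 by (simp add: kernel_F_def)
  ultimately obtain m2 where m2: "0 < m2" "\<And>t. c \<le> t \<Longrightarrow> t \<le> x1 \<Longrightarrow> m2 \<le> kernel_F \<psi> t"
    by (rule cont_pos_lower) auto
  obtain M1 where M1: "0 < M1" "\<And>t. c \<le> t \<Longrightarrow> t \<le> x1 \<Longrightarrow> \<bar>kernel_E \<psi> t\<bar> \<le> M1"
    by (rule cont_image_bounded[OF Ec]) blast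
  obtain M2 where M2: "0 < M2" "\<And>t. c \<le> t \<Longrightarrow> t \<le> x1 \<Longrightarrow> \<bar>kernel_F \<psi> t\<bar> \<le> M2"
    by (rule cont_image_bounded[OF Fc]) blast
  define m where "m = min m1 m2"
  define M where "M = max M1 M2"
  have b: "m \<le> kernel_E \<psi> t" "kernel_E \<psi> t \<le> M" "m \<le> kernel_F \<psi> t" "kernel_F \<psi> t \<le> M" if "c < t" "t < x1" for t
    using m1(2)[of t] m2(2)[of t] M1(2)[of t] M2(2)[of t] that by (auto simp: m_def M_def)
  have mM: "0 < m" "0 < M" using m1 m2 M1 by (auto simp: m_def M_def)
  have vj: "(v u has_real_derivative kernel_E \<psi> t * J u du t) (at t)"
      "(J u du has_real_derivative kernel_F \<psi> t * v u t powr p) (at t)" if "sol r0 R u du" "c < t" "t < x1" for u du t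
    using sol_quotient_derivs[OF that(1) psi(1), of t] psi(2)[of t] w_pos[of t] that c x1
    by (auto simp: v_def[abs_def] J_def[abs_def])
  have vp: "0 < v u1 t" "0 < v u2 t" if "c < t" "t < x1" for t using pos psi(2)[of t] that x1 c by (auto simp: v_def)
  have up: "v u1 t powr (1 - p) \<le> M\<^sup>2 * (t - c)\<^sup>2" if t: "c < t" "t < x1" for t
  proof (rule start_upper[OF p mM(2) _ _ vj(1)[OF s(1)] vj(2)[OF s(1)] vp(1) lim[OF s(1) z(1)] t])
    show "0 \<le> kernel_E \<psi> r \<and> kernel_E \<psi> r \<le> M" "0 \<le> kernel_F \<psi> r \<and> kernel_F \<psi> r \<le> M" if "c < r" "r < x1" for r
      using b[OF that] mM by auto
  qed
  obtain q where q: "0 < q" "\<And>t. c < t \<Longrightarrow> t < x1 \<Longrightarrow> q * (t - c)\<^sup>2 \<le> v u2 t powr (1 - p)"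
  proof -
    have "\<exists>q>0. \<forall>t. c < t \<and> t < x1 \<longrightarrow> q * (t - c)\<^sup>2 \<le> v u2 t powr (1 - p)"
    proof (rule start_lower[OF p mM _ _ vj(1)[OF s(2)] vj(2)[OF s(2)] vp(2) lim[OF s(2) z(2)]])
      show "m \<le> kernel_E \<psi> r \<and> kernel_E \<psi> r \<le> M" "m \<le> kernel_F \<psi> r" if "c < r" "r < x1" for r
        using b[OF that] by auto
    qed
    then show ?thesis using that by blast
  qed
  define C where "C = (M\<^sup>2 / q) powr (1 / (1 - p))"
  have "u1 t \<le> C * u2 t" if t: "c < t" "t < x1" for t
  proof -
    have "M\<^sup>2 * (t - c)\<^sup>2 = (M\<^sup>2 / q) * (q * (t - c)\<^sup>2)" using q(1) by simp
    also have "\<dots> \<le> (M\<^sup>2 / q) * v u2 t powr (1 - p)" using q t by (intro mult_left_mono) auto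
    finally have "v u1 t powr (1 - p) \<le> (M\<^sup>2 / q) * v u2 t powr (1 - p)" using up[OF t] by linarith
    then have "(v u1 t powr (1 - p)) powr (1 / (1 - p)) \<le> ((M\<^sup>2 / q) * v u2 t powr (1 - p)) powr (1 / (1 - p))"
      using p by (intro powr_mono2) auto
    also have "\<dots> = C * (v u2 t powr (1 - p)) powr (1 / (1 - p))"
      unfolding C_def by (rule powr_mult)
    finally have "v u1 t \<le> C * v u2 t"
      using p vp[OF t] by (simp add: powr_powr)
    then show ?thesis using psi(2)[of t] t c x1 by (simp add: v_def field_simps)
  qed
  then have ev: "\<forall>\<^sub>F t in at_right c. u1 t \<le> C * u2 t"
    unfolding eventually_at_right_field using x1 by (intro exI[of _ x1]) auto
  have sc: "sol c R u1 d1" "sol c R u2 d2" using s c unfolding ode_sol_def by auto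
  show ?thesis
    using compare_via[OF sc _ c(2) lc _ pos _ _ _ _ _ ev r, of 0] lim[OF s(1) z(1)] lim[OF s(2) z(2)] c psi(2)
    by (auto simp: v_def[abs_def] J_def[abs_def])
qed

text \<open>Since \<open>2 * bp > 1\<close>, a derivative of this size is not integrable at
  \<open>r0\<close>, so \<open>v\<close> would tend to minus infinity there. Multiplication by
  \<open>(r - r0) powr n\<close> turns this into a limit statement with the contradiction
  \<open>\<kappa> / n \<le> 0\<close>.\<close>

lemma no_blow_up:
  fixes v D :: "real \<Rightarrow> real"
  assumes k: "0 < \<kappa>" and x1: "r0 < x1"
    and d: "\<And>r. r0 < r \<Longrightarrow> r < x1 \<Longrightarrow> (v has_real_derivative D r) (at r)"
    and D: "\<And>r. r0 < r \<Longrightarrow> r < x1 \<Longrightarrow> \<kappa> * (r - r0) powr (- (2 * bp)) \<le> D r"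
    and lim: "(v \<longlongrightarrow> l) (at_right r0)"
  shows False
proof -
  define n where "n = 2 * bp - 1"
  have n: "0 < n" using bp_gt by (simp add: n_def)
  define x where "x = (r0 + x1) / 2"
  have x: "r0 < x" "x < x1" using x1 by (auto simp: x_def)
  define Gx where "Gx = v x - \<kappa> / n * (x - r0) powr (- n)"
  have "\<kappa> / n \<le> (v x - v r) * (r - r0) powr n + \<kappa> / n * (x - r0) powr (- n) * (r - r0) powr n" if r: "r0 < r" "r < x" for r
  proof -
    have "v r + \<kappa> / n * (r - r0) powr (- n) \<le> v x + \<kappa> / n * (x - r0) powr (- n)"
    proof (rule DERIV_nonneg_le[where f="\<lambda>r. v r + \<kappa> / n * (r - r0) powr (- n)"])
      fix z assume z: "r \<le> z" "z \<le> x"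
      have e: "- (2 * bp) = - n - 1" by (simp add: n_def)
      show "((\<lambda>r. v r + \<kappa> / n * (r - r0) powr (- n)) has_real_derivative D z - \<kappa> * (z - r0) powr (- n - 1)) (at z)"
        using z r x n by (auto intro!: derivative_eq_intros d)
      show "0 \<le> D z - \<kappa> * (z - r0) powr (- n - 1)" using D[of z] z r x unfolding e by auto
    qed (use r in simp)
    then have "\<kappa> / n * (r - r0) powr (- n) \<le> v x - v r + \<kappa> / n * (x - r0) powr (- n)" by simp
    then have "\<kappa> / n * (r - r0) powr (- n) * (r - r0) powr n \<le> (v x - v r + \<kappa> / n * (x - r0) powr (- n)) * (r - r0) powr n"
      by (intro mult_right_mono) auto
    moreover have "(r - r0) powr (- n) * (r - r0) powr n = 1" using r by (simp flip: powr_add)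
    ultimately show ?thesis by (simp add: algebra_simps)
  qed
  then have ev: "\<forall>\<^sub>F r in at_right r0. \<kappa> / n \<le> (v x - v r) * (r - r0) powr n + \<kappa> / n * (x - r0) powr (- n) * (r - r0) powr n"
    unfolding eventually_at_right_field using x by (intro exI[of _ x]) auto
  have "((\<lambda>r. (v x - v r) * (r - r0) powr n + \<kappa> / n * (x - r0) powr (- n) * (r - r0) powr n) \<longlongrightarrow>
      (v x - l) * 0 + \<kappa> / n * (x - r0) powr (- n) * 0) (at_right r0)"
    by (intro tendsto_intros lim powr_tendsto_0_right n)
  from tendsto_lowerbound[OF this ev] have "\<kappa> / n \<le> 0" by simp
  then show False using k n by (simp add: divide_le_0_iff)
qed

text \<open>Only the growth of \<open>u\<close> is prescribed, yet the comparison needs the flux to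
  vanish at \<open>r0\<close>. The flux \<open>J\<close> is nondecreasing; a limit other than 0
  would make the modulus of \<open>v' = kernel_E * J\<close> at least of order
  \<open>(r - r0) powr (- 2 * bp)\<close>, contradicting the finite limit of \<open>v\<close>. Then
  \<open>J \<ge> 0\<close>, so \<open>v\<close> is nondecreasing and \<open>u\<close> is positive
  throughout, which is how positivity arises in (v).\<close>

lemma singular_start:
  assumes psi: "lin r0 R \<psi> d" "((\<lambda>r. \<psi> r / (r - r0) powr bp) \<longlongrightarrow> 1) (at_right r0)"
    "\<And>r. r0 < r \<Longrightarrow> r < R \<Longrightarrow> 0 < \<psi> r"
    and s: "sol r0 R u du" and g: "bp \<le> \<gamma>" "0 < C" "((\<lambda>r. u r / (r - r0) powr \<gamma>) \<longlongrightarrow> C) (at_right r0)"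
  shows "((\<lambda>r. u r / \<psi> r) \<longlongrightarrow> (if \<gamma> = bp then C else 0)) (at_right r0)"
    "((\<lambda>r. w r * du r * \<psi> r - u r * (w r * d r)) \<longlongrightarrow> 0) (at_right r0)"
    "\<And>r. r0 < r \<Longrightarrow> r < R \<Longrightarrow> 0 < u r"
proof -
  define v where "v r = u r / \<psi> r" for r
  define J where "J r = w r * du r * \<psi> r - u r * (w r * d r)" for r
  have vj: "(v has_real_derivative kernel_E \<psi> r * J r) (at r)"
      "(J has_real_derivative kernel_F \<psi> r * v r powr p) (at r)" if "r0 < r" "r < R" for r
    using sol_quotient_derivs[OF s psi(1), of r] psi(3)[of r] w_pos[of r] that
    by (auto simp: v_def[abs_def] J_def[abs_def])
  have vl: "(v \<longlongrightarrow> (if \<gamma> = bp then C else 0)) (at_right r0)"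
  proof -
    have "((\<lambda>r. u r / (r - r0) powr \<gamma> * (r - r0) powr (\<gamma> - bp) / (\<psi> r / (r - r0) powr bp)) \<longlongrightarrow>
        C * (if \<gamma> = bp then 1 else 0) / 1) (at_right r0)"
    proof (intro tendsto_divide tendsto_mult g psi)
      show "((\<lambda>r. (r - r0) powr (\<gamma> - bp)) \<longlongrightarrow> (if \<gamma> = bp then 1 else 0)) (at_right r0)"
      proof (cases "\<gamma> = bp")
        case True
        have "((\<lambda>r. 1) \<longlongrightarrow> (1::real)) (at_right r0)" by simp
        then have "((\<lambda>r. (r - r0) powr 0) \<longlongrightarrow> 1) (at_right r0)"
          by (rule Lim_transform_eventually[OF _ eventually_mono[OF near_right(1)]]) auto
        then show ?thesis using True by simp
      qed (use g powr_tendsto_0_right[of "\<gamma> - bp"] in auto)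
    qed auto
    then have l: "((\<lambda>r. u r / (r - r0) powr \<gamma> * (r - r0) powr (\<gamma> - bp) / (\<psi> r / (r - r0) powr bp)) \<longlongrightarrow>
        (if \<gamma> = bp then C else 0)) (at_right r0)" by (auto split: if_splits)
    show ?thesis
    proof (rule Lim_transform_eventually[OF l eventually_mono[OF near_right(1)]])
      fix r assume r: "r0 < r \<and> r < R"
      then have "(r - r0) powr \<gamma> = (r - r0) powr (\<gamma> - bp) * (r - r0) powr bp" by (simp flip: powr_add)
      then show "u r / (r - r0) powr \<gamma> * (r - r0) powr (\<gamma> - bp) / (\<psi> r / (r - r0) powr bp) = v r"
        using r psi(3)[of r] by (simp add: v_def)
    qed
  qed
  have Jmono: "J x \<le> J y" if "r0 < x" "x \<le> y" "y < R" for x y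
    by (rule DERIV_nonneg_le[OF that(2) vj(2)]) (use that kernel_F_nonneg in auto)
  obtain mw M where wb: "0 < mw" "0 < M" "\<And>r. r0 \<le> r \<Longrightarrow> r \<le> R \<Longrightarrow> mw \<le> w r \<and> w r \<le> M \<and> \<bar>w' r\<bar> \<le> M"
    by (rule w_bounds) blast
  obtain x1 where x1: "r0 < x1" "x1 < R" "\<And>r. r0 < r \<Longrightarrow> r < x1 \<Longrightarrow> \<psi> r \<le> 2 * (r - r0) powr bp"
  proof -
    obtain y where "r0 < y" "\<And>r. r0 < r \<Longrightarrow> r < y \<Longrightarrow> \<psi> r \<le> 2 * (r - r0) powr bp"
      using principal_near[OF psi(2)] unfolding eventually_at_right_field by auto
    then show ?thesis using that[of "min y ((r0 + R) / 2)"] r0R by (auto simp: min_less_iff_disj)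
  qed
  have El: "1 / (4 * M) * (r - r0) powr (- (2 * bp)) \<le> kernel_E \<psi> r" if r: "r0 < r" "r < x1" for r
  proof -
    have "w r * (\<psi> r)\<^sup>2 \<le> M * (2 * (r - r0) powr bp)\<^sup>2"
      using wb(2) wb(3)[of r] r x1 psi(3)[of r] by (intro mult_mono power_mono) auto
    moreover have "0 < w r * (\<psi> r)\<^sup>2" using w_pos[of r] psi(3)[of r] r x1 by auto
    ultimately have "1 / (M * (2 * (r - r0) powr bp)\<^sup>2) \<le> kernel_E \<psi> r"
      unfolding kernel_E_def by (intro frac_le) auto
    moreover have "1 / (M * (2 * (r - r0) powr bp)\<^sup>2) = 1 / (4 * M) * (r - r0) powr (- (2 * bp))"
      using r by (simp add: power_mult_distrib powr_double powr_minus field_simps)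
    ultimately show ?thesis by simp
  qed
  \<comment> \<open>The sign \<tau> covers both cases: -1 excludes a negative value of
    \<open>J\<close>, 1 excludes a positive lower bound.\<close>
  have key: False if t: "\<tau> * \<tau> = 1" "0 < \<kappa>" "r0 < y" "y < x1" "\<And>r. r0 < r \<Longrightarrow> r < y \<Longrightarrow> \<kappa> \<le> \<tau> * J r" for \<tau> \<kappa> y
  proof (rule no_blow_up[where v="\<lambda>r. \<tau> * v r" and D="\<lambda>r. \<tau> * (kernel_E \<psi> r * J r)" and ?x1.0=y and \<kappa>="\<kappa> * (1 / (4 * M))"])
    show "((\<lambda>r. \<tau> * v r) \<longlongrightarrow> \<tau> * (if \<gamma> = bp then C else 0)) (at_right r0)" by (intro tendsto_intros vl)
    fix r assume r: "r0 < r" "r < y"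
    show "((\<lambda>r. \<tau> * v r) has_real_derivative \<tau> * (kernel_E \<psi> r * J r)) (at r)"
      using r t x1 by (intro DERIV_cmult vj) auto
    have "1 / (4 * M) * (r - r0) powr (- (2 * bp)) * \<kappa> \<le> kernel_E \<psi> r * (\<tau> * J r)"
      using El[of r] t(5)[of r] t(2,4) r wb x1 kernel_E_pos[of r \<psi>] psi(3)[of r] by (intro mult_mono) auto
    then show "\<kappa> * (1 / (4 * M)) * (r - r0) powr (- (2 * bp)) \<le> \<tau> * (kernel_E \<psi> r * J r)"
      by (simp add: ac_simps)
  qed (use t wb in auto)
  have J0: "0 \<le> J r" if r: "r0 < r" "r < R" for r
  proof (rule ccontr)
    assume n: "\<not> 0 \<le> J r"
    show False
    proof (rule key[of "-1" "- J r" "min r ((r0 + x1) / 2)"])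
      fix s assume "r0 < s" "s < min r ((r0 + x1) / 2)"
      then show "- J r \<le> - 1 * J s" using Jmono[of s r] r by auto
    qed (use n r x1 in \<open>auto simp: min_less_iff_disj\<close>)
  qed
  have Jl: "(J \<longlongrightarrow> 0) (at_right r0)"
  proof (rule order_tendstoI)
    fix y :: real assume y: "y < 0"
    show "\<forall>\<^sub>F r in at_right r0. y < J r"
      using near_right(1) by eventually_elim (use y less_le_trans[OF y J0] in auto)
  next
    fix y :: real assume y: "0 < y"
    have "\<exists>r. r0 < r \<and> r < (r0 + x1) / 2 \<and> J r < y"
    proof (rule ccontr)
      assume n: "\<not> (\<exists>r. r0 < r \<and> r < (r0 + x1) / 2 \<and> J r < y)"
      then have "y \<le> 1 * J r" if "r0 < r" "r < (r0 + x1) / 2" for r using that by (metis mult_1 not_less)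
      with key[of 1 y "(r0 + x1) / 2"] y x1 show False by (auto simp: field_simps)
    qed
    then obtain r where r: "r0 < r" "r < (r0 + x1) / 2" "J r < y" by blast
    then have "\<forall>s>r0. s < r \<longrightarrow> J s < y"
      using Jmono[of _ r] x1 by (auto intro!: le_less_trans[OF _ r(3)])
    then show "\<forall>\<^sub>F r in at_right r0. J r < y" unfolding eventually_at_right_field using r by blast
  qed
  show "((\<lambda>r. u r / \<psi> r) \<longlongrightarrow> (if \<gamma> = bp then C else 0)) (at_right r0)" using vl by (simp add: v_def[abs_def])
  show "((\<lambda>r. w r * du r * \<psi> r - u r * (w r * d r)) \<longlongrightarrow> 0) (at_right r0)"
    using Jl by (simp add: J_def[abs_def])
  have "\<forall>\<^sub>F r in at_right r0. 0 < u r / (r - r0) powr \<gamma>" by (rule order_tendstoD(1)[OF g(3,2)])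
  then obtain y where y: "r0 < y" "\<And>r. r0 < r \<Longrightarrow> r < y \<Longrightarrow> 0 < u r / (r - r0) powr \<gamma>"
    unfolding eventually_at_right_field by blast
  have upos: "0 < u r" if "r0 < r" "r < y" for r using y(2)[OF that] that by (simp add: zero_less_divide_iff)
  fix r assume r: "r0 < r" "r < R"
  define x where "x = min r ((r0 + y) / 2)"
  have x: "r0 < x" "x < y" "x \<le> r" using r y(1) unfolding x_def by (auto simp: min_def)
  have "0 < v x" using upos[of x] psi(3)[of x] x r by (simp add: v_def)
  also have "v x \<le> v r"
    by (rule DERIV_nonneg_le[OF x(3) vj(1)])
      (use x r J0 kernel_E_pos psi(3) in \<open>auto intro!: mult_nonneg_nonneg simp: less_imp_le\<close>)
  finally show "0 < u r" using psi(3)[OF r] by (simp add: v_def zero_less_divide_iff)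
qed

text \<open>Serves both growth rates, \<open>\<gamma> = bp\<close> and
  \<open>\<gamma> = \<alpha>\<close>; the a priori factor comes from the common positive limit
  \<open>C\<close>.\<close>

lemma singular_unique_le:
  assumes s: "sol r0 R u1 d1" "sol r0 R u2 d2" and g: "bp \<le> \<gamma>" "0 < C"
    "((\<lambda>r. u1 r / (r - r0) powr \<gamma>) \<longlongrightarrow> C) (at_right r0)"
    "((\<lambda>r. u2 r / (r - r0) powr \<gamma>) \<longlongrightarrow> C) (at_right r0)" and r: "r0 < r" "r < R"
  shows "u1 r \<le> u2 r"
proof -
  obtain \<psi> d where psi: "lin r0 R \<psi> d" "((\<lambda>r. \<psi> r / (r - r0) powr bp) \<longlongrightarrow> 1) (at_right r0)"
    "\<And>r. r0 < r \<Longrightarrow> r < R \<Longrightarrow> 0 < \<psi> r"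
    by (rule principal_pair) blast
  note 1 = singular_start[OF psi s(1) g(1,2,3)]
  note 2 = singular_start[OF psi s(2) g(1,2,4)]
  have "C / 2 < C" "C < 2 * C" using g by auto
  from order_tendstoD(1)[OF g(4) this(1)] order_tendstoD(2)[OF g(3) this(2)] near_right(1)
  have "\<forall>\<^sub>F r in at_right r0. u1 r \<le> 4 * u2 r"
  proof eventually_elim
    case (elim r)
    then have "u1 r < 2 * C * (r - r0) powr \<gamma>" "C / 2 * (r - r0) powr \<gamma> < u2 r" by (auto simp: field_simps)
    then show ?case by simp
  qed
  from compare_via[OF s _ r0R psi(1,3) 1(3) 2(3) _ 1(1) 2(1) 1(2) 2(2) this r] g show ?thesis by auto
qed

end

section \<open>Barriers of order \<alpha> at the inner boundary\<close>

context annular_pow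
begin

text \<open>A power p < 1 lowers bases above 1 and raises bases below 1. The form with a sign serves
  the super- and the subsolution at once.\<close>

lemma powr_1plus_sign:
  assumes "\<tau> = 1 \<or> \<tau> = -1" "0 \<le> x" "x \<le> (1::real)"
  shows "\<tau> * (1 + \<tau> * x) powr p \<le> \<tau> * (1 + \<tau> * x)"
proof (cases "\<tau> = 1")
  case True
  have "(1 + x) powr p \<le> (1 + x) powr 1" using assms p by (intro powr_mono) auto
  then show ?thesis using True assms by simp
next
  case False
  then have t: "\<tau> = -1" using assms by simp
  show ?thesis
  proof (cases "x = 1")
    case True then show ?thesis using t by simp
  next
    case False
    then have "(1 - x) powr 1 \<le> (1 - x) powr p" using assms p by (intro powr_mono') auto
    then show ?thesis using t False assms by simp
  qed
qed

text \<open>The factor that \<open>u'' + \<mu> / s\<^sup>2 * u\<close> produces from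
  \<open>s powr \<alpha>\<close>. By the indicial equation it is positive exactly for
  \<open>bp < \<alpha>\<close>.\<close>

definition barrier_gap :: real where "barrier_gap = \<alpha> * (\<alpha> - 1) + \<mu>"
text \<open>The constant \<open>c'\<close> of (v): for positive \<open>barrier_gap\<close>,
  \<open>barrier_coeff * s powr \<alpha>\<close> solves
  \<open>u'' + \<mu> / s\<^sup>2 * u = u powr p\<close> exactly.\<close>

definition barrier_coeff :: real where "barrier_coeff = barrier_gap powr (1 / (p - 1))"

lemma barrier_coeff_pos: "0 < barrier_gap \<Longrightarrow> 0 < barrier_coeff" by (simp add: barrier_coeff_def)

lemma barrier_coeff_powr:
  assumes "0 < barrier_gap" shows "barrier_coeff powr p = barrier_coeff * barrier_gap"
proof -
  have "barrier_coeff powr (p - 1) = barrier_gap" using p assms by (simp add: barrier_coeff_def powr_powr)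
  moreover have "barrier_coeff powr p = barrier_coeff * barrier_coeff powr (p - 1)" using barrier_coeff_pos[OF assms] by (simp add: powr_mult_base)
  ultimately show ?thesis by simp
qed

lemma bp_less_alpha: assumes "0 < barrier_gap" shows "bp < \<alpha>"
proof (rule ccontr)
  assume "\<not> bp < \<alpha>"
  then have "\<alpha> * (\<alpha> - 1) \<le> bp * (bp - 1)" using alpha by (intro mult_mono) auto
  then show False using assms bp_eq by (simp add: barrier_gap_def)
qed

text \<open>The correction lies half a power above \<alpha>: what it adds to the second-order part,
  of order \<open>\<alpha> - 3/2\<close>, dominates the weight term \<open>w' * u'\<close> of order
  \<open>\<alpha> - 1\<close>. Near \<open>r0\<close> the sign \<tau> = -1 gives a subsolution and
  \<tau> = 1 a supersolution.\<close>

definition barrier_fun :: "real \<Rightarrow> real \<Rightarrow> real" where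
  "barrier_fun \<tau> r = barrier_coeff * (r - r0) powr \<alpha> + \<tau> * (r - r0) powr (\<alpha> + 1/2)"

text \<open>Beyond the exact balance of the leading terms, the correction leaves the excess
  \<open>mh - barrier_gap\<close> times \<open>s powr (\<alpha> - 3/2)\<close> with the sign \<tau>;
  being positive, this factor absorbs the weight term for small \<open>s\<close>.\<close>

lemma barrier:
  assumes psi: "lin r0 R \<psi> d" "((\<lambda>r. \<psi> r / (r - r0) powr bp) \<longlongrightarrow> 1) (at_right r0)"
    "((\<lambda>r. (r - r0) powr bp * d r) \<longlongrightarrow> 0) (at_right r0)"
    "\<And>r. r0 < r \<Longrightarrow> r < R \<Longrightarrow> 0 < \<psi> r" and V: "volterra r0 R (kernel_E \<psi>) (kernel_F \<psi>)" and barrier_gap: "0 < barrier_gap"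
  obtains x1 where "r0 < x1" "x1 < R"
    "\<And>\<tau> r. \<tau> = 1 \<or> \<tau> = -1 \<Longrightarrow> r0 < r \<Longrightarrow> r \<le> x1 \<Longrightarrow> 0 < barrier_fun \<tau> r / \<psi> r"
    "\<And>\<tau>. ((\<lambda>r. barrier_fun \<tau> r / \<psi> r) \<longlongrightarrow> 0) (at_right r0)"
    "\<And>\<tau> h r. \<tau> = 1 \<or> \<tau> = -1 \<Longrightarrow> continuous_on {r0..<R} h \<Longrightarrow>
       (\<And>x. r0 < x \<Longrightarrow> x \<le> x1 \<Longrightarrow> h x = (barrier_fun \<tau> x / \<psi> x) powr p) \<Longrightarrow> r0 < r \<Longrightarrow> r \<le> x1 \<Longrightarrow>
       (- \<tau>) * (barrier_fun \<tau> r / \<psi> r) \<le> (- \<tau>) * volterra.T r0 (kernel_E \<psi>) (kernel_F \<psi>) h r"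
proof -
  interpret V: volterra r0 R "kernel_E \<psi>" "kernel_F \<psi>" by (rule V)
  obtain mw M where wb: "0 < mw" "0 < M" "\<And>r. r0 \<le> r \<Longrightarrow> r \<le> R \<Longrightarrow> mw \<le> w r \<and> w r \<le> M \<and> \<bar>w' r\<bar> \<le> M"
    by (rule w_bounds) blast
  have cp: "0 < barrier_coeff" by (rule barrier_coeff_pos[OF barrier_gap])
  define A where "A = barrier_coeff * \<alpha> + \<alpha> + 1/2"
  \<comment> \<open>The same factor as \<open>barrier_gap\<close>, for the exponent
    \<open>\<alpha> + 1/2\<close>.\<close>
  define mh where "mh = (\<alpha> + 1/2) * (\<alpha> - 1/2) + \<mu>"
  have A: "0 < A" using cp alpha by (simp add: A_def add_pos_pos)
  have mh: "mh - barrier_gap = \<alpha> - 1/4" by (simp add: mh_def barrier_gap_def algebra_simps)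
  \<comment> \<open>Bound for \<open>s powr (1/2)\<close>: 1 keeps \<open>s\<close> at most 1,
    \<open>barrier_coeff / 2\<close> keeps the correction below half of the leading term, and the
    last entry lets the weight term, of size \<open>M * A\<close>, be absorbed by
    \<open>mw * (\<alpha> - 1/4)\<close>.\<close>
  define q where "q = min 1 (min (barrier_coeff / 2) (mw * (\<alpha> - 1/4) / (M * A)))"
  have q: "0 < q" "q \<le> 1" "q \<le> barrier_coeff / 2" "q \<le> mw * (\<alpha> - 1/4) / (M * A)"
  proof -
    have "0 < mw * (\<alpha> - 1/4) / (M * A)" using wb A alpha by simp
    then show "0 < q" using cp by (simp add: q_def)
  qed (unfold q_def, linarith+)
  define x1 where "x1 = r0 + min (q\<^sup>2) ((R - r0) / 2)"
  have x1: "r0 < x1" "x1 \<le> (r0 + R) / 2" "x1 - r0 \<le> q\<^sup>2" "x1 < R"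
    using q r0R by (auto simp: x1_def min_def field_simps)
  have small: "(r - r0) powr (1/2) \<le> q" "r - r0 \<le> 1" if r: "r0 < r" "r \<le> x1" for r
  proof -
    have "(r - r0) powr (1/2) \<le> (q\<^sup>2) powr (1/2)" using r x1 by (intro powr_mono2) auto
    also have "(q\<^sup>2) powr (1/2) = q" using q by (simp add: powr_half_sqrt)
    finally show "(r - r0) powr (1/2) \<le> q" .
    have "q\<^sup>2 \<le> 1" using q by (simp add: power_le_one)
    then show "r - r0 \<le> 1" using r x1 by simp
  qed
  have split: "(r - r0) powr (\<alpha> + 1/2) = (r - r0) powr \<alpha> * (r - r0) powr (1/2)" for r by (simp add: powr_add)
  have bfac: "barrier_fun \<tau> r = barrier_coeff * (r - r0) powr \<alpha> * (1 + \<tau> * ((r - r0) powr (1/2) / barrier_coeff))" for \<tau> r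
    unfolding barrier_fun_def split using cp by (simp add: algebra_simps)
  have xle: "0 \<le> (r - r0) powr (1/2) / barrier_coeff" "(r - r0) powr (1/2) / barrier_coeff \<le> 1/2" if r: "r0 < r" "r \<le> x1" for r
    using small[OF r] q cp by (auto simp: field_simps)
  have bpos: "0 < barrier_fun \<tau> r" if t: "\<tau> = 1 \<or> \<tau> = -1" and r: "r0 < r" "r \<le> x1" for \<tau> r
  proof -
    have "0 < 1 + \<tau> * ((r - r0) powr (1/2) / barrier_coeff)"
      using t xle[OF r] by (elim disjE; simp only: mult_1 mult_minus1; linarith)
    then show ?thesis unfolding bfac using cp r by simp
  qed
  define b1 where "b1 \<tau> r = barrier_coeff * \<alpha> * (r - r0) powr (\<alpha> - 1) + \<tau> * (\<alpha> + 1/2) * (r - r0) powr (\<alpha> - 1/2)" for \<tau> r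
  define b2 where "b2 \<tau> r = barrier_coeff * (\<alpha> * (\<alpha> - 1)) * (r - r0) powr (\<alpha> - 2) + \<tau> * ((\<alpha> + 1/2) * (\<alpha> - 1/2)) * (r - r0) powr (\<alpha> - 3/2)" for \<tau> r
  have db: "(barrier_fun \<tau> has_real_derivative b1 \<tau> r) (at r)" "(b1 \<tau> has_real_derivative b2 \<tau> r) (at r)" if r: "r0 < r" for \<tau> r
  proof -
    have pd: "((\<lambda>r. (r - r0) powr y) has_real_derivative y * (r - r0) powr (y - 1)) (at r)" for y
      using r by (auto intro!: derivative_eq_intros)
    show "(barrier_fun \<tau> has_real_derivative b1 \<tau> r) (at r)"
      unfolding barrier_fun_def[abs_def] b1_def
      by (rule DERIV_cong[OF DERIV_add[OF DERIV_cmult[OF pd] DERIV_cmult[OF pd]]]) simp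
    show "(b1 \<tau> has_real_derivative b2 \<tau> r) (at r)"
      unfolding b1_def[abs_def] b2_def
      by (rule DERIV_cong[OF DERIV_add[OF DERIV_cmult[OF pd] DERIV_cmult[OF pd]]]) simp
  qed
  define e where "e r = (r - r0) powr bp" for r
  have ba: "bp < \<alpha>" by (rule bp_less_alpha[OF barrier_gap])
  have pz: "((\<lambda>r. \<psi> r) \<longlongrightarrow> 0) (at_right r0)"
    by (rule tendsto_zero_of_quotient[OF psi(2) powr_tendsto_0_right[OF bp_pos] near_right(2)])
  have be: "((\<lambda>r. barrier_fun \<tau> r / e r) \<longlongrightarrow> 0) (at_right r0)" for \<tau>
  proof -
    have "((\<lambda>r. barrier_coeff * (r - r0) powr (\<alpha> - bp) + \<tau> * (r - r0) powr (\<alpha> + 1/2 - bp)) \<longlongrightarrow> barrier_coeff * 0 + \<tau> * 0) (at_right r0)"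
      using ba by (intro tendsto_intros powr_tendsto_0_right) auto
    then have "((\<lambda>r. barrier_coeff * (r - r0) powr (\<alpha> - bp) + \<tau> * (r - r0) powr (\<alpha> + 1/2 - bp)) \<longlongrightarrow> 0) (at_right r0)" by simp
    then show ?thesis
      by (rule Lim_transform_eventually[OF _ eventually_mono[OF near_right(1)]])
        (auto simp: barrier_fun_def e_def powr_diff add_divide_distrib)
  qed
  have zl: "((\<lambda>r. barrier_fun \<tau> r / \<psi> r) \<longlongrightarrow> 0) (at_right r0)" for \<tau>
  proof -
    have "((\<lambda>r. barrier_fun \<tau> r / e r / (\<psi> r / (r - r0) powr bp)) \<longlongrightarrow> 0 / 1) (at_right r0)"
      by (intro tendsto_divide be psi) auto
    then have "((\<lambda>r. barrier_fun \<tau> r / e r / (\<psi> r / (r - r0) powr bp)) \<longlongrightarrow> 0) (at_right r0)" by simp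
    then show ?thesis
      by (rule Lim_transform_eventually[OF _ eventually_mono[OF near_right(1)]]) (auto simp: e_def)
  qed
  \<comment> \<open>The weighted Wronskian of barrier and \<psi>. Its second part tends to 0 because
    the barrier is of higher order than \<open>e\<close> while \<open>(r - r0) powr bp * d r\<close>
    tends to 0.\<close>
  define Jz where "Jz \<tau> r = w r * b1 \<tau> r * \<psi> r - barrier_fun \<tau> r * (w r * d r)" for \<tau> r
  have wl: "(w \<longlongrightarrow> w r0) (at_right r0)"
    using r0R by (intro isCont_tendsto_within DERIV_isCont[OF w_deriv]) auto
  have Jl: "(Jz \<tau> \<longlongrightarrow> 0) (at_right r0)" for \<tau>
  proof -
    have b1l: "(b1 \<tau> \<longlongrightarrow> barrier_coeff * \<alpha> * 0 + \<tau> * (\<alpha> + 1/2) * 0) (at_right r0)"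
      unfolding b1_def[abs_def] using alpha by (intro tendsto_intros powr_tendsto_0_right) auto
    have "((\<lambda>r. w r * b1 \<tau> r * \<psi> r - w r * (barrier_fun \<tau> r / e r) * ((r - r0) powr bp * d r)) \<longlongrightarrow>
        w r0 * (barrier_coeff * \<alpha> * 0 + \<tau> * (\<alpha> + 1/2) * 0) * 0 - w r0 * 0 * 0) (at_right r0)"
      by (intro tendsto_intros wl b1l pz be psi(3))
    then have "((\<lambda>r. w r * b1 \<tau> r * \<psi> r - w r * (barrier_fun \<tau> r / e r) * ((r - r0) powr bp * d r)) \<longlongrightarrow> 0) (at_right r0)" by simp
    then show ?thesis
      by (rule Lim_transform_eventually[OF _ eventually_mono[OF near_right(1)]]) (auto simp: e_def Jz_def)
  qed
  have key: "(- \<tau>) * (barrier_fun \<tau> r / \<psi> r) \<le> (- \<tau>) * V.T h r"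
    if t: "\<tau> = 1 \<or> \<tau> = -1" and h: "continuous_on {r0..<R} h"
      "\<And>x. r0 < x \<Longrightarrow> x \<le> x1 \<Longrightarrow> h x = (barrier_fun \<tau> x / \<psi> x) powr p" and r: "r0 < r" "r \<le> x1" for \<tau> h r
  proof (rule V.T_sub[OF h(1) x1(1,4) _ _ _ _ zl Jl r])
    fix x assume x: "r0 < x" "x \<le> x1"
    define s where "s = x - r0"
    have s: "0 < s" "s \<le> 1" "s powr (1/2) \<le> q" using x small[OF x] by (auto simp: s_def)
    have xR: "x < R" using x x1 by simp
    have ps: "0 < \<psi> x" and wx: "0 < w x" using psi(4)[OF x(1) xR] w_pos[of x] x xR by auto
    have ld: "(\<psi> has_real_derivative d x) (at x)"
      "((\<lambda>r. w r * d r) has_real_derivative - (w x * \<mu> / (\<delta> x)\<^sup>2 * \<psi> x)) (at x)"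
      using psi(1) x xR unfolding lin_sol_def by auto
    show "((\<lambda>r. barrier_fun \<tau> r / \<psi> r) has_real_derivative kernel_E \<psi> x * Jz \<tau> x) (at x)"
      by (rule DERIV_cong[OF DERIV_divide[OF db(1)[OF x(1)] ld(1)]])
        (use ps wx in \<open>auto simp: kernel_E_def Jz_def field_simps power2_eq_square\<close>)
    have wd: "(w has_real_derivative w' x) (at x)" using w_deriv x xR by auto
    show "(Jz \<tau> has_real_derivative \<psi> x * (w' x * b1 \<tau> x + w x * b2 \<tau> x + w x * \<mu> / s\<^sup>2 * barrier_fun \<tau> x)) (at x)"
    proof -
      have "\<delta> x = s" using x x1 by (auto simp: bdist_def s_def field_simps)
      then show ?thesis unfolding Jz_def[abs_def]
        by (intro DERIV_cong[OF DERIV_diff[OF DERIV_mult[OF DERIV_mult[OF wd db(2)[OF x(1)]] ld(1)] DERIV_mult[OF db(1)[OF x(1)] ld(2)]]])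
          (simp add: algebra_simps)
    qed
    have tt: "\<tau> * \<tau> = 1" using t by auto
    have pw: "s powr (\<alpha> - 3/2) = s powr (\<alpha> - 2) * s powr (1/2)" "s powr \<alpha> = s powr (\<alpha> - 2) * s\<^sup>2"
      "s powr (\<alpha> - 1) = s powr (\<alpha> - 2) * (s powr (1/2) * s powr (1/2))"
    proof -
      have "s\<^sup>2 = s powr 2" using s by simp
      then show "s powr \<alpha> = s powr (\<alpha> - 2) * s\<^sup>2" by (simp only: powr_add[symmetric]) simp
    qed (simp_all only: powr_add[symmetric], simp_all)
    have c1: "\<tau> * barrier_fun \<tau> x powr p \<le> \<tau> * (s powr (\<alpha> - 2) * (barrier_coeff * barrier_gap + \<tau> * barrier_gap * s powr (1/2)))"
    proof -
      define y where "y = s powr (1/2) / barrier_coeff"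
      have y: "0 \<le> y" "y \<le> 1/2" using xle[OF x] by (auto simp: y_def s_def)
      have "barrier_fun \<tau> x powr p = barrier_coeff powr p * (s powr \<alpha>) powr p * (1 + \<tau> * y) powr p"
        unfolding bfac s_def[symmetric] y_def[symmetric] by (simp add: powr_mult)
      also have "(s powr \<alpha>) powr p = s powr (\<alpha> - 2)" by (simp add: powr_powr alpha)
      finally have "\<tau> * barrier_fun \<tau> x powr p = (barrier_coeff * barrier_gap * s powr (\<alpha> - 2)) * (\<tau> * (1 + \<tau> * y) powr p)"
        using barrier_coeff_powr[OF barrier_gap] by (simp add: ac_simps)
      also have "\<dots> \<le> (barrier_coeff * barrier_gap * s powr (\<alpha> - 2)) * (\<tau> * (1 + \<tau> * y))"
        by (rule mult_left_mono[OF powr_1plus_sign[OF t y(1)]]) (use y cp barrier_gap in auto)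
      also have "\<dots> = \<tau> * (s powr (\<alpha> - 2) * (barrier_coeff * barrier_gap + \<tau> * barrier_gap * (barrier_coeff * y)))" by (simp add: algebra_simps)
      also have "barrier_coeff * y = s powr (1/2)" using cp by (simp add: y_def)
      finally show ?thesis .
    qed
    have c2: "b2 \<tau> x + \<mu> / s\<^sup>2 * barrier_fun \<tau> x = s powr (\<alpha> - 2) * (barrier_coeff * barrier_gap + \<tau> * mh * s powr (1/2))"
    proof -
      have "\<mu> / s\<^sup>2 * barrier_fun \<tau> x = \<mu> * s powr (\<alpha> - 2) * (barrier_coeff + \<tau> * s powr (1/2))"
        unfolding barrier_fun_def split unfolding s_def[symmetric] pw(2) using s by (simp add: field_simps)
      then show ?thesis
        by (simp add: b2_def s_def[symmetric] pw(1) barrier_gap_def mh_def algebra_simps)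
    qed
    have c3: "\<bar>b1 \<tau> x\<bar> \<le> A * s powr (\<alpha> - 1)"
    proof -
      have "s powr (\<alpha> - 1/2) \<le> s powr (\<alpha> - 1)" using s by (intro powr_mono') auto
      then have "(\<alpha> + 1/2) * s powr (\<alpha> - 1/2) \<le> (\<alpha> + 1/2) * s powr (\<alpha> - 1)" using alpha by (intro mult_left_mono) auto
      moreover have "\<bar>b1 \<tau> x\<bar> \<le> barrier_coeff * \<alpha> * s powr (\<alpha> - 1) + (\<alpha> + 1/2) * s powr (\<alpha> - 1/2)"
      proof -
        have PQ: "\<bar>P + \<tau> * Q\<bar> \<le> P + Q" if "0 \<le> P" "0 \<le> Q" for P Q :: real
          using t that by (elim disjE) auto
        have "b1 \<tau> x = barrier_coeff * \<alpha> * s powr (\<alpha> - 1) + \<tau> * ((\<alpha> + 1/2) * s powr (\<alpha> - 1/2))"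
          by (simp add: b1_def s_def mult.assoc)
        then show ?thesis using PQ[of "barrier_coeff * \<alpha> * s powr (\<alpha> - 1)" "(\<alpha> + 1/2) * s powr (\<alpha> - 1/2)"] cp alpha(1) by simp
      qed
      ultimately show ?thesis by (simp add: A_def algebra_simps)
    qed
    have "\<bar>w' x * b1 \<tau> x\<bar> \<le> M * (A * s powr (\<alpha> - 1))"
      using wb(2) wb(3)[of x] x xR c3 unfolding abs_mult by (intro mult_mono) auto
    also have "\<dots> = (M * A * s powr (1/2)) * (s powr (\<alpha> - 2) * s powr (1/2))" by (simp add: pw(3) ac_simps)
    also have "\<dots> \<le> (mw * (\<alpha> - 1/4)) * (s powr (\<alpha> - 2) * s powr (1/2))"
    proof (rule mult_right_mono)
      have "s powr (1/2) \<le> mw * (\<alpha> - 1/4) / (M * A)" using s(3) q(4) by linarith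
      then show "M * A * s powr (1/2) \<le> mw * (\<alpha> - 1/4)" using wb A by (simp add: field_simps)
    qed simp
    also have "\<dots> \<le> w x * (mh - barrier_gap) * (s powr (\<alpha> - 2) * s powr (1/2))"
      unfolding mh using wb(3)[of x] x xR alpha by (intro mult_right_mono) auto
    finally have c4: "\<bar>w' x * b1 \<tau> x\<bar> \<le> w x * (mh - barrier_gap) * (s powr (\<alpha> - 2) * s powr (1/2))" .
    have "- (\<tau> * (w' x * b1 \<tau> x)) \<le> \<bar>w' x * b1 \<tau> x\<bar>" using t by auto
    then have "w x * (\<tau> * barrier_fun \<tau> x powr p) \<le> \<tau> * (w' x * b1 \<tau> x + w x * (b2 \<tau> x + \<mu> / s\<^sup>2 * barrier_fun \<tau> x))"
    proof -
      assume a: "- (\<tau> * (w' x * b1 \<tau> x)) \<le> \<bar>w' x * b1 \<tau> x\<bar>"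
      have "w x * (\<tau> * barrier_fun \<tau> x powr p) \<le> w x * (\<tau> * (s powr (\<alpha> - 2) * (barrier_coeff * barrier_gap + \<tau> * barrier_gap * s powr (1/2))))"
        by (rule mult_left_mono[OF c1]) (use wx in auto)
      also have "\<dots> = w x * \<tau> * s powr (\<alpha> - 2) * (barrier_coeff * barrier_gap) + \<tau> * \<tau> * (w x * barrier_gap * (s powr (\<alpha> - 2) * s powr (1/2)))"
        by (simp add: algebra_simps)
      also have "\<dots> = w x * \<tau> * s powr (\<alpha> - 2) * (barrier_coeff * barrier_gap) + w x * mh * (s powr (\<alpha> - 2) * s powr (1/2))
          - w x * (mh - barrier_gap) * (s powr (\<alpha> - 2) * s powr (1/2))"
        unfolding tt by (simp add: algebra_simps)
      also have "\<dots> \<le> w x * \<tau> * s powr (\<alpha> - 2) * (barrier_coeff * barrier_gap) + \<tau> * \<tau> * (w x * mh * (s powr (\<alpha> - 2) * s powr (1/2)))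
          + \<tau> * (w' x * b1 \<tau> x)"
        unfolding tt using a c4 by simp
      also have "\<dots> = \<tau> * (w' x * b1 \<tau> x + w x * (b2 \<tau> x + \<mu> / s\<^sup>2 * barrier_fun \<tau> x))"
        unfolding c2 by (simp add: algebra_simps)
      finally show ?thesis .
    qed
    then have fin: "\<psi> x * (w x * (\<tau> * barrier_fun \<tau> x powr p)) \<le> \<psi> x * (\<tau> * (w' x * b1 \<tau> x + w x * (b2 \<tau> x + \<mu> / s\<^sup>2 * barrier_fun \<tau> x)))"
      by (rule mult_left_mono) (use ps in auto)
    have Fh: "kernel_F \<psi> x * h x = w x * \<psi> x * barrier_fun \<tau> x powr p"
      using ps bpos[OF t x] by (simp add: h(2)[OF x] kernel_F_def powr_divide powr_add)
    show "- \<tau> * (\<psi> x * (w' x * b1 \<tau> x + w x * b2 \<tau> x + w x * \<mu> / s\<^sup>2 * barrier_fun \<tau> x)) \<le> - \<tau> * (kernel_F \<psi> x * h x)"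
      unfolding Fh using fin by (simp add: algebra_simps)
    show "- \<tau> * (kernel_E \<psi> x * Jz \<tau> x) \<le> - \<tau> * (kernel_E \<psi> x * Jz \<tau> x)" by simp
  qed
  have pos': "0 < barrier_fun \<tau> r / \<psi> r" if "\<tau> = 1 \<or> \<tau> = -1" "r0 < r" "r \<le> x1" for \<tau> r
    using bpos[OF that] psi(4)[of r] that x1 by auto
  show ?thesis by (rule that[OF x1(1,4) pos' zl key])
qed

end

section \<open>Existence with prescribed growth, and existence and uniqueness with a flat
  start\<close>

context annular_pow
begin

text \<open>Here the constant \<open>c\<close> is itself a subsolution, and
  \<open>u / \<psi> = v\<close> tends to \<open>c\<close>, so the normalisation of \<psi> makes it
  the growth constant.\<close>

lemma principal_growth_exists:
  assumes barrier_gap: "0 < barrier_gap" and c: "0 < c"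
  obtains u d where "sol r0 R u d" "\<And>r. r0 < r \<Longrightarrow> r < R \<Longrightarrow> 0 < u r"
    "((\<lambda>r. u r / (r - r0) powr bp) \<longlongrightarrow> c) (at_right r0)"
    "\<exists>L>0. ((\<lambda>r. u r / (R - r) powr bm) \<longlongrightarrow> L) (at_left R)"
proof -
  obtain \<psi> d k where psi: "lin r0 R \<psi> d" "continuous_on {r0..<R} \<psi>" "\<psi> r0 = 0"
    "((\<lambda>r. \<psi> r / (r - r0) powr bp) \<longlongrightarrow> 1) (at_right r0)"
    "\<And>r. r0 < r \<Longrightarrow> r < R \<Longrightarrow> 0 < \<psi> r"
    "0 < k" "((\<lambda>r. \<psi> r / (R - r) powr bm) \<longlongrightarrow> k) (at_left R)"
    by (rule principal_pair) blast
  have V: "volterra r0 R (kernel_E \<psi>) (kernel_F \<psi>)"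
    by (rule volterra_singular[OF psi(1-5) bp_less_alpha[OF barrier_gap]])
  interpret V: volterra r0 R "kernel_E \<psi>" "kernel_F \<psi>" by (rule V)
  have sub: "c \<le> c + V.T (\<lambda>t. c powr p) r" if r: "r0 \<le> r" "r < R" for r
    using V.T_nonneg_mono[of "\<lambda>t. c powr p" r0 r] r kernel_F_nonneg by auto
  obtain v where v: "continuous_on {r0..<R} v" "\<And>r. r0 \<le> r \<Longrightarrow> r < R \<Longrightarrow> c \<le> v r"
    "\<And>r. r0 \<le> r \<Longrightarrow> r < R \<Longrightarrow> v r = c + V.T (\<lambda>t. v t powr p) r"
    by (rule V.sublinear_exists[OF _ p, of "\<lambda>_. c" c]) (use kernel_F_nonneg c sub in auto)
  have vp: "0 \<le> v r" "0 < v r" if "r0 \<le> r" "r < R" for r using v(2)[OF that] c by auto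
  obtain J where J: "sol r0 R (\<lambda>r. \<psi> r * v r) (\<lambda>r. d r * v r + J r / (w r * \<psi> r))"
    "(v \<longlongrightarrow> c) (at_right r0)"
    "\<exists>L>0. ((\<lambda>r. \<psi> r * v r / (R - r) powr bm) \<longlongrightarrow> L) (at_left R)"
    by (rule fixed_point_sol[OF V _ r0R psi(1,5,6,7) v(1,3) vp(1)]) (use vp in auto)
  have "((\<lambda>r. \<psi> r * v r / (r - r0) powr bp) \<longlongrightarrow> c) (at_right r0)"
    using tendsto_mult[OF psi(4) J(2)] by simp
  with J show ?thesis using psi(5) vp by (intro that[of "\<lambda>r. \<psi> r * v r"]) auto
qed

text \<open>The quotient starts with value 0, as for a dead core. The iteration climbs from the
  lower barrier and remains below the upper one; both have the leading term
  \<open>barrier_coeff * s powr \<alpha>\<close>, so a sandwich argument gives the limit.\<close>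

lemma barrier_growth_exists:
  assumes barrier_gap: "0 < barrier_gap"
  obtains u d where "sol r0 R u d" "((\<lambda>r. u r / (r - r0) powr \<alpha>) \<longlongrightarrow> barrier_coeff) (at_right r0)"
    "\<exists>L>0. ((\<lambda>r. u r / (R - r) powr bm) \<longlongrightarrow> L) (at_left R)"
proof -
  obtain \<psi> d k where psi: "lin r0 R \<psi> d" "continuous_on {r0..<R} \<psi>" "\<psi> r0 = 0"
    "((\<lambda>r. \<psi> r / (r - r0) powr bp) \<longlongrightarrow> 1) (at_right r0)"
    "\<And>r. r0 < r \<Longrightarrow> r < R \<Longrightarrow> 0 < \<psi> r"
    "((\<lambda>r. (r - r0) powr bp * d r) \<longlongrightarrow> 0) (at_right r0)"
    "0 < k" "((\<lambda>r. \<psi> r / (R - r) powr bm) \<longlongrightarrow> k) (at_left R)"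
    by (rule principal_pair) blast
  have V: "volterra r0 R (kernel_E \<psi>) (kernel_F \<psi>)"
    by (rule volterra_singular[OF psi(1-5) bp_less_alpha[OF barrier_gap]])
  interpret V: volterra r0 R "kernel_E \<psi>" "kernel_F \<psi>" by (rule V)
  define z where "z \<tau> r = barrier_fun \<tau> r / \<psi> r" for \<tau> r
  obtain x1 where x1: "r0 < x1" "x1 < R"
    and zpos: "\<And>\<tau> r. \<tau> = 1 \<or> \<tau> = -1 \<Longrightarrow> r0 < r \<Longrightarrow> r \<le> x1 \<Longrightarrow> 0 < z \<tau> r"
    and zlim: "\<And>\<tau>. (z \<tau> \<longlongrightarrow> 0) (at_right r0)"
    and zT: "\<And>\<tau> h r. \<tau> = 1 \<or> \<tau> = -1 \<Longrightarrow> continuous_on {r0..<R} h \<Longrightarrow>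
       (\<And>x. r0 < x \<Longrightarrow> x \<le> x1 \<Longrightarrow> h x = z \<tau> x powr p) \<Longrightarrow> r0 < r \<Longrightarrow> r \<le> x1 \<Longrightarrow>
       (- \<tau>) * z \<tau> r \<le> (- \<tau>) * V.T h r"
    by (rule barrier[OF psi(1,4,6,5) V barrier_gap, folded z_def]) (assumption | rule that | blast)+
  define y where "y \<tau> r = (if r \<le> r0 then 0 else z \<tau> (min r x1))" for \<tau> r
  have yx: "y \<tau> r = z \<tau> r" if "r0 < r" "r \<le> x1" for \<tau> r using that by (simp add: y_def min_def)
  have zc: "continuous_on {r0<..x1} (z \<tau>)" for \<tau>
  proof -
    have "continuous_on {r0<..x1} \<psi>" by (rule continuous_on_subset[OF psi(2)]) (use x1 in auto)
    moreover have "\<psi> r \<noteq> 0" if "r \<in> {r0<..x1}" for r using psi(5)[of r] that x1 by auto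
    ultimately show ?thesis
      unfolding z_def barrier_fun_def by (intro continuous_intros) auto
  qed
  have yc: "continuous_on {r0..<R} (y \<tau>)" for \<tau>
    unfolding y_def by (rule continuous_extension_const[OF zc zlim x1(1)])
  have ynn: "0 \<le> y \<tau> r" if "\<tau> = 1 \<or> \<tau> = -1" for \<tau> r
    using zpos[OF that, of "min r x1"] x1 by (simp add: y_def min_def less_imp_le)
  have hc: "continuous_on {r0..<R} (\<lambda>t. y \<tau> t powr p)" if "\<tau> = 1 \<or> \<tau> = -1" for \<tau>
    using yc ynn[OF that] p by (intro V.powr_cont) auto
  have T1: "(- \<tau>) * y \<tau> r \<le> (- \<tau>) * V.T (\<lambda>t. y \<tau> t powr p) r" if t: "\<tau> = 1 \<or> \<tau> = -1" and r: "r0 < r" "r \<le> x1" for \<tau> r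
    using zT[OF t hc[OF t] _ r] yx r by simp
  have sub: "y (-1) r \<le> 0 + V.T (\<lambda>t. y (-1) t powr p) r" if r: "r0 \<le> r" "r < R" for r
  proof (cases "r \<le> x1")
    case True
    then show ?thesis using T1[of "-1" r] r by (cases "r = r0") (auto simp: y_def)
  next
    case False
    then have "y (-1) r = y (-1) x1" using x1 by (simp add: y_def)
    also have "\<dots> \<le> V.T (\<lambda>t. y (-1) t powr p) x1" using T1[of "-1" x1] x1 by simp
    also have "\<dots> \<le> V.T (\<lambda>t. y (-1) t powr p) r"
      by (rule V.T_nonneg_mono[OF hc]) (use r x1 False kernel_F_nonneg in auto)
    finally show ?thesis by simp
  qed
  have yle: "y (-1) r \<le> y 1 r" if "r \<le> x1" for r
  proof (cases "r \<le> r0")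
    case False
    then have "barrier_fun (-1) r \<le> barrier_fun 1 r" by (simp add: barrier_fun_def)
    then show ?thesis using False yx that psi(5)[of r] x1 by (simp add: z_def divide_right_mono)
  qed (simp add: y_def)
  obtain v where v: "continuous_on {r0..<R} v" "\<And>r. r0 \<le> r \<Longrightarrow> r < R \<Longrightarrow> y (-1) r \<le> v r"
    "\<And>r. r0 \<le> r \<Longrightarrow> r < R \<Longrightarrow> v r = 0 + V.T (\<lambda>t. v t powr p) r"
    "\<And>r1 V r. r1 < R \<Longrightarrow> continuous_on {r0..<R} V \<Longrightarrow> (\<And>r. r0 \<le> r \<Longrightarrow> r < R \<Longrightarrow> 0 \<le> V r) \<Longrightarrow>
       (\<And>r. r0 \<le> r \<Longrightarrow> r \<le> r1 \<Longrightarrow> y (-1) r \<le> V r) \<Longrightarrow>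
       (\<And>r. r0 \<le> r \<Longrightarrow> r \<le> r1 \<Longrightarrow> 0 + V.T (\<lambda>t. V t powr p) r \<le> V r) \<Longrightarrow> r0 \<le> r \<Longrightarrow> r \<le> r1 \<Longrightarrow> v r \<le> V r"
    by (rule V.sublinear_exists[OF _ p yc, of "-1" 0]) (use kernel_F_nonneg ynn sub in auto)
  \<comment> \<open>The upper barrier is known to be a supersolution only up to \<open>x1\<close>;
    this is the case for which \<open>sublinear_exists\<close> states minimality on an initial
    interval.\<close>
  have vle: "v r \<le> y 1 r" if r: "r0 \<le> r" "r \<le> x1" for r
  proof (rule v(4)[OF x1(2) yc _ yle _ r])
    fix s assume s: "r0 \<le> s" "s \<le> x1"
    show "0 + V.T (\<lambda>t. y 1 t powr p) s \<le> y 1 s"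
      using T1[of 1 s] s by (cases "s = r0") (auto simp: y_def)
  qed (use ynn in auto)
  have vnn: "0 \<le> v r" if "r0 \<le> r" "r < R" for r using v(2)[OF that] ynn[of "-1" r] by auto
  have vp: "0 < v r" if r: "r0 < r" "r < R" for r
  proof -
    have "0 < y (-1) r" using zpos[of "-1" "min r x1"] r x1 by (simp add: y_def min_def)
    then show ?thesis using v(2)[of r] r by auto
  qed
  obtain J where J: "sol r0 R (\<lambda>r. \<psi> r * v r) (\<lambda>r. d r * v r + J r / (w r * \<psi> r))"
    "\<exists>L>0. ((\<lambda>r. \<psi> r * v r / (R - r) powr bm) \<longlongrightarrow> L) (at_left R)"
    by (rule fixed_point_sol[OF V _ r0R psi(1,5,7,8) v(1,3) vnn vp]) auto
  have bl: "((\<lambda>r. barrier_coeff + \<tau> * (r - r0) powr (1/2)) \<longlongrightarrow> barrier_coeff) (at_right r0)" for \<tau>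
  proof -
    have "((\<lambda>r. barrier_coeff + \<tau> * (r - r0) powr (1/2)) \<longlongrightarrow> barrier_coeff + \<tau> * 0) (at_right r0)"
      by (intro tendsto_intros powr_tendsto_0_right) auto
    then show ?thesis by simp
  qed
  have bq: "barrier_fun \<tau> r / (r - r0) powr \<alpha> = barrier_coeff + \<tau> * (r - r0) powr (1/2)" if "r0 < r" for \<tau> r
    using that by (simp add: barrier_fun_def powr_add add_divide_distrib)
  have near: "\<forall>\<^sub>F r in at_right r0. r0 < r \<and> r < x1"
    unfolding eventually_at_right_field using x1 by (intro exI[of _ x1]) auto
  have "((\<lambda>r. \<psi> r * v r / (r - r0) powr \<alpha>) \<longlongrightarrow> barrier_coeff) (at_right r0)"
  proof (rule tendsto_sandwich[OF _ _ bl[of "-1"] bl[of 1]])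
    show "\<forall>\<^sub>F r in at_right r0. barrier_coeff + - 1 * (r - r0) powr (1/2) \<le> \<psi> r * v r / (r - r0) powr \<alpha>"
      using near
    proof eventually_elim
      case (elim r)
      have "barrier_fun (-1) r \<le> \<psi> r * v r"
        using v(2)[of r] yx[of r "-1"] psi(5)[of r] elim x1 by (simp add: z_def field_simps)
      then have "barrier_fun (-1) r / (r - r0) powr \<alpha> \<le> \<psi> r * v r / (r - r0) powr \<alpha>" by (simp add: divide_right_mono)
      then show ?case using bq[of r "-1"] elim by simp
    qed
    show "\<forall>\<^sub>F r in at_right r0. \<psi> r * v r / (r - r0) powr \<alpha> \<le> barrier_coeff + 1 * (r - r0) powr (1/2)"
      using near
    proof eventually_elim
      case (elim r)
      have "\<psi> r * v r \<le> barrier_fun 1 r"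
        using vle[of r] yx[of r 1] psi(5)[of r] elim x1 by (simp add: z_def field_simps)
      then have "\<psi> r * v r / (r - r0) powr \<alpha> \<le> barrier_fun 1 r / (r - r0) powr \<alpha>" by (simp add: divide_right_mono)
      then show ?case using bq[of r 1] elim by simp
    qed
  qed
  with J show ?thesis using that by blast
qed

text \<open>A linear solution with value 1 and slope 0 at \<open>c\<close> turns the value
  \<open>u0\<close> with slope 0 into the value \<open>u0\<close> with zero flux for the quotient,
  and the constant \<open>u0\<close> is a subsolution of the Volterra equation. Only the part right
  of \<open>c\<close> is treated; the other part follows by reflection.\<close>

lemma regular_start_exists:
  assumes c: "r0 < c" "c < R" and l: "lin r0 R \<phi> d\<phi>" "\<And>r. r0 < r \<Longrightarrow> r < R \<Longrightarrow> 0 < \<phi> r"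
    and k: "0 < k" "((\<lambda>r. \<phi> r / (R - r) powr bm) \<longlongrightarrow> k) (at_left R)"
    and n: "\<phi> c = 1" "d\<phi> c = 0" and u0: "0 < u0"
  obtains u d where "sol c R u d" "\<And>r. c < r \<Longrightarrow> r < R \<Longrightarrow> 0 < u r"
    "(u \<longlongrightarrow> u0) (at_right c)" "(d \<longlongrightarrow> 0) (at_right c)"
    "\<exists>L>0. ((\<lambda>r. u r / (R - r) powr bm) \<longlongrightarrow> L) (at_left R)"
proof -
  have V: "volterra c R (kernel_E \<phi>) (kernel_F \<phi>)" by (rule volterra_regular[OF l c])
  interpret V: volterra c R "kernel_E \<phi>" "kernel_F \<phi>" by (rule V)
  have sub: "u0 \<le> u0 + V.T (\<lambda>t. u0 powr p) r" if r: "c \<le> r" "r < R" for r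
    using V.T_nonneg_mono[of "\<lambda>t. u0 powr p" c r] r kernel_F_nonneg c by auto
  obtain v where v: "continuous_on {c..<R} v" "\<And>r. c \<le> r \<Longrightarrow> r < R \<Longrightarrow> u0 \<le> v r"
    "\<And>r. c \<le> r \<Longrightarrow> r < R \<Longrightarrow> v r = u0 + V.T (\<lambda>t. v t powr p) r"
    by (rule V.sublinear_exists[OF _ p, of "\<lambda>_. u0" u0]) (use kernel_F_nonneg c u0 sub in auto)
  have vp: "0 \<le> v r" "0 < v r" if "c \<le> r" "r < R" for r using v(2)[OF that] u0 by auto
  have lc: "lin c R \<phi> d\<phi>" using l(1) c unfolding lin_sol_def by auto
  have pc: "0 < \<phi> r" if "c < r" "r < R" for r using l(2) that c by auto
  obtain J where J: "sol c R (\<lambda>r. \<phi> r * v r) (\<lambda>r. d\<phi> r * v r + J r / (w r * \<phi> r))"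
    "(v \<longlongrightarrow> u0) (at_right c)" "(J \<longlongrightarrow> 0) (at_right c)"
    "\<exists>L>0. ((\<lambda>r. \<phi> r * v r / (R - r) powr bm) \<longlongrightarrow> L) (at_left R)"
    by (rule fixed_point_sol[OF V _ c(2) lc pc k v(1,3) vp(1)]) (use vp c in auto)
  show ?thesis
    by (rule that[OF J(1) _ _ _ J(4)])
      (use vp pc n regular_limits[OF l(1) l(2)[OF c] c J(2,3)] in auto)
qed

lemma regular_unique_le:
  assumes c: "r0 < c" "c < R" and l: "lin r0 R \<phi> d\<phi>" "\<And>r. r0 < r \<Longrightarrow> r < R \<Longrightarrow> 0 < \<phi> r"
    and n: "\<phi> c = 1" "d\<phi> c = 0" and u0: "0 < u0"
    and s: "sol r0 R u1 d1" "sol r0 R u2 d2" and i: "u1 c = u0" "u2 c = u0" "d1 c = 0" "d2 c = 0"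
    and pos: "\<And>r. r0 < r \<Longrightarrow> r < R \<Longrightarrow> 0 < u1 r" "\<And>r. r0 < r \<Longrightarrow> r < R \<Longrightarrow> 0 < u2 r"
    and r: "c \<le> r" "r < R"
  shows "u1 r \<le> u2 r"
proof (cases "r = c")
  case False
  have wc: "0 < w c" using w_pos[of c] c by auto
  have lim: "((\<lambda>r. u r / \<phi> r) \<longlongrightarrow> u0) (at_right c)"
    "((\<lambda>r. w r * d r * \<phi> r - u r * (w r * d\<phi> r)) \<longlongrightarrow> 0) (at_right c)"
    "(u \<longlongrightarrow> u0) (at_right c)"
    if "sol r0 R u d" "u c = u0" "d c = 0" for u d
  proof -
    note vj = sol_quotient_derivs[OF that(1) l(1) l(2)[OF c] wc c]
    show "((\<lambda>r. u r / \<phi> r) \<longlongrightarrow> u0) (at_right c)"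
      using isCont_tendsto_within[OF DERIV_isCont[OF vj(1)]] that n by simp
    show "((\<lambda>r. w r * d r * \<phi> r - u r * (w r * d\<phi> r)) \<longlongrightarrow> 0) (at_right c)"
      using isCont_tendsto_within[OF DERIV_isCont[OF vj(2)]] that n by simp
    have "isCont u c" using that(1) c unfolding ode_sol_def by (auto intro: DERIV_isCont)
    from isCont_tendsto_within[OF this] show "(u \<longlongrightarrow> u0) (at_right c)" using that by simp
  qed
  note l1 = lim[OF s(1) i(1,3)] and l2 = lim[OF s(2) i(2,4)]
  have "u0 / 2 < u0" "u0 < 2 * u0" using u0 by auto
  from order_tendstoD(1)[OF l2(3) this(1)] order_tendstoD(2)[OF l1(3) this(2)]
  have ev: "\<forall>\<^sub>F r in at_right c. u1 r \<le> 4 * u2 r" by eventually_elim auto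
  have sc: "sol c R u1 d1" "sol c R u2 d2" "lin c R \<phi> d\<phi>" using s l c unfolding ode_sol_def lin_sol_def by auto
  show ?thesis
    by (rule compare_via[OF sc(1,2) _ c(2) sc(3) _ _ _ _ l1(1) l2(1) l1(2) l2(2) ev]) (use c l(2) pos u0 r False in auto)
qed (use i in simp)

text \<open>For \<open>\<mu> < 0\<close> the product \<open>w * d\<close> is nondecreasing. If
  \<open>d r \<le> 0\<close>, then \<open>d \<le> 0\<close> all the way from \<open>r0\<close> to
  \<open>r\<close>, and \<phi>, starting from 0, could not be positive.\<close>

lemma lin_increasing:
  assumes neg: "\<mu> < 0" and l: "lin r0 R \<phi> d" "\<And>r. r0 < r \<Longrightarrow> r < R \<Longrightarrow> 0 < \<phi> r"
    and lim: "(\<phi> \<longlongrightarrow> 0) (at_right r0)" and r: "r0 < r" "r < R"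
  shows "0 < d r"
proof (rule ccontr)
  assume n: "\<not> 0 < d r"
  have wd: "w s * d s \<le> w r * d r" if s: "r0 < s" "s \<le> r" for s
  proof (rule DERIV_nonneg_le[where f="\<lambda>r. w r * d r", OF s(2)])
    fix z assume z: "s \<le> z" "z \<le> r"
    then show "((\<lambda>r. w r * d r) has_real_derivative - (w z * \<mu> / (\<delta> z)\<^sup>2 * \<phi> z)) (at z)"
      using l(1) s r unfolding lin_sol_def by auto
    have "w z * \<mu> \<le> 0" using w_pos[of z] z s r neg by (simp add: mult_nonneg_nonpos)
    then have "w z * \<mu> / (\<delta> z)\<^sup>2 * \<phi> z \<le> 0"
      by (rule mult_nonpos_nonneg[OF divide_nonpos_nonneg]) (use l(2)[of z] z s r in auto)
    then show "0 \<le> - (w z * \<mu> / (\<delta> z)\<^sup>2 * \<phi> z)" by simp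
  qed
  have "0 \<le> - \<phi> r"
  proof (rule limit_le_of_deriv[OF _ _ _ r(1), where f="\<lambda>r. - \<phi> r" and f'="\<lambda>r. - d r"])
    show "((\<lambda>r. - \<phi> r) \<longlongrightarrow> 0) (at_right r0)" using tendsto_minus[OF lim] by simp
    fix z assume z: "r0 < z" "z \<le> r"
    show "((\<lambda>r. - \<phi> r) has_real_derivative - d z) (at z)"
      using l(1) z r unfolding lin_sol_def by (auto intro: DERIV_minus)
    have "w r * d r \<le> 0" using n w_pos[of r] r by (simp add: mult_nonneg_nonpos)
    then have "w z * d z \<le> 0" using wd[OF z] by linarith
    then show "0 \<le> - d z" using w_pos[of z] z r by (simp add: mult_le_0_iff)
  qed
  then show False using l(2)[OF r] by simp
qed

lemma lin_combine:
  assumes "lin a b f df" "lin a b g dg"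
  shows "lin a b (\<lambda>r. A * f r + B * g r) (\<lambda>r. A * df r + B * dg r)"
  unfolding lin_sol_def
proof (intro allI impI conjI)
  fix r assume r: "a < r \<and> r < b"
  then have x: "(f has_real_derivative df r) (at r)" "(g has_real_derivative dg r) (at r)"
    "((\<lambda>r. w r * df r) has_real_derivative - (w r * \<mu> / (\<delta> r)\<^sup>2 * f r)) (at r)"
    "((\<lambda>r. w r * dg r) has_real_derivative - (w r * \<mu> / (\<delta> r)\<^sup>2 * g r)) (at r)"
    using assms unfolding lin_sol_def by auto
  show "((\<lambda>r. A * f r + B * g r) has_real_derivative A * df r + B * dg r) (at r)"
    by (intro DERIV_add DERIV_cmult x)
  have "((\<lambda>r. A * (w r * df r) + B * (w r * dg r)) has_real_derivative
      A * - (w r * \<mu> / (\<delta> r)\<^sup>2 * f r) + B * - (w r * \<mu> / (\<delta> r)\<^sup>2 * g r)) (at r)"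
    by (intro DERIV_add DERIV_cmult x)
  then show "((\<lambda>r. w r * (A * df r + B * dg r)) has_real_derivative
      - (w r * \<mu> / (\<delta> r)\<^sup>2 * (A * f r + B * g r))) (at r)"
    by (simp add: algebra_simps add_divide_distrib)
qed

text \<open>The solution vanishing at \<open>r0\<close> increases and the one vanishing at
  \<open>R\<close> decreases; this is where \<open>\<mu> < 0\<close> enters. Hence a combination
  with positive coefficients is flat at \<open>c\<close>; it inherits positivity, and order
  \<open>bm\<close> at each end from the summand that dominates there.\<close>

lemma flat_linear_exists:
  assumes neg: "\<mu> < 0" and c: "r0 < c" "c < R"
  obtains \<phi> d\<phi> k k' where "lin r0 R \<phi> d\<phi>" "\<And>r. r0 < r \<Longrightarrow> r < R \<Longrightarrow> 0 < \<phi> r" "\<phi> c = 1" "d\<phi> c = 0"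
    "0 < k" "((\<lambda>r. \<phi> r / (R - r) powr bm) \<longlongrightarrow> k) (at_left R)"
    "0 < k'" "((\<lambda>r. \<phi> r / (r - r0) powr bm) \<longlongrightarrow> k') (at_right r0)"
proof -
  obtain \<psi> d \<xi> dx k k' where psi: "lin r0 R \<psi> d" "((\<lambda>r. \<psi> r / (r - r0) powr bp) \<longlongrightarrow> 1) (at_right r0)"
    "\<And>r. r0 < r \<Longrightarrow> r < R \<Longrightarrow> 0 < \<psi> r"
    "0 < k" "((\<lambda>r. \<psi> r / (R - r) powr bm) \<longlongrightarrow> k) (at_left R)"
    and xi: "lin r0 R \<xi> dx" "((\<lambda>r. \<xi> r / (R - r) powr bp) \<longlongrightarrow> 1) (at_left R)"
    "\<And>r. r0 < r \<Longrightarrow> r < R \<Longrightarrow> 0 < \<xi> r"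
    "0 < k'" "((\<lambda>r. \<xi> r / (r - r0) powr bm) \<longlongrightarrow> k') (at_right r0)"
    by (rule principal_pair) blast
  interpret m: annular_pow r0 R \<mu> "\<lambda>r. w (r0 + R - r)" "\<lambda>r. - w' (r0 + R - r)" p by (rule pow_mirror)
  have dp: "0 < d c"
    by (rule lin_increasing[OF neg psi(1,3) tendsto_zero_of_quotient[OF psi(2) powr_tendsto_0_right[OF bp_pos] near_right(2)] c])
  have xz: "(\<xi> \<longlongrightarrow> 0) (at_left R)"
    by (rule tendsto_zero_of_quotient[OF xi(2) powr_tendsto_0_left[OF bp_pos] near_left(2)])
  have "0 < - dx (r0 + R - (r0 + R - c))"
  proof (rule m.lin_increasing[OF neg, where \<phi>="\<lambda>r. \<xi> (r0 + R - r)" and d="\<lambda>r. - dx (r0 + R - r)"])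
    show "lin_sol r0 R \<mu> (\<lambda>r. w (r0 + R - r)) r0 R (\<lambda>r. \<xi> (r0 + R - r)) (\<lambda>r. - dx (r0 + R - r))"
      using lin_sol_mirror[OF xi(1)] by simp
    show "((\<lambda>r. \<xi> (r0 + R - r)) \<longlongrightarrow> 0) (at_right r0)"
      using filterlim_compose[OF xz] mirror_left[of "r0 + R" r0] by simp
  qed (use xi(3) c in auto)
  then have dxn: "dx c < 0" by simp
  define D where "D = d c * \<xi> c - \<psi> c * dx c"
  have "\<psi> c * dx c < 0" "0 < d c * \<xi> c"
    using dp dxn psi(3)[OF c] xi(3)[OF c] by (auto intro: mult_pos_neg mult_pos_pos)
  then have D: "0 < D" by (simp add: D_def)
  \<comment> \<open>Cramer's rule for value 1 and slope 0 at \<open>c\<close>; the determinant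
    \<open>D\<close> is positive because the slopes have opposite signs.\<close>
  define A where "A = - dx c / D"
  define B where "B = d c / D"
  have AB: "0 < A" "0 < B" using D dp dxn by (auto simp: A_def B_def divide_neg_pos)
  define \<phi> where "\<phi> r = A * \<psi> r + B * \<xi> r" for r
  define d\<phi> where "d\<phi> r = A * d r + B * dx r" for r
  have "lin r0 R \<phi> d\<phi>" unfolding \<phi>_def[abs_def] d\<phi>_def[abs_def] by (rule lin_combine[OF psi(1) xi(1)])
  moreover have "0 < \<phi> r" if "r0 < r" "r < R" for r using AB psi(3)[OF that] xi(3)[OF that] by (simp add: \<phi>_def add_pos_pos)
  moreover have "\<phi> c = 1"
  proof -
    have "\<phi> c = D / D" by (simp add: \<phi>_def A_def B_def D_def field_simps)
    then show ?thesis using D by simp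
  qed
  moreover have "d\<phi> c = 0" by (simp add: d\<phi>_def A_def B_def)
  moreover have "((\<lambda>r. \<phi> r / (R - r) powr bm) \<longlongrightarrow> A * k) (at_left R)"
  proof -
    have "((\<lambda>r. A * (\<psi> r / (R - r) powr bm) + B * (\<xi> r / (R - r) powr bp * (R - r) powr (bp - bm))) \<longlongrightarrow>
        A * k + B * (1 * 0)) (at_left R)"
      using bp_gt bpm by (intro tendsto_intros psi xi powr_tendsto_0_left) auto
    then have "((\<lambda>r. A * (\<psi> r / (R - r) powr bm) + B * (\<xi> r / (R - r) powr bp * (R - r) powr (bp - bm))) \<longlongrightarrow> A * k) (at_left R)" by simp
    then show ?thesis
      by (rule Lim_transform_eventually[OF _ eventually_mono[OF near_left(1)]])
        (auto simp: \<phi>_def add_divide_distrib powr_diff)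
  qed
  moreover have "((\<lambda>r. \<phi> r / (r - r0) powr bm) \<longlongrightarrow> B * k') (at_right r0)"
  proof -
    have "((\<lambda>r. A * (\<psi> r / (r - r0) powr bp * (r - r0) powr (bp - bm)) + B * (\<xi> r / (r - r0) powr bm)) \<longlongrightarrow>
        A * (1 * 0) + B * k') (at_right r0)"
      using bp_gt bpm by (intro tendsto_intros psi xi powr_tendsto_0_right) auto
    then have "((\<lambda>r. A * (\<psi> r / (r - r0) powr bp * (r - r0) powr (bp - bm)) + B * (\<xi> r / (r - r0) powr bm)) \<longlongrightarrow> B * k') (at_right r0)" by simp
    then show ?thesis
      by (rule Lim_transform_eventually[OF _ eventually_mono[OF near_right(1)]])
        (auto simp: \<phi>_def add_divide_distrib powr_diff)
  qed
  ultimately show ?thesis using that[of \<phi> d\<phi> "A * k" "B * k'"] AB psi(4) xi(4) by auto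
qed

end

context annular_pow
begin

text \<open>The left half is the right half of the reflected problem. A zero slope stays zero under
  reflection, so the halves match to first order at \<open>c\<close>.\<close>

lemma flat_start_exists:
  assumes neg: "\<mu> < 0" and c: "r0 < c" "c < R" and u0: "0 < u0"
  obtains u d where "sol r0 R u d" "\<And>r. r0 < r \<Longrightarrow> r < R \<Longrightarrow> 0 < u r" "u c = u0" "d c = 0"
    "\<exists>L>0. ((\<lambda>r. u r / (R - r) powr bm) \<longlongrightarrow> L) (at_left R)"
    "\<exists>L>0. ((\<lambda>r. u r / (r - r0) powr bm) \<longlongrightarrow> L) (at_right r0)"
proof -
  interpret m: annular_pow r0 R \<mu> "\<lambda>r. w (r0 + R - r)" "\<lambda>r. - w' (r0 + R - r)" p by (rule pow_mirror)
  obtain \<phi> d\<phi> k k' where phi: "lin r0 R \<phi> d\<phi>" "\<And>r. r0 < r \<Longrightarrow> r < R \<Longrightarrow> 0 < \<phi> r" "\<phi> c = 1" "d\<phi> c = 0"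
    "0 < k" "((\<lambda>r. \<phi> r / (R - r) powr bm) \<longlongrightarrow> k) (at_left R)"
    "0 < k'" "((\<lambda>r. \<phi> r / (r - r0) powr bm) \<longlongrightarrow> k') (at_right r0)"
    by (rule flat_linear_exists[OF neg c]) blast
  obtain ur dr where ur: "sol c R ur dr" "\<And>r. c < r \<Longrightarrow> r < R \<Longrightarrow> 0 < ur r"
    "(ur \<longlongrightarrow> u0) (at_right c)" "(dr \<longlongrightarrow> 0) (at_right c)"
    "\<exists>L>0. ((\<lambda>r. ur r / (R - r) powr bm) \<longlongrightarrow> L) (at_left R)"
    by (rule regular_start_exists[OF c phi(1,2,5,6,3,4) u0]) blast+
  define c' where "c' = r0 + R - c"
  have c': "r0 < c'" "c' < R" using c by (auto simp: c'_def)
  have L: "filterlim (\<lambda>r. r0 + R - r) (at_right r0) (at_left R)" "filterlim (\<lambda>r. r0 + R - r) (at_left R) (at_right r0)"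
    "filterlim (\<lambda>r. r0 + R - r) (at_right c') (at_left c)"
    using mirror_right[of "r0 + R" R] mirror_left[of "r0 + R" r0] mirror_right[of "r0 + R" c] by (auto simp: c'_def)
  obtain ul dl where ul: "ode_sol r0 R \<mu> p (\<lambda>r. w (r0 + R - r)) c' R ul dl" "\<And>r. c' < r \<Longrightarrow> r < R \<Longrightarrow> 0 < ul r"
    "(ul \<longlongrightarrow> u0) (at_right c')" "(dl \<longlongrightarrow> 0) (at_right c')"
    "\<exists>L>0. ((\<lambda>r. ul r / (R - r) powr bm) \<longlongrightarrow> L) (at_left R)"
  proof (rule m.regular_start_exists[OF c', where \<phi>="\<lambda>r. \<phi> (r0 + R - r)" and d\<phi>="\<lambda>r. - d\<phi> (r0 + R - r)" and k=k' and ?u0.0=u0])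
    show "lin_sol r0 R \<mu> (\<lambda>r. w (r0 + R - r)) r0 R (\<lambda>r. \<phi> (r0 + R - r)) (\<lambda>r. - d\<phi> (r0 + R - r))"
      using lin_sol_mirror[OF phi(1)] by simp
    show "((\<lambda>r. \<phi> (r0 + R - r) / (R - r) powr bm) \<longlongrightarrow> k') (at_left R)"
      using filterlim_compose[OF phi(8) L(1)] by simp
  qed (use phi u0 in \<open>auto simp: c'_def\<close>)
  define u where "u r = (if r < c then ul (r0 + R - r) else if r = c then u0 else ur r)" for r
  define d where "d r = (if r < c then - dl (r0 + R - r) else if r = c then 0 else dr r)" for r
  have "sol (r0 + R - R) (r0 + R - c') (\<lambda>r. ul (r0 + R - r)) (\<lambda>r. - dl (r0 + R - r))"
    using ode_sol_mirror[OF ul(1)] by simp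
  then have "sol r0 c (\<lambda>r. ul (r0 + R - r)) (\<lambda>r. - dl (r0 + R - r))" by (simp add: c'_def)
  then have s1: "sol r0 c u d" by (rule sol_cong) (auto simp: u_def d_def)
  have s2: "sol c R u d" by (rule sol_cong[OF ur(1)]) (auto simp: u_def d_def)
  have ev: "\<forall>\<^sub>F r in at_right c. c < r" by (rule eventually_at_right_less)
  have evl: "\<forall>\<^sub>F r in at_left c. r < c" unfolding eventually_at_left_field using c by blast
  have cu: "isCont u c"
  proof (rule isCont_sides)
    have "((\<lambda>r. ul (r0 + R - r)) \<longlongrightarrow> u0) (at_left c)" by (rule filterlim_compose[OF ul(3) L(3)])
    then have "(u \<longlongrightarrow> u0) (at_left c)"
      by (rule Lim_transform_eventually[OF _ eventually_mono[OF evl]]) (auto simp: u_def)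
    then show "(u \<longlongrightarrow> u c) (at_left c)" by (simp add: u_def)
    have "(u \<longlongrightarrow> u0) (at_right c)"
      by (rule Lim_transform_eventually[OF ur(3) eventually_mono[OF ev]]) (auto simp: u_def)
    then show "(u \<longlongrightarrow> u c) (at_right c)" by (simp add: u_def)
  qed
  have cd: "isCont d c"
  proof (rule isCont_sides)
    have "((\<lambda>r. - dl (r0 + R - r)) \<longlongrightarrow> - 0) (at_left c)" by (intro tendsto_minus filterlim_compose[OF ul(4) L(3)])
    then have "(d \<longlongrightarrow> - 0) (at_left c)"
      by (rule Lim_transform_eventually[OF _ eventually_mono[OF evl]]) (auto simp: d_def)
    then show "(d \<longlongrightarrow> d c) (at_left c)" by (simp add: d_def)
    have "(d \<longlongrightarrow> 0) (at_right c)"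
      by (rule Lim_transform_eventually[OF ur(4) eventually_mono[OF ev]]) (auto simp: d_def)
    then show "(d \<longlongrightarrow> d c) (at_right c)" by (simp add: d_def)
  qed
  have "sol r0 R u d" by (rule glue_sol[OF c s1 s2 _ cu cd]) (use u0 in \<open>simp add: u_def\<close>)
  moreover have "0 < u r" if "r0 < r" "r < R" for r
    using ul(2)[of "r0 + R - r"] ur(2)[of r] u0 that by (auto simp: u_def c'_def)
  moreover have "\<exists>L>0. ((\<lambda>r. u r / (R - r) powr bm) \<longlongrightarrow> L) (at_left R)"
  proof -
    obtain L where L: "0 < L" "((\<lambda>r. ur r / (R - r) powr bm) \<longlongrightarrow> L) (at_left R)" using ur(5) by auto
    have "\<forall>\<^sub>F r in at_left R. c < r" unfolding eventually_at_left_field using c by blast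
    then have "((\<lambda>r. u r / (R - r) powr bm) \<longlongrightarrow> L) (at_left R)"
      by (intro Lim_transform_eventually[OF L(2)]) (auto simp: u_def elim!: eventually_mono)
    then show ?thesis using L by blast
  qed
  moreover have "\<exists>L>0. ((\<lambda>r. u r / (r - r0) powr bm) \<longlongrightarrow> L) (at_right r0)"
  proof -
    obtain K where K: "0 < K" "((\<lambda>r. ul r / (R - r) powr bm) \<longlongrightarrow> K) (at_left R)" using ul(5) by auto
    have l: "((\<lambda>r. ul (r0 + R - r) / (r - r0) powr bm) \<longlongrightarrow> K) (at_right r0)"
      using filterlim_compose[OF K(2) L(2)] by simp
    have "\<forall>\<^sub>F r in at_right r0. r < c" unfolding eventually_at_right_field using c by blast
    then have "((\<lambda>r. u r / (r - r0) powr bm) \<longlongrightarrow> K) (at_right r0)"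
      by (intro Lim_transform_eventually[OF l]) (auto simp: u_def elim!: eventually_mono)
    then show ?thesis using K by blast
  qed
  ultimately show ?thesis by (intro that[of u d]) (auto simp: u_def d_def)
qed

lemma flat_start_unique_le:
  assumes neg: "\<mu> < 0" and c: "r0 < c" "c < R" and u0: "0 < u0"
    and s: "sol r0 R u1 d1" "sol r0 R u2 d2" and i: "u1 c = u0" "u2 c = u0" "d1 c = 0" "d2 c = 0"
    and pos: "\<And>r. r0 < r \<Longrightarrow> r < R \<Longrightarrow> 0 < u1 r" "\<And>r. r0 < r \<Longrightarrow> r < R \<Longrightarrow> 0 < u2 r"
    and r: "r0 < r" "r < R"
  shows "u1 r \<le> u2 r"
proof -
  interpret m: annular_pow r0 R \<mu> "\<lambda>r. w (r0 + R - r)" "\<lambda>r. - w' (r0 + R - r)" p by (rule pow_mirror)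
  obtain \<phi> d\<phi> where phi: "lin r0 R \<phi> d\<phi>" "\<And>r. r0 < r \<Longrightarrow> r < R \<Longrightarrow> 0 < \<phi> r" "\<phi> c = 1" "d\<phi> c = 0"
    by (rule flat_linear_exists[OF neg c]) blast
  show ?thesis
  proof (cases "c \<le> r")
    case True
    show ?thesis by (rule regular_unique_le[OF c phi u0 s i pos True r(2)])
  next
    case False
    have "(\<lambda>r. u1 (r0 + R - r)) (r0 + R - r) \<le> (\<lambda>r. u2 (r0 + R - r)) (r0 + R - r)"
    proof (rule m.regular_unique_le[of "r0 + R - c" "\<lambda>r. \<phi> (r0 + R - r)" "\<lambda>r. - d\<phi> (r0 + R - r)" u0
          "\<lambda>r. u1 (r0 + R - r)" "\<lambda>r. - d1 (r0 + R - r)" "\<lambda>r. u2 (r0 + R - r)" "\<lambda>r. - d2 (r0 + R - r)"])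
      show "lin_sol r0 R \<mu> (\<lambda>r. w (r0 + R - r)) r0 R (\<lambda>r. \<phi> (r0 + R - r)) (\<lambda>r. - d\<phi> (r0 + R - r))"
        using lin_sol_mirror[OF phi(1)] by simp
      show "ode_sol r0 R \<mu> p (\<lambda>r. w (r0 + R - r)) r0 R (\<lambda>r. u1 (r0 + R - r)) (\<lambda>r. - d1 (r0 + R - r))"
        using ode_sol_mirror[OF s(1)] by simp
      show "ode_sol r0 R \<mu> p (\<lambda>r. w (r0 + R - r)) r0 R (\<lambda>r. u2 (r0 + R - r)) (\<lambda>r. - d2 (r0 + R - r))"
        using ode_sol_mirror[OF s(2)] by simp
    qed (use c phi u0 i pos r False in auto)
    then show ?thesis by simp
  qed
qed

end

section \<open>Radial functions\<close>

lemma partial_eqI: "(f has_derivative f') (at x) \<Longrightarrow> partial b f x = f' b"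
  unfolding partial_def by (metis frechet_derivative_at)

lemma open_annulus: "open (annulus r0 R :: 'a::euclidean_space set)"
proof -
  have "annulus r0 R = {x::'a. r0 < norm x} \<inter> {x. norm x < R}" by (auto simp: annulus_def)
  then show ?thesis by (auto intro!: open_Collect_less continuous_intros)
qed

lemma has_derivative_radial:
  fixes x :: "'a::euclidean_space"
  assumes "x \<noteq> 0" "(u has_real_derivative D) (at (norm x))"
  shows "((\<lambda>x. u (norm x)) has_derivative (\<lambda>h. D * ((x \<bullet> h) / norm x))) (at x)"
proof -
  have n: "(norm has_derivative (\<lambda>h. h \<bullet> sgn x)) (at x)" by (rule has_derivative_norm[OF assms(1)])
  have "((\<lambda>x. u (norm x)) has_derivative (\<lambda>h. D * (h \<bullet> sgn x))) (at x)"
    using has_derivative_compose[OF n assms(2)[unfolded has_field_derivative_def]] by simp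
  then show ?thesis by (simp add: sgn_div_norm inner_commute field_simps)
qed

text \<open>A partial derivative of a radial function is the radial function \<open>d r / r\<close>
  times the coordinate \<open>x \<bullet> b\<close>, to which the product rule applies.\<close>

lemma second_radial:
  fixes x :: "'a::euclidean_space"
  assumes S: "x \<in> annulus r0 R" "0 < r0"
    and d: "\<And>r. r0 < r \<Longrightarrow> r < R \<Longrightarrow> (u has_real_derivative d r) (at r)"
    and d2: "(d has_real_derivative D) (at (norm x))"
  shows "((partial b (\<lambda>x::'a. u (norm x))) has_derivative
      (\<lambda>h. (D - d (norm x) / norm x) / norm x * ((x \<bullet> h) / norm x) * (x \<bullet> b) + d (norm x) / norm x * (h \<bullet> b))) (at x)"
proof -
  have x: "r0 < norm x" "norm x < R" "x \<noteq> 0" using S by (auto simp: annulus_def)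
  have "((\<lambda>r. d r / r) has_real_derivative (D - d (norm x) / norm x) / norm x) (at (norm x))"
    by (rule DERIV_cong[OF DERIV_divide[OF d2 DERIV_ident]]) (use x in \<open>auto simp: field_simps\<close>)
  from has_derivative_radial[OF x(3) this]
  have q: "((\<lambda>x. d (norm x) / norm x) has_derivative
      (\<lambda>h. (D - d (norm x) / norm x) / norm x * ((x \<bullet> h) / norm x))) (at x)" .
  have i: "((\<lambda>x. x \<bullet> b) has_derivative (\<lambda>h. h \<bullet> b)) (at x)" by (auto intro!: derivative_eq_intros)
  have "((\<lambda>x. d (norm x) / norm x * (x \<bullet> b)) has_derivative
      (\<lambda>h. d (norm x) / norm x * (h \<bullet> b) + (D - d (norm x) / norm x) / norm x * ((x \<bullet> h) / norm x) * (x \<bullet> b))) (at x)"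
    by (rule has_derivative_mult[OF q i])
  then have "((partial b (\<lambda>x::'a. u (norm x))) has_derivative
      (\<lambda>h. d (norm x) / norm x * (h \<bullet> b) + (D - d (norm x) / norm x) / norm x * ((x \<bullet> h) / norm x) * (x \<bullet> b))) (at x)"
  proof (rule has_derivative_transform_within_open[OF _ open_annulus S(1)])
    fix y :: 'a assume y: "y \<in> annulus r0 R"
    then have "(u has_real_derivative d (norm y)) (at (norm y))" "y \<noteq> 0" using d S by (auto simp: annulus_def)
    from partial_eqI[OF has_derivative_radial[OF this(2,1)]]
    show "d (norm y) / norm y * (y \<bullet> b) = partial b (\<lambda>x. u (norm x)) y" by simp
  qed
  then show ?thesis by (simp add: add.commute)
qed

lemma laplacian_radial:
  fixes x :: "'a::euclidean_space"
  assumes S: "x \<in> annulus r0 R" "0 < r0"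
    and d: "\<And>r. r0 < r \<Longrightarrow> r < R \<Longrightarrow> (u has_real_derivative d r) (at r)"
    and d2: "(d has_real_derivative D) (at (norm x))"
  shows "laplacian (\<lambda>x::'a. u (norm x)) x = D + real (DIM('a) - 1) / norm x * d (norm x)"
proof -
  have x: "0 < norm x" using S by (auto simp: annulus_def)
  define q where "q = (D - d (norm x) / norm x) / norm x"
  have "laplacian (\<lambda>x::'a. u (norm x)) x =
      (\<Sum>b\<in>Basis. q * ((x \<bullet> b) / norm x) * (x \<bullet> b) + d (norm x) / norm x * (b \<bullet> b))"
    unfolding laplacian_def q_def by (intro sum.cong refl partial_eqI[OF second_radial[OF S d d2]])
  also have "\<dots> = q / norm x * (\<Sum>b\<in>Basis. (x \<bullet> b) * (x \<bullet> b)) + d (norm x) / norm x * real DIM('a)"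
    by (simp add: sum.distrib sum_distrib_left field_simps)
  also have "(\<Sum>b\<in>Basis. (x \<bullet> b) * (x \<bullet> b)) = (norm x)\<^sup>2"
    by (simp add: euclidean_inner[symmetric] power2_norm_eq_inner)
  also have "q / norm x * (norm x)\<^sup>2 + d (norm x) / norm x * real DIM('a) = D + real (DIM('a) - 1) / norm x * d (norm x)"
    using x DIM_positive[where 'a='a] by (simp add: q_def power2_eq_square of_nat_diff field_simps)
  finally show ?thesis .
qed

lemma weight_deriv:
  assumes "0 < (r::real)"
  shows "((\<lambda>r. r ^ n) has_real_derivative real n / r * r ^ n) (at r)"
  by (rule DERIV_cong[OF DERIV_pow]) (use assms in \<open>cases n; simp\<close>)

lemma weighted_deriv_iff:
  fixes d :: "real \<Rightarrow> real"
  assumes r: "0 < r"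
  shows "((\<lambda>r. r ^ n * d r) has_real_derivative r ^ n * G) (at r) \<longleftrightarrow>
    (d has_real_derivative G - real n / r * d r) (at r)"
proof
  assume "((\<lambda>r. r ^ n * d r) has_real_derivative r ^ n * G) (at r)"
  then have "((\<lambda>r. r ^ n * d r / r ^ n) has_real_derivative G - real n / r * d r) (at r)"
    by (rule DERIV_cong[OF DERIV_divide[OF _ weight_deriv[OF r, of n]]])
      (use r in \<open>simp_all add: field_simps\<close>)
  then show "(d has_real_derivative G - real n / r * d r) (at r)"
    by (rule has_field_derivative_transform_within_open[where S="{0<..}"]) (use r in auto)
next
  assume "(d has_real_derivative G - real n / r * d r) (at r)"
  from DERIV_mult[OF weight_deriv[OF r, of n] this]
  show "((\<lambda>r. r ^ n * d r) has_real_derivative r ^ n * G) (at r)" by (simp add: algebra_simps)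
qed

text \<open>From the annulus to the profile by restriction to the ray through a basis vector, on
  which the norm is the parameter; back by computing partial derivatives, where the equation itself
  supplies the second derivative.\<close>

theorem radial_solution_iff:
  assumes r0: "0 < r0" and p: "0 < p"
  shows "radial_solution TYPE('a::euclidean_space) p \<mu> r0 R u \<longleftrightarrow>
    (\<exists>d. ode_sol r0 R \<mu> p (\<lambda>r. r ^ (DIM('a) - 1)) r0 R u d)"
proof
  let ?U = "\<lambda>x::'a. u (norm x)"
  let ?n = "DIM('a) - 1"
  assume "radial_solution TYPE('a) p \<mu> r0 R u"
  then have C: "Ck_on 2 (annulus r0 R) ?U"
    and eq: "\<And>x. x \<in> annulus r0 R \<Longrightarrow> 0 \<le> ?U x \<and> laplacian ?U x + \<mu> / (annulus_dist r0 R x)\<^sup>2 * ?U x = ?U x powr p"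
    unfolding radial_solution_def nonneg_solution_def by auto
  obtain e :: 'a where e: "e \<in> Basis" using nonempty_Basis by blast
  have ne: "norm e = 1" using e by simp
  have "Ck_on (Suc (Suc 0)) (annulus r0 R) ?U" using C by (simp add: numeral_2_eq_2)
  then have U1: "?U differentiable_on annulus r0 R" and U2: "partial e ?U differentiable_on annulus r0 R"
    using e by auto
  have mem: "r *\<^sub>R e \<in> annulus r0 R" "norm (r *\<^sub>R e) = r" if "r0 < r" "r < R" for r
    using that r0 ne by (auto simp: annulus_def)
  have at: "f differentiable (at x)" if "f differentiable_on annulus r0 R" "x \<in> annulus r0 R" for f :: "'a \<Rightarrow> real" and x
    using that open_annulus by (metis differentiable_on_eq_differentiable_at)
  have line: "((\<lambda>r. r *\<^sub>R e) has_derivative (\<lambda>h. h *\<^sub>R e)) (at r)" for r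
    by (auto intro!: derivative_eq_intros)
  have comp: "((\<lambda>r. f (r *\<^sub>R e)) has_real_derivative partial e f (r *\<^sub>R e)) (at r)"
    if "f differentiable (at (r *\<^sub>R e))" for f :: "'a \<Rightarrow> real" and r
  proof -
    have f: "(f has_derivative frechet_derivative f (at (r *\<^sub>R e))) (at (r *\<^sub>R e))"
      using that frechet_derivative_works by blast
    then have lin: "linear (frechet_derivative f (at (r *\<^sub>R e)))" by (rule has_derivative_linear)
    have "((\<lambda>r. f (r *\<^sub>R e)) has_derivative (\<lambda>h. frechet_derivative f (at (r *\<^sub>R e)) (h *\<^sub>R e))) (at r)"
      by (rule has_derivative_compose[OF line f])
    then show ?thesis unfolding has_field_derivative_def partial_def
      by (simp add: linear_scale[OF lin] mult.commute[of _ "frechet_derivative f (at (r *\<^sub>R e)) e"])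
  qed
  define d where "d r = partial e ?U (r *\<^sub>R e)" for r
  have du: "(u has_real_derivative d r) (at r)" if r: "r0 < r" "r < R" for r
  proof -
    have "((\<lambda>r. ?U (r *\<^sub>R e)) has_real_derivative d r) (at r)"
      unfolding d_def by (rule comp[OF at[OF U1 mem(1)[OF r]]])
    then show ?thesis
      by (rule has_field_derivative_transform_within_open[where S="{0<..}"]) (use r r0 ne in auto)
  qed
  have "ode_sol r0 R \<mu> p (\<lambda>r. r ^ ?n) r0 R u d"
    unfolding ode_sol_def
  proof (intro allI impI)
    fix r assume r: "r0 < r \<and> r < R"
    define x where "x = r *\<^sub>R e"
    have x: "x \<in> annulus r0 R" "norm x = r" using mem[of r] r by (auto simp: x_def)
    obtain D where D: "(d has_real_derivative D) (at r)"
      unfolding d_def using comp[OF at[OF U2]] mem r by blast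
    have L: "laplacian ?U x = D + real ?n / r * d r"
      using laplacian_radial[OF x(1) r0 du, of D] D x(2) by simp
    have "D + real ?n / r * d r + \<mu> / (bdist r0 R r)\<^sup>2 * u r = u r powr p" "0 \<le> u r"
      using eq[OF x(1)] unfolding L annulus_dist_def x(2) bdist_def by auto
    then have "D = (u r powr p - \<mu> / (bdist r0 R r)\<^sup>2 * u r) - real ?n / r * d r" by linarith
    then have "((\<lambda>r. r ^ ?n * d r) has_real_derivative r ^ ?n * (u r powr p - \<mu> / (bdist r0 R r)\<^sup>2 * u r)) (at r)"
      using D weighted_deriv_iff[of r ?n d] r r0 by auto
    then show "0 \<le> u r \<and> (u has_real_derivative d r) (at r) \<and>
      ((\<lambda>r. r ^ ?n * d r) has_real_derivative r ^ ?n * (u r powr p - \<mu> / (bdist r0 R r)\<^sup>2 * u r)) (at r)"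
      using du r \<open>0 \<le> u r\<close> by auto
  qed
  then show "\<exists>d. ode_sol r0 R \<mu> p (\<lambda>r. r ^ ?n) r0 R u d" by blast
next
  let ?U = "\<lambda>x::'a. u (norm x)"
  let ?n = "DIM('a) - 1"
  assume "\<exists>d. ode_sol r0 R \<mu> p (\<lambda>r. r ^ ?n) r0 R u d"
  then obtain d where s: "\<And>r. r0 < r \<Longrightarrow> r < R \<Longrightarrow> 0 \<le> u r" "\<And>r. r0 < r \<Longrightarrow> r < R \<Longrightarrow> (u has_real_derivative d r) (at r)"
    "\<And>r. r0 < r \<Longrightarrow> r < R \<Longrightarrow> ((\<lambda>r. r ^ ?n * d r) has_real_derivative r ^ ?n * (u r powr p - \<mu> / (bdist r0 R r)\<^sup>2 * u r)) (at r)"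
    unfolding ode_sol_def by blast
  \<comment> \<open>The second derivative of \<open>u\<close> as read off from the equation; its
    continuity is what \<open>Ck_on 2\<close> asks for.\<close>
  define D where "D r = u r powr p - \<mu> / (bdist r0 R r)\<^sup>2 * u r - real ?n / r * d r" for r
  have d2: "(d has_real_derivative D r) (at r)" if "r0 < r" "r < R" for r
    using s(3)[OF that] weighted_deriv_iff[of r ?n d] that r0 by (auto simp: D_def)
  have uc: "continuous_on {r0<..<R} u" "continuous_on {r0<..<R} d"
    using DERIV_isCont[OF s(2)] DERIV_isCont[OF d2] by (auto intro!: continuous_at_imp_continuous_on)
  have Dc: "continuous_on {r0<..<R} D"
  proof -
    have "bdist r0 R r \<noteq> 0" if "r \<in> {r0<..<R}" for r using bdist_pos[of r0 r R] that by auto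
    then show ?thesis unfolding D_def
      using uc s(1) p r0
      by (intro continuous_intros continuous_on_powr') (auto simp: bdist_def[abs_def] intro!: continuous_intros)
  qed
  have nx: "r0 < norm x" "norm x < R" "0 < norm x" "x \<noteq> 0" if "x \<in> annulus r0 R" for x :: 'a
    using that r0 by (auto simp: annulus_def)
  have U1: "?U differentiable_on annulus r0 R"
  proof (rule differentiable_at_imp_differentiable_on)
    fix x :: 'a assume x: "x \<in> annulus r0 R"
    show "?U differentiable (at x)"
      using has_derivative_radial[OF nx(4)[OF x] s(2)[OF nx(1,2)[OF x]]] by (rule differentiableI)
  qed
  have P: "((partial b ?U) has_derivative
      (\<lambda>h. (D (norm x) - d (norm x) / norm x) / norm x * ((x \<bullet> h) / norm x) * (x \<bullet> b) + d (norm x) / norm x * (h \<bullet> b))) (at x)"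
    if "x \<in> annulus r0 R" for x b
    by (rule second_radial[OF that r0 s(2) d2]) (use nx[OF that] in auto)
  have U2: "partial b ?U differentiable_on annulus r0 R" for b
    by (rule differentiable_at_imp_differentiable_on) (rule differentiableI[OF P])
  have U3: "continuous_on (annulus r0 R) (partial c (partial b ?U))" for b c :: 'a
  proof -
    have n: "continuous_on (annulus r0 R) (norm :: 'a \<Rightarrow> real)" by (intro continuous_intros)
    have sub: "norm ` (annulus r0 R :: 'a set) \<subseteq> {r0<..<R}" by (auto simp: annulus_def)
    have c1: "continuous_on (annulus r0 R :: 'a set) (\<lambda>x. d (norm x))"
      by (rule continuous_on_compose2[OF uc(2) n sub])
    have c2: "continuous_on (annulus r0 R :: 'a set) (\<lambda>x. D (norm x))"
      by (rule continuous_on_compose2[OF Dc n sub])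
    have "continuous_on (annulus r0 R) (\<lambda>x::'a. (D (norm x) - d (norm x) / norm x) / norm x * ((x \<bullet> c) / norm x) * (x \<bullet> b) + d (norm x) / norm x * (c \<bullet> b))"
      using nx by (intro continuous_intros c1 c2) auto
    then show ?thesis by (rule continuous_on_eq) (simp add: partial_eqI[OF P])
  qed
  have "Ck_on 2 (annulus r0 R) ?U" using U1 U2 U3 by (simp add: numeral_2_eq_2)
  moreover have "0 \<le> ?U x \<and> laplacian ?U x + \<mu> / (annulus_dist r0 R x)\<^sup>2 * ?U x = ?U x powr p"
    if x: "x \<in> annulus r0 R" for x
    using laplacian_radial[OF x r0 s(2) d2] nx[OF x] s(1) by (simp add: D_def annulus_dist_def bdist_def)
  ultimately show "radial_solution TYPE('a) p \<mu> r0 R u"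
    unfolding radial_solution_def nonneg_solution_def by auto
qed

section \<open>Smooth test functions\<close>

lemma Ck_UNIV_Suc: "Ck_on (Suc k) UNIV f \<longleftrightarrow> (\<forall>x. f differentiable (at x)) \<and> (\<forall>b\<in>Basis. Ck_on k UNIV (partial b f))"
  by (simp add: differentiable_on_def)

lemma Ck_UNIV_cont: "Ck_on k UNIV f \<Longrightarrow> continuous_on UNIV f"
  by (cases k) (auto intro: differentiable_imp_continuous_on)

lemma Ck_UNIV_mono: "Ck_on (Suc k) UNIV f \<Longrightarrow> Ck_on k UNIV f"
proof (induction k arbitrary: f)
  case 0 then show ?case using Ck_UNIV_cont[of "Suc 0" f] by simp
next
  case (Suc k)
  have "Ck_on k UNIV (partial b f)" if "b \<in> Basis" for b
    using Suc.prems that by (intro Suc.IH) auto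
  then show ?case using Suc.prems by simp
qed

lemma partial_works: "f differentiable (at x) \<Longrightarrow> (f has_derivative (\<lambda>h. frechet_derivative f (at x) h)) (at x)"
  using frechet_derivative_works by blast

lemma partial_add: "f differentiable (at x) \<Longrightarrow> g differentiable (at x) \<Longrightarrow>
    partial b (\<lambda>x. f x + g x) x = partial b f x + partial b g x"
  using partial_eqI[OF has_derivative_add[OF partial_works partial_works]] by (simp add: partial_def)

lemma partial_mult: "f differentiable (at x) \<Longrightarrow> g differentiable (at x) \<Longrightarrow>
    partial b (\<lambda>x. f x * g x) x = f x * partial b g x + partial b f x * g x"
  using partial_eqI[OF has_derivative_mult[OF partial_works partial_works]] by (simp add: partial_def)

lemma Ck_UNIV_add: "Ck_on k UNIV f \<Longrightarrow> Ck_on k UNIV g \<Longrightarrow> Ck_on k UNIV (\<lambda>x. f x + g x)"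
proof (induction k arbitrary: f g)
  case 0 then show ?case by (auto intro: continuous_intros)
next
  case (Suc k)
  then have d: "f differentiable (at x)" "g differentiable (at x)" for x by (auto simp: Ck_UNIV_Suc simp del: Ck_on.simps(2))
  have "partial b (\<lambda>x. f x + g x) = (\<lambda>x. partial b f x + partial b g x)" for b
    by (rule ext) (rule partial_add[OF d])
  then show ?case using Suc d by (auto simp: Ck_UNIV_Suc simp del: Ck_on.simps(2))
qed

lemma Ck_UNIV_mult: "Ck_on k UNIV f \<Longrightarrow> Ck_on k UNIV g \<Longrightarrow> Ck_on k UNIV (\<lambda>x. f x * g x)"
proof (induction k arbitrary: f g)
  case 0 then show ?case by (auto intro: continuous_intros)
next
  case (Suc k)
  then have d: "f differentiable (at x)" "g differentiable (at x)" for x by (auto simp: Ck_UNIV_Suc simp del: Ck_on.simps(2))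
  have e: "partial b (\<lambda>x. f x * g x) = (\<lambda>x. f x * partial b g x + partial b f x * g x)" for b
    by (rule ext) (rule partial_mult[OF d])
  have "Ck_on k UNIV (partial b (\<lambda>x. f x * g x))" if "b \<in> Basis" for b
  proof -
    have "Ck_on k UNIV f" "Ck_on k UNIV g" using Suc.prems by (auto intro: Ck_UNIV_mono simp del: Ck_on.simps(2))
    moreover have "Ck_on k UNIV (partial b f)" "Ck_on k UNIV (partial b g)" using Suc.prems that by auto
    ultimately show ?thesis unfolding e by (rule_tac Ck_UNIV_add[OF Suc.IH Suc.IH])
  qed
  then show ?case using d by (auto simp: Ck_UNIV_Suc simp del: Ck_on.simps(2))
qed

lemma Ck_UNIV_const: "Ck_on k UNIV (\<lambda>x. c)"
proof (induction k arbitrary: c)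
  case (Suc k)
  have "partial b (\<lambda>x::'a. c) = (\<lambda>x. 0)" for b by (rule ext) (rule partial_eqI, simp)
  then show ?case using Suc by (auto simp: Ck_UNIV_Suc simp del: Ck_on.simps(2))
qed (auto intro: continuous_intros)

lemma Ck_UNIV_inner: "Ck_on k UNIV (\<lambda>x. x \<bullet> b)"
proof (cases k)
  case (Suc j)
  have h: "((\<lambda>x. x \<bullet> b) has_derivative (\<lambda>h. h \<bullet> b)) (at x)" for x by (auto intro!: derivative_eq_intros)
  have "partial c (\<lambda>x. x \<bullet> b) = (\<lambda>x. c \<bullet> b)" for c by (rule ext) (rule partial_eqI[OF h])
  then show ?thesis unfolding Suc Ck_UNIV_Suc using differentiableI[OF h] Ck_UNIV_const by auto
qed (auto intro: continuous_intros)

text \<open>Partial derivatives of a function of \<open>x \<bullet> x\<close> are again such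
  functions times a coordinate. The square of the norm avoids the singularity of the norm at 0, and
  the family \<open>D\<close> lists all successive derivatives so that the induction can step from
  \<open>n\<close> to \<open>Suc n\<close>.\<close>

lemma Ck_UNIV_comp_square:
  fixes D :: "nat \<Rightarrow> real \<Rightarrow> real"
  assumes D: "\<And>n x. (D n has_real_derivative D (Suc n) x) (at x)"
  shows "Ck_on k UNIV (\<lambda>x::'a::euclidean_space. D n (x \<bullet> x))"
proof (induction k arbitrary: n)
  case 0
  have "continuous_on UNIV (D n)" using D by (meson DERIV_continuous_on has_field_derivative_at_within)
  then show ?case by (auto intro!: continuous_on_compose2[of UNIV "D n"] continuous_intros)
next
  case (Suc k)
  have h: "((\<lambda>x::'a. D n (x \<bullet> x)) has_derivative (\<lambda>h. D (Suc n) (x \<bullet> x) * (2 * (x \<bullet> h)))) (at x)" for x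
  proof -
    have "((\<lambda>x::'a. x \<bullet> x) has_derivative (\<lambda>h. 2 * (x \<bullet> h))) (at x)"
      by (auto intro!: derivative_eq_intros simp: inner_commute)
    from has_derivative_compose[OF this D[unfolded has_field_derivative_def]] show ?thesis by simp
  qed
  have p: "partial b (\<lambda>x::'a. D n (x \<bullet> x)) = (\<lambda>x. D (Suc n) (x \<bullet> x) * (2 * (x \<bullet> b)))" for b
    by (rule ext) (rule partial_eqI[OF h])
  show ?case unfolding Ck_UNIV_Suc p
    using differentiableI[OF h] by (auto intro!: Ck_UNIV_mult Suc Ck_UNIV_const Ck_UNIV_inner)
qed

lemma Ck_UNIV_square: "Ck_on k UNIV (\<lambda>x::'a::euclidean_space. x \<bullet> x)"
proof -
  define D :: "nat \<Rightarrow> real \<Rightarrow> real" where "D n s = (if n = 0 then s else if n = 1 then 1 else 0)" for n s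
  have "(D n has_real_derivative D (Suc n) x) (at x)" for n x
    unfolding D_def[abs_def] by (cases "n = 0"; cases "n = 1") auto
  from Ck_UNIV_comp_square[of D, OF this, of k 0] show ?thesis by (simp add: D_def)
qed

lemma Ck_UNIV_polynomial:
  assumes "real_polynomial_function P"
  shows "Ck_on k UNIV (\<lambda>x::'a::euclidean_space. P (x \<bullet> x :: real))"
  using assms
proof (induction rule: real_polynomial_function.induct)
  case (linear f)
  have "f s = f 1 * s" for s using linear_scale[OF bounded_linear.linear[OF linear], of s 1] by (simp add: mult.commute)
  then have "(\<lambda>x::'a. f (x \<bullet> x)) = (\<lambda>x. f 1 * (x \<bullet> x))" by (rule_tac ext)
  then show ?case using Ck_UNIV_mult[OF Ck_UNIV_const Ck_UNIV_square] by simp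
qed (auto intro: Ck_UNIV_mult Ck_UNIV_const Ck_UNIV_add)

subsection \<open>A smooth bump\<close>

text \<open>The n-th derivative of \<open>exp (- 1 / t)\<close> is a polynomial in
  \<open>y = 1 / t\<close> times \<open>exp (- 1 / t)\<close>; differentiation replaces the
  polynomial \<open>P\<close> by \<open>y\<^sup>2 * (P - P')\<close>.\<close>

primrec bump_poly :: "nat \<Rightarrow> real poly" where
  "bump_poly 0 = 1"
| "bump_poly (Suc n) = monom 1 2 * (bump_poly n - pderiv (bump_poly n))"

definition bump :: "nat \<Rightarrow> real \<Rightarrow> real" where
  "bump n t = (if t \<le> 0 then 0 else poly (bump_poly n) (1 / t) * exp (- (1 / t)))"

lemma poly_exp_tendsto_0: "((\<lambda>y. poly P y * exp (- y)) \<longlongrightarrow> (0::real)) at_top"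
proof -
  have "((\<lambda>y. \<Sum>i\<le>degree P. coeff P i * (y ^ i / exp y)) \<longlongrightarrow> (\<Sum>i\<le>degree P. coeff P i * 0)) at_top"
    by (intro tendsto_intros tendsto_power_div_exp_0)
  then show ?thesis by (simp add: poly_altdef sum_distrib_right exp_minus divide_inverse mult.assoc)
qed

lemma bump_tendsto_0: "(bump n \<longlongrightarrow> 0) (at_right 0)"
proof -
  have "((\<lambda>t. poly (bump_poly n) (inverse t) * exp (- inverse t)) \<longlongrightarrow> 0) (at_right 0)"
    by (rule filterlim_compose[OF poly_exp_tendsto_0 filterlim_inverse_at_top_right])
  then show ?thesis
    by (rule Lim_transform_eventually)
      (auto simp: bump_def divide_inverse eventually_at_right_field intro: exI[of _ 1])
qed

text \<open>At 0 the derivative comes from \<open>glue_deriv\<close>: every \<open>bump n\<close> is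
  continuous there, as exponential decay beats each polynomial in \<open>1 / t\<close>.\<close>

lemma bump_deriv: "(bump n has_real_derivative bump (Suc n) t) (at t)"
proof -
  have off: "(bump n has_real_derivative bump (Suc n) t) (at t)" if t: "t \<noteq> 0" for n t
  proof (cases "t < 0")
    case True
    have "((\<lambda>_. 0) has_real_derivative bump (Suc n) t) (at t)" using True by (simp add: bump_def)
    then show ?thesis
      by (rule has_field_derivative_transform_within_open[where S="{..<0}"]) (use True in \<open>auto simp: bump_def\<close>)
  next
    case False
    then have t0: "0 < t" using t by simp
    let ?Q = "bump_poly n"
    have i: "((\<lambda>t. 1 / t) has_real_derivative - (1 / t\<^sup>2)) (at t)"
      using t0 by (auto intro!: derivative_eq_intros simp: power2_eq_square)
    have "((\<lambda>t. poly ?Q (1 / t)) has_real_derivative poly (pderiv ?Q) (1 / t) * - (1 / t\<^sup>2)) (at t)"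
      by (rule DERIV_chain2[OF poly_DERIV i])
    moreover have "((\<lambda>t. exp (- (1 / t))) has_real_derivative exp (- (1 / t)) * (1 / t\<^sup>2)) (at t)"
      using DERIV_chain2[OF DERIV_exp DERIV_minus[OF i]] by simp
    ultimately have "((\<lambda>t. poly ?Q (1 / t) * exp (- (1 / t))) has_real_derivative
        poly (pderiv ?Q) (1 / t) * - (1 / t\<^sup>2) * exp (- (1 / t)) + exp (- (1 / t)) * (1 / t\<^sup>2) * poly ?Q (1 / t)) (at t)"
      by (rule DERIV_mult)
    moreover have "poly (pderiv ?Q) (1 / t) * - (1 / t\<^sup>2) * exp (- (1 / t)) + exp (- (1 / t)) * (1 / t\<^sup>2) * poly ?Q (1 / t) = bump (Suc n) t"
      using t0 by (simp add: bump_def poly_monom algebra_simps power_one_over)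
    ultimately have "((\<lambda>t. poly ?Q (1 / t) * exp (- (1 / t))) has_real_derivative bump (Suc n) t) (at t)" by simp
    then show ?thesis
      by (rule has_field_derivative_transform_within_open[where S="{0<..}"]) (use t0 in \<open>auto simp: bump_def\<close>)
  qed
  have c: "isCont (bump n) 0" for n
  proof (rule isCont_sides)
    have "(bump n \<longlongrightarrow> 0) (at_left 0)"
      by (rule Lim_transform_eventually[OF tendsto_const])
        (auto simp: bump_def eventually_at_left_field intro: exI[of _ "-1"])
    then show "(bump n \<longlongrightarrow> bump n 0) (at_left 0)" by (simp add: bump_def)
    show "(bump n \<longlongrightarrow> bump n 0) (at_right 0)" using bump_tendsto_0[of n] by (simp add: bump_def)
  qed
  show ?thesis
  proof (cases "t = 0")
    case True
    have "(bump n has_real_derivative bump (Suc n) 0) (at 0)"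
      by (rule glue_deriv[of "-1" 0 1]) (use off c in auto)
    then show ?thesis using True by simp
  qed (rule off)
qed

definition bump2 :: "real \<Rightarrow> real \<Rightarrow> real \<Rightarrow> real" where
  "bump2 a b s = bump 0 (s - a) * bump 0 (b - s)"

definition bump2' :: "real \<Rightarrow> real \<Rightarrow> real \<Rightarrow> real" where
  "bump2' a b s = bump 0 (s - a) * - bump 1 (b - s) + bump 1 (s - a) * bump 0 (b - s)"

lemma bump_affine: "((\<lambda>s. c ^ n * bump n (c * s + d)) has_real_derivative c ^ Suc n * bump (Suc n) (c * x + d)) (at x)"
proof -
  have "((\<lambda>s. c * s + d) has_real_derivative c) (at x)" by (auto intro!: derivative_eq_intros)
  from DERIV_cmult[OF DERIV_chain2[OF bump_deriv this], of "c ^ n"] show ?thesis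
    by (simp add: ac_simps)
qed

lemma bump2_deriv: "(bump2 a b has_real_derivative bump2' a b s) (at s)"
  unfolding bump2_def[abs_def] bump2'_def
  using DERIV_mult[OF bump_affine[of 1 0 "- a"] bump_affine[of "-1" 0 b]]
  by (simp add: algebra_simps)

lemma bump2'_cont: "continuous_on A (bump2' a b)"
proof -
  have "continuous_on UNIV (bump n)" for n
    by (meson DERIV_continuous_on has_field_derivative_at_within bump_deriv)
  then have "continuous_on A (\<lambda>s. bump n (s - a))" "continuous_on A (\<lambda>s. bump n (b - s))" for n
    by (rule continuous_on_compose2[where t=UNIV]; auto intro!: continuous_intros)+
  then show ?thesis unfolding bump2'_def[abs_def] by (intro continuous_intros)
qed

lemma bump2_pos: "a < s \<Longrightarrow> s < b \<Longrightarrow> 0 < bump2 a b s"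
  by (simp add: bump2_def bump_def)

lemma bump2_zero: "s \<le> a \<or> b \<le> s \<Longrightarrow> bump2 a b s = 0 \<and> bump2' a b s = 0"
  by (auto simp: bump2_def bump2'_def bump_def)

lemma Ck_UNIV_bump2: "Ck_on k UNIV (\<lambda>x::'a::euclidean_space. bump2 a b (x \<bullet> x))"
proof -
  have "Ck_on k UNIV (\<lambda>x::'a. bump 0 (x \<bullet> x - a))"
    using Ck_UNIV_comp_square[of "\<lambda>n s. 1 ^ n * bump n (1 * s + - a)" k 0, OF bump_affine] by simp
  moreover have "Ck_on k UNIV (\<lambda>x::'a. bump 0 (b - x \<bullet> x))"
    using Ck_UNIV_comp_square[of "\<lambda>n s. (-1) ^ n * bump n (-1 * s + b)" k 0, OF bump_affine] by simp
  ultimately show ?thesis unfolding bump2_def by (rule Ck_UNIV_mult)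
qed

text \<open>Translation invariance instead of iterated integration: the difference quotients in
  direction \<open>b\<close> have integral 0 and converge to the partial derivative, dominated by a
  bound for it on a slightly larger ball.\<close>

lemma integral_partial_zero:
  fixes f :: "'a::euclidean_space \<Rightarrow> real"
  assumes C: "Ck_on 1 UNIV f" and b: "b \<in> Basis" and M: "\<And>x. M \<le> norm x \<Longrightarrow> f x = 0"
  shows "(\<integral>x. partial b f x \<partial>lborel) = 0"
proof -
  have df: "f differentiable (at x)" for x using C by (auto simp: differentiable_on_def)
  have pc: "continuous_on UNIV (partial b f)" using C b by auto
  have fc: "continuous_on UNIV f" by (rule Ck_UNIV_cont[OF C])
  have nb: "norm b = 1" using b by simp
  have line: "((\<lambda>s. f (x + s *\<^sub>R b)) has_real_derivative partial b f (x + s *\<^sub>R b)) (at s)" for x s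
  proof -
    have l: "((\<lambda>s. x + s *\<^sub>R b) has_derivative (\<lambda>h. h *\<^sub>R b)) (at s)" by (auto intro!: derivative_eq_intros)
    have g: "(f has_derivative frechet_derivative f (at (x + s *\<^sub>R b))) (at (x + s *\<^sub>R b))"
      using df frechet_derivative_works by blast
    then have lin: "linear (frechet_derivative f (at (x + s *\<^sub>R b)))" by (rule has_derivative_linear)
    from has_derivative_compose[OF l g] show ?thesis
      unfolding has_field_derivative_def partial_def
      by (simp add: linear_scale[OF lin] mult.commute[of _ "frechet_derivative f (at (x + s *\<^sub>R b)) b"])
  qed
  \<comment> \<open>One unit of room beyond the support, since the shifts \<open>t n\<close> have
    length at most 1.\<close>
  define M' where "M' = \<bar>M\<bar> + 1"
  obtain L where L: "0 < L" "\<And>x. norm x \<le> M' + 1 \<Longrightarrow> \<bar>partial b f x\<bar> \<le> L"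
  proof -
    have "compact (partial b f ` cball 0 (M' + 1))"
      by (intro compact_continuous_image continuous_on_subset[OF pc]) auto
    then obtain L where "\<And>y. y \<in> partial b f ` cball 0 (M' + 1) \<Longrightarrow> \<bar>y\<bar> \<le> L"
      by (metis bounded_real compact_imp_bounded)
    then show ?thesis using that[of "\<bar>L\<bar> + 1"] by fastforce
  qed
  define t where "t n = inverse (real (Suc n))" for n
  have t: "0 < t n" "t n \<le> 1" for n by (auto simp: t_def inverse_le_1_iff)
  have tl: "t \<longlonglongrightarrow> 0" unfolding t_def by (rule LIMSEQ_inverse_real_of_nat)
  define g where "g n x = (f (x + t n *\<^sub>R b) - f x) / t n" for n x
  have intf: "integrable lborel f"
  proof -
    have "integrable lborel (\<lambda>x. indicator (cball 0 M') x *\<^sub>R f x)"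
      by (rule borel_integrable_compact) (auto intro: continuous_on_subset[OF fc])
    moreover have "f x = 0" if "\<not> norm x \<le> M'" for x using that M by (auto simp: M'_def)
    then have "(\<lambda>x. indicator (cball 0 M') x *\<^sub>R f x) = f"
      by (intro ext) (auto simp: indicator_def)
    ultimately show ?thesis by simp
  qed
  have fm: "f \<in> borel_measurable borel" by (rule borel_measurable_continuous_onI[OF fc])
  have shift: "integrable lborel (\<lambda>x. f (x + c))" "(\<integral>x. f (x + c) \<partial>lborel) = (\<integral>x. f x \<partial>lborel)" for c
  proof -
    have "(\<lambda>x. x + c) = (+) c" by (auto simp: add.commute)
    then have eq: "distr lborel borel (\<lambda>x. x + c) = lborel"
      using lborel_distr_plus[of c] by simp
    have "integrable (distr lborel borel (\<lambda>x. x + c)) f" unfolding eq by (rule intf)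
    then show "integrable lborel (\<lambda>x. f (x + c))" by (subst (asm) integrable_distr_eq) (auto simp: fm)
    have "(\<integral>x. f x \<partial>lborel) = (\<integral>x. f x \<partial>distr lborel borel (\<lambda>x. x + c))" unfolding eq ..
    also have "\<dots> = (\<integral>x. f (x + c) \<partial>lborel)" by (subst integral_distr) (auto simp: fm)
    finally show "(\<integral>x. f (x + c) \<partial>lborel) = (\<integral>x. f x \<partial>lborel)" by simp
  qed
  have g0: "(\<integral>x. g n x \<partial>lborel) = 0" for n
    unfolding g_def using shift[of "t n *\<^sub>R b"] intf by (simp add: Bochner_Integration.integral_diff)
  have "(\<lambda>n. \<integral>x. g n x \<partial>lborel) \<longlonglongrightarrow> (\<integral>x. partial b f x \<partial>lborel)"
  proof (rule integral_dominated_convergence[where w="\<lambda>x. L * indicator (cball 0 M') x"])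
    show "partial b f \<in> borel_measurable lborel" using borel_measurable_continuous_onI[OF pc] by simp
    show "g n \<in> borel_measurable lborel" for n
      unfolding g_def using borel_measurable_integrable[OF shift(1)[of "t n *\<^sub>R b"]] fm by auto
    show "integrable lborel (\<lambda>x. L * indicator (cball 0 M') x)"
      using borel_integrable_compact[of "cball 0 M'" "\<lambda>_. L"] by (simp add: mult.commute)
    show "AE x in lborel. (\<lambda>n. g n x) \<longlonglongrightarrow> partial b f x"
    proof (rule AE_I2)
      fix x
      have "((\<lambda>h. (f (x + (0 + h) *\<^sub>R b) - f (x + 0 *\<^sub>R b)) / h) \<longlongrightarrow> partial b f (x + 0 *\<^sub>R b)) (at 0)"
        using line[of x 0] unfolding DERIV_def .
      then have l: "((\<lambda>h. (f (x + h *\<^sub>R b) - f x) / h) \<longlongrightarrow> partial b f x) (at 0)" by simp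
      have "filterlim t (at 0) sequentially"
        unfolding filterlim_at using tl t by (auto simp: less_imp_neq[symmetric])
      from filterlim_compose[OF l this] show "(\<lambda>n. g n x) \<longlonglongrightarrow> partial b f x" by (simp add: g_def)
    qed
    show "AE x in lborel. norm (g n x) \<le> L * indicator (cball 0 M') x" for n
    proof (rule AE_I2)
      fix x
      show "norm (g n x) \<le> L * indicator (cball 0 M') x"
      proof (cases "norm x \<le> M'")
        case True
        obtain z where z: "0 < z" "z < t n" "f (x + t n *\<^sub>R b) - f (x + 0 *\<^sub>R b) = (t n - 0) * partial b f (x + z *\<^sub>R b)"
          using MVT2[of 0 "t n" "\<lambda>s. f (x + s *\<^sub>R b)" "\<lambda>s. partial b f (x + s *\<^sub>R b)"] t(1) line by blast
        have "norm (x + z *\<^sub>R b) \<le> norm x + norm (z *\<^sub>R b)" by (rule norm_triangle_ineq)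
        also have "\<dots> \<le> M' + 1" using True z t(2)[of n] nb by simp
        finally have "\<bar>partial b f (x + z *\<^sub>R b)\<bar> \<le> L" by (rule L(2))
        moreover have "g n x = partial b f (x + z *\<^sub>R b)" using z(3) t(1)[of n] by (simp add: g_def)
        ultimately show ?thesis using True by simp
      next
        case False
        have "norm x \<le> norm (x + t n *\<^sub>R b) + norm (t n *\<^sub>R b)" by (metis add_diff_cancel_right' norm_triangle_ineq4)
        then have "M \<le> norm (x + t n *\<^sub>R b)" using False t(2)[of n] t(1)[of n] nb by (simp add: M'_def)
        then have "f (x + t n *\<^sub>R b) = 0" "f x = 0" using M False by (auto simp: M'_def)
        then show ?thesis using False by (simp add: g_def)
      qed
    qed
  qed
  then show ?thesis using g0 by (simp add: LIMSEQ_const_iff)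
qed

text \<open>Sobolev functions are defined with the completed measure on \<Omega>, while integration
  by parts is done with \<open>lborel\<close> on the whole space; for continuous functions with
  compact support in \<Omega> the integrals coincide.\<close>

lemma lebesgue_on_compact_support:
  fixes f :: "'a::euclidean_space \<Rightarrow> 'b::euclidean_space"
  assumes f: "continuous_on UNIV f" and K: "compact K" "K \<subseteq> \<Omega>" "\<And>x. x \<notin> K \<Longrightarrow> f x = 0" and O: "open \<Omega>"
  shows "integrable (lebesgue_on \<Omega>) f" "(\<integral>x. f x \<partial>lebesgue_on \<Omega>) = (\<integral>x. f x \<partial>lborel)"
    "f \<in> borel_measurable (lebesgue_on \<Omega>)"
proof -
  have "integrable lborel (\<lambda>x. indicator K x *\<^sub>R f x)"
    by (rule borel_integrable_compact[OF K(1)]) (rule continuous_on_subset[OF f], simp)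
  moreover have "(\<lambda>x. indicator K x *\<^sub>R f x) = f"
    by (rule ext) (auto simp: indicator_def K(3))
  ultimately have i: "integrable lborel f" by simp
  have m: "f \<in> borel_measurable lborel" using borel_measurable_continuous_onI[OF f] by simp
  have O': "\<Omega> \<in> sets lebesgue" using O by (simp add: lmeasurable_iff_integrable)
  have e: "(\<lambda>x. indicator \<Omega> x *\<^sub>R f x) = f" using K by (intro ext) (auto simp: indicator_def)
  have il: "integrable lebesgue f" using i integrable_completion[OF m] by simp
  show "integrable (lebesgue_on \<Omega>) f"
    using il O' e by (subst integrable_restrict_space) auto
  show "(\<integral>x. f x \<partial>lebesgue_on \<Omega>) = (\<integral>x. f x \<partial>lborel)"
    using O' e integral_completion[OF m] by (subst integral_restrict_space) auto
  show "f \<in> borel_measurable (lebesgue_on \<Omega>)"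
    by (rule borel_measurable_integrable) fact
qed

lemma gradient_inner: "b \<in> Basis \<Longrightarrow> gradient f x \<bullet> b = partial b f x"
  by (simp add: gradient_def inner_sum_left inner_Basis if_distrib cong: if_cong)

lemma partial_zero_outside:
  assumes "closed K" "\<And>x. x \<notin> K \<Longrightarrow> f x = 0" "x \<notin> K"
  shows "partial b f x = 0"
proof -
  have "(f has_derivative (\<lambda>h. 0)) (at x)"
    by (rule has_derivative_transform_within_open[where f="\<lambda>x. 0" and s="- K"]) (use assms in auto)
  then show ?thesis by (rule partial_eqI)
qed

text \<open>The constant sequence shows membership in the closure. That the classical gradient is a
  weak one is integration by parts, that is \<open>integral_partial_zero\<close> for a product of
  test functions.\<close>

lemma test_function_W12_0:
  fixes \<phi> :: "'a::euclidean_space \<Rightarrow> real"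
  assumes t: "test_function \<Omega> \<phi>" and O: "open \<Omega>"
  shows "W12_0 \<Omega> \<phi> (gradient \<phi>)"
proof -
  define S where "S \<psi> = closure {x::'a. \<psi> x \<noteq> (0::real)}" for \<psi>
  have S: "compact (S \<psi>)" "S \<psi> \<subseteq> \<Omega>" "closed (S \<psi>)" "\<And>x. x \<notin> S \<psi> \<Longrightarrow> \<psi> x = 0" if "test_function \<Omega> \<psi>" for \<psi>
    using that closure_subset[of "{x. \<psi> x \<noteq> 0}"] by (auto simp: test_function_def S_def)
  have C: "Ck_on k UNIV \<psi>" if "test_function \<Omega> \<psi>" for \<psi> k using that by (simp add: test_function_def)
  have C1: "continuous_on UNIV \<psi>" "\<And>b. b \<in> Basis \<Longrightarrow> continuous_on UNIV (partial b \<psi>)" "\<And>x. \<psi> differentiable (at x)"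
    if "test_function \<Omega> \<psi>" for \<psi>
    using C[OF that, of 0] C[OF that, of "Suc 0"] by (auto simp: differentiable_on_def)
  have gc: "continuous_on UNIV (gradient \<phi>)" unfolding gradient_def[abs_def]
    by (intro continuous_intros C1[OF t])
  have gz: "gradient \<phi> x = 0" if "x \<notin> S \<phi>" for x
    unfolding gradient_def using partial_zero_outside[OF S(3,4)[OF t] that] by simp
  have L1: "L2_on \<Omega> \<phi>" unfolding L2_on_def
    using lebesgue_on_compact_support(3)[OF C1(1)[OF t] S(1,2,4)[OF t] O]
      lebesgue_on_compact_support(1)[OF _ S(1,2)[OF t] _ O, of "\<lambda>x. (norm (\<phi> x))\<^sup>2"] C1(1)[OF t] S(4)[OF t]
    by (auto intro!: continuous_intros)
  have gn: "continuous_on UNIV (\<lambda>x. (norm (gradient \<phi> x))\<^sup>2)" by (intro continuous_intros gc)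
  have L2: "L2_on \<Omega> (gradient \<phi>)" unfolding L2_on_def
    using lebesgue_on_compact_support(3)[OF gc S(1,2)[OF t] gz O]
      lebesgue_on_compact_support(1)[OF _ S(1,2)[OF t] _ O, of "\<lambda>x. (norm (gradient \<phi> x))\<^sup>2"] gn gz
    by auto
  have wg: "weak_gradient \<Omega> \<phi> (gradient \<phi>)" unfolding weak_gradient_def
  proof (intro allI impI ballI)
    fix \<psi> :: "'a \<Rightarrow> real" and b :: 'a assume p: "test_function \<Omega> \<psi>" and b: "b \<in> Basis"
    have c: "continuous_on UNIV (\<lambda>x. \<phi> x * partial b \<psi> x)" "continuous_on UNIV (\<lambda>x. partial b \<phi> x * \<psi> x)"
      by (intro continuous_intros C1[OF t] C1[OF p] b)+
    have z: "\<phi> x * partial b \<psi> x = 0" "partial b \<phi> x * \<psi> x = 0" if "x \<notin> S \<psi>" for x :: 'a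
      using S(4)[OF p that] partial_zero_outside[OF S(3,4)[OF p] that] by auto
    note l1 = lebesgue_on_compact_support[OF c(1) S(1,2)[OF p] z(1) O]
    note l2 = lebesgue_on_compact_support[OF c(2) S(1,2)[OF p] z(2) O]
    have i: "integrable lborel (\<lambda>x. \<phi> x * partial b \<psi> x)" "integrable lborel (\<lambda>x. partial b \<phi> x * \<psi> x)"
    proof -
      have "integrable lborel (\<lambda>x. indicator (S \<psi>) x *\<^sub>R (\<phi> x * partial b \<psi> x))" "integrable lborel (\<lambda>x. indicator (S \<psi>) x *\<^sub>R (partial b \<phi> x * \<psi> x))"
        by (rule borel_integrable_compact[OF S(1)[OF p]]; rule continuous_on_subset[OF c(1)] continuous_on_subset[OF c(2)]; simp)+
      moreover have "(\<lambda>x. indicator (S \<psi>) x *\<^sub>R (\<phi> x * partial b \<psi> x)) = (\<lambda>x. \<phi> x * partial b \<psi> x)"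
        "(\<lambda>x. indicator (S \<psi>) x *\<^sub>R (partial b \<phi> x * \<psi> x)) = (\<lambda>x. partial b \<phi> x * \<psi> x)"
        using z by (auto simp: indicator_def fun_eq_iff)
      ultimately show "integrable lborel (\<lambda>x. \<phi> x * partial b \<psi> x)" "integrable lborel (\<lambda>x. partial b \<phi> x * \<psi> x)" by simp_all
    qed
    obtain M where M: "\<And>x :: 'a. x \<in> S \<psi> \<Longrightarrow> norm x \<le> M" using compact_imp_bounded[OF S(1)[OF p]] bounded_iff by metis
    have "(\<integral>x. partial b (\<lambda>x. \<phi> x * \<psi> x) x \<partial>lborel) = 0"
    proof (rule integral_partial_zero[OF _ b, of _ "M + 1"])
      show "Ck_on 1 UNIV (\<lambda>x. \<phi> x * \<psi> x)" by (intro Ck_UNIV_mult C t p)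
      fix x :: 'a assume "M + 1 \<le> norm x"
      then have "x \<notin> S \<psi>" using M by fastforce
      then show "\<phi> x * \<psi> x = 0" using S(4)[OF p] by simp
    qed
    then have "(\<integral>x. \<phi> x * partial b \<psi> x + partial b \<phi> x * \<psi> x \<partial>lborel) = 0"
      using partial_mult[OF C1(3)[OF t] C1(3)[OF p]] by simp
    then have "(\<integral>x. \<phi> x * partial b \<psi> x \<partial>lborel) = - (\<integral>x. partial b \<phi> x * \<psi> x \<partial>lborel)"
      using Bochner_Integration.integral_add[OF i] by simp
    then show "(\<integral>x. \<phi> x * partial b \<psi> x \<partial>lebesgue_on \<Omega>) = - (\<integral>x. (gradient \<phi> x \<bullet> b) * \<psi> x \<partial>lebesgue_on \<Omega>)"
      using l1(2) l2(2) by (simp add: gradient_inner[OF b])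
  qed
  show ?thesis unfolding W12_0_def W12_def
    using L1 L2 wg t by (auto intro!: exI[of _ "\<lambda>_. \<phi>"])
qed

section \<open>Hardy's inequality for radial profiles\<close>

text \<open>The infimum of quotients turned into an inequality. In \<open>ennreal\<close> the
  denominator can be cleared only if it is neither 0 nor \<open>top\<close>; an infinite one would
  make the quotient 0, which \<open>0 < m\<close> excludes.\<close>

lemma hardy_test_function:
  fixes \<phi> :: "'a::euclidean_space \<Rightarrow> real"
  assumes m: "0 < m" "ereal m < hardy_constant \<Omega>" and O: "open \<Omega>" and t: "test_function \<Omega> \<phi>"
  shows "ennreal m * (\<integral>\<^sup>+x. ennreal ((\<phi> x)\<^sup>2 / (infdist x (frontier \<Omega>))\<^sup>2) \<partial>lebesgue_on \<Omega>)
    \<le> (\<integral>\<^sup>+x. ennreal ((norm (gradient \<phi> x))\<^sup>2) \<partial>lebesgue_on \<Omega>)" (is "_ * ?b \<le> ?a")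
proof (cases "AE x in lebesgue_on \<Omega>. \<phi> x = 0")
  case True
  then have "?b = (\<integral>\<^sup>+x. 0 \<partial>lebesgue_on \<Omega>)" by (intro nn_integral_cong_AE) auto
  then show ?thesis by simp
next
  case False
  let ?S = "{(\<integral>\<^sup>+x. ennreal ((norm (g x))\<^sup>2) \<partial>lebesgue_on \<Omega>) /
           (\<integral>\<^sup>+x. ennreal ((u x)\<^sup>2 / (infdist x (frontier \<Omega>))\<^sup>2) \<partial>lebesgue_on \<Omega>) | u g.
           W12_0 \<Omega> u g \<and> \<not> (AE x in lebesgue_on \<Omega>. u x = 0)}"
  have "?a / ?b \<in> ?S" using test_function_W12_0[OF t O] False by blast
  then have "Inf ?S \<le> ?a / ?b" by (rule Inf_lower)
  moreover have "ennreal m < Inf ?S"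
    using m unfolding hardy_constant_def less_ennreal.rep_eq by simp
  ultimately have le: "ennreal m \<le> ?a / ?b" by (meson less_imp_le less_le_trans)
  show ?thesis
  proof (cases "?b = 0 \<or> ?b = top")
    case True
    then show ?thesis
    proof
      assume "?b = top"
      then have "?a / ?b = 0" by simp
      with le have "ennreal m \<le> 0" by metis
      then show ?thesis using m by simp
    qed simp
  next
    case False
    then have "\<not> ?a / ?b < ennreal m \<longleftrightarrow> \<not> ?a < ennreal m * ?b"
      using divide_less_ennreal[of ?b ?a "ennreal m"] by (simp add: less_top)
    then show ?thesis using le by (simp add: not_less)
  qed
qed

text \<open>The points of radius \<open>r0\<close> and \<open>R\<close> on the ray through
  \<open>x\<close> lie on the frontier. The upper bound for the distance is the direction that
  bounds the Hardy weight from below by the radial one.\<close>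

lemma annulus_infdist:
  fixes x :: "'a::euclidean_space"
  assumes r: "0 < r0" "r0 < R" and x: "x \<in> annulus r0 R"
  shows "0 < infdist x (frontier (annulus r0 R))" "infdist x (frontier (annulus r0 R)) \<le> bdist r0 R (norm x)"
proof -
  let ?O = "annulus r0 R :: 'a set"
  have xn: "r0 < norm x" "norm x < R" "0 < norm x" using x r by (auto simp: annulus_def)
  have fr: "(t / norm x) *\<^sub>R x \<in> frontier ?O" if t: "t = r0 \<or> t = R" for t
  proof -
    have "(t / norm x) *\<^sub>R x \<in> closure ?O"
      unfolding closure_approachable
    proof (intro allI impI)
      fix e :: real assume e: "0 < e"
      obtain s where s: "r0 < s" "s < R" "\<bar>s - t\<bar> < e"
      proof (cases "t = r0")
        case True
        then show ?thesis using that[of "r0 + min e (R - r0) / 2"] e r by (auto simp: min_def field_simps)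
      next
        case False
        then have "t = R" using t by simp
        then show ?thesis using that[of "R - min e (R - r0) / 2"] e r by (auto simp: min_def field_simps)
      qed
      have "(s / norm x) *\<^sub>R x \<in> ?O" using s xn r by (auto simp: annulus_def)
      moreover have "dist ((s / norm x) *\<^sub>R x) ((t / norm x) *\<^sub>R x) < e"
      proof -
        have "(s / norm x) *\<^sub>R x - (t / norm x) *\<^sub>R x = ((s - t) / norm x) *\<^sub>R x"
          by (simp add: scaleR_diff_left diff_divide_distrib)
        then show ?thesis using s xn by (simp add: dist_norm)
      qed
      ultimately show "\<exists>y\<in>?O. dist y ((t / norm x) *\<^sub>R x) < e" by blast
    qed
    moreover have "(t / norm x) *\<^sub>R x \<notin> ?O" using t xn r by (auto simp: annulus_def)
    ultimately show ?thesis by (simp add: frontier_def interior_open[OF open_annulus])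
  qed
  have d: "dist x ((t / norm x) *\<^sub>R x) = \<bar>norm x - t\<bar>" for t
  proof -
    have "x - (t / norm x) *\<^sub>R x = ((norm x - t) / norm x) *\<^sub>R x"
      using xn by (simp add: diff_divide_distrib scaleR_diff_left)
    then show ?thesis using xn by (simp add: dist_norm)
  qed
  have "x \<notin> frontier ?O" using x by (simp add: frontier_def interior_open[OF open_annulus])
  then show "0 < infdist x (frontier ?O)" using fr[of R] by (intro infdist_pos_not_in_closed) auto
  show "infdist x (frontier ?O) \<le> bdist r0 R (norm x)"
    using infdist_le[OF fr[of R], of x] infdist_le[OF fr[of r0], of x] xn unfolding d by (auto simp: bdist_def)
qed

text \<open>Polar coordinates for radial integrands: the image under the norm of Lebesgue measure on
  the annulus and the measure with density \<open>c * N * r ^ (N - 1)\<close> agree on all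
  half-lines, by the volume of balls, and hence coincide.\<close>

lemma nn_integral_annulus:
  fixes f :: "real \<Rightarrow> ennreal"
  assumes r: "0 < r0" "r0 < R" and f: "f \<in> borel_measurable borel"
  defines "N \<equiv> DIM('a::euclidean_space)"
  shows "(\<integral>\<^sup>+x. f (norm x) \<partial>lebesgue_on (annulus r0 R :: 'a set)) =
    (\<integral>\<^sup>+r. ennreal (unit_ball_vol N * N * r ^ (N - 1)) * indicator {r0<..<R} r * f r \<partial>lborel)"
proof -
  let ?O = "annulus r0 R :: 'a set"
  have Os: "?O \<in> sets borel" by (intro borel_open open_annulus)
  define c where "c = unit_ball_vol N"
  have c: "0 < c" by (simp add: c_def)
  have N: "0 < N" by (simp add: N_def)
  define dens where "dens r = ennreal (c * N * r ^ (N - 1)) * indicator {r0<..<R} r" for r :: real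
  define M1 where "M1 = distr (density lborel (indicator ?O)) borel (norm :: 'a \<Rightarrow> real)"
  define M2 where "M2 = density lborel dens"
  have dm: "dens \<in> borel_measurable lborel" unfolding dens_def by measurable
  have e1: "emeasure M1 {x<..} = ennreal (c * R ^ N - c * (min R (max r0 x)) ^ N)" for x
  proof -
    \<comment> \<open>The radius at which the half-line cuts the annulus: \<open>x\<close> clamped
      to the interval from \<open>r0\<close> to \<open>R\<close>.\<close>
    let ?y = "min R (max r0 x)"
    have "emeasure M1 {x<..} = (\<integral>\<^sup>+y. indicator ?O y * indicator (norm -` {x<..}) y \<partial>lborel)"
    proof -
      have "open (norm -` {x<..} :: 'a set)"
        unfolding vimage_def greaterThan_iff by (intro open_Collect_less continuous_intros)
      then have ns: "(norm -` {x<..} :: 'a set) \<in> sets lborel" by simp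
      have "emeasure M1 {x<..} = emeasure (density lborel (indicator ?O)) (norm -` {x<..})"
        unfolding M1_def by (subst emeasure_distr) auto
      also have "\<dots> = (\<integral>\<^sup>+y. indicator ?O y * indicator (norm -` {x<..}) y \<partial>lborel)"
        by (rule emeasure_density) (use Os ns in auto)
      finally show ?thesis .
    qed
    also have "\<dots> = (\<integral>\<^sup>+y. indicator (ball 0 R - cball (0::'a) ?y) y \<partial>lborel)"
      using r by (intro nn_integral_cong) (auto simp: annulus_def indicator_def)
    also have "\<dots> = emeasure lborel (ball 0 R - cball (0::'a) ?y)"
      by (subst nn_integral_indicator) auto
    also have "\<dots> = ennreal (c * R ^ N - c * ?y ^ N)"
    proof (cases "?y = R")
      case True
      have e: "ball 0 R - cball (0::'a) R = {}" by auto
      show ?thesis unfolding True e by simp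
    next
      case False
      then have y: "?y < R" "0 \<le> ?y" using r by auto
      have "emeasure lborel (ball 0 R - cball (0::'a) ?y) = emeasure lborel (ball (0::'a) R) - emeasure lborel (cball (0::'a) ?y)"
        by (rule emeasure_Diff) (use y in \<open>auto simp: emeasure_cball\<close>)
      also have "\<dots> = ennreal (c * R ^ N) - ennreal (c * ?y ^ N)"
        using y r by (simp add: emeasure_cball emeasure_ball c_def N_def)
      finally show ?thesis using c y by (simp add: ennreal_minus)
    qed
    finally show ?thesis .
  qed
  have e2: "emeasure M2 {x<..} = ennreal (c * R ^ N - c * (min R (max r0 x)) ^ N)" for x
  proof -
    let ?y = "min R (max r0 x)"
    have "emeasure M2 {x<..} = (\<integral>\<^sup>+r. dens r * indicator {x<..} r \<partial>lborel)"
      unfolding M2_def using dm by (subst emeasure_density) auto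
    also have "\<dots> = (\<integral>\<^sup>+r. ennreal (c * N * r ^ (N - 1)) * indicator {?y<..<R} r \<partial>lborel)"
      by (intro nn_integral_cong) (auto simp: dens_def indicator_def)
    also have "\<dots> = (\<integral>\<^sup>+r. ennreal (c * N * r ^ (N - 1)) * indicator {?y..R} r \<partial>lborel)"
    proof (rule nn_integral_cong_AE)
      have "AE r in lborel. r \<noteq> ?y \<and> r \<noteq> R" using AE_lborel_singleton[of ?y] AE_lborel_singleton[of R] by eventually_elim auto
      then show "AE r in lborel. ennreal (c * N * r ^ (N - 1)) * indicator {?y<..<R} r = ennreal (c * N * r ^ (N - 1)) * indicator {?y..R} r"
        by eventually_elim (auto simp: indicator_def)
    qed
    also have "\<dots> = ennreal (c * R ^ N - c * ?y ^ N)"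
    proof (rule nn_integral_has_integral_lebesgue')
      show "((\<lambda>r. c * N * r ^ (N - 1)) has_integral c * R ^ N - c * ?y ^ N) {?y..R}"
        by (rule fundamental_theorem_of_calculus)
          (use r in \<open>auto intro!: derivative_eq_intros simp: has_real_derivative_iff_has_vector_derivative[symmetric]\<close>)
      show "0 \<le> c * N * s ^ (N - 1)" if "s \<in> {?y..R}" for s using that c r by auto
    qed
    finally show ?thesis .
  qed
  have "M1 = M2"
  proof (rule measure_eqI_lessThan)
    show "sets M1 = sets borel" "sets M2 = sets borel" by (simp_all add: M1_def M2_def)
  qed (simp_all add: e1 e2)
  have "(\<integral>\<^sup>+x. f (norm x) \<partial>lebesgue_on ?O) = (\<integral>\<^sup>+x. f (norm x) * indicator ?O x \<partial>lborel)"
    using Os by (subst nn_integral_restrict_space) (auto simp: nn_integral_completion)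
  also have "\<dots> = (\<integral>\<^sup>+x. f (norm x) \<partial>density lborel (indicator ?O))"
    using f Os by (subst nn_integral_density) (auto simp: mult.commute)
  also have "\<dots> = (\<integral>\<^sup>+r. f r \<partial>M1)" unfolding M1_def using f by (subst nn_integral_distr) auto
  also have "\<dots> = (\<integral>\<^sup>+r. f r \<partial>M2)" using \<open>M1 = M2\<close> by simp
  also have "\<dots> = (\<integral>\<^sup>+r. dens r * f r \<partial>lborel)" unfolding M2_def using f dm by (subst nn_integral_density) auto
  finally show ?thesis by (simp add: dens_def c_def)
qed

text \<open>Bump and polynomial are taken in the variable \<open>x \<bullet> x\<close>, so that
  their product is smooth on the whole space. In polar coordinates both sides carry the same
  positive constant factor, which cancels.\<close>

lemma hardy_smooth_profile:
  assumes r: "0 < r0" "r0 < A" "A < B" "B < R"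
    and m: "0 < m" "ereal m < hardy_constant (annulus r0 R :: 'a::euclidean_space set)"
    and P: "real_polynomial_function P" "\<And>s. (P has_real_derivative P' s) (at s)" "continuous_on UNIV P'"
  defines "g \<equiv> \<lambda>r. bump2 (A\<^sup>2) (B\<^sup>2) (r\<^sup>2) * P (r\<^sup>2)"
    and "g' \<equiv> \<lambda>r. 2 * r * (bump2 (A\<^sup>2) (B\<^sup>2) (r\<^sup>2) * P' (r\<^sup>2) + bump2' (A\<^sup>2) (B\<^sup>2) (r\<^sup>2) * P (r\<^sup>2))"
  shows "m * integral {A..B} (\<lambda>r. (g r)\<^sup>2 / (bdist r0 R r)\<^sup>2 * r ^ (DIM('a) - 1))
    \<le> integral {A..B} (\<lambda>r. (g' r)\<^sup>2 * r ^ (DIM('a) - 1))"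
proof -
  let ?O = "annulus r0 R :: 'a set"
  let ?b = "bump2 (A\<^sup>2) (B\<^sup>2)" and ?b' = "bump2' (A\<^sup>2) (B\<^sup>2)"
  define N where "N = DIM('a)"
  define \<Phi> where "\<Phi> x = g (norm x)" for x :: 'a
  have Phi: "\<Phi> = (\<lambda>x. ?b (x \<bullet> x) * P (x \<bullet> x))"
    by (auto simp: \<Phi>_def g_def fun_eq_iff power2_norm_eq_inner)
  have sq: "A\<^sup>2 < r\<^sup>2 \<longleftrightarrow> A < r" "r\<^sup>2 < B\<^sup>2 \<longleftrightarrow> r < B" if "0 \<le> r" for r
    using that assms(1-4) by (auto simp: power_mono_iff abs_le_square_iff[symmetric] simp flip: not_le)
  have z: "g s = 0" "g' s = 0" if "0 \<le> s" "s \<le> A \<or> B \<le> s" for s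
    using bump2_zero[of "s\<^sup>2" "A\<^sup>2" "B\<^sup>2"] that sq[of s] by (auto simp: g_def g'_def not_less)
  have dg: "(g has_real_derivative g' s) (at s)" for s
  proof -
    have i: "((\<lambda>r. r\<^sup>2) has_real_derivative 2 * s) (at s)" by (auto intro!: derivative_eq_intros)
    have "(g has_real_derivative ?b' (s\<^sup>2) * (2 * s) * P (s\<^sup>2) + P' (s\<^sup>2) * (2 * s) * ?b (s\<^sup>2)) (at s)"
      unfolding g_def by (rule DERIV_mult[OF DERIV_chain2[OF bump2_deriv i] DERIV_chain2[OF P(2) i]])
    then show ?thesis by (simp add: g'_def algebra_simps)
  qed
  have test: "test_function ?O \<Phi>"
    unfolding test_function_def
  proof (intro conjI allI)
    show "Ck_on k UNIV \<Phi>" for k unfolding Phi by (intro Ck_UNIV_mult Ck_UNIV_bump2 Ck_UNIV_polynomial P)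
    have "closed ({x::'a. A \<le> norm x} \<inter> {x. norm x \<le> B})"
      by (intro closed_Int closed_Collect_le continuous_intros)
    moreover have "{x. \<Phi> x \<noteq> 0} \<subseteq> {x::'a. A \<le> norm x} \<inter> {x. norm x \<le> B}"
      using z by (auto simp: \<Phi>_def) (metis linear norm_ge_zero)+
    ultimately have sub: "closure {x. \<Phi> x \<noteq> 0} \<subseteq> {x::'a. A \<le> norm x} \<inter> {x. norm x \<le> B}" by (rule closure_minimal[rotated])
    then have "closure {x. \<Phi> x \<noteq> 0} \<subseteq> cball 0 B" by auto
    then show "compact (closure {x. \<Phi> x \<noteq> 0})"
      by (meson bounded_cball bounded_subset closed_closure compact_eq_bounded_closed)
    show "closure {x. \<Phi> x \<noteq> 0} \<subseteq> ?O" using sub r by (auto simp: annulus_def)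
  qed
  have grad: "(norm (gradient \<Phi> x))\<^sup>2 = (g' (norm x))\<^sup>2" if "x \<in> ?O" for x
  proof -
    have x: "x \<noteq> 0" using that r by (auto simp: annulus_def)
    have "partial b \<Phi> x = g' (norm x) * ((x \<bullet> b) / norm x)" for b
      unfolding \<Phi>_def[abs_def] by (rule partial_eqI[OF has_derivative_radial[OF x dg]])
    then have "gradient \<Phi> x = (g' (norm x) / norm x) *\<^sub>R (\<Sum>b\<in>Basis. (x \<bullet> b) *\<^sub>R b)"
      unfolding gradient_def by (simp add: scaleR_sum_right)
    then have "gradient \<Phi> x = (g' (norm x) / norm x) *\<^sub>R x" by (simp add: euclidean_representation)
    then show ?thesis using x by (simp add: power_mult_distrib power_divide)
  qed
  have gc: "continuous_on UNIV g" "continuous_on UNIV g'"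
  proof -
    show "continuous_on UNIV g" using dg by (meson DERIV_continuous_on has_field_derivative_at_within)
    have "continuous_on UNIV ?b" "continuous_on UNIV P"
      using DERIV_isCont[OF bump2_deriv] DERIV_isCont[OF P(2)] by (auto intro!: continuous_at_imp_continuous_on)
    moreover have sqc: "continuous_on UNIV (\<lambda>r::real. r\<^sup>2)" by (intro continuous_intros)
    ultimately have "continuous_on UNIV (\<lambda>r. ?b (r\<^sup>2))" "continuous_on UNIV (\<lambda>r. P (r\<^sup>2))"
      using continuous_on_compose2[OF _ sqc, of UNIV ?b] continuous_on_compose2[OF _ sqc, of UNIV P] by simp_all
    moreover have "continuous_on UNIV (\<lambda>r. ?b' (r\<^sup>2))" "continuous_on UNIV (\<lambda>r. P' (r\<^sup>2))"
      using continuous_on_compose2[OF bump2'_cont[of UNIV] sqc] continuous_on_compose2[OF P(3) sqc] by simp_all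
    ultimately show "continuous_on UNIV g'" unfolding g'_def by (intro continuous_intros)
  qed
  define F1 where "F1 r = (g r)\<^sup>2 / (bdist r0 R r)\<^sup>2" for r
  define F2 where "F2 r = (g' r)\<^sup>2" for r
  have gm: "g \<in> borel_measurable borel" "g' \<in> borel_measurable borel" "bdist r0 R \<in> borel_measurable borel"
    using gc by (auto intro!: borel_measurable_continuous_onI continuous_intros simp: bdist_def[abs_def])
  have Fm: "(\<lambda>r. ennreal (F1 r)) \<in> borel_measurable borel" "(\<lambda>r. ennreal (F2 r)) \<in> borel_measurable borel"
    unfolding F1_def F2_def using gm by measurable
  have "ennreal m * (\<integral>\<^sup>+x. ennreal (F1 (norm x)) \<partial>lebesgue_on ?O) \<le>
      ennreal m * (\<integral>\<^sup>+x. ennreal ((\<Phi> x)\<^sup>2 / (infdist x (frontier ?O))\<^sup>2) \<partial>lebesgue_on ?O)"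
  proof (intro mult_left_mono nn_integral_mono)
    fix x assume "x \<in> space (lebesgue_on ?O)"
    then have x: "x \<in> ?O" by (simp add: space_restrict_space)
    note id = annulus_infdist[OF r(1) _ x]
    have rR: "r0 < R" using r by simp
    show "ennreal (F1 (norm x)) \<le> ennreal ((\<Phi> x)\<^sup>2 / (infdist x (frontier ?O))\<^sup>2)"
      unfolding F1_def \<Phi>_def using id[OF rR]
      by (intro ennreal_leI divide_left_mono power_mono mult_pos_pos zero_less_power) auto
  qed simp
  also have "\<dots> \<le> (\<integral>\<^sup>+x. ennreal ((norm (gradient \<Phi> x))\<^sup>2) \<partial>lebesgue_on ?O)"
    by (rule hardy_test_function[OF m open_annulus test])
  also have "\<dots> = (\<integral>\<^sup>+x. ennreal (F2 (norm x)) \<partial>lebesgue_on ?O)"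
    by (intro nn_integral_cong) (simp add: F2_def grad space_restrict_space)
  finally have main: "ennreal m * (\<integral>\<^sup>+x. ennreal (F1 (norm x)) \<partial>lebesgue_on ?O) \<le> (\<integral>\<^sup>+x. ennreal (F2 (norm x)) \<partial>lebesgue_on ?O)" .
  define c where "c = unit_ball_vol N * N"
  have c: "0 < c" by (simp add: c_def N_def)
  have conv: "(\<integral>\<^sup>+x. ennreal (F (norm x)) \<partial>lebesgue_on ?O) = ennreal (c * integral {A..B} (\<lambda>r. F r * r ^ (N - 1)))"
    if F: "(\<lambda>r. ennreal (F r)) \<in> borel_measurable borel" "\<And>r. 0 \<le> F r" "\<And>r. 0 \<le> r \<Longrightarrow> r \<le> A \<or> B \<le> r \<Longrightarrow> F r = 0"
      "continuous_on {A..B} F" for F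
  proof -
    have "(\<integral>\<^sup>+x. ennreal (F (norm x)) \<partial>lebesgue_on ?O) = (\<integral>\<^sup>+r. ennreal (c * r ^ (N - 1)) * indicator {r0<..<R} r * ennreal (F r) \<partial>lborel)"
      unfolding c_def N_def by (rule nn_integral_annulus[OF r(1) _ F(1)]) (use r in simp)
    also have "\<dots> = (\<integral>\<^sup>+s. ennreal (c * (F s * s ^ (N - 1))) * indicator {A..B} s \<partial>lborel)"
    proof (rule nn_integral_cong)
      fix s :: real
      show "ennreal (c * s ^ (N - 1)) * indicator {r0<..<R} s * ennreal (F s) = ennreal (c * (F s * s ^ (N - 1))) * indicator {A..B} s"
      proof (cases "A \<le> s \<and> s \<le> B")
        case True
        then show ?thesis using r c F(2)[of s] by (simp add: indicator_def ac_simps flip: ennreal_mult)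
      next
        case False
        then show ?thesis using F(3)[of s] r by (cases "r0 < s") (auto simp: indicator_def)
      qed
    qed
    also have "\<dots> = ennreal (integral {A..B} (\<lambda>s. c * (F s * s ^ (N - 1))))"
    proof (rule nn_integral_has_integral_lebesgue')
      show "((\<lambda>s. c * (F s * s ^ (N - 1))) has_integral integral {A..B} (\<lambda>s. c * (F s * s ^ (N - 1)))) {A..B}"
        by (intro integrable_integral integrable_continuous_interval continuous_intros F)
      show "0 \<le> c * (F s * s ^ (N - 1))" if "s \<in> {A..B}" for s using that c F(2)[of s] r by simp
    qed
    finally show ?thesis by simp
  qed
  have F1c: "continuous_on {A..B} F1" and F2c: "continuous_on {A..B} F2"
  proof -
    have "bdist r0 R s \<noteq> 0" if "s \<in> {A..B}" for s using bdist_pos[of r0 s R] that r by auto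
    then show "continuous_on {A..B} F1" unfolding F1_def bdist_def
      by (intro continuous_intros continuous_on_subset[OF gc(1)]) auto
    show "continuous_on {A..B} F2" unfolding F2_def by (intro continuous_intros continuous_on_subset[OF gc(2)]) auto
  qed
  have "ennreal m * ennreal (c * integral {A..B} (\<lambda>r. F1 r * r ^ (N - 1))) \<le> ennreal (c * integral {A..B} (\<lambda>r. F2 r * r ^ (N - 1)))"
    using main conv[OF Fm(1) _ _ F1c] conv[OF Fm(2) _ _ F2c] z by (simp add: F1_def F2_def)
  moreover have nn: "0 \<le> integral {A..B} (\<lambda>r. F r * r ^ (N - 1))" if "continuous_on {A..B} F" "\<And>r. 0 \<le> F r" for F
    using that r by (intro integral_nonneg integrable_continuous_interval continuous_intros) auto
  ultimately have "m * (c * integral {A..B} (\<lambda>r. F1 r * r ^ (N - 1))) \<le> c * integral {A..B} (\<lambda>r. F2 r * r ^ (N - 1))"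
    using m c nn[OF F1c] nn[OF F2c] by (subst (asm) ennreal_mult[symmetric]) (auto simp: F1_def F2_def)
  then have "c * (m * integral {A..B} (\<lambda>r. F1 r * r ^ (N - 1))) \<le> c * integral {A..B} (\<lambda>r. F2 r * r ^ (N - 1))"
    by (simp add: ac_simps)
  then show ?thesis using c by (simp add: F1_def F2_def N_def)
qed

lemma real_polynomial_antiderivative:
  assumes "real_polynomial_function Q"
  obtains P where "real_polynomial_function P" "\<And>s. (P has_real_derivative Q s) (at s)" "P x0 = 0"
proof -
  obtain a n where Q: "Q = (\<lambda>x. \<Sum>i\<le>n. a i * x ^ i)" using assms real_polynomial_function_iff_sum by auto
  define P0 where "P0 x = (\<Sum>i\<le>n. a i / real (Suc i) * x ^ Suc i)" for x
  define P where "P x = P0 x + - P0 x0" for x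
  have "real_polynomial_function (\<lambda>x. a i / real (Suc i) * x ^ Suc i)" for i
    by (intro real_polynomial_function.intros real_polynomial_function_power bounded_linear_ident)
  then have "real_polynomial_function P0" unfolding P0_def
    by (intro real_polynomial_function_sum) auto
  then have "real_polynomial_function P" unfolding P_def
    by (intro real_polynomial_function.intros(2,3))
  moreover have "(P has_real_derivative Q s) (at s)" for s
  proof -
    have t: "((\<lambda>x. a i / real (Suc i) * x ^ Suc i) has_real_derivative a i * s ^ i) (at s)" for i
    proof -
      have "((\<lambda>x. a i / real (Suc i) * x ^ Suc i) has_real_derivative a i / real (Suc i) * (real (Suc i) * s ^ (Suc i - Suc 0))) (at s)"
        by (intro DERIV_cmult DERIV_pow)
      then show ?thesis by (simp del: of_nat_Suc)
    qed
    have "(P0 has_real_derivative Q s) (at s)" unfolding P0_def[abs_def] Q by (intro DERIV_sum t)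
    from DERIV_add[OF this DERIV_const[of "- P0 x0"]] show ?thesis by (simp add: P_def[abs_def])
  qed
  ultimately show ?thesis using that[of P] by (simp add: P_def)
qed

lemma abs_le_of_abs_diff_le:
  fixes x y c C :: real
  assumes "\<bar>x - y\<bar> \<le> c" "\<bar>y\<bar> \<le> C" shows "\<bar>x\<bar> \<le> C + c"
  using assms by linarith

text \<open>A \<open>C\<^sup>1\<close> profile \<open>h\<close> is the bump times \<open>k = h / bump\<close>, and \<open>k\<close> is approximated in \<open>C\<^sup>1\<close>
  by polynomials in \<open>r\<^sup>2\<close>.\<close>

lemma hardy_profile:
  assumes r: "0 < r0" "r0 < a" "a < b" "b < R"
    and m: "0 < m" "ereal m < hardy_constant (annulus r0 R :: 'a::euclidean_space set)"
    and h: "\<And>r. (h has_real_derivative h' r) (at r)" "continuous_on UNIV h'"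
      "\<And>r. r \<le> a \<or> b \<le> r \<Longrightarrow> h r = 0 \<and> h' r = 0"
  shows "m * integral {a..b} (\<lambda>r. (h r)\<^sup>2 / (bdist r0 R r)\<^sup>2 * r ^ (DIM('a) - 1))
    \<le> integral {a..b} (\<lambda>r. (h' r)\<^sup>2 * r ^ (DIM('a) - 1))"
proof -
  \<comment> \<open>A slightly larger interval: the bump is then positive at the squares of all
    radii where \<open>h\<close> may be nonzero.\<close>
  define A where "A = (r0 + a) / 2"
  define B where "B = (b + R) / 2"
  have AB: "r0 < A" "A < a" "b < B" "B < R" "A < B" "0 < A" "0 < a" "0 < b" using r by (auto simp: A_def B_def field_simps)
  define \<beta> where "\<beta> = bump2 (A\<^sup>2) (B\<^sup>2)"
  define \<beta>' where "\<beta>' = bump2' (A\<^sup>2) (B\<^sup>2)"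
  \<comment> \<open>In the variable \<open>s = r\<^sup>2\<close>. Where the bump vanishes
    \<open>h\<close> vanishes too, and division by 0 gives the value 0.\<close>
  define k where "k s = h (sqrt s) / \<beta> s" for s
  define k' where "k' s = (h' (sqrt s) / (2 * sqrt s) * \<beta> s - h (sqrt s) * \<beta>' s) / (\<beta> s * \<beta> s)" for s
  have dbeta: "(\<beta> has_real_derivative \<beta>' s) (at s)" for s unfolding \<beta>_def \<beta>'_def by (rule bump2_deriv)
  have hc: "continuous_on UNIV h" using DERIV_isCont[OF h(1)] by (auto intro!: continuous_at_imp_continuous_on)
  have bc: "continuous_on UNIV \<beta>" "continuous_on UNIV \<beta>'"
    using DERIV_isCont[OF dbeta] bump2'_cont by (auto intro!: continuous_at_imp_continuous_on simp: \<beta>'_def)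
  let ?I = "{A\<^sup>2..B\<^sup>2}"
  have Ipos: "0 < s" if "s \<in> ?I" for s using that AB by (auto intro: less_le_trans[of _ "A\<^sup>2"])
  have bpos: "0 < \<beta> s" if "A\<^sup>2 < s" "s < B\<^sup>2" for s unfolding \<beta>_def by (rule bump2_pos[OF that])
  have sq: "A\<^sup>2 < a\<^sup>2" "b\<^sup>2 < B\<^sup>2" "a\<^sup>2 < b\<^sup>2" using AB r by (auto intro!: power_strict_mono)
  have loc0: "h (sqrt s) = 0 \<and> h' (sqrt s) = 0" if "s \<le> a\<^sup>2 \<or> b\<^sup>2 \<le> s" for s
  proof (rule h(3))
    show "sqrt s \<le> a \<or> b \<le> sqrt s" using that AB real_le_lsqrt real_le_rsqrt[of b s]
      by (metis abs_of_pos real_sqrt_abs real_sqrt_le_iff)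
  qed
  \<comment> \<open>Two overlapping open cases: where the bump is positive the quotient rule
    applies, and off the support of \<open>h\<close> the quotient is locally 0.\<close>
  have split: "(A\<^sup>2 < s \<and> s < B\<^sup>2) \<or> s < a\<^sup>2 \<or> b\<^sup>2 < s" for s using sq by linarith
  have dk: "(k has_real_derivative k' s) (at s)" if s: "s \<in> ?I" for s
    using split[of s]
  proof
    assume i: "A\<^sup>2 < s \<and> s < B\<^sup>2"
    have "(sqrt has_real_derivative inverse (sqrt s) / 2) (at s)" using Ipos[OF s] by (rule DERIV_real_sqrt)
    from DERIV_chain2[OF h(1) this]
    have "((\<lambda>s. h (sqrt s)) has_real_derivative h' (sqrt s) * (inverse (sqrt s) / 2)) (at s)" .
    from DERIV_divide[OF this dbeta] bpos[of s] i show ?thesis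
      unfolding k_def[abs_def] k'_def by (simp add: field_simps)
  next
    assume i: "s < a\<^sup>2 \<or> b\<^sup>2 < s"
    have "k' s = 0" using loc0[of s] i by (auto simp: k'_def)
    then have "((\<lambda>_. 0) has_real_derivative k' s) (at s)" by simp
    then show ?thesis
    proof (rule has_field_derivative_transform_within_open[where S="{..<a\<^sup>2} \<union> {b\<^sup>2<..}"])
      fix x assume "x \<in> {..<a\<^sup>2} \<union> {b\<^sup>2<..}"
      then show "0 = k x" using loc0[of x] by (auto simp: k_def)
    qed (use i in auto)
  qed
  have ck': "continuous_on ?I k'"
  proof (intro continuous_at_imp_continuous_on ballI)
    fix s assume s: "s \<in> ?I"
    from split[of s] show "isCont k' s"
    proof
      assume i: "A\<^sup>2 < s \<and> s < B\<^sup>2"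
      have "isCont (\<lambda>s. h (sqrt s)) s" "isCont (\<lambda>s. h' (sqrt s)) s"
        using hc h(2) by (auto intro!: continuous_intros isCont_o2[where f=sqrt] simp: continuous_on_eq_continuous_at)
      moreover have "isCont \<beta> s" "isCont \<beta>' s" using bc by (auto simp: continuous_on_eq_continuous_at)
      ultimately show ?thesis unfolding k'_def[abs_def] using bpos[of s] i Ipos[OF s]
        by (intro continuous_intros) auto
    next
      assume i: "s < a\<^sup>2 \<or> b\<^sup>2 < s"
      have "\<forall>\<^sub>F x in nhds s. k' x = 0"
      proof -
        have "\<forall>\<^sub>F x in nhds s. x \<in> {..<a\<^sup>2} \<union> {b\<^sup>2<..}" by (rule eventually_nhds_in_open) (use i in auto)
        then show ?thesis by eventually_elim (use loc0 in \<open>auto simp: k'_def\<close>)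
      qed
      then show ?thesis using isCont_cong[of k' "\<lambda>_. 0" s] by simp
    qed
  qed
  have ck: "continuous_on ?I k" using DERIV_isCont[OF dk] by (auto intro!: continuous_at_imp_continuous_on)
  \<comment> \<open>Weierstrass approximation is applied to the derivative; integrating from
    \<open>A\<^sup>2\<close>, where \<open>k\<close> vanishes, approximates \<open>k\<close> as
    well.\<close>
  have "\<exists>Q. real_polynomial_function Q \<and> (\<forall>s\<in>?I. \<bar>k' s - Q s\<bar> < inverse (real (Suc n)))" for n
    by (rule Stone_Weierstrass_real_polynomial_function) (use ck' in auto)
  then obtain Q where Q: "\<And>n. real_polynomial_function (Q n)" "\<And>n s. s \<in> ?I \<Longrightarrow> \<bar>k' s - Q n s\<bar> < inverse (real (Suc n))"
    by metis
  have "\<exists>P. real_polynomial_function P \<and> (\<forall>s. (P has_real_derivative Q n s) (at s)) \<and> P (A\<^sup>2) = 0" for n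
    using real_polynomial_antiderivative[OF Q(1)] by metis
  then obtain P where P: "\<And>n. real_polynomial_function (P n)" "\<And>n s. (P n has_real_derivative Q n s) (at s)" "\<And>n. P n (A\<^sup>2) = 0"
    by metis
  define e where "e n = inverse (real (Suc n))" for n
  have e: "0 < e n" "e n \<le> 1" for n by (auto simp: e_def inverse_le_1_iff)
  have el: "e \<longlonglongrightarrow> 0" unfolding e_def by (rule LIMSEQ_inverse_real_of_nat)
  have Qb: "\<bar>Q n s - k' s\<bar> \<le> e n" if "s \<in> ?I" for n s using Q(2)[OF that, of n] by (simp add: e_def abs_minus_commute)
  define D where "D = B\<^sup>2 - A\<^sup>2"
  have D: "0 < D" using sq by (simp add: D_def)
  have Pb: "\<bar>P n s - k s\<bar> \<le> D * e n" if s: "s \<in> ?I" for n s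
  proof -
    have kA: "k (A\<^sup>2) = 0" using loc0[of "A\<^sup>2"] sq by (simp add: k_def)
    have "e n * (A\<^sup>2 - A\<^sup>2) + \<tau> * (P n (A\<^sup>2) - k (A\<^sup>2)) \<le> e n * (s - A\<^sup>2) + \<tau> * (P n s - k s)" if t: "\<tau> = 1 \<or> \<tau> = -1" for \<tau>
    proof (rule DERIV_nonneg_le[where f="\<lambda>s. e n * (s - A\<^sup>2) + \<tau> * (P n s - k s)" and f'="\<lambda>s. e n + \<tau> * (Q n s - k' s)"])
      fix z assume z: "A\<^sup>2 \<le> z" "z \<le> s"
      then have zI: "z \<in> ?I" using s by auto
      show "((\<lambda>s. e n * (s - A\<^sup>2) + \<tau> * (P n s - k s)) has_real_derivative e n + \<tau> * (Q n z - k' z)) (at z)"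
        by (auto intro!: derivative_eq_intros P dk[OF zI])
      show "0 \<le> e n + \<tau> * (Q n z - k' z)" using Qb[OF zI, of n] t by auto
    qed (use s in simp)
    from this[of 1] this[of "-1"] have "\<bar>P n s - k s\<bar> \<le> e n * (s - A\<^sup>2)" by (simp add: P(3) kA abs_le_iff)
    also have "\<dots> \<le> e n * D" using s e(1)[of n] by (intro mult_left_mono) (auto simp: D_def)
    finally show ?thesis by (simp add: mult.commute)
  qed
  have lim0: "(\<lambda>n. f n) \<longlonglongrightarrow> l" if "\<And>n. \<bar>f n - l\<bar> \<le> c * e n" for f :: "nat \<Rightarrow> real" and l c
  proof -
    have c0: "(\<lambda>n. c * e n) \<longlonglongrightarrow> 0" using tendsto_mult[OF tendsto_const[of c] el] by simp
    have "(\<lambda>n. f n - l) \<longlonglongrightarrow> 0"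
      by (rule Lim_null_comparison[OF _ c0]) (use that in auto)
    then show ?thesis by (simp add: LIM_zero_iff)
  qed
  have Ql: "(\<lambda>n. Q n s) \<longlonglongrightarrow> k' s" and Pl: "(\<lambda>n. P n s) \<longlonglongrightarrow> k s" if s: "s \<in> ?I" for s
    using lim0[of "\<lambda>n. Q n s" "k' s" 1] lim0[of "\<lambda>n. P n s" "k s" D] Qb[OF s] Pb[OF s] by auto
  obtain C1 where C1: "0 < C1" "\<And>s. A\<^sup>2 \<le> s \<Longrightarrow> s \<le> B\<^sup>2 \<Longrightarrow> \<bar>k s\<bar> \<le> C1" by (rule cont_image_bounded[OF ck]) blast
  obtain C2 where C2: "0 < C2" "\<And>s. A\<^sup>2 \<le> s \<Longrightarrow> s \<le> B\<^sup>2 \<Longrightarrow> \<bar>k' s\<bar> \<le> C2" by (rule cont_image_bounded[OF ck']) blast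
  obtain C3 where C3: "0 < C3" "\<And>s. A\<^sup>2 \<le> s \<Longrightarrow> s \<le> B\<^sup>2 \<Longrightarrow> \<bar>\<beta> s\<bar> \<le> C3"
    by (rule cont_image_bounded[OF continuous_on_subset[OF bc(1)]]) auto
  obtain C4 where C4: "0 < C4" "\<And>s. A\<^sup>2 \<le> s \<Longrightarrow> s \<le> B\<^sup>2 \<Longrightarrow> \<bar>\<beta>' s\<bar> \<le> C4"
    by (rule cont_image_bounded[OF continuous_on_subset[OF bc(2)]]) auto
  define g where "g n r = \<beta> (r\<^sup>2) * P n (r\<^sup>2)" for n r
  define g' where "g' n r = 2 * r * (\<beta> (r\<^sup>2) * Q n (r\<^sup>2) + \<beta>' (r\<^sup>2) * P n (r\<^sup>2))" for n r
  have rI: "r\<^sup>2 \<in> ?I" "0 < r" if "r \<in> {A..B}" for r using that AB by (auto intro!: power_mono)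
  have Pbd: "\<bar>P n s\<bar> \<le> C1 + D" and Qbd: "\<bar>Q n s\<bar> \<le> C2 + 1" if s: "s \<in> ?I" for n s
  proof -
    have "D * e n \<le> D" using D e(2)[of n] by (simp add: mult_le_cancel_left1)
    then show "\<bar>P n s\<bar> \<le> C1 + D" using abs_le_of_abs_diff_le[OF Pb[OF s, of n] C1(2)[of s]] s by auto
    show "\<bar>Q n s\<bar> \<le> C2 + 1" using abs_le_of_abs_diff_le[OF Qb[OF s, of n] C2(2)[of s]] s e(2)[of n] by auto
  qed
  have gb: "\<bar>g n r\<bar> \<le> C3 * (C1 + D)" if "r \<in> {A..B}" for n r
    unfolding g_def abs_mult using rI[OF that] C3(2)[of "r\<^sup>2"] Pbd[of "r\<^sup>2" n] C3(1) by (intro mult_mono) auto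
  have g'b: "\<bar>g' n r\<bar> \<le> 2 * B * (C3 * (C2 + 1) + C4 * (C1 + D))" if r: "r \<in> {A..B}" for n r
  proof -
    have "\<bar>\<beta> (r\<^sup>2) * Q n (r\<^sup>2)\<bar> \<le> C3 * (C2 + 1)"
      unfolding abs_mult using rI[OF r] C3(2)[of "r\<^sup>2"] Qbd[of "r\<^sup>2" n] C3(1) by (intro mult_mono) auto
    moreover have "\<bar>\<beta>' (r\<^sup>2) * P n (r\<^sup>2)\<bar> \<le> C4 * (C1 + D)"
      unfolding abs_mult using rI[OF r] C4(2)[of "r\<^sup>2"] Pbd[of "r\<^sup>2" n] C4(1) by (intro mult_mono) auto
    ultimately have "\<bar>\<beta> (r\<^sup>2) * Q n (r\<^sup>2) + \<beta>' (r\<^sup>2) * P n (r\<^sup>2)\<bar> \<le> C3 * (C2 + 1) + C4 * (C1 + D)" by linarith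
    then show ?thesis unfolding g'_def abs_mult using r AB by (intro mult_mono) auto
  qed
  have gl: "(\<lambda>n. g n r) \<longlonglongrightarrow> h r" and g'l: "(\<lambda>n. g' n r) \<longlonglongrightarrow> h' r" if r: "r \<in> {A..B}" for r
  proof -
    note rr = rI[OF r]
    have s: "sqrt (r\<^sup>2) = r" using rr by simp
    have 1: "(\<lambda>n. g n r) \<longlonglongrightarrow> \<beta> (r\<^sup>2) * k (r\<^sup>2)" unfolding g_def by (intro tendsto_intros Pl rr)
    have 2: "(\<lambda>n. g' n r) \<longlonglongrightarrow> 2 * r * (\<beta> (r\<^sup>2) * k' (r\<^sup>2) + \<beta>' (r\<^sup>2) * k (r\<^sup>2))"
      unfolding g'_def by (intro tendsto_intros Pl Ql rr)
    have "\<beta> (r\<^sup>2) * k (r\<^sup>2) = h r \<and> 2 * r * (\<beta> (r\<^sup>2) * k' (r\<^sup>2) + \<beta>' (r\<^sup>2) * k (r\<^sup>2)) = h' r"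
      using split[of "r\<^sup>2"]
    proof
      assume "A\<^sup>2 < r\<^sup>2 \<and> r\<^sup>2 < B\<^sup>2"
      then have "\<beta> (r\<^sup>2) \<noteq> 0" using bpos by force
      then show ?thesis using rr unfolding k_def k'_def s by (simp add: field_simps)
    next
      assume "r\<^sup>2 < a\<^sup>2 \<or> b\<^sup>2 < r\<^sup>2"
      then show ?thesis using loc0[of "r\<^sup>2"] unfolding k_def k'_def s by auto
    qed
    then show "(\<lambda>n. g n r) \<longlonglongrightarrow> h r" "(\<lambda>n. g' n r) \<longlonglongrightarrow> h' r" using 1 2 by auto
  qed
  define W where "W r = r ^ (DIM('a) - 1)" for r :: real
  have Wb: "0 \<le> W r" if "r \<in> {A..B}" for r using that AB by (simp add: W_def)
  have Wc: "continuous_on S W" for S unfolding W_def by (intro continuous_intros)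
  have dc: "continuous_on {A..B} (\<lambda>r. 1 / (bdist r0 R r)\<^sup>2)"
  proof -
    have "bdist r0 R s \<noteq> 0" if "s \<in> {A..B}" for s using bdist_pos[of r0 s R] that AB by auto
    then show ?thesis unfolding bdist_def by (intro continuous_intros) auto
  qed
  have sqc: "continuous_on UNIV (\<lambda>r::real. r\<^sup>2)" by (intro continuous_intros)
  have Pc: "continuous_on UNIV (P n)" for n
    using DERIV_isCont[OF P(2)] by (auto intro!: continuous_at_imp_continuous_on)
  have Qc: "continuous_on UNIV (Q n)" for n
    using Q(1)[of n] unfolding real_polynomial_function_eq by (rule continuous_on_polymonial_function)
  have gc: "continuous_on {A..B} (g n)" "continuous_on {A..B} (g' n)" for n
    unfolding g_def g'_def
    by (intro continuous_intros continuous_on_subset[OF continuous_on_compose2[OF bc(1) sqc]]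
        continuous_on_subset[OF continuous_on_compose2[OF bc(2) sqc]]
        continuous_on_subset[OF continuous_on_compose2[OF Pc sqc]]
        continuous_on_subset[OF continuous_on_compose2[OF Qc sqc]]; simp)+
  have conv: "(\<lambda>n. integral {A..B} (\<lambda>r. (f n r)\<^sup>2 * q r)) \<longlonglongrightarrow> integral {A..B} (\<lambda>r. (l r)\<^sup>2 * q r)"
    if f: "\<And>n. continuous_on {A..B} (f n)" "\<And>n r. r \<in> {A..B} \<Longrightarrow> \<bar>f n r\<bar> \<le> C" "\<And>r. r \<in> {A..B} \<Longrightarrow> (\<lambda>n. f n r) \<longlonglongrightarrow> l r"
      and q: "continuous_on {A..B} q" "\<And>r. r \<in> {A..B} \<Longrightarrow> 0 \<le> q r" for f l q and C :: real
  proof (rule dominated_convergence(2)[where h="\<lambda>r. C\<^sup>2 * q r"])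
    show "(\<lambda>r. (f n r)\<^sup>2 * q r) integrable_on {A..B}" for n
      by (intro integrable_continuous_interval continuous_intros f q)
    show "(\<lambda>r. C\<^sup>2 * q r) integrable_on {A..B}" by (intro integrable_continuous_interval continuous_intros q)
    show "norm ((f n r)\<^sup>2 * q r) \<le> C\<^sup>2 * q r" if "r \<in> {A..B}" for n r
    proof -
      have "(f n r)\<^sup>2 \<le> C\<^sup>2" using f(2)[OF that, of n] by (metis abs_ge_zero power2_abs power_mono)
      then show ?thesis using q(2)[OF that] by (simp add: abs_mult mult_right_mono)
    qed
    show "(\<lambda>n. (f n r)\<^sup>2 * q r) \<longlonglongrightarrow> (l r)\<^sup>2 * q r" if "r \<in> {A..B}" for r
      by (intro tendsto_intros f that)
  qed
  have qc: "continuous_on {A..B} (\<lambda>r. 1 / (bdist r0 R r)\<^sup>2 * W r)" by (intro continuous_intros dc Wc)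
  have c1: "(\<lambda>n. integral {A..B} (\<lambda>r. (g n r)\<^sup>2 * (1 / (bdist r0 R r)\<^sup>2 * W r))) \<longlonglongrightarrow> integral {A..B} (\<lambda>r. (h r)\<^sup>2 * (1 / (bdist r0 R r)\<^sup>2 * W r))"
    by (rule conv[OF gc(1) gb gl qc]) (use Wb in auto)
  have c2: "(\<lambda>n. integral {A..B} (\<lambda>r. (g' n r)\<^sup>2 * W r)) \<longlonglongrightarrow> integral {A..B} (\<lambda>r. (h' r)\<^sup>2 * W r)"
    by (rule conv[OF gc(2) g'b g'l Wc]) (use Wb in auto)
  have "m * integral {A..B} (\<lambda>r. (g n r)\<^sup>2 * (1 / (bdist r0 R r)\<^sup>2 * W r)) \<le> integral {A..B} (\<lambda>r. (g' n r)\<^sup>2 * W r)" for n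
    using hardy_smooth_profile[OF r(1) AB(1,5,4) m P(1)[of n] P(2)[of n] Qc]
    by (simp add: g_def g'_def \<beta>_def \<beta>'_def W_def)
  then have le: "m * integral {A..B} (\<lambda>r. (h r)\<^sup>2 * (1 / (bdist r0 R r)\<^sup>2 * W r)) \<le> integral {A..B} (\<lambda>r. (h' r)\<^sup>2 * W r)"
    by (intro LIMSEQ_le[OF tendsto_mult[OF tendsto_const c1] c2]) auto
  have shrink: "integral {A..B} f = integral {a..b} f" if "\<And>r. r \<le> a \<or> b \<le> r \<Longrightarrow> f r = 0" for f :: "real \<Rightarrow> real"
  proof -
    have "integral {A..B} f = integral {A..B} (\<lambda>r. if r \<in> {a..b} then f r else 0)"
      by (intro integral_cong) (use that in auto)
    also have "\<dots> = integral ({a..b} \<inter> {A..B}) f" by (rule integral_restrict_Int)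
    also have "{a..b} \<inter> {A..B} = {a..b}" using AB by auto
    finally show ?thesis .
  qed
  show ?thesis using le h(3) by (subst (asm) (1 2) shrink) (auto simp: W_def)
qed

section \<open>Consequences of Hardy's inequality\<close>

text \<open>Truncation alone destroys differentiability, but an exponent above 1 restores it: at 0
  the difference quotient is at most \<open>\<bar>y\<bar> powr (q - 1)\<close> in modulus.\<close>

lemma pos_part_powr_deriv:
  fixes q s :: real
  assumes q: "1 < q"
  shows "((\<lambda>s. max 0 s powr q) has_real_derivative q * max 0 s powr (q - 1)) (at s)"
proof (rule linorder_cases[of s 0])
  assume s: "s < 0"
  have "((\<lambda>_. 0) has_real_derivative q * max 0 s powr (q - 1)) (at s)" using s by simp
  then show ?thesis
    by (rule has_field_derivative_transform_within_open[where S="{..<0}"]) (use s in auto)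
next
  assume s: "0 < s"
  then have "((\<lambda>s. s powr q) has_real_derivative q * max 0 s powr (q - 1)) (at s)"
    by (auto intro!: derivative_eq_intros)
  then show ?thesis
    by (rule has_field_derivative_transform_within_open[where S="{0<..}"]) (use s in auto)
next
  assume s: "s = 0"
  have l: "((\<lambda>y. \<bar>y\<bar> powr (q - 1)) \<longlongrightarrow> 0) (at (0::real))"
    using q by (auto intro!: tendsto_eq_intros tendsto_powr')
  have "((\<lambda>y. max 0 y powr q / y) \<longlongrightarrow> 0) (at (0::real))"
  proof (rule Lim_null_comparison[OF _ l], rule always_eventually, rule allI)
    fix y :: real
    show "norm (max 0 y powr q / y) \<le> \<bar>y\<bar> powr (q - 1)"
    proof (cases "0 < y")
      case True then show ?thesis by (simp add: powr_diff)
    next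
      case False
      then have "max 0 y = 0" by simp
      then show ?thesis by simp
    qed
  qed
  then show ?thesis using s q by (simp add: has_field_derivative_iff)
qed

lemma integrable_bdist_powr:
  fixes r0 R a b e :: real
  assumes e: "- 1 < e" and r: "r0 \<le> a" "b \<le> R"
  shows "(\<lambda>r. (r - r0) powr e + (R - r) powr e) integrable_on {a..b}"
proof (rule integrable_on_subinterval[where S="{r0..R}"])
  have 1: "(\<lambda>r. (r - r0) powr e) integrable_on {r0..R}" by (rule powr_shift_integrable[OF e])
  have "(\<lambda>r. (R - r) powr e) integrable_on {r0..R}"
  proof (cases "r0 \<le> R")
    case True
    have "((\<lambda>s. (R - s) powr e) has_integral - ((R - R) powr (e + 1)) / (e + 1) - - ((R - r0) powr (e + 1)) / (e + 1)) {r0..R}"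
    proof (rule fundamental_theorem_of_calculus_interior[OF True])
      show "continuous_on {r0..R} (\<lambda>s. - ((R - s) powr (e + 1)) / (e + 1))"
        using e by (intro continuous_intros continuous_on_powr') auto
      show "((\<lambda>s. - ((R - s) powr (e + 1)) / (e + 1)) has_vector_derivative (R - x) powr e) (at x)"
        if "x \<in> {r0<..<R}" for x
        unfolding has_real_derivative_iff_has_vector_derivative[symmetric] using that e
        by (auto intro!: derivative_eq_intros)
    qed
    then show ?thesis by blast
  qed auto
  then show "(\<lambda>r. (r - r0) powr e + (R - r) powr e) integrable_on {r0..R}"
    by (intro integrable_add 1)
qed (use r in auto)

lemma bdist_powr_le:
  assumes "r0 < r" "r < R"
  shows "bdist r0 R r powr e \<le> (r - r0) powr e + (R - r) powr e"
  by (cases "R - r \<le> r - r0") (auto simp: bdist_def min_def)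

text \<open>Testing the inequality for \<open>\<psi>\<close> with \<open>(\<psi> - \<epsilon>)\<^sub>+ powr (1 + 2\<tau>)\<close> and Hardy's inequality with
  \<open>(\<psi> - \<epsilon>)\<^sub>+ powr (1 + \<tau>)\<close>; the exponent \<open>\<tau> > 0\<close> makes all integrals converge as \<open>\<epsilon> \<rightarrow> 0\<close>.\<close>

lemma no_subsolution:
  assumes r: "0 < r0" "r0 \<le> a" "a < b" "b \<le> R"
    and m: "0 < m" "ereal m < hardy_constant (annulus r0 R :: 'a::euclidean_space set)"
    and \<psi>: "\<And>r. a < r \<Longrightarrow> r < b \<Longrightarrow> (\<psi> has_real_derivative d r) (at r)"
      "\<And>r. a < r \<Longrightarrow> r < b \<Longrightarrow> ((\<lambda>r. r ^ (DIM('a) - 1) * d r) has_real_derivative D r) (at r)"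
      "\<And>r. a < r \<Longrightarrow> r < b \<Longrightarrow> - (r ^ (DIM('a) - 1) * \<nu> / (bdist r0 R r)\<^sup>2 * \<psi> r) \<le> D r"
      "\<And>r. a < r \<Longrightarrow> r < b \<Longrightarrow> 0 < \<psi> r \<and> \<psi> r \<le> C * bdist r0 R r powr \<gamma>"
      "(\<psi> \<longlongrightarrow> 0) (at_right a)" "(\<psi> \<longlongrightarrow> 0) (at_left b)"
    and \<tau>: "0 < \<tau>" "(1 + \<tau>)\<^sup>2 * \<nu> < (1 + 2 * \<tau>) * m" "1 < 2 * \<gamma> * (1 + \<tau>)"
  shows False
proof -
  define W where "W r = r ^ (DIM('a) - 1)" for r :: real
  define \<delta> where "\<delta> = bdist r0 R"
  have W: "0 < W r" if "a < r" for r using that r by (simp add: W_def)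
  have Wn: "W r \<noteq> 0" if "r \<in> {a<..<b}" for r using W[of r] that by auto
  have Wc: "continuous_on S W" for S unfolding W_def by (intro continuous_intros)
  have \<delta>: "0 < \<delta> r" if "a < r" "r < b" for r using that r unfolding \<delta>_def by (intro bdist_pos) auto
  have \<delta>c: "continuous_on S \<delta>" for S unfolding \<delta>_def bdist_def by (intro continuous_intros)
  have \<psi>c: "continuous_on {a<..<b} \<psi>"
    using DERIV_isCont[OF \<psi>(1)] by (auto intro!: continuous_at_imp_continuous_on)
  have dc: "continuous_on {a<..<b} d"
  proof -
    have "continuous_on {a<..<b} (\<lambda>r. W r * d r)"
      using DERIV_isCont[OF \<psi>(2)] by (auto intro!: continuous_at_imp_continuous_on simp: W_def)
    then have "continuous_on {a<..<b} (\<lambda>r. W r * d r / W r)"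
      by (intro continuous_on_divide Wc) (use Wn in auto)
    then show ?thesis
      by (rule continuous_on_eq) (use Wn in auto)
  qed
  define P where "P \<epsilon> r = (if a < r \<and> r < b then max 0 (\<psi> r - \<epsilon>) else 0)" for \<epsilon> r
  have Pnn: "0 \<le> P \<epsilon> r" for \<epsilon> r by (simp add: P_def)
  \<comment> \<open>With \<open>M\<close> and \<open>H\<close> for the two integrals and
    \<open>G\<close> for that of \<open>W * P powr (2 * \<tau>) * d\<^sup>2\<close>, Hardy's
    inequality gives \<open>m * M \<le> (1 + \<tau>)\<^sup>2 * G\<close> and the tested inequality
    gives \<open>(1 + 2 * \<tau>) * G \<le> \<nu> * H\<close>. Eliminating \<open>G\<close> leaves
    two integrals that have the same limit as \<epsilon> tends to 0.\<close>
  have step: "m * (1 + 2 * \<tau>) * integral {a..b} (\<lambda>r. W r / (\<delta> r)\<^sup>2 * P \<epsilon> r powr (2 + 2 * \<tau>))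
      \<le> (1 + \<tau>)\<^sup>2 * (\<nu> * integral {a..b} (\<lambda>r. W r / (\<delta> r)\<^sup>2 * (\<psi> r * P \<epsilon> r powr (1 + 2 * \<tau>))))
     \<and> (\<lambda>r. W r / (\<delta> r)\<^sup>2 * P \<epsilon> r powr (2 + 2 * \<tau>)) integrable_on {a..b}
     \<and> (\<lambda>r. W r / (\<delta> r)\<^sup>2 * (\<psi> r * P \<epsilon> r powr (1 + 2 * \<tau>))) integrable_on {a..b}"
    if \<epsilon>: "0 < \<epsilon>" for \<epsilon>
  proof -
    obtain x where x: "a < x" "\<And>s. a < s \<Longrightarrow> s < x \<Longrightarrow> \<psi> s < \<epsilon>"
      using order_tendstoD(2)[OF \<psi>(5) \<epsilon>] unfolding eventually_at_right_field by auto
    obtain y where y: "y < b" "\<And>s. y < s \<Longrightarrow> s < b \<Longrightarrow> \<psi> s < \<epsilon>"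
      using order_tendstoD(2)[OF \<psi>(6) \<epsilon>] unfolding eventually_at_left_field by auto
    \<comment> \<open>The truncation vanishes near both ends, so everything happens on a compact
      subinterval; the thirds ensure \<open>A < B\<close>.\<close>
    define A where "A = min ((a + x) / 2) (a + (b - a) / 3)"
    define B where "B = max ((y + b) / 2) (b - (b - a) / 3)"
    have "A \<le> a + (b - a) / 3" "b - (b - a) / 3 \<le> B" "(y + b) / 2 \<le> B" "A \<le> (a + x) / 2"
      unfolding A_def B_def by (rule min.cobounded1 min.cobounded2 max.cobounded1 max.cobounded2)+
    moreover have "a < A" "B < b" using x(1) y(1) r(3) by (auto simp: A_def B_def)
    moreover have "a + (b - a) / 3 < b - (b - a) / 3" "(a + x) / 2 < x" "y < (y + b) / 2" using x(1) y(1) r(3) by (simp_all add: field_simps)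
    ultimately have AB: "a < A" "A < B" "B < b" "A < x" "y < B" by linarith+
    have P0: "P \<epsilon> r = 0" if "r \<le> A \<or> B \<le> r" for r
      unfolding P_def using x(2)[of r] y(2)[of r] that AB by auto
    have sub: "{A..B} \<subseteq> {a<..<b}" using AB by auto
    have Pc: "continuous_on {A..B} (P \<epsilon>)"
    proof (rule continuous_on_eq)
      show "continuous_on {A..B} (\<lambda>r. max 0 (\<psi> r - \<epsilon>))" by (intro continuous_intros continuous_on_subset[OF \<psi>c sub])
    qed (use AB in \<open>auto simp: P_def\<close>)
    have Ppc: "continuous_on {A..B} (\<lambda>r. P \<epsilon> r powr q)" if "0 < q" for q
      using that Pnn by (intro continuous_on_powr' Pc continuous_intros) auto
    have cW: "continuous_on {A..B} (\<lambda>r. W r / (\<delta> r)\<^sup>2)"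
    proof (intro continuous_intros Wc \<delta>c ballI)
      fix r assume "r \<in> {A..B}"
      then show "(\<delta> r)\<^sup>2 \<noteq> 0" using \<delta>[of r] AB by simp
    qed
    have cd: "continuous_on {A..B} d" "continuous_on {A..B} \<psi>"
      by (intro continuous_on_subset[OF dc sub] continuous_on_subset[OF \<psi>c sub])+
    have Pd: "((\<lambda>r. P \<epsilon> r powr q) has_real_derivative q * P \<epsilon> r powr (q - 1) * d r) (at r)"
      if q: "1 < q" and rr: "a < r" "r < b" for q r
    proof -
      have 1: "((\<lambda>r. \<psi> r - \<epsilon>) has_real_derivative d r) (at r)"
        using DERIV_diff[OF \<psi>(1)[OF rr] DERIV_const[of \<epsilon>]] by simp
      have 2: "((\<lambda>r. max 0 (\<psi> r - \<epsilon>) powr q) has_real_derivative q * P \<epsilon> r powr (q - 1) * d r) (at r)"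
        using DERIV_chain2[OF pos_part_powr_deriv[OF q] 1] rr by (simp add: P_def)
      show ?thesis
        by (rule has_field_derivative_transform_within_open[OF 2, where S="{a<..<b}"]) (use rr in \<open>auto simp: P_def\<close>)
    qed
    define d0 where "d0 r = (if a < r \<and> r < b then d r else 0)" for r
    define h where "h r = P \<epsilon> r powr (1 + \<tau>)" for r
    define h' where "h' r = (1 + \<tau>) * P \<epsilon> r powr \<tau> * d0 r" for r
    have h0: "h r = 0 \<and> h' r = 0" if "r \<le> A \<or> B \<le> r" for r using P0[OF that] \<tau> by (simp add: h_def h'_def)
    have cases3: "(a < r \<and> r < b) \<or> r \<in> {..<A} \<union> {B<..}" for r using AB by auto
    have hd: "(h has_real_derivative h' r) (at r)" for r
      using cases3[of r]
    proof
      assume rr: "a < r \<and> r < b"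
      have "h = (\<lambda>r. P \<epsilon> r powr (1 + \<tau>))" by (simp add: h_def fun_eq_iff)
      then show ?thesis using Pd[of "1 + \<tau>" r] rr \<tau> by (simp add: h'_def d0_def)
    next
      assume rr: "r \<in> {..<A} \<union> {B<..}"
      then have "h' r = 0" using h0[of r] by auto
      then have "((\<lambda>_. 0) has_real_derivative h' r) (at r)" by simp
      then show ?thesis
        by (rule has_field_derivative_transform_within_open[where S="{..<A} \<union> {B<..}"]) (use rr h0 in \<open>auto\<close>)
    qed
    have hc: "continuous_on UNIV h'"
    proof (intro continuous_at_imp_continuous_on ballI)
      fix r
      from cases3[of r] show "isCont h' r"
      proof
        assume rr: "a < r \<and> r < b"
        have "continuous_on {a<..<b} (\<lambda>r. (1 + \<tau>) * max 0 (\<psi> r - \<epsilon>) powr \<tau> * d r)"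
          using \<tau> by (intro continuous_intros continuous_on_powr' \<psi>c dc) auto
        then have "continuous_on {a<..<b} h'" by (rule continuous_on_eq) (auto simp: h'_def P_def d0_def)
        then show ?thesis using rr by (simp add: continuous_on_eq_continuous_at)
      next
        assume rr: "r \<in> {..<A} \<union> {B<..}"
        have "\<forall>\<^sub>F x in nhds r. x \<in> {..<A} \<union> {B<..}" by (rule eventually_nhds_in_open) (use rr in auto)
        then have "\<forall>\<^sub>F x in nhds r. h' x = 0" by eventually_elim (use h0 in auto)
        then show ?thesis using isCont_cong[of h' "\<lambda>_. 0" r] by simp
      qed
    qed
    have hardy: "m * integral {A..B} (\<lambda>r. (h r)\<^sup>2 / (\<delta> r)\<^sup>2 * W r) \<le> integral {A..B} (\<lambda>r. (h' r)\<^sup>2 * W r)"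
      unfolding W_def \<delta>_def
      by (rule hardy_profile[OF r(1) _ AB(2) _ m hd hc h0]) (use r AB in auto)
    define G where "G = integral {A..B} (\<lambda>r. W r * P \<epsilon> r powr (2 * \<tau>) * (d r)\<^sup>2)"
    define H where "H = integral {A..B} (\<lambda>r. W r / (\<delta> r)\<^sup>2 * (\<psi> r * P \<epsilon> r powr (1 + 2 * \<tau>)))"
    define M where "M = integral {A..B} (\<lambda>r. W r / (\<delta> r)\<^sup>2 * P \<epsilon> r powr (2 + 2 * \<tau>))"
    have pw: "(P \<epsilon> r powr q)\<^sup>2 = P \<epsilon> r powr (2 * q)" for r q
      by (simp add: power2_eq_square flip: powr_add)
    have e1: "integral {A..B} (\<lambda>r. (h r)\<^sup>2 / (\<delta> r)\<^sup>2 * W r) = M"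
      unfolding M_def by (intro integral_cong) (simp add: h_def pw)
    have e2: "integral {A..B} (\<lambda>r. (h' r)\<^sup>2 * W r) = (1 + \<tau>)\<^sup>2 * G"
    proof -
      have "integral {A..B} (\<lambda>r. (h' r)\<^sup>2 * W r) = integral {A..B} (\<lambda>r. (1 + \<tau>)\<^sup>2 * (W r * P \<epsilon> r powr (2 * \<tau>) * (d r)\<^sup>2))"
        by (intro integral_cong) (use AB in \<open>simp add: h'_def d0_def power_mult_distrib pw\<close>)
      then show ?thesis by (simp add: G_def)
    qed
    have iG: "(\<lambda>r. W r * P \<epsilon> r powr (2 * \<tau>) * (d r)\<^sup>2) integrable_on {A..B}"
      using \<tau> by (intro integrable_continuous_interval continuous_intros Wc Ppc cd) auto
    have iH: "(\<lambda>r. W r / (\<delta> r)\<^sup>2 * (\<psi> r * P \<epsilon> r powr (1 + 2 * \<tau>))) integrable_on {A..B}"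
      using \<tau> by (intro integrable_continuous_interval continuous_on_mult cW Ppc cd) auto
    have iM: "(\<lambda>r. W r / (\<delta> r)\<^sup>2 * P \<epsilon> r powr (2 + 2 * \<tau>)) integrable_on {A..B}"
      using \<tau> by (intro integrable_continuous_interval continuous_on_mult cW Ppc) auto
    \<comment> \<open>Integration by parts, as the integral of the derivative of
      \<open>W * d * P powr (1 + 2 * \<tau>)\<close>; the boundary terms are 0 because
      \<open>P\<close> vanishes at \<open>A\<close> and \<open>B\<close>.\<close>
    have ftc: "((\<lambda>r. D r * P \<epsilon> r powr (1 + 2 * \<tau>) + (1 + 2 * \<tau>) * (W r * P \<epsilon> r powr (2 * \<tau>) * (d r)\<^sup>2)) has_integral
      W B * d B * P \<epsilon> B powr (1 + 2 * \<tau>) - W A * d A * P \<epsilon> A powr (1 + 2 * \<tau>)) {A..B}"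
    proof (rule fundamental_theorem_of_calculus)
      fix r assume rr: "r \<in> {A..B}"
      then have ab: "a < r" "r < b" using AB by auto
      have "((\<lambda>r. W r * d r * P \<epsilon> r powr (1 + 2 * \<tau>)) has_real_derivative
          D r * P \<epsilon> r powr (1 + 2 * \<tau>) + (1 + 2 * \<tau>) * (W r * P \<epsilon> r powr (2 * \<tau>) * (d r)\<^sup>2)) (at r)"
        by (rule DERIV_cong[OF DERIV_mult[OF \<psi>(2)[OF ab, folded W_def] Pd[of "1 + 2 * \<tau>", OF _ ab]]])
          (use \<tau> in \<open>auto simp: power2_eq_square algebra_simps\<close>)
      then show "((\<lambda>r. W r * d r * P \<epsilon> r powr (1 + 2 * \<tau>)) has_vector_derivative
          D r * P \<epsilon> r powr (1 + 2 * \<tau>) + (1 + 2 * \<tau>) * (W r * P \<epsilon> r powr (2 * \<tau>) * (d r)\<^sup>2)) (at r within {A..B})"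
        by (rule has_vector_derivative_at_within[OF has_real_derivative_iff_has_vector_derivative[THEN iffD1]])
    qed (use AB in simp)
    have "- \<nu> * H + (1 + 2 * \<tau>) * G \<le> 0"
    proof (rule has_integral_le)
      show "((\<lambda>r. - \<nu> * (W r / (\<delta> r)\<^sup>2 * (\<psi> r * P \<epsilon> r powr (1 + 2 * \<tau>))) + (1 + 2 * \<tau>) * (W r * P \<epsilon> r powr (2 * \<tau>) * (d r)\<^sup>2))
          has_integral - \<nu> * H + (1 + 2 * \<tau>) * G) {A..B}"
        unfolding G_def H_def by (intro has_integral_add has_integral_mult_right integrable_integral iG iH)
      show "((\<lambda>r. D r * P \<epsilon> r powr (1 + 2 * \<tau>) + (1 + 2 * \<tau>) * (W r * P \<epsilon> r powr (2 * \<tau>) * (d r)\<^sup>2)) has_integral 0) {A..B}"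
        using ftc \<tau> by (simp add: P0)
      fix r assume "r \<in> {A..B}"
      then have ab: "a < r" "r < b" using AB by auto
      have "- (W r * \<nu> / (\<delta> r)\<^sup>2 * \<psi> r) * P \<epsilon> r powr (1 + 2 * \<tau>) \<le> D r * P \<epsilon> r powr (1 + 2 * \<tau>)"
        using \<psi>(3)[OF ab] unfolding W_def \<delta>_def by (intro mult_right_mono) auto
      then show "- \<nu> * (W r / (\<delta> r)\<^sup>2 * (\<psi> r * P \<epsilon> r powr (1 + 2 * \<tau>))) + (1 + 2 * \<tau>) * (W r * P \<epsilon> r powr (2 * \<tau>) * (d r)\<^sup>2)
         \<le> D r * P \<epsilon> r powr (1 + 2 * \<tau>) + (1 + 2 * \<tau>) * (W r * P \<epsilon> r powr (2 * \<tau>) * (d r)\<^sup>2)"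
        by (simp add: ac_simps)
    qed
    then have GH: "(1 + 2 * \<tau>) * G \<le> \<nu> * H" by simp
    have "m * (1 + 2 * \<tau>) * M \<le> (1 + 2 * \<tau>) * ((1 + \<tau>)\<^sup>2 * G)"
      using mult_left_mono[OF hardy[unfolded e1 e2], of "1 + 2 * \<tau>"] \<tau> by (simp add: ac_simps)
    also have "\<dots> = (1 + \<tau>)\<^sup>2 * ((1 + 2 * \<tau>) * G)" by (simp only: ac_simps)
    also have "\<dots> \<le> (1 + \<tau>)\<^sup>2 * (\<nu> * H)" by (intro mult_left_mono GH) simp
    finally have fin: "m * (1 + 2 * \<tau>) * M \<le> (1 + \<tau>)\<^sup>2 * (\<nu> * H)" .
    have ext: "f integrable_on {a..b} \<and> integral {a..b} f = integral {A..B} f"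
      if f: "f integrable_on {A..B}" "\<And>r. r \<le> A \<or> B \<le> r \<Longrightarrow> f r = 0" for f :: "real \<Rightarrow> real"
    proof -
      have eq: "(\<lambda>r. if r \<in> {A..B} then f r else 0) = f" using f(2) by (auto simp: fun_eq_iff)
      have "((\<lambda>r. if r \<in> {A..B} then f r else 0) has_integral integral {A..B} f) {a..b}"
        using has_integral_restrict_closed_subinterval[of f "integral {A..B} f" A B a b]
          integrable_integral[OF f(1)] AB by auto
      then have "(f has_integral integral {A..B} f) {a..b}" unfolding eq .
      then show ?thesis by (auto simp: integral_unique)
    qed
    have "M = integral {a..b} (\<lambda>r. W r / (\<delta> r)\<^sup>2 * P \<epsilon> r powr (2 + 2 * \<tau>)) \<and>
        (\<lambda>r. W r / (\<delta> r)\<^sup>2 * P \<epsilon> r powr (2 + 2 * \<tau>)) integrable_on {a..b}"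
      using ext[OF iM] P0 by (simp add: M_def)
    moreover have "H = integral {a..b} (\<lambda>r. W r / (\<delta> r)\<^sup>2 * (\<psi> r * P \<epsilon> r powr (1 + 2 * \<tau>))) \<and>
        (\<lambda>r. W r / (\<delta> r)\<^sup>2 * (\<psi> r * P \<epsilon> r powr (1 + 2 * \<tau>))) integrable_on {a..b}"
      using ext[OF iH] P0 by (simp add: H_def)
    ultimately show ?thesis using fin by auto
  qed
  define \<psi>0 where "\<psi>0 r = (if a < r \<and> r < b then \<psi> r else 0)" for r
  have C0: "0 < C"
  proof -
    have "0 < \<psi> ((a + b) / 2) \<and> \<psi> ((a + b) / 2) \<le> C * bdist r0 R ((a + b) / 2) powr \<gamma>" using \<psi>(4) r by auto
    then have "0 < C * bdist r0 R ((a + b) / 2) powr \<gamma>" by linarith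
    then show ?thesis using powr_ge_zero[of "bdist r0 R ((a + b) / 2)" \<gamma>] by (auto simp: zero_less_mult_iff)
  qed
  \<comment> \<open>The exponent of the distance in the majorant of the integrands; the hypothesis
    \<open>1 < 2 * \<gamma> * (1 + \<tau>)\<close> says that it exceeds -1.\<close>
  define e where "e = \<gamma> * (2 + 2 * \<tau>) - 2"
  have e: "- 1 < e" using \<tau>(3) by (simp add: e_def algebra_simps)
  define V where "V = R ^ (DIM('a) - 1)"
  define dom where "dom r = V * C powr (2 + 2 * \<tau>) * ((r - r0) powr e + (R - r) powr e)" for r
  have dom: "dom integrable_on {a..b}" unfolding dom_def
    by (intro integrable_on_mult_right integrable_bdist_powr e) (use r in auto)
  have dom_le: "W r / (\<delta> r)\<^sup>2 * \<psi>0 r powr (2 + 2 * \<tau>) \<le> dom r" for r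
  proof (cases "a < r \<and> r < b")
    case True
    then have ps: "0 < \<psi> r" "\<psi> r \<le> C * \<delta> r powr \<gamma>" "0 < \<delta> r" using \<psi>(4)[of r] \<delta>[of r] by (auto simp: \<delta>_def)
    have "\<psi> r powr (2 + 2 * \<tau>) \<le> (C * \<delta> r powr \<gamma>) powr (2 + 2 * \<tau>)" using ps \<tau> by (intro powr_mono2) auto
    also have "\<dots> = C powr (2 + 2 * \<tau>) * \<delta> r powr (e + 2)"
      using C0 by (simp add: powr_mult powr_powr e_def)
    also have "\<dots> = C powr (2 + 2 * \<tau>) * \<delta> r powr e * (\<delta> r)\<^sup>2" using ps by (simp add: powr_add)
    finally have "\<psi>0 r powr (2 + 2 * \<tau>) / (\<delta> r)\<^sup>2 \<le> C powr (2 + 2 * \<tau>) * \<delta> r powr e" using ps True by (simp add: divide_simps \<psi>0_def)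
    also have "\<dots> \<le> C powr (2 + 2 * \<tau>) * ((r - r0) powr e + (R - r) powr e)"
      unfolding \<delta>_def using True r by (intro mult_left_mono bdist_powr_le) auto
    finally have "W r * (\<psi>0 r powr (2 + 2 * \<tau>) / (\<delta> r)\<^sup>2) \<le> V * (C powr (2 + 2 * \<tau>) * ((r - r0) powr e + (R - r) powr e))"
      unfolding W_def V_def using True r by (intro mult_mono power_mono) auto
    then show ?thesis by (simp add: dom_def ac_simps)
  next
    case False
    then show ?thesis using C0 r by (auto simp: \<psi>0_def dom_def V_def)
  qed
  define ee where "ee n = inverse (real (Suc n))" for n
  have ee: "0 < ee n" for n by (simp add: ee_def)
  have eel: "ee \<longlonglongrightarrow> 0" unfolding ee_def by (rule LIMSEQ_inverse_real_of_nat)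
  have Pl: "(\<lambda>n. P (ee n) r powr q) \<longlonglongrightarrow> \<psi>0 r powr q" if "0 < q" for r q
  proof (cases "a < r \<and> r < b")
    case True
    have "(\<lambda>n. max 0 (\<psi> r - ee n)) \<longlonglongrightarrow> max 0 (\<psi> r - 0)" by (intro tendsto_intros eel)
    then have "(\<lambda>n. P (ee n) r) \<longlonglongrightarrow> \<psi>0 r" using True \<psi>(4)[of r] by (simp add: P_def \<psi>0_def max_def)
    then show ?thesis using True \<psi>(4)[of r] by (intro tendsto_powr tendsto_const) (auto simp: \<psi>0_def)
  next
    case False
    then have "\<psi>0 r = 0" "P (ee n) r = 0" for n unfolding P_def \<psi>0_def by argo+
    then show ?thesis by simp
  qed
  have Ple: "P (ee n) r \<le> \<psi>0 r" for n r using ee[of n] \<psi>(4)[of r] by (auto simp: P_def \<psi>0_def)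
  have wnn: "0 \<le> W r / (\<delta> r)\<^sup>2" if "r \<in> {a..b}" for r using that r by (auto simp: W_def)
  have Pple: "P (ee n) r powr q \<le> \<psi>0 r powr q" if "0 < q" for n r q using Ple Pnn that by (intro powr_mono2) auto
  have \<psi>0nn: "0 \<le> \<psi>0 r" for r using \<psi>(4)[of r] by (auto simp: \<psi>0_def)
  have \<psi>0p: "\<psi>0 r powr (2 + 2 * \<tau>) = \<psi>0 r * \<psi>0 r powr (1 + 2 * \<tau>)" for r
  proof -
    have "\<psi>0 r powr (2 + 2 * \<tau>) = \<psi>0 r powr (1 + (1 + 2 * \<tau>))" by simp
    also have "\<dots> = \<psi>0 r powr 1 * \<psi>0 r powr (1 + 2 * \<tau>)" by (rule powr_add)
    finally show ?thesis using \<psi>0nn[of r] by simp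
  qed
  have \<psi>P: "\<psi> r * P \<epsilon> r powr q = \<psi>0 r * P \<epsilon> r powr q" for \<epsilon> r q by (simp add: P_def \<psi>0_def)
  define L where "L r = W r / (\<delta> r)\<^sup>2 * \<psi>0 r powr (2 + 2 * \<tau>)" for r
  have i1: "(\<lambda>r. W r / (\<delta> r)\<^sup>2 * P (ee n) r powr (2 + 2 * \<tau>)) integrable_on {a..b}"
    and i2: "(\<lambda>r. W r / (\<delta> r)\<^sup>2 * (\<psi> r * P (ee n) r powr (1 + 2 * \<tau>))) integrable_on {a..b}" for n
    using step[OF ee[of n]] by blast+
  have b1: "norm (W r / (\<delta> r)\<^sup>2 * P (ee n) r powr (2 + 2 * \<tau>)) \<le> dom r" if "r \<in> {a..b}" for n r
  proof -
    have "W r / (\<delta> r)\<^sup>2 * P (ee n) r powr (2 + 2 * \<tau>) \<le> dom r"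
      by (rule order_trans[OF _ dom_le], intro mult_left_mono wnn[OF that] Pple) (use \<tau> in simp)
    moreover have "0 \<le> W r / (\<delta> r)\<^sup>2 * P (ee n) r powr (2 + 2 * \<tau>)" by (intro mult_nonneg_nonneg wnn[OF that]) simp
    ultimately show ?thesis by (simp only: real_norm_def abs_of_nonneg)
  qed
  have b2: "norm (W r / (\<delta> r)\<^sup>2 * (\<psi> r * P (ee n) r powr (1 + 2 * \<tau>))) \<le> dom r" if "r \<in> {a..b}" for n r
  proof -
    have "W r / (\<delta> r)\<^sup>2 * (\<psi>0 r * P (ee n) r powr (1 + 2 * \<tau>)) \<le> dom r"
      by (rule order_trans[OF _ dom_le[unfolded \<psi>0p]], intro mult_left_mono wnn[OF that] Pple \<psi>0nn) (use \<tau> in simp)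
    moreover have "0 \<le> W r / (\<delta> r)\<^sup>2 * (\<psi>0 r * P (ee n) r powr (1 + 2 * \<tau>))" by (intro mult_nonneg_nonneg wnn[OF that] \<psi>0nn) simp
    ultimately show ?thesis unfolding \<psi>P by (simp only: real_norm_def abs_of_nonneg)
  qed
  have l1: "(\<lambda>n. W r / (\<delta> r)\<^sup>2 * P (ee n) r powr (2 + 2 * \<tau>)) \<longlonglongrightarrow> L r" for r
    unfolding L_def using \<tau> by (intro tendsto_mult tendsto_const Pl) auto
  have l2: "(\<lambda>n. W r / (\<delta> r)\<^sup>2 * (\<psi> r * P (ee n) r powr (1 + 2 * \<tau>))) \<longlonglongrightarrow> L r" for r
    unfolding L_def \<psi>P \<psi>0p using \<tau> by (intro tendsto_mult tendsto_const Pl) auto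
  have c1: "L integrable_on {a..b}"
    "(\<lambda>n. integral {a..b} (\<lambda>r. W r / (\<delta> r)\<^sup>2 * P (ee n) r powr (2 + 2 * \<tau>))) \<longlonglongrightarrow> integral {a..b} L"
    by (rule dominated_convergence[OF i1 dom b1 l1]; assumption)+
  have c2: "(\<lambda>n. integral {a..b} (\<lambda>r. W r / (\<delta> r)\<^sup>2 * (\<psi> r * P (ee n) r powr (1 + 2 * \<tau>)))) \<longlonglongrightarrow> integral {a..b} L"
    by (rule dominated_convergence(2)[OF i2 dom b2 l2]; assumption)
  \<comment> \<open>Both sides now contain the same integral; it is positive, and cancelling it
    contradicts the choice of \<tau>.\<close>
  have le: "m * (1 + 2 * \<tau>) * integral {a..b} L \<le> (1 + \<tau>)\<^sup>2 * (\<nu> * integral {a..b} L)"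
    by (rule LIMSEQ_le[OF tendsto_mult[OF tendsto_const c1(2)] tendsto_mult[OF tendsto_const tendsto_mult[OF tendsto_const c2]]])
      (intro exI allI impI step[OF ee, THEN conjunct1])
  have Lnn: "0 \<le> L r" if "r \<in> {a..b}" for r unfolding L_def by (intro mult_nonneg_nonneg wnn[OF that]) simp
  have "0 < integral {a..b} L"
  proof -
    define x where "x = a + (b - a) / 3"
    define y where "y = b - (b - a) / 3"
    have xy: "a < x" "y < b" using r(3) by (auto simp: x_def y_def)
    have xy': "x < y" using r(3) by (simp add: x_def y_def field_simps)
    have sub: "{x..y} \<subseteq> {a<..<b}" using xy by auto
    have "continuous_on {x..y} (\<lambda>r. W r / (\<delta> r)\<^sup>2 * \<psi> r powr (2 + 2 * \<tau>))"
    proof (intro continuous_intros Wc \<delta>c continuous_on_subset[OF \<psi>c sub] ballI)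
      fix r assume "r \<in> {x..y}"
      then have rr: "a < r" "r < b" using xy by auto
      show "(\<delta> r)\<^sup>2 \<noteq> 0" "\<psi> r \<noteq> 0" using \<delta>[OF rr] \<psi>(4)[OF rr] by auto
    qed
    then obtain l where l: "0 < l" "\<And>t. x \<le> t \<Longrightarrow> t \<le> y \<Longrightarrow> l \<le> W t / (\<delta> t)\<^sup>2 * \<psi> t powr (2 + 2 * \<tau>)"
    proof (rule cont_pos_lower)
      fix t assume "x \<le> t" "t \<le> y"
      then have t: "a < t" "t < b" using xy by auto
      show "0 < W t / (\<delta> t)\<^sup>2 * \<psi> t powr (2 + 2 * \<tau>)" using W[OF t(1)] \<delta>[OF t] \<psi>(4)[OF t] by simp
    qed blast
    have Lxy: "L integrable_on {x..y}" by (rule integrable_on_subinterval[OF c1(1)]) (use xy in auto)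
    have "0 < l * (y - x)" using l xy' by simp
    also have "\<dots> = integral {x..y} (\<lambda>_. l)" using xy' by simp
    also have "\<dots> \<le> integral {x..y} L"
      by (rule integral_le) (use Lxy l(2) xy in \<open>auto simp: L_def \<psi>0_def\<close>)
    also have "\<dots> \<le> integral {a..b} L"
      by (rule integral_subset_le) (use Lxy c1(1) Lnn xy in auto)
    finally show ?thesis .
  qed
  then have "m * (1 + 2 * \<tau>) \<le> (1 + \<tau>)\<^sup>2 * \<nu>" using le by (metis mult.assoc mult_le_cancel_right_pos)
  then show False using \<tau>(2) by (simp add: mult.commute)
qed

text \<open>At \<tau> = 0 the inequality reads \<open>\<nu> < m\<close>, so it persists for small
  \<tau>.\<close>

lemma small_exponent:
  fixes \<nu> m :: real
  assumes "0 < \<nu>" "\<nu> < m"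
  obtains \<tau> where "0 < \<tau>" "(1 + \<tau>)\<^sup>2 * \<nu> < (1 + 2 * \<tau>) * m"
proof
  define \<tau> where "\<tau> = min 1 ((m - \<nu>) / (2 * \<nu>))"
  have t: "0 < \<tau>" "\<tau> \<le> 1" "\<tau> \<le> (m - \<nu>) / (2 * \<nu>)" using assms by (auto simp: \<tau>_def)
  have "2 * (\<tau> * \<nu>) \<le> m - \<nu>" using mult_right_mono[OF t(3), of \<nu>] assms by simp
  moreover have "\<tau> * (\<tau> * \<nu>) \<le> 1 * (\<tau> * \<nu>)" using t assms by (intro mult_right_mono) auto
  moreover have "0 < \<tau> * (m - \<nu>)" using t assms by simp
  moreover have "(1 + \<tau>)\<^sup>2 * \<nu> = \<nu> + 2 * (\<tau> * \<nu>) + \<tau> * (\<tau> * \<nu>)" "(1 + 2 * \<tau>) * m = m + 2 * (\<tau> * m)"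
    "\<tau> * (m - \<nu>) = \<tau> * m - \<tau> * \<nu>"
    by (simp_all add: power2_eq_square algebra_simps)
  moreover have "\<nu> + 2 * x + y < m + 2 * z" if "2 * x \<le> m - \<nu>" "y \<le> 1 * x" "0 < z - x" for x y z
    using that assms(2) by (smt (verit))
  ultimately show "(1 + \<tau>)\<^sup>2 * \<nu> < (1 + 2 * \<tau>) * m" by metis
  show "0 < \<tau>" by (fact t)
qed

lemma hardy_constant_gt:
  assumes "ereal x < hardy_constant \<Omega>"
  obtains m where "x < m" "ereal m < hardy_constant \<Omega>"
proof -
  obtain y where "ereal x < y" "y < hardy_constant \<Omega>" using dense[OF assms] by auto
  then show ?thesis using that by (cases y) auto
qed

text \<open>For \<open>1/4 < \<nu>\<close> and \<open>g < 1/2\<close> close to \<open>1/2\<close>, the function \<open>s powr g - k s powr (1/2)\<close> of the distance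
  \<open>s\<close> to the inner boundary is a subsolution for small \<open>s\<close>.\<close>

lemma hardy_constant_le_quarter:
  assumes r: "0 < r0" "r0 < R"
  shows "hardy_constant (annulus r0 R :: 'a::euclidean_space set) \<le> ereal (1/4)"
proof (rule ccontr)
  assume "\<not> ?thesis"
  then have "ereal (1/4) < hardy_constant (annulus r0 R :: 'a set)" by simp
  then obtain m where m: "1/4 < m" "ereal m < hardy_constant (annulus r0 R :: 'a set)" by (rule hardy_constant_gt)
  define n where "n = DIM('a) - 1"
  obtain \<nu> where \<nu>: "1/4 < \<nu>" "\<nu> < m" using dense[OF m(1)] by auto
  obtain \<tau> where \<tau>: "0 < \<tau>" "(1 + \<tau>)\<^sup>2 * \<nu> < (1 + 2 * \<tau>) * m" using small_exponent[of \<nu> m] \<nu> by auto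
  \<comment> \<open>The midpoint of \<open>1 / (2 * (1 + \<tau>))\<close> and 1/2: below 1/2, yet
    large enough for the integrability condition of \<open>no_subsolution\<close>.\<close>
  define g where "g = (1/2 + 1 / (2 * (1 + \<tau>))) / 2"
  have g2: "2 * g * (1 + \<tau>) = (1 + \<tau>) / 2 + 1/2" using \<tau>(1) by (simp add: g_def field_simps)
  have g: "0 < g" "g < 1/2" "1 < 2 * g * (1 + \<tau>)"
    using \<tau>(1) by (simp_all add: g2) (simp_all add: g_def divide_simps)
  \<comment> \<open>\<open>c1\<close> and \<open>c2\<close> are the factors that
    \<open>u'' + \<nu> / s\<^sup>2 * u\<close> produces from the exponents \<open>g\<close> and 1/2.
    Both are positive for \<open>\<nu> > 1/4\<close>, and they differ by
    \<open>(g - 1/2)\<^sup>2\<close>.\<close>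
  define c1 where "c1 = g * (g - 1) + \<nu>"
  define c2 where "c2 = \<nu> - 1/4"
  have "c1 - c2 = (g - 1/2)\<^sup>2" by (simp add: c1_def c2_def power2_eq_square algebra_simps)
  then have c: "0 < c2" "0 < c1 - c2" using g \<nu> by (auto simp: c2_def)
  \<comment> \<open>Small enough for the distance to the boundary to be \<open>s\<close>, and for
    the factor \<open>n * s / r\<close> of the weight term to stay below
    \<open>c1 - c2\<close>.\<close>
  define b where "b = min ((R - r0) / 2) ((c1 - c2) * r0 / (real n + 1))"
  have b: "b \<le> (R - r0) / 2" "b \<le> (c1 - c2) * r0 / (real n + 1)" unfolding b_def by (rule min.cobounded1 min.cobounded2)+
  moreover have "0 < b" using r c by (simp add: b_def)
  ultimately have b: "0 < b" "b \<le> (R - r0) / 2" "b \<le> (c1 - c2) * r0 / (real n + 1)" by auto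
  \<comment> \<open>Makes \<psi> vanish at \<open>r0 + b\<close>.\<close>
  define k where "k = b powr (g - 1/2)"
  define \<psi> where "\<psi> r = (r - r0) powr g - k * (r - r0) powr (1/2)" for r
  define d where "d r = g * (r - r0) powr (g - 1) - k * (1/2 * (r - r0) powr (1/2 - 1))" for r
  define d2 where "d2 r = g * ((g - 1) * (r - r0) powr (g - 2)) - k * (1/2 * ((1/2 - 1) * (r - r0) powr (1/2 - 2)))" for r
  define D where "D r = real n / r * r ^ n * d r + d2 r * r ^ n" for r
  have dp: "((\<lambda>r. (r - r0) powr q) has_real_derivative q * (r - r0) powr (q - 1)) (at r)" if "r0 < r" for q r
    using that by (auto intro!: derivative_eq_intros)
  have psid: "(\<psi> has_real_derivative d r) (at r)" if "r0 < r" for r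
    unfolding \<psi>_def[abs_def] d_def by (intro DERIV_diff DERIV_cmult dp that)
  have dd: "(d has_real_derivative d2 r) (at r)" if "r0 < r" for r
  proof -
    have "(d has_real_derivative g * ((g - 1) * (r - r0) powr (g - 1 - 1)) - k * (1/2 * ((1/2 - 1) * (r - r0) powr (1/2 - 1 - 1)))) (at r)"
      unfolding d_def[abs_def] by (intro DERIV_diff DERIV_cmult dp that)
    then show ?thesis by (simp add: d2_def)
  qed
  have pw: "k * (r - r0) powr (1/2) = (r - r0) powr g * ((r - r0) / b) powr (1/2 - g)" if "r0 < r" for r
    using that b(1) unfolding k_def by (simp add: powr_divide powr_diff)
  have t: "0 < ((r - r0) / b) powr (1/2 - g)" "((r - r0) / b) powr (1/2 - g) < 1" if "r0 < r" "r < r0 + b" for r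
  proof -
    show "0 < ((r - r0) / b) powr (1/2 - g)" using that b(1) by simp
    have "((r - r0) / b) powr (1/2 - g) < 1 powr (1/2 - g)" using that b(1) g by (intro powr_less_mono2) auto
    then show "((r - r0) / b) powr (1/2 - g) < 1" by simp
  qed
  have bd: "bdist r0 R r = r - r0" if "r0 < r" "r < r0 + b" for r
    using that b(2) by (auto simp: bdist_def min_def field_simps)
  show False
  proof (rule no_subsolution[of r0 r0 "r0 + b" R m \<psi> d D \<nu> 1 g \<tau>])
    show "ereal m < hardy_constant (annulus r0 R :: 'a set)" by (fact m)
    fix r assume rr: "r0 < r" "r < r0 + b"
    show "(\<psi> has_real_derivative d r) (at r)" by (rule psid[OF rr(1)])
    show "((\<lambda>r. r ^ (DIM('a) - 1) * d r) has_real_derivative D r) (at r)"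
      unfolding D_def n_def[symmetric] by (rule DERIV_mult[OF weight_deriv dd]) (use rr r in auto)
    define s where "s = r - r0"
    \<comment> \<open>The ratio of the two terms of \<psi>, between 0 and 1. In terms of it \<psi>,
      \<open>d\<close> and \<open>d2\<close> are powers of \<open>s\<close> times affine functions
      of \<open>x\<close>.\<close>
    define x where "x = (s / b) powr (1/2 - g)"
    have s: "0 < s" "s < b" using rr by (auto simp: s_def)
    have x: "0 < x" "x < 1" using t[OF rr] by (auto simp: x_def s_def)
    have k2: "k * s powr (1/2) = s powr g * x" using pw[OF rr(1)] by (simp add: s_def x_def)
    have psi: "\<psi> r = s powr g * (1 - x)" using k2 by (simp add: \<psi>_def s_def[symmetric] algebra_simps)
    have d: "d r = s powr g * (g - x / 2) / s"
    proof -
      have "s powr (g - 1) = s powr g / s" "s powr (1/2 - 1) = s powr (1/2) / s" using s by (auto simp only: powr_diff powr_one)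
      then have "d r = (g * s powr g - k * s powr (1/2) / 2) / s"
        unfolding d_def s_def[symmetric] by (simp add: diff_divide_distrib)
      then show ?thesis unfolding k2 by (simp add: algebra_simps)
    qed
    have d2: "d2 r = s powr g * (g * (g - 1) + x / 4) / s\<^sup>2"
    proof -
      have "s powr (g - 2) = s powr g / s\<^sup>2" "s powr (1/2 - 2) = s powr (1/2) / s\<^sup>2" using s by (simp_all only: powr_diff powr_numeral)
      then have "d2 r = (g * (g - 1) * s powr g + k * s powr (1/2) / 4) / s\<^sup>2"
        unfolding d2_def s_def[symmetric] by (simp add: add_divide_distrib diff_divide_distrib algebra_simps)
      then show ?thesis unfolding k2 by (simp add: algebra_simps)
    qed
    show "0 < \<psi> r \<and> \<psi> r \<le> 1 * bdist r0 R r powr g"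
      using x s by (simp add: psi bd[OF rr] s_def[symmetric] mult_le_cancel_left1)
    have "x * c2 \<le> c2" using x c by (simp add: mult_le_cancel_right1)
    moreover have "- (c1 - c2) \<le> real n * s / r * (g - x / 2)"
    proof -
      have "real n * s / r \<le> c1 - c2"
      proof -
        have "real n * s / r \<le> real n * b / r0" using s rr r by (intro frac_le mult_left_mono) auto
        also have "\<dots> \<le> (real n + 1) * b / r0" using b r by (intro divide_right_mono mult_right_mono) auto
        also have "\<dots> \<le> c1 - c2" using b(3) r by (simp add: field_simps)
        finally show ?thesis .
      qed
      moreover have "0 \<le> real n * s / r" using s rr r by simp
      moreover have "\<bar>g - x / 2\<bar> \<le> 1" using g x by linarith
      ultimately have "\<bar>real n * s / r * (g - x / 2)\<bar> \<le> (c1 - c2) * 1" unfolding abs_mult by (intro mult_mono) auto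
      from abs_le_D2[OF this] show ?thesis by simp
    qed
    ultimately have key: "0 \<le> c1 - x * c2 + real n * s / r * (g - x / 2)" by linarith
    have "D r + r ^ n * \<nu> / s\<^sup>2 * \<psi> r = r ^ n * s powr g / s\<^sup>2 * (c1 - x * c2 + real n * s / r * (g - x / 2))"
      unfolding D_def d d2 psi c1_def c2_def using s rr r by (simp add: field_simps power2_eq_square)
    moreover have "0 \<le> r ^ n * s powr g / s\<^sup>2 * (c1 - x * c2 + real n * s / r * (g - x / 2))"
      using key s rr r by (intro mult_nonneg_nonneg) auto
    ultimately show "- (r ^ (DIM('a) - 1) * \<nu> / (bdist r0 R r)\<^sup>2 * \<psi> r) \<le> D r"
      unfolding bd[OF rr] n_def[symmetric] s_def[symmetric] by linarith
  next
    have c: "continuous_on {r0..r0 + b} \<psi>" unfolding \<psi>_def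
      using g by (intro continuous_intros continuous_on_powr') auto
    have "\<psi> r0 = 0" by (simp add: \<psi>_def)
    moreover have "\<psi> (r0 + b) = 0" using pw[of "r0 + b"] b(1) by (simp add: \<psi>_def)
    ultimately show "(\<psi> \<longlongrightarrow> 0) (at_right r0)" "(\<psi> \<longlongrightarrow> 0) (at_left (r0 + b))"
      using c b(1) by (auto simp: continuous_on_Icc_at_rightD continuous_on_Icc_at_leftD dest: continuous_on_Icc_at_rightD continuous_on_Icc_at_leftD)
  qed (use r b \<tau> g m in auto)
qed

text \<open>For \<open>0 < \<mu>\<close> a ground state contradicts \<open>no_subsolution\<close>
  with the exponent \<open>beta_plus \<mu>\<close>, at least 1/2, and an \<open>m\<close> strictly
  between \<mu> and the Hardy constant. Otherwise \<open>W * d\<close> is nondecreasing, so a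
  solution that leaves 0 with positive slope cannot return to 0.\<close>

theorem annular_ode_hardy:
  assumes r: "0 < r0" "r0 < R" and mu: "\<mu> \<noteq> 0" "ereal \<mu> < hardy_constant (annulus r0 R :: 'a::euclidean_space set)"
  shows "annular_ode r0 R \<mu> (\<lambda>r. r ^ (DIM('a) - 1)) (\<lambda>r. real (DIM('a) - 1) / r * r ^ (DIM('a) - 1))"
proof
  obtain m where m: "\<mu> < m" "ereal m < hardy_constant (annulus r0 R :: 'a set)" by (rule hardy_constant_gt[OF mu(2)])
  have "ereal m < ereal (1/4)" using less_le_trans[OF m(2) hardy_constant_le_quarter[OF r]] .
  then show q: "\<mu> < 1/4" using m(1) by simp
  show "r0 < R" by fact
  show "((\<lambda>r. r ^ (DIM('a) - 1)) has_real_derivative real (DIM('a) - 1) / r * r ^ (DIM('a) - 1)) (at r)" if "r0 \<le> r" for r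
    by (rule weight_deriv) (use that r in auto)
  show "continuous_on {r0..R} (\<lambda>r. real (DIM('a) - 1) / r * r ^ (DIM('a) - 1))"
    by (intro continuous_intros) (use r in auto)
  show "0 < r ^ (DIM('a) - 1)" if "r0 \<le> r" for r using that r by simp
  fix \<phi> d a b C
  assume ab: "r0 \<le> a" "a < b" "b \<le> R" and l: "lin_sol r0 R \<mu> (\<lambda>r. r ^ (DIM('a) - 1)) a b \<phi> d"
    and ph: "\<And>r. a < r \<Longrightarrow> r < b \<Longrightarrow> 0 < \<phi> r \<and> \<phi> r \<le> C * bdist r0 R r powr beta_plus \<mu>"
    and lim: "(\<phi> \<longlongrightarrow> 0) (at_right a)" "(\<phi> \<longlongrightarrow> 0) (at_left b)"
  define W where "W r = r ^ (DIM('a) - 1)" for r :: real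
  have W: "0 < W r" if "a < r" for r using that ab r by (simp add: W_def)
  have der: "(\<phi> has_real_derivative d r) (at r)"
    "((\<lambda>r. W r * d r) has_real_derivative - (W r * \<mu> / (bdist r0 R r)\<^sup>2 * \<phi> r)) (at r)" if "a < r" "r < b" for r
    using l that unfolding lin_sol_def W_def by auto
  show False
  proof (cases "0 < \<mu>")
    case True
    obtain \<tau> where \<tau>: "0 < \<tau>" "(1 + \<tau>)\<^sup>2 * \<mu> < (1 + 2 * \<tau>) * m" using small_exponent[of \<mu> m] True m by auto
    have bp: "1/2 \<le> beta_plus \<mu>" using q by (simp add: beta_plus_def)
    have "1 < 1 * (1 + \<tau>)" using \<tau> by simp
    also have "\<dots> \<le> 2 * beta_plus \<mu> * (1 + \<tau>)" using bp \<tau> by (intro mult_right_mono) auto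
    finally have g: "1 < 2 * beta_plus \<mu> * (1 + \<tau>)" .
    show False
      by (rule no_subsolution[OF r(1) ab _ m(2) der(1) der(2)[unfolded W_def] _ ph lim \<tau> g])
        (use True m in auto)
  next
    case False
    define x where "x = (a + b) / 2"
    have x: "a < x" "x < b" using ab by (auto simp: x_def)
    have "0 < \<phi> x" using ph x by blast
    from order_tendstoD(2)[OF lim(1) this] obtain z where z: "a < z" "\<And>s. a < s \<Longrightarrow> s < z \<Longrightarrow> \<phi> s < \<phi> x"
      unfolding eventually_at_right_field by auto
    define y where "y = min ((a + z) / 2) ((a + x) / 2)"
    have y: "a < y" "y < z" "y < x" using z(1) x by (auto simp: y_def min_def)
    have "\<phi> y < \<phi> x" using z y by auto
    moreover obtain t where t: "y < t" "t < x" "\<phi> x - \<phi> y = (x - y) * d t"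
      using MVT2[OF y(3), of \<phi> d] der(1) y x by (metis le_less_trans less_le_trans order.strict_trans1 order.strict_trans2)
    ultimately have "0 < (x - y) * d t" by simp
    then have dt: "0 < d t" using y(3) by (simp add: zero_less_mult_iff)
    have tab: "a < t" "t < b" using t y x by auto
    have dpos: "0 < d s" if s: "t \<le> s" "s < b" for s
    proof -
      have "W t * d t \<le> W s * d s"
      proof (rule DERIV_nonneg_le[where f="\<lambda>r. W r * d r" and f'="\<lambda>r. - (W r * \<mu> / (bdist r0 R r)\<^sup>2 * \<phi> r)"])
        fix v assume v: "t \<le> v" "v \<le> s"
        then have v': "a < v" "v < b" using tab s by auto
        show "((\<lambda>r. W r * d r) has_real_derivative - (W v * \<mu> / (bdist r0 R v)\<^sup>2 * \<phi> v)) (at v)" by (rule der(2)[OF v'])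
        have "W v * \<mu> / (bdist r0 R v)\<^sup>2 * \<phi> v \<le> 0"
          using W[OF v'(1)] ph[OF v'] False by (intro mult_nonpos_nonneg divide_nonpos_nonneg mult_nonneg_nonpos) auto
        then show "0 \<le> - (W v * \<mu> / (bdist r0 R v)\<^sup>2 * \<phi> v)" by simp
      qed (use s in simp)
      moreover have "0 < W t * d t" using W tab dt by simp
      ultimately have "0 < W s * d s" by linarith
      then show ?thesis using W[of s] tab s by (simp add: zero_less_mult_iff)
    qed
    have "\<phi> t \<le> \<phi> s" if s: "t \<le> s" "s < b" for s
    proof (rule DERIV_nonneg_le[where f=\<phi> and f'=d])
      show "(\<phi> has_real_derivative d v) (at v)" "0 \<le> d v" if "t \<le> v" "v \<le> s" for v
        using der(1)[of v] dpos[of v] that s tab by auto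
    qed (use s in simp)
    then have "eventually (\<lambda>s. \<phi> t \<le> \<phi> s) (at_left b)"
      unfolding eventually_at_left_field using tab by (intro exI[of _ t]) auto
    then have "\<phi> t \<le> 0" using lim(2) by (intro tendsto_lowerbound) auto
    then show False using ph[OF tab] by simp
  qed
qed

section \<open>Solutions in the annulus\<close>

lemma behaves_outer_cong:
  assumes "r0 < R" "\<And>r. r0 < r \<Longrightarrow> r < R \<Longrightarrow> v r = u r"
  shows "behaves_outer R a k v \<longleftrightarrow> behaves_outer R a k u"
  unfolding behaves_outer_def
proof (rule tendsto_cong)
  show "\<forall>\<^sub>F r in at_left R. v r / (R - r) powr a = u r / (R - r) powr a"
    unfolding eventually_at_left_field using assms by (intro exI[of _ r0]) auto
qed

lemma behaves_mirror:
  "behaves_outer R a k (\<lambda>r. u (r0 + R - r)) \<longleftrightarrow> behaves_inner r0 a k u" (is ?A)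
  "behaves_inner r0 a k (\<lambda>r. u (r0 + R - r)) \<longleftrightarrow> behaves_outer R a k u" (is ?B)
proof -
  have 1: "behaves_inner r0 a k v \<Longrightarrow> behaves_outer R a k (\<lambda>r. v (r0 + R - r))" for v
  proof -
    assume "behaves_inner r0 a k v"
    then have "((\<lambda>r. v r / (r - r0) powr a) \<longlongrightarrow> k) (at_right (r0 + R - R))" by (simp add: behaves_inner_def)
    from filterlim_compose[OF this mirror_right] show ?thesis by (simp add: behaves_outer_def)
  qed
  have 2: "behaves_outer R a k v \<Longrightarrow> behaves_inner r0 a k (\<lambda>r. v (r0 + R - r))" for v
  proof -
    assume "behaves_outer R a k v"
    then have "((\<lambda>r. v r / (R - r) powr a) \<longlongrightarrow> k) (at_left (r0 + R - r0))" by (simp add: behaves_outer_def)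
    from filterlim_compose[OF this mirror_left] show ?thesis by (simp add: behaves_inner_def)
  qed
  show ?A using 1[of u] 2[of "\<lambda>r. u (r0 + R - r)"] by auto
  show ?B using 2[of u] 1[of "\<lambda>r. u (r0 + R - r)"] by auto
qed

text \<open>Comparison of all pairs in one direction gives equality by symmetry, and the boundary
  behaviour then passes from the constructed solution to every other one.\<close>

lemma unique_behavesI:
  assumes "r0 < R" "P u" "\<exists>k>0. behaves_outer R a k u"
    and "\<And>v1 v2 r. P v1 \<Longrightarrow> P v2 \<Longrightarrow> r0 < r \<Longrightarrow> r < R \<Longrightarrow> v1 r \<le> v2 r"
  shows "unique_on {r0<..<R} P \<and> (\<forall>v. P v \<longrightarrow> (\<exists>k>0. behaves_outer R a k v))"
proof -
  have eq: "v r = u r" if "P v" "r0 < r" "r < R" for v r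
    using assms(4)[OF that(1) assms(2) that(2,3)] assms(4)[OF assms(2) that(1) that(2,3)] by simp
  then have "\<exists>k>0. behaves_outer R a k v" if "P v" for v
    using assms(3) behaves_outer_cong[OF assms(1), of v u] that by auto
  moreover have "unique_on {r0<..<R} P"
    unfolding unique_on_def using assms(2) eq by (intro exI[of _ u]) auto
  ultimately show ?thesis by blast
qed

text \<open>The statements with the boundaries exchanged come from here, with \<open>P\<close> the
  property in the reflected problem; reflection is an involution and turns outer into inner
  behaviour.\<close>

lemma unique_behaves_mirror:
  assumes P: "unique_on {r0<..<R} P \<and> (\<forall>v. P v \<longrightarrow> (\<exists>k>0. behaves_outer R a k v))"
    and Q: "\<And>u. Q u \<longleftrightarrow> P (\<lambda>r. u (r0 + R - r))"
  shows "unique_on {r0<..<R} Q \<and> (\<forall>v. Q v \<longrightarrow> (\<exists>k>0. behaves_inner r0 a k v))"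
proof
  obtain u where u: "P u" "\<And>v r. P v \<Longrightarrow> r \<in> {r0<..<R} \<Longrightarrow> v r = u r" using P unfolding unique_on_def by auto
  show "unique_on {r0<..<R} Q"
    unfolding unique_on_def
  proof (intro exI[of _ "\<lambda>r. u (r0 + R - r)"] conjI allI impI ballI)
    show "Q (\<lambda>r. u (r0 + R - r))" using u(1) by (simp add: Q)
    fix v r assume "Q v" "r \<in> {r0<..<R}"
    then show "v r = u (r0 + R - r)" using u(2)[of "\<lambda>r. v (r0 + R - r)" "r0 + R - r"] by (auto simp: Q)
  qed
  show "\<forall>v. Q v \<longrightarrow> (\<exists>k>0. behaves_inner r0 a k v)"
  proof (intro allI impI)
    fix v assume "Q v"
    then have "P (\<lambda>r. v (r0 + R - r))" by (simp add: Q)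
    then obtain k where "0 < k" "behaves_outer R a k (\<lambda>r. v (r0 + R - r))" using P by blast
    then show "\<exists>k>0. behaves_inner r0 a k v" using behaves_mirror(1)[of R a k v r0] by auto
  qed
qed

context annular_pow
begin

definition solves :: "(real \<Rightarrow> real) \<Rightarrow> bool" where
  "solves u \<longleftrightarrow> (\<exists>d. sol r0 R u d)"

lemma dead_core_result:
  assumes c: "r0 < c" "c < R"
  shows "unique_on {r0<..<R} (\<lambda>u. solves u \<and> positive_on {c<..<R} u \<and> dead_core {r0..c} u) \<and>
    (\<forall>u. solves u \<and> positive_on {c<..<R} u \<and> dead_core {r0..c} u \<longrightarrow> (\<exists>k>0. behaves_outer R bm k u))"
proof -
  obtain u d where u: "sol r0 R u d" "\<And>r. r \<le> c \<Longrightarrow> u r = 0" "\<And>r. c < r \<Longrightarrow> r < R \<Longrightarrow> 0 < u r"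
    "\<exists>L>0. ((\<lambda>r. u r / (R - r) powr bm) \<longlongrightarrow> L) (at_left R)"
    by (rule dead_core_exists[OF c]) blast
  show ?thesis
  proof (rule unique_behavesI[OF r0R, of _ u])
    show "solves u \<and> positive_on {c<..<R} u \<and> dead_core {r0..c} u"
      using u by (auto simp: solves_def positive_on_def dead_core_def)
    show "\<exists>k>0. behaves_outer R bm k u" using u(4) by (simp add: behaves_outer_def)
    fix v1 v2 r
    assume v: "solves v1 \<and> positive_on {c<..<R} v1 \<and> dead_core {r0..c} v1"
      "solves v2 \<and> positive_on {c<..<R} v2 \<and> dead_core {r0..c} v2" and r: "r0 < r" "r < R"
    show "v1 r \<le> v2 r"
    proof (cases "c < r")
      case True
      obtain d1 d2 where "sol r0 R v1 d1" "sol r0 R v2 d2" using v by (auto simp: solves_def)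
      from dead_core_unique_le[OF c this] v c True r show ?thesis by (auto simp: positive_on_def dead_core_def)
    next
      case False
      then show ?thesis using v r by (auto simp: dead_core_def)
    qed
  qed
qed

lemma principal_growth_result:
  assumes m: "0 < barrier_gap" and c: "0 < c"
  shows "unique_on {r0<..<R} (\<lambda>u. (solves u \<and> positive_on {r0<..<R} u) \<and> behaves_inner r0 bp c u) \<and>
    (\<forall>u. (solves u \<and> positive_on {r0<..<R} u) \<and> behaves_inner r0 bp c u \<longrightarrow> (\<exists>k>0. behaves_outer R bm k u))"
proof -
  obtain u d where u: "sol r0 R u d" "\<And>r. r0 < r \<Longrightarrow> r < R \<Longrightarrow> 0 < u r"
    "((\<lambda>r. u r / (r - r0) powr bp) \<longlongrightarrow> c) (at_right r0)"
    "\<exists>L>0. ((\<lambda>r. u r / (R - r) powr bm) \<longlongrightarrow> L) (at_left R)"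
    by (rule principal_growth_exists[OF m c]) blast
  show ?thesis
  proof (rule unique_behavesI[OF r0R, of _ u])
    show "(solves u \<and> positive_on {r0<..<R} u) \<and> behaves_inner r0 bp c u"
      using u by (auto simp: solves_def positive_on_def behaves_inner_def)
    show "\<exists>k>0. behaves_outer R bm k u" using u(4) by (simp add: behaves_outer_def)
    fix v1 v2 r
    assume v: "(solves v1 \<and> positive_on {r0<..<R} v1) \<and> behaves_inner r0 bp c v1"
      "(solves v2 \<and> positive_on {r0<..<R} v2) \<and> behaves_inner r0 bp c v2" and r: "r0 < r" "r < R"
    obtain d1 d2 where s: "sol r0 R v1 d1" "sol r0 R v2 d2" using v by (auto simp: solves_def)
    show "v1 r \<le> v2 r"
      by (rule singular_unique_le[OF s order_refl c _ _ r]) (use v in \<open>auto simp: behaves_inner_def\<close>)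
  qed
qed

lemma barrier_growth_result:
  assumes m: "0 < barrier_gap"
  shows "unique_on {r0<..<R} (\<lambda>u. solves u \<and> behaves_inner r0 \<alpha> barrier_coeff u) \<and>
    (\<forall>u. solves u \<and> behaves_inner r0 \<alpha> barrier_coeff u \<longrightarrow> (\<exists>k>0. behaves_outer R bm k u))"
proof -
  obtain u d where u: "sol r0 R u d" "((\<lambda>r. u r / (r - r0) powr \<alpha>) \<longlongrightarrow> barrier_coeff) (at_right r0)"
    "\<exists>L>0. ((\<lambda>r. u r / (R - r) powr bm) \<longlongrightarrow> L) (at_left R)"
    by (rule barrier_growth_exists[OF m]) blast
  show ?thesis
  proof (rule unique_behavesI[OF r0R, of _ u])
    show "solves u \<and> behaves_inner r0 \<alpha> barrier_coeff u"
      using u by (auto simp: solves_def behaves_inner_def)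
    show "\<exists>k>0. behaves_outer R bm k u" using u(3) by (simp add: behaves_outer_def)
    fix v1 v2 r
    assume v: "solves v1 \<and> behaves_inner r0 \<alpha> barrier_coeff v1" "solves v2 \<and> behaves_inner r0 \<alpha> barrier_coeff v2" and r: "r0 < r" "r < R"
    obtain d1 d2 where s: "sol r0 R v1 d1" "sol r0 R v2 d2" using v by (auto simp: solves_def)
    show "v1 r \<le> v2 r"
      by (rule singular_unique_le[OF s less_imp_le[OF bp_less_alpha[OF m]] _ _ _ r])
        (use v barrier_coeff_pos[OF m] in \<open>auto simp: behaves_inner_def\<close>)
  qed
qed

lemma flat_start_result:
  assumes neg: "\<mu> < 0" and c: "r0 < c" "c < R" and u0: "0 < u0"
  defines "Q \<equiv> \<lambda>u. (solves u \<and> positive_on {r0<..<R} u) \<and> u c = u0 \<and> (u has_real_derivative 0) (at c)"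
  shows "unique_on {r0<..<R} Q \<and>
    (\<forall>u. Q u \<longrightarrow> (\<exists>k1>0. behaves_outer R bm k1 u) \<and> (\<exists>k2>0. behaves_inner r0 bm k2 u))"
proof -
  obtain u d where u: "sol r0 R u d" "\<And>r. r0 < r \<Longrightarrow> r < R \<Longrightarrow> 0 < u r" "u c = u0" "d c = 0"
    "\<exists>L>0. ((\<lambda>r. u r / (R - r) powr bm) \<longlongrightarrow> L) (at_left R)"
    "\<exists>L>0. ((\<lambda>r. u r / (r - r0) powr bm) \<longlongrightarrow> L) (at_right r0)"
    by (rule flat_start_exists[OF neg c u0]) blast
  have "(u has_real_derivative d c) (at c)" using u(1) c unfolding ode_sol_def by blast
  then have Qu: "Q u" using u by (auto simp: Q_def solves_def positive_on_def)
  have le: "v1 r \<le> v2 r" if v: "Q v1" "Q v2" and r: "r0 < r" "r < R" for v1 v2 r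
  proof -
    obtain d1 d2 where s: "sol r0 R v1 d1" "sol r0 R v2 d2" using v by (auto simp: Q_def solves_def)
    have "(v1 has_real_derivative d1 c) (at c)" "(v2 has_real_derivative d2 c) (at c)"
      using s c unfolding ode_sol_def by blast+
    then have "d1 c = 0" "d2 c = 0" using v DERIV_unique unfolding Q_def by blast+
    then show ?thesis
      by (intro flat_start_unique_le[OF neg c u0 s _ _ _ _ _ _ r]) (use v in \<open>auto simp: Q_def positive_on_def\<close>)
  qed
  have 1: "unique_on {r0<..<R} Q \<and> (\<forall>u. Q u \<longrightarrow> (\<exists>k1>0. behaves_outer R bm k1 u))"
  proof (rule unique_behavesI[where P=Q, OF r0R Qu])
    show "\<exists>k>0. behaves_outer R bm k u" using u(5) by (simp add: behaves_outer_def)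
  qed (rule le)
  have "\<exists>k2>0. behaves_inner r0 bm k2 v" if v: "Q v" for v
  proof -
    have "v (r0 + R - r) = u (r0 + R - r)" if "r0 < r" "r < R" for r
      using le[OF v Qu, of "r0 + R - r"] le[OF Qu v, of "r0 + R - r"] that by simp
    from behaves_outer_cong[OF r0R, of "\<lambda>r. v (r0 + R - r)" "\<lambda>r. u (r0 + R - r)" bm, OF this]
    have "behaves_inner r0 bm k v \<longleftrightarrow> behaves_inner r0 bm k u" for k by (simp add: behaves_mirror)
    then show ?thesis using u(6) by (simp add: behaves_inner_def)
  qed
  with 1 show ?thesis by blast
qed

lemma solves_mirror:
  "annular_pow.solves r0 R \<mu> (\<lambda>r. w (r0 + R - r)) p (\<lambda>r. u (r0 + R - r)) \<longleftrightarrow> solves u"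
proof -
  interpret B: annular_pow r0 R \<mu> "\<lambda>r. w (r0 + R - r)" "\<lambda>r. - w' (r0 + R - r)" p by (rule pow_mirror)
  have "solves u \<Longrightarrow> B.solves (\<lambda>r. u (r0 + R - r))"
    unfolding solves_def B.solves_def using ode_sol_mirror[of r0 R \<mu> p w r0 R u] by fastforce
  moreover have "B.solves (\<lambda>r. u (r0 + R - r)) \<Longrightarrow> solves u"
    unfolding solves_def B.solves_def
    using ode_sol_mirror[of r0 R \<mu> p "\<lambda>r. w (r0 + R - r)" r0 R "\<lambda>r. u (r0 + R - r)"] by fastforce
  ultimately show ?thesis by blast
qed

lemma positive_on_mirror:
  "positive_on {a<..<b} (\<lambda>r. u (r0 + R - r)) \<longleftrightarrow> positive_on {r0 + R - b<..<r0 + R - a} u"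
proof -
  have im: "(\<lambda>r. r0 + R - r) ` {a<..<b} = {r0 + R - b<..<r0 + R - a}"
    by (auto intro!: image_eqI[where x="r0 + R - x" for x])
  show ?thesis unfolding positive_on_def im[symmetric] by blast
qed

lemma dead_core_mirror:
  "dead_core {a..b} (\<lambda>r. u (r0 + R - r)) \<longleftrightarrow> dead_core {r0 + R - b..r0 + R - a} u"
proof -
  have im: "(\<lambda>r. r0 + R - r) ` {a..b} = {r0 + R - b..r0 + R - a}"
    by (auto intro!: image_eqI[where x="r0 + R - x" for x])
  show ?thesis unfolding dead_core_def im[symmetric] by blast
qed

lemma dead_core_result_outer:
  assumes c: "r0 < c" "c < R"
  shows "unique_on {r0<..<R} (\<lambda>u. solves u \<and> positive_on {r0<..<c} u \<and> dead_core {c..R} u) \<and>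
    (\<forall>u. solves u \<and> positive_on {r0<..<c} u \<and> dead_core {c..R} u \<longrightarrow> (\<exists>k>0. behaves_inner r0 bm k u))"
proof -
  interpret B: annular_pow r0 R \<mu> "\<lambda>r. w (r0 + R - r)" "\<lambda>r. - w' (r0 + R - r)" p by (rule pow_mirror)
  show ?thesis
    by (rule unique_behaves_mirror[OF B.dead_core_result[of "r0 + R - c"]])
      (use c in \<open>simp_all add: solves_mirror positive_on_mirror dead_core_mirror\<close>)
qed

lemma principal_growth_result_outer:
  assumes m: "0 < barrier_gap" and c: "0 < c"
  shows "unique_on {r0<..<R} (\<lambda>u. (solves u \<and> positive_on {r0<..<R} u) \<and> behaves_outer R bp c u) \<and>
    (\<forall>u. (solves u \<and> positive_on {r0<..<R} u) \<and> behaves_outer R bp c u \<longrightarrow> (\<exists>k>0. behaves_inner r0 bm k u))"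
proof -
  interpret B: annular_pow r0 R \<mu> "\<lambda>r. w (r0 + R - r)" "\<lambda>r. - w' (r0 + R - r)" p by (rule pow_mirror)
  show ?thesis
    by (rule unique_behaves_mirror[OF B.principal_growth_result[OF m c]])
      (simp add: solves_mirror positive_on_mirror behaves_mirror)
qed

lemma barrier_growth_result_outer:
  assumes m: "0 < barrier_gap"
  shows "unique_on {r0<..<R} (\<lambda>u. solves u \<and> behaves_outer R \<alpha> barrier_coeff u) \<and>
    (\<forall>u. solves u \<and> behaves_outer R \<alpha> barrier_coeff u \<longrightarrow> (\<exists>k>0. behaves_inner r0 bm k u))"
proof -
  interpret B: annular_pow r0 R \<mu> "\<lambda>r. w (r0 + R - r)" "\<lambda>r. - w' (r0 + R - r)" p by (rule pow_mirror)
  show ?thesis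
    by (rule unique_behaves_mirror[OF B.barrier_growth_result[OF m]])
      (simp add: solves_mirror behaves_mirror)
qed

text \<open>The nonlinearity is additive at every point where one summand is 0, as
  \<open>0 powr p = 0\<close>.\<close>

lemma solves_add:
  assumes "solves u" "solves v" "\<And>r. r0 < r \<Longrightarrow> r < R \<Longrightarrow> u r = 0 \<or> v r = 0"
  shows "solves (\<lambda>r. u r + v r)"
proof -
  obtain d1 d2 where s: "sol r0 R u d1" "sol r0 R v d2" using assms by (auto simp: solves_def)
  have "sol r0 R (\<lambda>r. u r + v r) (\<lambda>r. d1 r + d2 r)"
    unfolding ode_sol_def
  proof (intro allI impI conjI)
    fix r assume r: "r0 < r \<and> r < R"
    then have u: "0 \<le> u r" "(u has_real_derivative d1 r) (at r)"
      "((\<lambda>r. w r * d1 r) has_real_derivative w r * (u r powr p - \<mu> / (\<delta> r)\<^sup>2 * u r)) (at r)"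
      and v: "0 \<le> v r" "(v has_real_derivative d2 r) (at r)"
      "((\<lambda>r. w r * d2 r) has_real_derivative w r * (v r powr p - \<mu> / (\<delta> r)\<^sup>2 * v r)) (at r)"
      using s unfolding ode_sol_def by auto
    show "0 \<le> u r + v r" using u v by simp
    show "((\<lambda>r. u r + v r) has_real_derivative d1 r + d2 r) (at r)" by (rule DERIV_add[OF u(2) v(2)])
    have "(u r + v r) powr p = u r powr p + v r powr p" using assms(3)[of r] r by auto
    then show "((\<lambda>r. w r * (d1 r + d2 r)) has_real_derivative
        w r * ((u r + v r) powr p - \<mu> / (\<delta> r)\<^sup>2 * (u r + v r))) (at r)"
      using DERIV_add[OF u(3) v(3)] by (simp add: algebra_simps add_divide_distrib)
  qed
  then show ?thesis by (auto simp: solves_def)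
qed

text \<open>Disjoint supports force \<open>R1 \<le> R2\<close>, since otherwise both summands are
  positive between \<open>R2\<close> and \<open>R1\<close>. The dead core is then the interval from
  \<open>R1\<close> to \<open>R2\<close>, a point if they are equal.\<close>

lemma solves_add_dead_cores:
  assumes R1: "r0 < R1" "R1 < R" and R2: "r0 < R2" "R2 < R"
    and u: "solves u \<and> positive_on {r0<..<R1} u \<and> dead_core {R1..R} u"
    and v: "solves v \<and> positive_on {R2<..<R} v \<and> dead_core {r0..R2} v"
    and disj: "{r\<in>{r0<..<R}. u r \<noteq> 0} \<inter> {r\<in>{r0<..<R}. v r \<noteq> 0} = {}"
  shows "solves (\<lambda>r. u r + v r) \<and> (\<exists>a b. r0 < a \<and> a \<le> b \<and> b < R \<and> dead_core {a..b} (\<lambda>r. u r + v r) \<and>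
    positive_on {r0<..<a} (\<lambda>r. u r + v r) \<and> positive_on {b<..<R} (\<lambda>r. u r + v r))"
proof
  have z: "u r = 0 \<or> v r = 0" if "r0 < r" "r < R" for r using disj that by auto
  show "solves (\<lambda>r. u r + v r)" using u v z by (intro solves_add) auto
  have le: "R1 \<le> R2"
  proof (rule ccontr)
    assume "\<not> R1 \<le> R2"
    then obtain x where x: "R2 < x" "x < R1" using dense[of R2 R1] by auto
    have "0 < u x" "0 < v x" using u v x R1 R2 by (auto simp: positive_on_def)
    then show False using z[of x] x R1 R2 by auto
  qed
  have "u r = 0" if "R1 \<le> r" "r \<le> R" for r using u that by (auto simp: dead_core_def)
  moreover have "v r = 0" if "r0 \<le> r" "r \<le> R2" for r using v that by (auto simp: dead_core_def)
  ultimately show "\<exists>a b. r0 < a \<and> a \<le> b \<and> b < R \<and> dead_core {a..b} (\<lambda>r. u r + v r) \<and>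
    positive_on {r0<..<a} (\<lambda>r. u r + v r) \<and> positive_on {b<..<R} (\<lambda>r. u r + v r)"
    using R1 R2 le u v by (intro exI[of _ R1] exI[of _ R2]) (auto simp: dead_core_def positive_on_def)
qed

end

theorem theorem3p2:
  fixes p r0 R \<mu> :: real
  assumes "0 < p" "p < 1" "0 < r0" "r0 < R" "\<mu> \<noteq> 0"
    and "ereal \<mu> < hardy_constant (annulus r0 R :: (real ^ 'n) set)"
  shows
    "\<comment> \<open>(i)\<close>
     (\<forall>R0. r0 < R0 \<and> R0 < R \<longrightarrow>
        unique_on {r0<..<R} (inner_dead_core_solution TYPE(real ^ 'n) p \<mu> r0 R R0) \<and>
        (\<forall>u. inner_dead_core_solution TYPE(real ^ 'n) p \<mu> r0 R R0 u \<longrightarrow>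
           (\<exists>k>0. behaves_outer R (beta_minus \<mu>) k u)) \<and>
        unique_on {r0<..<R} (outer_dead_core_solution TYPE(real ^ 'n) p \<mu> r0 R R0) \<and>
        (\<forall>u. outer_dead_core_solution TYPE(real ^ 'n) p \<mu> r0 R R0 u \<longrightarrow>
           (\<exists>k>0. behaves_inner r0 (beta_minus \<mu>) k u))) \<and>
     \<comment> \<open>(ii)\<close>
     (\<forall>R1 R2 u v. r0 < R1 \<and> R1 < R \<and> r0 < R2 \<and> R2 < R \<and>
        outer_dead_core_solution TYPE(real ^ 'n) p \<mu> r0 R R1 u \<and>
        inner_dead_core_solution TYPE(real ^ 'n) p \<mu> r0 R R2 v \<and>
        {r\<in>{r0<..<R}. u r \<noteq> 0} \<inter> {r\<in>{r0<..<R}. v r \<noteq> 0} = {} \<longrightarrow>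
        radial_solution TYPE(real ^ 'n) p \<mu> r0 R (\<lambda>r. u r + v r) \<and>
        (\<exists>a b. r0 < a \<and> a \<le> b \<and> b < R \<and>
           dead_core {a..b} (\<lambda>r. u r + v r) \<and>
           positive_on {r0<..<a} (\<lambda>r. u r + v r) \<and>
           positive_on {b<..<R} (\<lambda>r. u r + v r))) \<and>
     \<comment> \<open>(iii)\<close>
     (\<mu> < 0 \<longrightarrow> (\<forall>R0 u0. r0 < R0 \<and> R0 < R \<and> 0 < u0 \<longrightarrow>
        unique_on {r0<..<R} (positive_solution_from TYPE(real ^ 'n) p \<mu> r0 R R0 u0) \<and>
        (\<forall>u. positive_solution_from TYPE(real ^ 'n) p \<mu> r0 R R0 u0 u \<longrightarrow>
           (\<exists>k1>0. behaves_outer R (beta_minus \<mu>) k1 u) \<and>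
           (\<exists>k2>0. behaves_inner r0 (beta_minus \<mu>) k2 u)))) \<and>
     (\<mu> > - (2 * (p + 1) / (1 - p)\<^sup>2) \<longrightarrow>
        \<comment> \<open>(iv)\<close>
        (\<forall>c>0.
           unique_on {r0<..<R} (\<lambda>u. positive_solution TYPE(real ^ 'n) p \<mu> r0 R u \<and>
             behaves_inner r0 (beta_plus \<mu>) c u) \<and>
           (\<forall>u. positive_solution TYPE(real ^ 'n) p \<mu> r0 R u \<and>
             behaves_inner r0 (beta_plus \<mu>) c u \<longrightarrow>
             (\<exists>k>0. behaves_outer R (beta_minus \<mu>) k u)) \<and>
           unique_on {r0<..<R} (\<lambda>u. positive_solution TYPE(real ^ 'n) p \<mu> r0 R u \<and>
             behaves_outer R (beta_plus \<mu>) c u) \<and>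
           (\<forall>u. positive_solution TYPE(real ^ 'n) p \<mu> r0 R u \<and>
             behaves_outer R (beta_plus \<mu>) c u \<longrightarrow>
             (\<exists>k>0. behaves_inner r0 (beta_minus \<mu>) k u))) \<and>
        \<comment> \<open>(v)\<close>
        (let c' = (2 * (1 + p) / (p - 1)\<^sup>2 + \<mu>) powr (1 / (p - 1)) in
           unique_on {r0<..<R} (\<lambda>u. radial_solution TYPE(real ^ 'n) p \<mu> r0 R u \<and>
             behaves_inner r0 (2 / (1 - p)) c' u) \<and>
           (\<forall>u. radial_solution TYPE(real ^ 'n) p \<mu> r0 R u \<and>
             behaves_inner r0 (2 / (1 - p)) c' u \<longrightarrow>
             (\<exists>k>0. behaves_outer R (beta_minus \<mu>) k u)) \<and>
           unique_on {r0<..<R} (\<lambda>u. radial_solution TYPE(real ^ 'n) p \<mu> r0 R u \<and>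
             behaves_outer R (2 / (1 - p)) c' u) \<and>
           (\<forall>u. radial_solution TYPE(real ^ 'n) p \<mu> r0 R u \<and>
             behaves_outer R (2 / (1 - p)) c' u \<longrightarrow>
             (\<exists>k>0. behaves_inner r0 (beta_minus \<mu>) k u))))"
proof -
  define w where "w r = r ^ (DIM(real ^ 'n) - 1)" for r :: real
  have ode: "annular_ode r0 R \<mu> w (\<lambda>r. real (DIM(real ^ 'n) - 1) / r * w r)"
    unfolding w_def[abs_def] by (rule annular_ode_hardy) (use assms in auto)
  interpret annular_pow r0 R \<mu> w "\<lambda>r. real (DIM(real ^ 'n) - 1) / r * w r" p
    using ode assms by (simp add: annular_pow_def annular_pow_axioms_def)
  have S: "radial_solution TYPE(real ^ 'n) p \<mu> r0 R u \<longleftrightarrow> solves u" for u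
    unfolding solves_def unfolding w_def[abs_def] by (rule radial_solution_iff) (use assms in auto)
  have idc: "inner_dead_core_solution TYPE(real ^ 'n) p \<mu> r0 R c = (\<lambda>u. solves u \<and> positive_on {c<..<R} u \<and> dead_core {r0..c} u)" for c
    by (simp add: fun_eq_iff inner_dead_core_solution_def S)
  have odc: "outer_dead_core_solution TYPE(real ^ 'n) p \<mu> r0 R c = (\<lambda>u. solves u \<and> positive_on {r0<..<c} u \<and> dead_core {c..R} u)" for c
    by (simp add: fun_eq_iff outer_dead_core_solution_def S)
  have pos: "positive_solution TYPE(real ^ 'n) p \<mu> r0 R = (\<lambda>u. solves u \<and> positive_on {r0<..<R} u)"
    by (simp add: fun_eq_iff positive_solution_def S)
  have psf: "positive_solution_from TYPE(real ^ 'n) p \<mu> r0 R c u0 =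
      (\<lambda>u. (solves u \<and> positive_on {r0<..<R} u) \<and> u c = u0 \<and> (u has_real_derivative 0) (at c))" for c u0
    by (simp add: fun_eq_iff positive_solution_from_def pos)
  have a: "\<alpha> * (\<alpha> - 1) = 2 * (1 + p) / (p - 1)\<^sup>2"
    using p by (simp add: \<alpha>_def power2_eq_square divide_simps) (simp add: algebra_simps)
  have barrier_gap: "barrier_gap = 2 * (1 + p) / (p - 1)\<^sup>2 + \<mu>" unfolding barrier_gap_def a ..
  have c': "(2 * (1 + p) / (p - 1)\<^sup>2 + \<mu>) powr (1 / (p - 1)) = barrier_coeff" unfolding barrier_coeff_def barrier_gap ..
  \<comment> \<open>The additional hypothesis on \<mu> in (iv) and (v) is positivity of
    \<open>barrier_gap\<close>, up to the order of the terms in the square.\<close>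
  have gap_pos: "0 < barrier_gap" if "- (2 * (p + 1) / (1 - p)\<^sup>2) < \<mu>"
    using that by (simp add: barrier_gap power2_commute[of p 1] add.commute)
  show ?thesis
    unfolding idc odc psf pos S Let_def c' \<alpha>_def[symmetric]
  proof (intro conjI allI impI; (elim conjE)?)
    fix R0 assume "r0 < R0" "R0 < R"
    note 1 = dead_core_result[OF this] dead_core_result_outer[OF this]
    show "unique_on {r0<..<R} (\<lambda>u. solves u \<and> positive_on {R0<..<R} u \<and> dead_core {r0..R0} u)"
      "unique_on {r0<..<R} (\<lambda>u. solves u \<and> positive_on {r0<..<R0} u \<and> dead_core {R0..R} u)" using 1 by blast+
    { fix u assume "solves u" "positive_on {R0<..<R} u" "dead_core {r0..R0} u"
      then show "\<exists>k>0. behaves_outer R bm k u" using 1 by blast }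
    { fix u assume "solves u" "positive_on {r0<..<R0} u" "dead_core {R0..R} u"
      then show "\<exists>k>0. behaves_inner r0 bm k u" using 1 by blast }
  next
    fix R1 R2 u v
    assume "r0 < R1" "R1 < R" "r0 < R2" "R2 < R" "solves u" "positive_on {r0<..<R1} u" "dead_core {R1..R} u"
      "solves v" "positive_on {R2<..<R} v" "dead_core {r0..R2} v"
      "{r \<in> {r0<..<R}. u r \<noteq> 0} \<inter> {r \<in> {r0<..<R}. v r \<noteq> 0} = {}"
    note 2 = solves_add_dead_cores[OF this(1-4) conjI[OF this(5) conjI[OF this(6,7)]] conjI[OF this(8) conjI[OF this(9,10)]] this(11)]
    show "solves (\<lambda>r. u r + v r)" using 2 by blast
    show "\<exists>a b. r0 < a \<and> a \<le> b \<and> b < R \<and> dead_core {a..b} (\<lambda>r. u r + v r) \<and>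
      positive_on {r0<..<a} (\<lambda>r. u r + v r) \<and> positive_on {b<..<R} (\<lambda>r. u r + v r)" using 2 by blast
  next
    fix R0 u0 :: real assume "\<mu> < 0" "r0 < R0" "R0 < R" "0 < u0"
    note 3 = flat_start_result[OF this]
    show "unique_on {r0<..<R} (\<lambda>u. (solves u \<and> positive_on {r0<..<R} u) \<and> u R0 = u0 \<and> (u has_real_derivative 0) (at R0))"
      using 3 by blast
    fix u assume "solves u" "positive_on {r0<..<R} u" "u R0 = u0" "(u has_real_derivative 0) (at R0)"
    then show "\<exists>k1>0. behaves_outer R bm k1 u" "\<exists>k2>0. behaves_inner r0 bm k2 u" using 3 by blast+
  next
    fix c :: real assume "- (2 * (p + 1) / (1 - p)\<^sup>2) < \<mu>" "0 < c"
    note 4 = principal_growth_result[OF gap_pos[OF this(1)] this(2)] principal_growth_result_outer[OF gap_pos[OF this(1)] this(2)]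
    show "unique_on {r0<..<R} (\<lambda>u. (solves u \<and> positive_on {r0<..<R} u) \<and> behaves_inner r0 bp c u)"
      "unique_on {r0<..<R} (\<lambda>u. (solves u \<and> positive_on {r0<..<R} u) \<and> behaves_outer R bp c u)" using 4 by blast+
    { fix u assume "solves u" "positive_on {r0<..<R} u" "behaves_inner r0 bp c u"
      then show "\<exists>k>0. behaves_outer R bm k u" using 4 by blast }
    { fix u assume "solves u" "positive_on {r0<..<R} u" "behaves_outer R bp c u"
      then show "\<exists>k>0. behaves_inner r0 bm k u" using 4 by blast }
  next
    assume "- (2 * (p + 1) / (1 - p)\<^sup>2) < \<mu>"
    note 5 = barrier_growth_result[OF gap_pos[OF this]] barrier_growth_result_outer[OF gap_pos[OF this]]
    show "unique_on {r0<..<R} (\<lambda>u. solves u \<and> behaves_inner r0 \<alpha> barrier_coeff u)"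
      "unique_on {r0<..<R} (\<lambda>u. solves u \<and> behaves_outer R \<alpha> barrier_coeff u)" using 5 by blast+
    { fix u assume "solves u" "behaves_inner r0 \<alpha> barrier_coeff u"
      then show "\<exists>k>0. behaves_outer R bm k u" using 5 by blast }
    { fix u assume "solves u" "behaves_outer R \<alpha> barrier_coeff u"
      then show "\<exists>k>0. behaves_inner r0 bm k u" using 5 by blast }
  qed
qed

end
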